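(* If the system $\textsf{P}+\Pi^0_1\text{-}\textsf{TRANS}+\textsf{LMP}$ is consistent, then it cannot prove $\textsf{ATR}_0^{\text{st}}$.
   Context: Types: $0$ is the type of natural numbers, $1=0\to0$, $2=1\to0$, and $\tau^*$ is the type of finite sequences of objects of type $\tau$. $\textsf{E-PA}^{\omega*}$ is classical Peano arithmetic in all finite types with the axiom of extensionality, definitionally extended with the types $\tau^*$. The language of $\textsf{P}$ adds a predicate $\text{st}$ ("is standard") for every type. $(\forall^{\text{st}}x)A$ abbreviates $(\forall x)(\text{st}(x)\to A)$ and $(\exists^{\text{st}}x)A$ abbreviates $(\exists x)(\text{st}(x)\wedge A)$; a formula is internal if it does not involve $\text{st}$. For internal $A$, $A^{\text{st}}$ is obtained from $A$ by relativising all quantifiers (except bounded number quantifiers) to $\text{st}$. The system $\textsf{P}$ consists of $\textsf{E-PA}^{\omega*}$ (axioms for internal formulas) plus: (1) $\text{st}(x)\wedge x=y\to\text{st}(y)$; $\text{st}(t)$ for every closed term $t$ of $\textsf{E-PA}^{\omega*}$; $\text{st}(f)\wedge\text{st}(x)\to\text{st}(f(x))$; (2) external induction: $\Phi(0)\wedge(\forall^{\text{st}}n^0)(\Phi(n)\to\Phi(n+1))\to(\forall^{\text{st}}n^0)\Phi(n)$ for every (possibly external) $\Phi$; (3) Idealisation $\textsf{I}$: $(\forall^{\text{st}}x^{\sigma^*})(\exists y^\tau)(\forall z^\sigma\in x)\varphi(z,y)\to(\exists y^\tau)(\forall^{\text{st}}x^\sigma)\varphi(x,y)$ for internal $\varphi$;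 (4) $\textsf{HAC}_{\textsf{int}}$: $(\forall^{\text{st}}x^\rho)(\exists^{\text{st}}y^\tau)\varphi(x,y)\to(\exists^{\text{st}}F^{\rho\to\tau^*})(\forall^{\text{st}}x^\rho)(\exists y^\tau\in F(x))\varphi(x,y)$ for internal $\varphi$. $\overline{g}n$ is (the code of) the initial segment $\langle g(0),\dots,g(n-1)\rangle$. $\Pi^0_1\text{-}\textsf{TRANS}$: $(\forall^{\text{st}}f^1)\big[(\forall^{\text{st}}n^0)(f(n)\neq0)\to(\forall m^0)(f(m)\neq0)\big]$. $\textsf{LMP}$: $(\forall T\leq_11)\big[\mu(T)\gg0\to(\exists^{\text{st}}\beta^1\leq_11)(\forall^{\text{st}}m^0)(\overline{\beta}m\in T)\big]$, where $T\leq_11$ ranges over (possibly nonstandard) binary trees given by characteristic functions, $\beta\leq_11$ means $\beta(n)\le1$ for all $n$, and $\mu(T)\gg0$ is the formula $(\exists^{\text{st}}k^0)(\forall^{\text{st}}n^0)\Big(\frac{|\{\sigma\in T:|\sigma|=n\}|}{2^n}\geq\frac1k\Big)$. $\textsf{ATR}_0$ is the usual system of second-order arithmetic: $\textsf{ACA}_0$ plus, for every arithmetical $\theta$, $(\forall X^1)[\textsf{WO}(X)\to(\exists Y^1)H_\theta(X,Y)]$, where $\textsf{WO}(X)$ says that $X$ is a countable well-ordering and $H_\theta(X,Y)$ says that $Y$ results from iterating $\theta$ along $X$, i.e. $Y=\{(n,j):j\in\text{field}(X)\wedge\theta(n,Y^j)\}$ with $Y^j=\{(m,i)\in Y:i<_Xj\}$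 (sets coded by characteristic functions). $\textsf{ATR}_0^{\text{st}}$ is $\textsf{ATR}_0$ relativised to $\text{st}$. *)

theory Defs
  imports Main
begin

section \<open>The language of P\<close>

text \<open>Finite types: \<open>N\<close> is the type 0, and \<open>Seq \<tau>\<close> is the type \<open>\<tau>*\<close> of finite sequences.\<close>

datatype ty = N | Fn ty ty (infixr "\<rightarrow>\<^sub>t" 70) | Seq ty

abbreviation T1 :: ty where "T1 \<equiv> N \<rightarrow>\<^sub>t N"

text \<open>
  Terms are combinatory. \<open>CK\<close>, \<open>CS\<close> are the projector and the distributor of the indicated types,
  \<open>CRec\<close> is the recursor, \<open>CLRec \<sigma> \<tau>\<close> is the recursor on \<open>Seq \<sigma>\<close> with values in \<open>\<tau>\<close>. Their types
  are given by \<open>ty_const\<close> and their equations by \<open>EPA\<close> below.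
\<close>

datatype const = CZero | CSuc | CK ty ty | CS ty ty ty | CRec ty | CNil ty | CCons ty | CLRec ty ty

type_synonym var = "nat \<times> ty"  \<comment> \<open>a name together with its type\<close>

datatype tm = Var var | Cst const | App tm tm (infixl "\<bullet>" 100)

fun ty_const :: "const \<Rightarrow> ty" where
  "ty_const CZero = N"
| "ty_const CSuc = T1"
| "ty_const (CK \<sigma> \<tau>) = \<sigma> \<rightarrow>\<^sub>t \<tau> \<rightarrow>\<^sub>t \<sigma>"
| "ty_const (CS \<rho> \<sigma> \<tau>) = (\<rho> \<rightarrow>\<^sub>t \<sigma> \<rightarrow>\<^sub>t \<tau>) \<rightarrow>\<^sub>t (\<rho> \<rightarrow>\<^sub>t \<sigma>) \<rightarrow>\<^sub>t \<rho> \<rightarrow>\<^sub>t \<tau>"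
| "ty_const (CRec \<tau>) = N \<rightarrow>\<^sub>t \<tau> \<rightarrow>\<^sub>t (\<tau> \<rightarrow>\<^sub>t N \<rightarrow>\<^sub>t \<tau>) \<rightarrow>\<^sub>t \<tau>"
| "ty_const (CNil \<sigma>) = Seq \<sigma>"
| "ty_const (CCons \<sigma>) = \<sigma> \<rightarrow>\<^sub>t Seq \<sigma> \<rightarrow>\<^sub>t Seq \<sigma>"
| "ty_const (CLRec \<sigma> \<tau>) = Seq \<sigma> \<rightarrow>\<^sub>t \<tau> \<rightarrow>\<^sub>t (\<tau> \<rightarrow>\<^sub>t \<sigma> \<rightarrow>\<^sub>t \<tau>) \<rightarrow>\<^sub>t \<tau>"

text \<open>The value of \<open>ty_of\<close> is meaningful only on terms satisfying \<open>wt\<close>.\<close>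

fun ty_of :: "tm \<Rightarrow> ty" where
  "ty_of (Var x) = snd x"
| "ty_of (Cst c) = ty_const c"
| "ty_of (s \<bullet> t) = (case ty_of s of \<sigma> \<rightarrow>\<^sub>t \<tau> \<Rightarrow> \<tau> | _ \<Rightarrow> N)"

fun wt :: "tm \<Rightarrow> bool" where
  "wt (Var x) = True"
| "wt (Cst c) = True"
| "wt (s \<bullet> t) = (wt s \<and> wt t \<and> (\<exists>\<tau>. ty_of s = ty_of t \<rightarrow>\<^sub>t \<tau>))"

text \<open>
  Equality is primitive at every type, and \<open>St\<close> is the standardness predicate (of the type of its
  argument). The remaining connectives and \<open>\<exists>\<close> are the usual classical abbreviations.
\<close>

datatype fm =
    Eq tm tm (infix "\<^bold>=" 70)
  | St tm
  | Bot
  | Imp fm fm (infixr "\<^bold>\<longrightarrow>" 62)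
  | Forall var fm

abbreviation Neg :: "fm \<Rightarrow> fm" where "Neg A \<equiv> A \<^bold>\<longrightarrow> Bot"
abbreviation Or :: "fm \<Rightarrow> fm \<Rightarrow> fm" (infixr "\<^bold>\<or>" 64) where "A \<^bold>\<or> B \<equiv> Neg A \<^bold>\<longrightarrow> B"
abbreviation And :: "fm \<Rightarrow> fm \<Rightarrow> fm" (infixr "\<^bold>\<and>" 66) where "A \<^bold>\<and> B \<equiv> Neg (A \<^bold>\<longrightarrow> Neg B)"
abbreviation Exists :: "var \<Rightarrow> fm \<Rightarrow> fm" where "Exists x A \<equiv> Neg (Forall x (Neg A))"
abbreviation ForallSt :: "var \<Rightarrow> fm \<Rightarrow> fm" where "ForallSt x A \<equiv> Forall x (St (Var x) \<^bold>\<longrightarrow> A)"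
abbreviation ExistsSt :: "var \<Rightarrow> fm \<Rightarrow> fm" where "ExistsSt x A \<equiv> Exists x (St (Var x) \<^bold>\<and> A)"

fun wff :: "fm \<Rightarrow> bool" where
  "wff (s \<^bold>= t) = (wt s \<and> wt t \<and> ty_of s = ty_of t)"
| "wff (St t) = wt t"
| "wff Bot = True"
| "wff (A \<^bold>\<longrightarrow> B) = (wff A \<and> wff B)"
| "wff (Forall x A) = wff A"

fun internal :: "fm \<Rightarrow> bool" where
  "internal (s \<^bold>= t) = True"
| "internal (St t) = False"
| "internal Bot = True"
| "internal (A \<^bold>\<longrightarrow> B) = (internal A \<and> internal B)"
| "internal (Forall x A) = internal A"

fun tv :: "tm \<Rightarrow> var set" where
  "tv (Var x) = {x}"
| "tv (Cst c) = {}"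
| "tv (s \<bullet> t) = tv s \<union> tv t"

fun fv :: "fm \<Rightarrow> var set" where
  "fv (s \<^bold>= t) = tv s \<union> tv t"
| "fv (St t) = tv t"
| "fv Bot = {}"
| "fv (A \<^bold>\<longrightarrow> B) = fv A \<union> fv B"
| "fv (Forall x A) = fv A - {x}"

fun tsubst :: "tm \<Rightarrow> var \<Rightarrow> tm \<Rightarrow> tm" where
  "tsubst (Var y) x u = (if y = x then u else Var y)"
| "tsubst (Cst c) x u = Cst c"
| "tsubst (s \<bullet> t) x u = tsubst s x u \<bullet> tsubst t x u"

text \<open>Substitution does not rename bound variables; capture is excluded by \<open>free_for\<close>.\<close>

fun subst :: "fm \<Rightarrow> var \<Rightarrow> tm \<Rightarrow> fm" where
  "subst (s \<^bold>= t) x u = (tsubst s x u \<^bold>= tsubst t x u)"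
| "subst (St t) x u = St (tsubst t x u)"
| "subst Bot x u = Bot"
| "subst (A \<^bold>\<longrightarrow> B) x u = (subst A x u \<^bold>\<longrightarrow> subst B x u)"
| "subst (Forall y A) x u = (if y = x then Forall y A else Forall y (subst A x u))"

fun free_for :: "tm \<Rightarrow> var \<Rightarrow> fm \<Rightarrow> bool" where
  "free_for u x (A \<^bold>\<longrightarrow> B) = (free_for u x A \<and> free_for u x B)"
| "free_for u x (Forall y A) = (x \<notin> fv (Forall y A) \<or> (y \<notin> tv u \<and> free_for u x A))"
| "free_for u x _ = True"

section \<open>Provability\<close>

text \<open>
  A Hilbert calculus for many-sorted classical predicate logic. As generalisation is
  unrestricted, free variables of elements of \<open>\<Gamma>\<close> are read as universally quantified.
  Elements of \<open>\<Gamma>\<close> that are not well-formed are ignored.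
\<close>

inductive proves :: "fm set \<Rightarrow> fm \<Rightarrow> bool" (infix "\<^bold>\<turnstile>" 40) for \<Gamma> where
  axiom: "A \<in> \<Gamma> \<Longrightarrow> wff A \<Longrightarrow> \<Gamma> \<^bold>\<turnstile> A"
| weaken: "wff (A \<^bold>\<longrightarrow> B \<^bold>\<longrightarrow> A) \<Longrightarrow> \<Gamma> \<^bold>\<turnstile> A \<^bold>\<longrightarrow> B \<^bold>\<longrightarrow> A"
| distr: "wff ((A \<^bold>\<longrightarrow> B \<^bold>\<longrightarrow> C) \<^bold>\<longrightarrow> (A \<^bold>\<longrightarrow> B) \<^bold>\<longrightarrow> A \<^bold>\<longrightarrow> C)
    \<Longrightarrow> \<Gamma> \<^bold>\<turnstile> (A \<^bold>\<longrightarrow> B \<^bold>\<longrightarrow> C) \<^bold>\<longrightarrow> (A \<^bold>\<longrightarrow> B) \<^bold>\<longrightarrow> A \<^bold>\<longrightarrow> C"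
| dneg: "wff A \<Longrightarrow> \<Gamma> \<^bold>\<turnstile> Neg (Neg A) \<^bold>\<longrightarrow> A"
| inst: "wff A \<Longrightarrow> wt t \<Longrightarrow> ty_of t = snd x \<Longrightarrow> free_for t x A \<Longrightarrow> \<Gamma> \<^bold>\<turnstile> Forall x A \<^bold>\<longrightarrow> subst A x t"
| distr_all: "wff A \<Longrightarrow> wff B \<Longrightarrow> x \<notin> fv A \<Longrightarrow> \<Gamma> \<^bold>\<turnstile> Forall x (A \<^bold>\<longrightarrow> B) \<^bold>\<longrightarrow> A \<^bold>\<longrightarrow> Forall x B"
| mp: "\<Gamma> \<^bold>\<turnstile> A \<^bold>\<longrightarrow> B \<Longrightarrow> \<Gamma> \<^bold>\<turnstile> A \<Longrightarrow> \<Gamma> \<^bold>\<turnstile> B"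
| gen: "\<Gamma> \<^bold>\<turnstile> A \<Longrightarrow> \<Gamma> \<^bold>\<turnstile> Forall x A"

definition consistent :: "fm set \<Rightarrow> bool" where
  "consistent \<Gamma> \<longleftrightarrow> \<not> \<Gamma> \<^bold>\<turnstile> Bot"

section \<open>Some closed terms\<close>

text \<open>
  Bracket abstraction. The functionals below are closed terms, so that applying them to arbitrary
  terms never captures variables.
\<close>

fun lam :: "var \<Rightarrow> tm \<Rightarrow> tm" where
  "lam x (Var y) = (if y = x
     then Cst (CS (snd x) (snd x \<rightarrow>\<^sub>t snd x) (snd x)) \<bullet> Cst (CK (snd x) (snd x \<rightarrow>\<^sub>t snd x))
            \<bullet> Cst (CK (snd x) (snd x))
     else Cst (CK (snd y) (snd x)) \<bullet> Var y)"
| "lam x (Cst c) = Cst (CK (ty_const c) (snd x)) \<bullet> Cst c"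
| "lam x (s \<bullet> t) = (if x \<in> tv s \<union> tv t
     then Cst (CS (snd x) (ty_of t) (ty_of (s \<bullet> t))) \<bullet> lam x s \<bullet> lam x t
     else Cst (CK (ty_of (s \<bullet> t)) (snd x)) \<bullet> (s \<bullet> t))"

abbreviation Zero :: tm where "Zero \<equiv> Cst CZero"
abbreviation Succ :: "tm \<Rightarrow> tm" where "Succ t \<equiv> Cst CSuc \<bullet> t"
abbreviation One :: tm where "One \<equiv> Succ Zero"
abbreviation nv :: "nat \<Rightarrow> var" where "nv i \<equiv> (i, N)"
abbreviation V :: "nat \<Rightarrow> tm" where "V i \<equiv> Var (nv i)"

definition plus_c :: tm where
  "plus_c = lam (nv 0) (lam (nv 1)
     (Cst (CRec N) \<bullet> V 1 \<bullet> V 0 \<bullet> lam (nv 2) (lam (nv 3) (Succ (V 2)))))"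
abbreviation plus_tm :: "tm \<Rightarrow> tm \<Rightarrow> tm" where "plus_tm s t \<equiv> plus_c \<bullet> s \<bullet> t"

definition times_c :: tm where
  "times_c = lam (nv 0) (lam (nv 1)
     (Cst (CRec N) \<bullet> V 1 \<bullet> Zero \<bullet> lam (nv 2) (lam (nv 3) (plus_tm (V 2) (V 0)))))"
abbreviation times_tm :: "tm \<Rightarrow> tm \<Rightarrow> tm" where "times_tm s t \<equiv> times_c \<bullet> s \<bullet> t"

definition pred_c :: tm where
  "pred_c = lam (nv 0) (Cst (CRec N) \<bullet> V 0 \<bullet> Zero \<bullet> lam (nv 2) (lam (nv 3) (V 3)))"

definition monus_c :: tm where
  "monus_c = lam (nv 0) (lam (nv 1)
     (Cst (CRec N) \<bullet> V 1 \<bullet> V 0 \<bullet> lam (nv 2) (lam (nv 3) (pred_c \<bullet> V 2))))"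

abbreviation le_tm :: "tm \<Rightarrow> tm \<Rightarrow> fm" (infix "\<^bold>\<le>" 70) where
  "s \<^bold>\<le> t \<equiv> monus_c \<bullet> s \<bullet> t \<^bold>= Zero"
abbreviation lt_tm :: "tm \<Rightarrow> tm \<Rightarrow> fm" (infix "\<^bold><" 70) where
  "s \<^bold>< t \<equiv> Succ s \<^bold>\<le> t"

definition pow2_c :: tm where
  "pow2_c = lam (nv 0)
     (Cst (CRec N) \<bullet> V 0 \<bullet> One \<bullet> lam (nv 2) (lam (nv 3) (plus_tm (V 2) (V 2))))"

text \<open>Length and projection of finite sequences; \<open>zero_tm \<sigma>\<close> is the value outside of the range.\<close>

fun zero_tm :: "ty \<Rightarrow> tm" where
  "zero_tm N = Zero"
| "zero_tm (\<sigma> \<rightarrow>\<^sub>t \<tau>) = Cst (CK \<tau> \<sigma>) \<bullet> zero_tm \<tau>"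
| "zero_tm (Seq \<sigma>) = Cst (CNil \<sigma>)"

definition len_c :: "ty \<Rightarrow> tm" where
  "len_c \<sigma> = lam (0, Seq \<sigma>)
     (Cst (CLRec \<sigma> N) \<bullet> Var (0, Seq \<sigma>) \<bullet> Zero \<bullet> lam (nv 1) (lam (2, \<sigma>) (Succ (V 1))))"

text \<open>\<open>(Cons a s)\<^sub>0 = a\<close> and \<open>(Cons a s)\<^sub>i\<^sub>+\<^sub>1 = s\<^sub>i\<close>, by list recursion with values in \<open>N \<rightarrow>\<^sub>t \<sigma>\<close>.\<close>

definition nth_c :: "ty \<Rightarrow> tm" where
  "nth_c \<sigma> = lam (0, Seq \<sigma>)
     (Cst (CLRec \<sigma> (N \<rightarrow>\<^sub>t \<sigma>)) \<bullet> Var (0, Seq \<sigma>) \<bullet> zero_tm (N \<rightarrow>\<^sub>t \<sigma>)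
       \<bullet> lam (1, N \<rightarrow>\<^sub>t \<sigma>) (lam (2, \<sigma>) (lam (nv 3)
           (Cst (CRec \<sigma>) \<bullet> V 3 \<bullet> Var (2, \<sigma>)
             \<bullet> lam (4, \<sigma>) (lam (nv 5) (Var (1, N \<rightarrow>\<^sub>t \<sigma>) \<bullet> V 5))))))"

text \<open>\<open>s \<in> t\<close>, for \<open>s\<close> of type \<open>\<sigma>\<close> and \<open>t\<close> of type \<open>Seq \<sigma>\<close>: \<open>\<exists>i < |t|. s = t\<^sub>i\<close>, with \<open>i\<close> fresh.\<close>

definition elem :: "tm \<Rightarrow> tm \<Rightarrow> fm" where
  "elem s t = (let i = nv (LEAST i. nv i \<notin> tv s \<union> tv t); \<sigma> = ty_of s
     in Exists i (Var i \<^bold>< len_c \<sigma> \<bullet> t \<^bold>\<and> s \<^bold>= nth_c \<sigma> \<bullet> t \<bullet> Var i))"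

section \<open>The systems \<open>E-PA\<^sup>\<omega>*\<close> and P\<close>

text \<open>
  Only the well-formed members of the following sets count, see \<open>proves\<close>. Substituting \<open>Succ n\<close>
  for \<open>n\<close> is always capture-free.
\<close>

inductive_set EPA :: "fm set" where
  eq_refl: "s \<^bold>= s \<in> EPA"
| eq_eucl: "s \<^bold>= t \<^bold>\<longrightarrow> s \<^bold>= u \<^bold>\<longrightarrow> t \<^bold>= u \<in> EPA"
| eq_cong: "f \<^bold>= g \<^bold>\<longrightarrow> s \<^bold>= t \<^bold>\<longrightarrow> f \<bullet> s \<^bold>= g \<bullet> t \<in> EPA"
| extensionality: "x \<notin> tv f \<union> tv g \<Longrightarrow> Forall x (f \<bullet> Var x \<^bold>= g \<bullet> Var x) \<^bold>\<longrightarrow> f \<^bold>= g \<in> EPA"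
| suc_nonzero: "Neg (Succ s \<^bold>= Zero) \<in> EPA"
| suc_inj: "Succ s \<^bold>= Succ t \<^bold>\<longrightarrow> s \<^bold>= t \<in> EPA"
| induction: "internal A \<Longrightarrow> snd n = N \<Longrightarrow>
    subst A n Zero \<^bold>\<and> Forall n (A \<^bold>\<longrightarrow> subst A n (Succ (Var n))) \<^bold>\<longrightarrow> Forall n A \<in> EPA"
| k: "Cst (CK \<sigma> \<tau>) \<bullet> s \<bullet> t \<^bold>= s \<in> EPA"
| s: "Cst (CS \<rho> \<sigma> \<tau>) \<bullet> s \<bullet> t \<bullet> u \<^bold>= s \<bullet> u \<bullet> (t \<bullet> u) \<in> EPA"
| rec_zero: "Cst (CRec \<tau>) \<bullet> Zero \<bullet> s \<bullet> t \<^bold>= s \<in> EPA"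
| rec_suc: "Cst (CRec \<tau>) \<bullet> Succ u \<bullet> s \<bullet> t \<^bold>= t \<bullet> (Cst (CRec \<tau>) \<bullet> u \<bullet> s \<bullet> t) \<bullet> u \<in> EPA"
| lrec_nil: "Cst (CLRec \<sigma> \<tau>) \<bullet> Cst (CNil \<sigma>) \<bullet> s \<bullet> t \<^bold>= s \<in> EPA"
| lrec_cons: "Cst (CLRec \<sigma> \<tau>) \<bullet> (Cst (CCons \<sigma>) \<bullet> a \<bullet> u) \<bullet> s \<bullet> t
    \<^bold>= t \<bullet> (Cst (CLRec \<sigma> \<tau>) \<bullet> u \<bullet> s \<bullet> t) \<bullet> a \<in> EPA"
| seq_cases: "x \<notin> tv s \<Longrightarrow> y \<notin> tv s \<Longrightarrow>
    s \<^bold>= Cst (CNil \<sigma>) \<^bold>\<or> Exists x (Exists y (s \<^bold>= Cst (CCons \<sigma>) \<bullet> Var x \<bullet> Var y)) \<in> EPA"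

inductive_set sysP :: "fm set" where
  EPA: "A \<in> EPA \<Longrightarrow> A \<in> sysP"
| st_eq: "St s \<^bold>\<and> s \<^bold>= t \<^bold>\<longrightarrow> St t \<in> sysP"
| st_closed: "tv t = {} \<Longrightarrow> St t \<in> sysP"
| st_app: "St f \<^bold>\<and> St s \<^bold>\<longrightarrow> St (f \<bullet> s) \<in> sysP"
| external_induction: "snd n = N \<Longrightarrow>
    subst A n Zero \<^bold>\<and> ForallSt n (A \<^bold>\<longrightarrow> subst A n (Succ (Var n))) \<^bold>\<longrightarrow> ForallSt n A \<in> sysP"
| idealisation: "internal A \<Longrightarrow> y \<noteq> z \<Longrightarrow> snd w = Seq (snd z) \<Longrightarrow> w \<notin> fv A \<Longrightarrow> w \<noteq> y \<Longrightarrow>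
    ForallSt w (Exists y (Forall z (elem (Var z) (Var w) \<^bold>\<longrightarrow> A))) \<^bold>\<longrightarrow> Exists y (ForallSt z A) \<in> sysP"
| HAC_int: "internal A \<Longrightarrow> x \<noteq> y \<Longrightarrow> snd F = snd x \<rightarrow>\<^sub>t Seq (snd y) \<Longrightarrow> F \<notin> fv A \<Longrightarrow>
    ForallSt x (ExistsSt y A) \<^bold>\<longrightarrow> ExistsSt F (ForallSt x (Exists y (elem (Var y) (Var F \<bullet> Var x) \<^bold>\<and> A))) \<in> sysP"

section \<open>The axioms \<open>\<Pi>\<^sup>0\<^sub>1-TRANS\<close> and \<open>LMP\<close>\<close>

definition Pi01_TRANS :: fm where
  "Pi01_TRANS = (let f = (0, T1) in
     ForallSt f (ForallSt (nv 0) (Neg (Var f \<bullet> V 0 \<^bold>= Zero)) \<^bold>\<longrightarrow> Forall (nv 0) (Neg (Var f \<bullet> V 0 \<^bold>= Zero))))"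

text \<open>
  Finite binary sequences are coded by numbers through the bijection
  \<open>code \<langle>\<rangle> = 0\<close>, \<open>code (\<sigma> * \<langle>b\<rangle>) = 2 * code \<sigma> + b + 1\<close>. The codes of the sequences of length \<open>n\<close> are
  the numbers \<open>2^n - 1 + i\<close> with \<open>i < 2^n\<close>, and every number is a code. The sequence \<open>\<sigma>\<close> is in
  \<open>T\<close> iff \<open>T (code \<sigma>) = 1\<close>.
\<close>

definition initseg_c :: tm where  \<comment> \<open>code of \<open>\<langle>\<beta>(0), \<dots>, \<beta>(m-1)\<rangle>\<close> for binary \<open>\<beta>\<close>\<close>
  "initseg_c = lam (0, T1) (lam (nv 1)
     (Cst (CRec N) \<bullet> V 1 \<bullet> Zero
       \<bullet> lam (nv 2) (lam (nv 3) (Succ (plus_tm (plus_tm (V 2) (V 2)) (Var (0, T1) \<bullet> V 3))))))"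

text \<open>For binary-valued \<open>T\<close>, the number of sequences of length \<open>n\<close> in \<open>T\<close> is
  the sum of the \<open>T (2^n - 1 + i)\<close> with \<open>i < 2^n\<close>.\<close>

definition count_c :: tm where
  "count_c = lam (0, T1) (lam (nv 1)
     (Cst (CRec N) \<bullet> (pow2_c \<bullet> V 1) \<bullet> Zero
       \<bullet> lam (nv 2) (lam (nv 3)
           (plus_tm (V 2) (Var (0, T1) \<bullet> plus_tm (pred_c \<bullet> (pow2_c \<bullet> V 1)) (V 3))))))"

definition binary :: "nat \<Rightarrow> fm" where  \<comment> \<open>\<open>f \<le>\<^sub>1 1\<close>, for the type 1 variable with name \<open>f\<close>\<close>
  "binary f = Forall (nv 0) (Var (f, T1) \<bullet> V 0 \<^bold>\<le> One)"

definition tree :: "nat \<Rightarrow> fm" where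
  "tree T = binary T \<^bold>\<and>
     Forall (nv 0) (Forall (nv 1) (V 1 \<^bold>\<le> One \<^bold>\<longrightarrow>
       Var (T, T1) \<bullet> Succ (plus_tm (plus_tm (V 0) (V 0)) (V 1)) \<^bold>= One \<^bold>\<longrightarrow> Var (T, T1) \<bullet> V 0 \<^bold>= One))"

text \<open>The inequality \<open>count / 2^n \<ge> 1 / k\<close> is written without denominators.\<close>

definition positive_measure :: "nat \<Rightarrow> fm" where
  "positive_measure T = ExistsSt (nv 0) (Zero \<^bold>< V 0 \<^bold>\<and>
     ForallSt (nv 1) (pow2_c \<bullet> V 1 \<^bold>\<le> times_tm (V 0) (count_c \<bullet> Var (T, T1) \<bullet> V 1)))"

definition LMP :: fm where
  "LMP = (let T = 0; \<beta> = 1 in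
     Forall (T, T1) (tree T \<^bold>\<longrightarrow> positive_measure T \<^bold>\<longrightarrow>
       ExistsSt (\<beta>, T1) (binary \<beta> \<^bold>\<and>
         ForallSt (nv 0) (Var (T, T1) \<bullet> (initseg_c \<bullet> Var (\<beta>, T1) \<bullet> V 0) \<^bold>= One))))"

section \<open>Second-order arithmetic and \<open>ATR\<^sub>0\<close>\<close>

datatype ntm = NV nat | N0 | N1 | Add ntm ntm | Mul ntm ntm

text \<open>
  \<open>AllN\<close> and \<open>AllS\<close> quantify over numbers and sets. The bounded quantifier \<open>BAllN n t\<close>,
  i.e. \<open>\<forall>n < t\<close>, is a primitive because it is not relativised to \<open>st\<close>.
\<close>

datatype sofm =
    SEq ntm ntm (infix "=\<^sub>2" 70)
  | SLess ntm ntm (infix "<\<^sub>2" 70)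
  | SMem ntm nat (infix "\<in>\<^sub>2" 70)
  | SBot
  | SImp sofm sofm (infixr "\<longrightarrow>\<^sub>2" 62)
  | AllN nat sofm
  | BAllN nat ntm sofm
  | AllS nat sofm

abbreviation SNeg :: "sofm \<Rightarrow> sofm" where "SNeg A \<equiv> A \<longrightarrow>\<^sub>2 SBot"
abbreviation SOr :: "sofm \<Rightarrow> sofm \<Rightarrow> sofm" (infixr "\<or>\<^sub>2" 64) where "A \<or>\<^sub>2 B \<equiv> SNeg A \<longrightarrow>\<^sub>2 B"
abbreviation SAnd :: "sofm \<Rightarrow> sofm \<Rightarrow> sofm" (infixr "\<and>\<^sub>2" 66) where
  "A \<and>\<^sub>2 B \<equiv> SNeg (A \<longrightarrow>\<^sub>2 SNeg B)"
abbreviation SIff :: "sofm \<Rightarrow> sofm \<Rightarrow> sofm" (infix "\<longleftrightarrow>\<^sub>2" 61) where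
  "A \<longleftrightarrow>\<^sub>2 B \<equiv> (A \<longrightarrow>\<^sub>2 B) \<and>\<^sub>2 (B \<longrightarrow>\<^sub>2 A)"
abbreviation ExN :: "nat \<Rightarrow> sofm \<Rightarrow> sofm" where "ExN n A \<equiv> SNeg (AllN n (SNeg A))"
abbreviation ExS :: "nat \<Rightarrow> sofm \<Rightarrow> sofm" where "ExS X A \<equiv> SNeg (AllS X (SNeg A))"

fun ntv :: "ntm \<Rightarrow> nat set" where
  "ntv (NV n) = {n}"
| "ntv N0 = {}"
| "ntv N1 = {}"
| "ntv (Add s t) = ntv s \<union> ntv t"
| "ntv (Mul s t) = ntv s \<union> ntv t"

fun free_nvars :: "sofm \<Rightarrow> nat set" where
  "free_nvars (s =\<^sub>2 t) = ntv s \<union> ntv t"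
| "free_nvars (s <\<^sub>2 t) = ntv s \<union> ntv t"
| "free_nvars (t \<in>\<^sub>2 X) = ntv t"
| "free_nvars SBot = {}"
| "free_nvars (A \<longrightarrow>\<^sub>2 B) = free_nvars A \<union> free_nvars B"
| "free_nvars (AllN n A) = free_nvars A - {n}"
| "free_nvars (BAllN n t A) = ntv t \<union> (free_nvars A - {n})"
| "free_nvars (AllS X A) = free_nvars A"

fun free_svars :: "sofm \<Rightarrow> nat set" where
  "free_svars (s =\<^sub>2 t) = {}"
| "free_svars (s <\<^sub>2 t) = {}"
| "free_svars (t \<in>\<^sub>2 X) = {X}"
| "free_svars SBot = {}"
| "free_svars (A \<longrightarrow>\<^sub>2 B) = free_svars A \<union> free_svars B"
| "free_svars (AllN n A) = free_svars A"
| "free_svars (BAllN n t A) = free_svars A"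
| "free_svars (AllS X A) = free_svars A - {X}"

fun nvars :: "sofm \<Rightarrow> nat set" where  \<comment> \<open>number variables occurring free or bound\<close>
  "nvars (s =\<^sub>2 t) = ntv s \<union> ntv t"
| "nvars (s <\<^sub>2 t) = ntv s \<union> ntv t"
| "nvars (t \<in>\<^sub>2 X) = ntv t"
| "nvars SBot = {}"
| "nvars (A \<longrightarrow>\<^sub>2 B) = nvars A \<union> nvars B"
| "nvars (AllN n A) = insert n (nvars A)"
| "nvars (BAllN n t A) = insert n (ntv t \<union> nvars A)"
| "nvars (AllS X A) = nvars A"

text \<open>No set quantifiers; the variable of a bounded quantifier must not occur in the bound.\<close>

fun arithmetical :: "sofm \<Rightarrow> bool" where
  "arithmetical (A \<longrightarrow>\<^sub>2 B) = (arithmetical A \<and> arithmetical B)"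
| "arithmetical (AllN n A) = arithmetical A"
| "arithmetical (BAllN n t A) = (n \<notin> ntv t \<and> arithmetical A)"
| "arithmetical (AllS X A) = False"
| "arithmetical _ = True"

text \<open>Replaces \<open>t \<in> Z\<close> by \<open>R t\<close>; used for arithmetical formulas only.\<close>

fun set_subst :: "sofm \<Rightarrow> nat \<Rightarrow> (ntm \<Rightarrow> sofm) \<Rightarrow> sofm" where
  "set_subst (t \<in>\<^sub>2 X) Z R = (if X = Z then R t else t \<in>\<^sub>2 X)"
| "set_subst (A \<longrightarrow>\<^sub>2 B) Z R = (set_subst A Z R \<longrightarrow>\<^sub>2 set_subst B Z R)"
| "set_subst (AllN n A) Z R = AllN n (set_subst A Z R)"
| "set_subst (BAllN n t A) Z R = BAllN n t (set_subst A Z R)"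
| "set_subst (AllS X A) Z R = AllS X (if X = Z then A else set_subst A Z R)"
| "set_subst A Z R = A"

definition pair :: "ntm \<Rightarrow> ntm \<Rightarrow> ntm" where
  "pair s t = Add (Mul (Add s t) (Add s t)) s"

definition le_in :: "nat \<Rightarrow> ntm \<Rightarrow> ntm \<Rightarrow> sofm" where  \<comment> \<open>\<open>s \<le>\<^sub>X t\<close>\<close>
  "le_in X s t = (pair s t \<in>\<^sub>2 X)"

definition less_in :: "nat \<Rightarrow> ntm \<Rightarrow> ntm \<Rightarrow> sofm" where
  "less_in X s t = le_in X s t \<and>\<^sub>2 SNeg (le_in X t s)"

definition field_in :: "nat \<Rightarrow> ntm \<Rightarrow> sofm" where
  "field_in X s = le_in X s s"

text \<open>\<open>X\<close> codes a reflexive relation which is a linear ordering of its field.\<close>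

definition LO :: "nat \<Rightarrow> sofm" where
  "LO X = (let a = NV 0; b = NV 1; c = NV 2 in
     AllN 0 (AllN 1 (le_in X a b \<longrightarrow>\<^sub>2 field_in X a \<and>\<^sub>2 field_in X b)) \<and>\<^sub>2
     AllN 0 (AllN 1 (AllN 2 (le_in X a b \<and>\<^sub>2 le_in X b c \<longrightarrow>\<^sub>2 le_in X a c))) \<and>\<^sub>2
     AllN 0 (AllN 1 (le_in X a b \<and>\<^sub>2 le_in X b a \<longrightarrow>\<^sub>2 a =\<^sub>2 b)) \<and>\<^sub>2
     AllN 0 (AllN 1 (field_in X a \<and>\<^sub>2 field_in X b \<longrightarrow>\<^sub>2 le_in X a b \<or>\<^sub>2 le_in X b a)))"

text \<open>There is no function \<open>F\<close>, coded as a set of pairs, with \<open>F(n+1) <\<^sub>X F(n)\<close> for all \<open>n\<close>.\<close>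

definition WF :: "nat \<Rightarrow> sofm" where
  "WF X = (let F = Suc X; a = NV 0; b = NV 1; c = NV 2 in
     SNeg (ExS F (
       AllN 0 (ExN 1 (pair a b \<in>\<^sub>2 F)) \<and>\<^sub>2
       AllN 0 (AllN 1 (AllN 2 (pair a b \<in>\<^sub>2 F \<and>\<^sub>2 pair a c \<in>\<^sub>2 F \<longrightarrow>\<^sub>2 b =\<^sub>2 c))) \<and>\<^sub>2
       AllN 0 (AllN 1 (AllN 2 (pair a b \<in>\<^sub>2 F \<and>\<^sub>2 pair (Add a N1) c \<in>\<^sub>2 F \<longrightarrow>\<^sub>2 less_in X c b))))))"

definition WO :: "nat \<Rightarrow> sofm" where
  "WO X = LO X \<and>\<^sub>2 WF X"

text \<open>
  \<open>t \<in> Y\<^sup>j\<close> where \<open>Y\<^sup>j = {(m,i) \<in> Y. i <\<^sub>X j}\<close>; the variables \<open>m\<close>, \<open>i\<close> are to be fresh.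
\<close>

definition in_part :: "nat \<Rightarrow> nat \<Rightarrow> nat \<Rightarrow> nat \<Rightarrow> nat \<Rightarrow> ntm \<Rightarrow> sofm" where
  "in_part m i X Y j t =
     t \<in>\<^sub>2 Y \<and>\<^sub>2 ExN m (ExN i (t =\<^sub>2 pair (NV m) (NV i) \<and>\<^sub>2 less_in X (NV i) (NV j)))"

text \<open>
  \<open>Y = {(n,j). j \<in> field X \<and> \<theta>(n, Y\<^sup>j)}\<close>, where \<open>n\<close> and \<open>Z\<close> are the distinguished variables of \<open>\<theta>\<close>
  (which may have further parameters).
\<close>

definition H_iter :: "nat \<Rightarrow> nat \<Rightarrow> sofm \<Rightarrow> nat \<Rightarrow> nat \<Rightarrow> nat \<Rightarrow> nat \<Rightarrow> nat \<Rightarrow> nat \<Rightarrow> sofm" where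
  "H_iter n Z \<theta> j k m i X Y =
     AllN k (NV k \<in>\<^sub>2 Y \<longleftrightarrow>\<^sub>2
       ExN n (ExN j (NV k =\<^sub>2 pair (NV n) (NV j) \<and>\<^sub>2 field_in X (NV j) \<and>\<^sub>2
         set_subst \<theta> Z (in_part m i X Y j))))"

inductive_set ACA0_open :: "sofm set" where
  "SNeg (Add (NV 0) N1 =\<^sub>2 N0) \<in> ACA0_open"
| "Add (NV 0) N1 =\<^sub>2 Add (NV 1) N1 \<longrightarrow>\<^sub>2 NV 0 =\<^sub>2 NV 1 \<in> ACA0_open"
| "Add (NV 0) N0 =\<^sub>2 NV 0 \<in> ACA0_open"
| "Add (NV 0) (Add (NV 1) N1) =\<^sub>2 Add (Add (NV 0) (NV 1)) N1 \<in> ACA0_open"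
| "Mul (NV 0) N0 =\<^sub>2 N0 \<in> ACA0_open"
| "Mul (NV 0) (Add (NV 1) N1) =\<^sub>2 Add (Mul (NV 0) (NV 1)) (NV 0) \<in> ACA0_open"
| "SNeg (NV 0 <\<^sub>2 N0) \<in> ACA0_open"
| "NV 0 <\<^sub>2 Add (NV 1) N1 \<longleftrightarrow>\<^sub>2 NV 0 <\<^sub>2 NV 1 \<or>\<^sub>2 NV 0 =\<^sub>2 NV 1 \<in> ACA0_open"
| induction: "N0 \<in>\<^sub>2 0 \<and>\<^sub>2 AllN 0 (NV 0 \<in>\<^sub>2 0 \<longrightarrow>\<^sub>2 Add (NV 0) N1 \<in>\<^sub>2 0) \<longrightarrow>\<^sub>2 AllN 0 (NV 0 \<in>\<^sub>2 0)
    \<in> ACA0_open"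
| comprehension: "arithmetical A \<Longrightarrow> X \<notin> free_svars A \<Longrightarrow> ExS X (AllN n (NV n \<in>\<^sub>2 X \<longleftrightarrow>\<^sub>2 A)) \<in> ACA0_open"

inductive_set ATR0_open :: "sofm set" where
  ACA0: "A \<in> ACA0_open \<Longrightarrow> A \<in> ATR0_open"
| recursion: "arithmetical \<theta> \<Longrightarrow> distinct [n, j, k, m, i] \<Longrightarrow> {j, k, m, i} \<inter> nvars \<theta> = {} \<Longrightarrow>
    X \<noteq> Y \<Longrightarrow> {X, Y} \<inter> free_svars \<theta> = {} \<Longrightarrow>
    AllS X (WO X \<longrightarrow>\<^sub>2 ExS Y (H_iter n Z \<theta> j k m i X Y)) \<in> ATR0_open"

text \<open>The axioms of \<open>ATR\<^sub>0\<close> are the universal closures of the formulas above.\<close>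

definition ATR0 :: "sofm set" where
  "ATR0 = {A. \<exists>ns Xs B. B \<in> ATR0_open \<and> A = foldr AllN ns (foldr AllS Xs B)
     \<and> free_nvars A = {} \<and> free_svars A = {}}"

section \<open>Relativisation to the standard objects\<close>

fun tr_tm :: "ntm \<Rightarrow> tm" where
  "tr_tm (NV n) = V n"
| "tr_tm N0 = Zero"
| "tr_tm N1 = One"
| "tr_tm (Add s t) = plus_tm (tr_tm s) (tr_tm t)"
| "tr_tm (Mul s t) = times_tm (tr_tm s) (tr_tm t)"

text \<open>
  The formula \<open>A\<^sup>s\<^sup>t\<close> in the language of P. Sets are coded by characteristic functions: a set
  quantifier becomes a quantifier over type 1 objects \<open>f\<close> with \<open>f \<le>\<^sub>1 1\<close>, where \<open>f \<le>\<^sub>1 1\<close> is itself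
  relativised, and \<open>t \<in> X\<close> becomes \<open>f(t) = 1\<close>.
\<close>

fun st_tr :: "sofm \<Rightarrow> fm" where
  "st_tr (s =\<^sub>2 t) = (tr_tm s \<^bold>= tr_tm t)"
| "st_tr (s <\<^sub>2 t) = (tr_tm s \<^bold>< tr_tm t)"
| "st_tr (t \<in>\<^sub>2 X) = (Var (X, T1) \<bullet> tr_tm t \<^bold>= One)"
| "st_tr SBot = Bot"
| "st_tr (A \<longrightarrow>\<^sub>2 B) = (st_tr A \<^bold>\<longrightarrow> st_tr B)"
| "st_tr (AllN n A) = ForallSt (nv n) (st_tr A)"
| "st_tr (BAllN n t A) = Forall (nv n) (V n \<^bold>< tr_tm t \<^bold>\<longrightarrow> st_tr A)"
| "st_tr (AllS X A) =
     ForallSt (X, T1) (ForallSt (nv 0) (Var (X, T1) \<bullet> V 0 \<^bold>\<le> One) \<^bold>\<longrightarrow> st_tr A)"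

text \<open>A system proves \<open>ATR\<^sub>0\<^sup>s\<^sup>t\<close> if it proves the relativisation of every axiom of \<open>ATR\<^sub>0\<close>.\<close>

definition proves_ATR0_st :: "fm set \<Rightarrow> bool" where
  "proves_ATR0_st \<Gamma> \<longleftrightarrow> (\<forall>A \<in> ATR0. \<Gamma> \<^bold>\<turnstile> st_tr A)"

end

theory Submission
  imports Defs "HOL-Probability.Probability"
begin

unbundle cardinal_syntax
no_notation inner (infix "\<bullet>" 70)

text \<open>
  Formulas are interpreted by challenges and responses over a graph model of the lambda calculus:
  a challenge is answered by a finite list of candidates, and the realisers are the closed terms of
  a typed lambda calculus with a constant for \<open>\<mu>\<close>, which realises \<open>\<Pi>\<^sup>0\<^sub>1-TRANS\<close>, and a constant for a
  covering functional, which realises \<open>LMP\<close>. The latter is random. Blocks of independent points of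
  Cantor space are given, one block for each countable ordinal. A functional \<open>g\<close> defined by a
  closed term depends on countably many points only, so with probability 1 the points \<open>x\<close> of a later
  block, with the neighbourhoods given by their first \<open>g(x)\<close> bits, cover Cantor space up to measure 0.

  Suppose that \<open>ATR\<^sub>0\<^sup>s\<^sup>t\<close> is provable. Then for every real parameter \<open>p\<close> coding a well-ordering, with
  probability 1 some closed term computes a solution of transfinite recursion along it. The closed
  terms of type 1 are almost surely Borel functions of \<open>p\<close> and the random points, so that ``with
  positive probability some closed term computes a solution which affirms the root'' is a Borel
  property of \<open>p\<close>. But transfinite recursion evaluates Borel codes. Take a code of the complement of
  this property, and let \<open>p\<close> contain this code: then the property holds of \<open>p\<close> iff it does not.
\<close>

section \<open>Countable ordinals\<close>

text \<open>The covering constant has to serve functionals that are themselves defined from it, and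
  it must be extensional. Asking \<open>g\<close> for its values at all coins and taking the least
  block that covers meets both demands, since the answer then depends on the values of
  \<open>g\<close> alone. The blocks are indexed by \<open>om1\<close> because no bound on the coins
  used by a term is known in advance, whereas every countable set of blocks is exceeded by a later
  one, and what lies beyond is fresh for the term. Independence yields a good block only almost
  surely, and only for countably many functionals at a time, namely those named by closed terms.
  Hence realisers have to meet definable challenges only, and the real parameter is fixed before the
  coins are tossed, because the exceptional null set depends on it. This order of choices is what
  makes diagonalisation possible: averaging over the coins by Fubini removes them from the claim
  that some term affirms the root, and a property of the parameter alone is left.\<close>

typedef om1 = "Field (cardSuc natLeq)"
  using Field_cardSuc_not_empty[OF natLeq_Card_order] by blast

setup_lifting type_definition_om1

instantiation om1 :: linorder
begin

lift_definition less_eq_om1 :: "om1 \<Rightarrow> om1 \<Rightarrow> bool" is "\<lambda>a b. (a, b) \<in> cardSuc natLeq" .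

definition less_om1 :: "om1 \<Rightarrow> om1 \<Rightarrow> bool" where
  "less_om1 a b \<longleftrightarrow> a \<le> b \<and> \<not> b \<le> a"

instance
proof
  have wo: "Well_order (cardSuc natLeq)"
    by (rule cardSuc_Well_order[OF natLeq_Card_order])
  fix x y z :: om1
  show "(x < y) = (x \<le> y \<and> \<not> y \<le> x)" by (simp add: less_om1_def)
  show "x \<le> x"
    using wo Rep_om1[of x] unfolding less_eq_om1.rep_eq order_on_defs refl_on_def by blast
  show "x \<le> y \<Longrightarrow> y \<le> z \<Longrightarrow> x \<le> z"
    using wo unfolding less_eq_om1.rep_eq order_on_defs trans_def by blast
  show "x \<le> y \<Longrightarrow> y \<le> x \<Longrightarrow> x = y"
    using wo unfolding less_eq_om1.rep_eq order_on_defs antisym_def Rep_om1_inject[symmetric]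
    by blast
  show "x \<le> y \<or> y \<le> x"
    using wo Rep_om1[of x] Rep_om1[of y] \<open>x \<le> x\<close>
    unfolding less_eq_om1.rep_eq order_on_defs total_on_def by metis
qed

end

lemma om1_less_iff: "a < b \<longleftrightarrow> (Rep_om1 a, Rep_om1 b) \<in> cardSuc natLeq - Id"
  by (auto simp: less_le less_eq_om1.rep_eq Rep_om1_inject)

instance om1 :: wellorder
proof
  fix P :: "om1 \<Rightarrow> bool" and a
  assume step: "\<And>x. (\<And>y. y < x \<Longrightarrow> P y) \<Longrightarrow> P x"
  have "wf (cardSuc natLeq - Id)"
    using cardSuc_Well_order[OF natLeq_Card_order] by (simp add: well_order_on_def)
  then have "wf (inv_image (cardSuc natLeq - Id) Rep_om1)" by (rule wf_inv_image)
  then show "P a"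
    by (rule wf_induct_rule) (auto intro: step simp: om1_less_iff in_inv_image)
qed

lemma countable_iff_ordLeq: "countable A \<longleftrightarrow> |A| \<le>o natLeq"
proof -
  have "countable A \<longleftrightarrow> |A| \<le>o |UNIV :: nat set|"
    unfolding countable_def card_of_ordLeq[symmetric] by simp
  then show ?thesis
    using card_of_nat ordIso_symmetric ordLeq_ordIso_trans by metis
qed

lemma uncountable_Field_cardSuc: "\<not> countable (Field (cardSuc natLeq))"
proof
  assume "countable (Field (cardSuc natLeq))"
  then have "|Field (cardSuc natLeq)| \<le>o natLeq"
    unfolding countable_iff_ordLeq .
  moreover have "|Field (cardSuc natLeq)| =o cardSuc natLeq"
    by (rule card_of_Field_ordIso[OF cardSuc_Card_order[OF natLeq_Card_order]])
  ultimately have "cardSuc natLeq \<le>o natLeq"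
    using ordIso_symmetric ordIso_ordLeq_trans by blast
  then show False
    using cardSuc_greater[OF natLeq_Card_order] not_ordLess_ordLeq by blast
qed

lemma countable_lessThan_om1: "countable {..<a :: om1}"
proof -
  have "|underS (cardSuc natLeq) (Rep_om1 a)| <o cardSuc natLeq"
    by (rule card_of_underS[OF cardSuc_Card_order[OF natLeq_Card_order] Rep_om1])
  then have "|underS (cardSuc natLeq) (Rep_om1 a)| \<le>o natLeq"
    using cardSuc_ordLeq_ordLess[OF natLeq_Card_order card_of_Card_order]
    by blast
  then have "countable (underS (cardSuc natLeq) (Rep_om1 a))"
    unfolding countable_iff_ordLeq .
  moreover have "Rep_om1 ` {..<a} \<subseteq> underS (cardSuc natLeq) (Rep_om1 a)"
    by (auto simp: underS_def om1_less_iff)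
  ultimately have "countable (Rep_om1 ` {..<a})" by (rule countable_subset[rotated])
  then show ?thesis
    by (rule countable_image_inj_on) (auto simp: inj_on_def Rep_om1_inject)
qed

lemma countable_atMost_om1: "countable {..a :: om1}"
  by (metis countable_insert countable_lessThan_om1 ivl_disj_un_singleton(2) sup_commute insert_is_Un)

text \<open>Without such a bound \<open>om1\<close> would be a countable union of countable initial
  segments. Every later choice of a fresh block rests on this.\<close>

lemma ex_greater_om1:
  assumes "countable (A :: om1 set)"
  shows "\<exists>u. \<forall>a\<in>A. a < u"
proof (rule ccontr)
  assume "\<not> ?thesis"
  then have "UNIV \<subseteq> (\<Union>a\<in>A. {..a})" by (force simp: not_less)
  moreover have "countable (\<Union>a\<in>A. {..a})"
    using assms countable_atMost_om1 by blast
  ultimately have "countable (UNIV :: om1 set)" by (rule countable_subset)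
  then have "countable (range Rep_om1)" by (rule countable_image)
  then show False
    using uncountable_Field_cardSuc type_definition.Rep_range[OF type_definition_om1] by simp
qed

text \<open>A strict upper bound is taken, so that \<open>rk\<close> drops properly from a node to
  each of its children.\<close>

definition sup_om1 :: "(nat \<Rightarrow> om1) \<Rightarrow> om1" where
  "sup_om1 f = (LEAST u. \<forall>n. f n < u)"

lemma less_sup_om1: "f n < sup_om1 f"
proof -
  obtain u where "\<forall>a\<in>range f. a < u" using ex_greater_om1[of "range f"] by auto
  then have "\<forall>n. f n < u" by blast
  then have "\<forall>n. f n < sup_om1 f" unfolding sup_om1_def by (rule LeastI)
  then show ?thesis by blast
qed

text \<open>A coin is named by its block and its position within the block. Its outcome is not a
  single bit but a point of Cantor space, see \<open>coins\<close>.\<close>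

type_synonym coin = "om1 \<times> nat"

section \<open>A graph model of the lambda calculus\<close>

text \<open>
  Arrow tokens have arguments of the size of the set of coins: the functional interpreting \<open>LMP\<close>
  inspects its argument at all coins.
\<close>

datatype tok = TNum nat | TArr "coin \<Rightarrow> tok option" tok | TFst tok | TSnd tok

type_synonym D = "tok set"

text \<open>A partial function on the coins encodes a set of at most as many tokens as there are
  coins. Partiality makes the empty set representable, and the bounded size makes the recursion of
  the datatype \<open>tok\<close> admissible.\<close>

definition setof :: "(coin \<Rightarrow> 'a option) \<Rightarrow> 'a set" where
  "setof a = {t. \<exists>c. a c = Some t}"

definition ap :: "D \<Rightarrow> D \<Rightarrow> D" (infixl "\<cdot>" 100) where
  "f \<cdot> x = {b. \<exists>a. TArr a b \<in> f \<and> setof a \<subseteq> x}"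

definition lm :: "(D \<Rightarrow> D) \<Rightarrow> D" where
  "lm F = {TArr a b |a b. b \<in> F (setof a)}"

text \<open>Continuity as needed in a graph model, with finite neighbourhoods replaced by
  neighbourhoods no larger than the set of coins. A condition on all coins at once may therefore
  guard a result, see \<open>cont_guard_all\<close>.\<close>

definition cont :: "(D \<Rightarrow> D) \<Rightarrow> bool" where
  "cont F \<longleftrightarrow> (\<forall>x b. b \<in> F x \<longleftrightarrow> (\<exists>a. setof a \<subseteq> x \<and> b \<in> F (setof a)))"

lemma ap_lm: "cont F \<Longrightarrow> lm F \<cdot> x = F x"
  unfolding cont_def ap_def lm_def by fast

lemma setof_card: "(\<exists>a :: coin \<Rightarrow> 'a option. setof a = A) \<longleftrightarrow> |A| \<le>o |UNIV :: coin set|"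
proof
  assume "\<exists>a :: coin \<Rightarrow> 'a option. setof a = A"
  then obtain a where a: "setof a = A" by blast
  have "A \<subseteq> (the \<circ> a) ` UNIV"
  proof
    fix t assume "t \<in> A"
    then obtain c where "a c = Some t" unfolding a[symmetric] setof_def by blast
    then have "t = (the \<circ> a) c" by simp
    then show "t \<in> (the \<circ> a) ` UNIV" by blast
  qed
  then show "|A| \<le>o |UNIV :: coin set|"
    by (rule surj_imp_ordLeq)
next
  assume "|A| \<le>o |UNIV :: coin set|"
  then obtain f :: "'a \<Rightarrow> coin" where f: "inj_on f A"
    by (auto simp: card_of_ordLeq[symmetric])
  define a where "a c = (if c \<in> f ` A then Some (the_inv_into A f c) else None)" for c :: coin
  have "t \<in> setof a \<longleftrightarrow> t \<in> A" for t
  proof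
    assume "t \<in> setof a"
    then show "t \<in> A" using the_inv_into_f_f[OF f] by (auto simp: setof_def a_def split: if_splits)
  next
    assume "t \<in> A"
    then have "a (f t) = Some t" by (auto simp: a_def the_inv_into_f_f[OF f])
    then show "t \<in> setof a" unfolding setof_def by blast
  qed
  then show "\<exists>a :: coin \<Rightarrow> 'a option. setof a = A" by blast
qed

lemma infinite_coin: "infinite (UNIV :: coin set)"
proof
  assume "finite (UNIV :: coin set)"
  then have "finite (range (\<lambda>n. (undefined, n) :: coin))" by (rule finite_subset[rotated]) simp
  then show False by (rule finite_imageD[THEN infinite_UNIV_nat[THEN notE]]) (auto simp: inj_on_def)
qed

text \<open>An infinite cardinal equals its square. Thus neighbourhoods chosen separately for every
  token of a neighbourhood, or for every coin, can be merged into one.\<close>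

lemma setof_UN: "\<exists>b :: coin \<Rightarrow> 'b option. setof b = (\<Union>x\<in>setof (a :: coin \<Rightarrow> 'a option). setof (f x))"
proof -
  have "\<forall>x. |setof (f x) :: 'b set| \<le>o |UNIV :: coin set|" using setof_card by blast
  moreover have "|setof a| \<le>o |UNIV :: coin set|" using setof_card by blast
  ultimately show ?thesis
    unfolding setof_card by (intro card_of_UNION_ordLeq_infinite[OF infinite_coin]) auto
qed

lemma setof_Un: "\<exists>b :: coin \<Rightarrow> 'b option. setof b = setof a \<union> setof a'"
  unfolding setof_card
proof (rule card_of_Un_ordLeq_infinite_Field)
  show "infinite (Field |UNIV :: coin set| )" using infinite_coin by (simp add: Field_card_of)
  show "|setof a| \<le>o |UNIV :: coin set|" "|setof a'| \<le>o |UNIV :: coin set|"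
    unfolding setof_card[symmetric] by (rule exI, rule refl)+
qed (rule card_of_Card_order)

lemma contI:
  assumes "\<And>x y. x \<subseteq> y \<Longrightarrow> F x \<subseteq> F y"
    and "\<And>x b. b \<in> F x \<Longrightarrow> \<exists>a. setof a \<subseteq> x \<and> b \<in> F (setof a)"
  shows "cont F"
  unfolding cont_def
proof (intro allI iffI)
  fix x b assume "\<exists>a. setof a \<subseteq> x \<and> b \<in> F (setof a)"
  then obtain a where a: "setof a \<subseteq> x" "b \<in> F (setof a)" by (elim exE conjE)
  from assms(1)[OF a(1)] a(2) show "b \<in> F x" by (rule subsetD)
qed (rule assms(2))

lemma contD1: "cont F \<Longrightarrow> x \<subseteq> y \<Longrightarrow> F x \<subseteq> F y"
proof
  fix b assume F: "cont F" "x \<subseteq> y" "b \<in> F x"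
  then obtain a where "setof a \<subseteq> x" "b \<in> F (setof a)" unfolding cont_def by meson
  with F(2) have "setof a \<subseteq> y \<and> b \<in> F (setof a)" by (meson order_trans)
  with F(1) show "b \<in> F y" unfolding cont_def by meson
qed

lemma contD2: "cont F \<Longrightarrow> b \<in> F x \<Longrightarrow> \<exists>a. setof a \<subseteq> x \<and> b \<in> F (setof a)"
  unfolding cont_def by blast

lemma cont_const: "cont (\<lambda>x. c)"
proof (rule contI)
  fix x :: D and b assume "b \<in> c"
  then show "\<exists>a :: coin \<Rightarrow> tok option. setof a \<subseteq> x \<and> b \<in> c"
    by (intro exI[of _ "\<lambda>_. None"]) (simp add: setof_def)
qed simp

lemma setof_single: "\<exists>a :: coin \<Rightarrow> 'a option. setof a = {t}"
  by (rule exI[of _ "\<lambda>_. Some t"]) (auto simp: setof_def)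

lemma cont_id: "cont (\<lambda>x. x)"
proof (rule contI)
  fix x :: D and b assume "b \<in> x"
  moreover obtain a :: "coin \<Rightarrow> tok option" where "setof a = {b}" using setof_single by metis
  ultimately show "\<exists>a :: coin \<Rightarrow> tok option. setof a \<subseteq> x \<and> b \<in> setof a"
    by (intro exI[of _ a]) simp
qed

lemma cont_collect:
  assumes "cont F" "setof a \<subseteq> F x"
  shows "\<exists>a'. setof a' \<subseteq> x \<and> setof a \<subseteq> F (setof a')"
proof -
  have "\<forall>t\<in>setof a. \<exists>s. setof s \<subseteq> x \<and> t \<in> F (setof s)"
  proof
    fix t assume "t \<in> setof a"
    with assms(2) have "t \<in> F x" by (rule subsetD)
    then show "\<exists>s. setof s \<subseteq> x \<and> t \<in> F (setof s)" by (rule contD2[OF assms(1)])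
  qed
  from bchoice[OF this] obtain s
    where s': "\<forall>t\<in>setof a. setof (s t) \<subseteq> x \<and> t \<in> F (setof (s t))" ..
  note s = bspec[OF s']
  obtain a' where a': "setof a' = (\<Union>t\<in>setof a. setof (s t))"
    using setof_UN[of s a] by (elim exE)
  have "t \<in> F (setof a')" if "t \<in> setof a" for t
  proof -
    have "setof (s t) \<subseteq> setof a'" using that unfolding a' by blast
    then show ?thesis using s[OF that] contD1[OF assms(1)] by blast
  qed
  moreover have "setof a' \<subseteq> x" using s unfolding a' by blast
  ultimately show ?thesis by blast
qed

lemma cont_ap: assumes F: "cont F" and G: "cont G" shows "cont (\<lambda>x. F x \<cdot> G x)"
proof (rule contI)
  fix x y :: D assume "x \<subseteq> y"
  then have "F x \<subseteq> F y" "G x \<subseteq> G y" using contD1[OF F] contD1[OF G] by simp_all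
  then show "F x \<cdot> G x \<subseteq> F y \<cdot> G y" by (auto simp: ap_def)
next
  fix x b assume "b \<in> F x \<cdot> G x"
  then obtain a where a: "TArr a b \<in> F x" "setof a \<subseteq> G x" by (auto simp: ap_def)
  obtain s1 where s1: "setof s1 \<subseteq> x" "TArr a b \<in> F (setof s1)" using contD2[OF F a(1)] by blast
  obtain s2 where s2: "setof s2 \<subseteq> x" "setof a \<subseteq> G (setof s2)"
    using cont_collect[OF G a(2)] by blast
  obtain s where s: "setof s = setof s1 \<union> setof s2" using setof_Un by metis
  have "TArr a b \<in> F (setof s)" using contD1[OF F, of "setof s1" "setof s"] s s1(2) by blast
  moreover have "setof a \<subseteq> G (setof s)" using contD1[OF G, of "setof s2" "setof s"] s s2(2) by blast
  ultimately have "b \<in> F (setof s) \<cdot> G (setof s)" unfolding ap_def by blast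
  then show "\<exists>a. setof a \<subseteq> x \<and> b \<in> F (setof a) \<cdot> G (setof a)"
    using s s1(1) s2(1) by blast
qed

lemma cont_lm: assumes "\<And>y. cont (\<lambda>x. F x y)" shows "cont (\<lambda>x. lm (F x))"
proof (rule contI)
  fix x y :: D assume "x \<subseteq> y"
  then show "lm (F x) \<subseteq> lm (F y)" using contD1[OF assms] unfolding lm_def by blast
next
  fix x b assume "b \<in> lm (F x)"
  then obtain a t where "b = TArr a t" "t \<in> F x (setof a)" by (auto simp: lm_def)
  then show "\<exists>a. setof a \<subseteq> x \<and> b \<in> lm (F (setof a))"
    using contD2[OF assms] unfolding lm_def by fast
qed

lemma cont_Union:
  assumes "\<And>i. i \<in> I \<Longrightarrow> cont (F i)"
  shows "cont (\<lambda>x. \<Union>i\<in>I. F i x)"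
proof (rule contI)
  fix x y :: D assume "x \<subseteq> y"
  then show "(\<Union>i\<in>I. F i x) \<subseteq> (\<Union>i\<in>I. F i y)" using contD1[OF assms] by blast
next
  fix x b assume "b \<in> (\<Union>i\<in>I. F i x)"
  then show "\<exists>a. setof a \<subseteq> x \<and> b \<in> (\<Union>i\<in>I. F i (setof a))"
    using contD2[OF assms] by (metis UN_iff)
qed

lemma cont_guard:
  assumes F: "cont F" and G: "cont G"
  shows "cont (\<lambda>x. if setof a \<subseteq> F x then G x else {})"
proof (rule contI)
  fix x y :: D assume "x \<subseteq> y"
  then show "(if setof a \<subseteq> F x then G x else {}) \<subseteq> (if setof a \<subseteq> F y then G y else {})"
    using contD1[OF F, of x y] contD1[OF G, of x y] by auto
next
  fix x b assume b: "b \<in> (if setof a \<subseteq> F x then G x else {})"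
  then have "setof a \<subseteq> F x" "b \<in> G x" by (auto split: if_splits)
  obtain s1 where s1: "setof s1 \<subseteq> x" "b \<in> G (setof s1)" using contD2[OF G \<open>b \<in> G x\<close>] by blast
  obtain s2 where s2: "setof s2 \<subseteq> x" "setof a \<subseteq> F (setof s2)"
    using cont_collect[OF F \<open>setof a \<subseteq> F x\<close>] by blast
  obtain s where s: "setof s = setof s1 \<union> setof s2" using setof_Un by metis
  have "b \<in> G (setof s)" using contD1[OF G, of "setof s1" "setof s"] s s1(2) by blast
  moreover have "setof a \<subseteq> F (setof s)" using contD1[OF F, of "setof s2" "setof s"] s s2(2) by blast
  ultimately show "\<exists>s. setof s \<subseteq> x \<and> b \<in> (if setof a \<subseteq> F (setof s) then G (setof s) else {})"
    using s s1(1) s2(1) by (intro exI[of _ s]) auto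
qed

lemma cont_guard1:
  assumes F: "cont F" and G: "cont G"
  shows "cont (\<lambda>x. if t \<in> F x then G x else {})"
proof -
  obtain a :: "coin \<Rightarrow> tok option" where a: "setof a = {t}" using setof_single by metis
  show ?thesis using cont_guard[OF F G, of a] by (simp add: a)
qed

lemma cont_guard_all:
  assumes F: "\<And>c :: coin. cont (F c)" and G: "cont G"
  shows "cont (\<lambda>x. if \<forall>c. t c \<in> F c x then G x else {})"
proof (rule contI)
  fix x y :: D assume "x \<subseteq> y"
  then have "F c x \<subseteq> F c y" "G x \<subseteq> G y" for c using contD1[OF F] contD1[OF G] by blast+
  then show "(if \<forall>c. t c \<in> F c x then G x else {}) \<subseteq> (if \<forall>c. t c \<in> F c y then G y else {})"
    by (auto simp: subset_iff)
next
  fix x b assume b: "b \<in> (if \<forall>c. t c \<in> F c x then G x else {})"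
  then have 1: "\<And>c. t c \<in> F c x" "b \<in> G x" by (auto split: if_splits)
  obtain s1 where s1: "setof s1 \<subseteq> x" "b \<in> G (setof s1)" using contD2[OF G 1(2)] by blast
  have "\<forall>c. \<exists>s. setof s \<subseteq> x \<and> t c \<in> F c (setof s)" by (intro allI contD2[OF F 1(1)])
  from choice[OF this] obtain r
    where r: "\<forall>c. setof (r c) \<subseteq> x \<and> t c \<in> F c (setof (r c))" ..
  \<comment> \<open>The function \<open>Some\<close> presents the set of all coins as a
    \<open>setof\<close>, so that one neighbourhood per coin can be merged by
    \<open>setof_UN\<close>.\<close>
  obtain s2 :: "coin \<Rightarrow> tok option" where s2: "setof s2 = (\<Union>c\<in>setof (Some :: coin \<Rightarrow> coin option). setof (r c))"
    using setof_UN[of r "Some :: coin \<Rightarrow> coin option"] by (elim exE)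
  have S: "setof (Some :: coin \<Rightarrow> coin option) = UNIV" by (auto simp: setof_def)
  obtain s where s: "setof s = setof s1 \<union> setof s2" using setof_Un by metis
  have "b \<in> G (setof s)" using contD1[OF G, of "setof s1" "setof s"] s s1(2) by blast
  moreover have "t c \<in> F c (setof s)" for c
    using contD1[OF F[of c], of "setof (r c)" "setof s"] s r s2 S by blast
  moreover have "setof s \<subseteq> x" using s s1 s2 r by blast
  ultimately show "\<exists>s. setof s \<subseteq> x \<and> b \<in> (if \<forall>c. t c \<in> F c (setof s) then G (setof s) else {})"
    by (intro exI[of _ s]) auto
qed

lemma cont_image_un:
  assumes "cont F" "cont G"
  shows "cont (\<lambda>x. f ` F x \<union> g ` G x)"
proof (rule contI)
  fix x y :: D assume "x \<subseteq> y"
  then show "f ` F x \<union> g ` G x \<subseteq> f ` F y \<union> g ` G y"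
    using contD1[OF assms(1), of x y] contD1[OF assms(2), of x y] by blast
next
  fix x b assume "b \<in> f ` F x \<union> g ` G x"
  then consider t where "b = f t" "t \<in> F x" | t where "b = g t" "t \<in> G x" by blast
  then show "\<exists>a. setof a \<subseteq> x \<and> b \<in> f ` F (setof a) \<union> g ` G (setof a)"
  proof cases
    case 1
    obtain a where "setof a \<subseteq> x" "t \<in> F (setof a)" using contD2[OF assms(1) 1(2)] by (elim exE conjE)
    then show ?thesis unfolding 1(1) by (intro exI[of _ a]) simp
  next
    case 2
    obtain a where "setof a \<subseteq> x" "t \<in> G (setof a)" using contD2[OF assms(2) 2(2)] by (elim exE conjE)
    then show ?thesis unfolding 2(1) by (intro exI[of _ a]) simp
  qed
qed

lemma cont_vimage: assumes "cont F" shows "cont (\<lambda>x. {t. f t \<in> F x})"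
proof (rule contI)
  fix x y :: D assume "x \<subseteq> y"
  then show "{t. f t \<in> F x} \<subseteq> {t. f t \<in> F y}" using contD1[OF assms, of x y] by blast
next
  fix x b assume "b \<in> {t. f t \<in> F x}"
  then have "f b \<in> F x" by simp
  from contD2[OF assms this] show "\<exists>a. setof a \<subseteq> x \<and> b \<in> {t. f t \<in> F (setof a)}" by simp
qed

section \<open>Denotations of the constants\<close>

definition num :: "nat \<Rightarrow> D" where "num n = {TNum n}"

text \<open>A case distinction on a numeral. Taking the union over all numerals contained in the
  argument keeps it continuous on arguments that are not numerals.\<close>

definition bnd :: "D \<Rightarrow> (nat \<Rightarrow> D) \<Rightarrow> D" where
  "bnd x F = (\<Union>n. if TNum n \<in> x then F n else {})"

definition pr :: "D \<Rightarrow> D \<Rightarrow> D" where "pr x y = TFst ` x \<union> TSnd ` y"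
definition fstD :: "D \<Rightarrow> D" where "fstD x = {t. TFst t \<in> x}"
definition sndD :: "D \<Rightarrow> D" where "sndD x = {t. TSnd t \<in> x}"

lemma num_inject [simp]: "num m = num n \<longleftrightarrow> m = n" by (simp add: num_def)
lemma bnd_num [simp]: "bnd (num n) F = F n" by (auto simp: bnd_def num_def)
lemma fstD_pr [simp]: "fstD (pr x y) = x" by (auto simp: pr_def fstD_def)
lemma sndD_pr [simp]: "sndD (pr x y) = y" by (auto simp: pr_def sndD_def)
lemma TNum_in_num [simp]: "TNum m \<in> num n \<longleftrightarrow> m = n" by (simp add: num_def)

lemma cont_bnd:
  assumes "cont G" "\<And>n. cont (\<lambda>x. F x n)" shows "cont (\<lambda>x. bnd (G x) (F x))"
  unfolding bnd_def by (intro cont_Union cont_guard1 assms)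

lemma cont_pr: "cont F \<Longrightarrow> cont G \<Longrightarrow> cont (\<lambda>x. pr (F x) (G x))"
  unfolding pr_def by (rule cont_image_un)
lemma cont_fstD: "cont F \<Longrightarrow> cont (\<lambda>x. fstD (F x))"
  unfolding fstD_def by (rule cont_vimage)
lemma cont_sndD: "cont F \<Longrightarrow> cont (\<lambda>x. sndD (F x))"
  unfolding sndD_def by (rule cont_vimage)

primrec recn :: "D \<Rightarrow> D \<Rightarrow> nat \<Rightarrow> D" where
  "recn s f 0 = s"
| "recn s f (Suc n) = f \<cdot> recn s f n \<cdot> num n"

lemma cont_recn: "cont S \<Longrightarrow> cont F \<Longrightarrow> cont (\<lambda>x. recn (S x) (F x) n)"
  by (induction n) (auto intro!: cont_ap cont_const)

primrec lrecn :: "D \<Rightarrow> D \<Rightarrow> nat \<Rightarrow> (nat \<Rightarrow> D) \<Rightarrow> D" where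
  "lrecn s f 0 h = s"
| "lrecn s f (Suc n) h = f \<cdot> lrecn s f n (\<lambda>i. h (Suc i)) \<cdot> h 0"

lemma cont_lrecn:
  "cont S \<Longrightarrow> cont F \<Longrightarrow> (\<And>i. cont (\<lambda>x. H x i)) \<Longrightarrow> cont (\<lambda>x. lrecn (S x) (F x) n (H x))"
proof (induction n arbitrary: H)
  case (Suc n)
  show ?case by (simp, intro cont_ap Suc)
qed simp

text \<open>If \<open>h\<close> has no zero, the value is an arbitrary number. This is harmless,
  since the functional is trusted only where a zero is known to exist.\<close>

definition muv :: "(nat \<Rightarrow> nat) \<Rightarrow> nat" where "muv h = (LEAST n. h n = 0)"

text \<open>The neighbourhoods of the \<open>x i\<close> given by their first \<open>h i\<close> bits, \<open>i \<le> j\<close>, together have measure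
  greater than \<open>1 - 1/m\<close>; see \<open>covers_iff\<close>.\<close>

definition covers :: "(nat \<Rightarrow> nat \<Rightarrow> bool) \<Rightarrow> (nat \<Rightarrow> nat) \<Rightarrow> nat \<Rightarrow> nat \<Rightarrow> bool" where
  "covers x h j m \<longleftrightarrow> (let N = \<Sum>i\<le>j. h i in
     (m - 1) * 2 ^ N < m * card {s. length s = N \<and> (\<exists>i\<le>j. \<forall>l<h i. s ! l = x i l)})"

type_synonym coins = "coin \<Rightarrow> nat \<Rightarrow> bool"

text \<open>All precisions \<open>m\<close> are demanded of the same block, so that the choice of
  the block depends on the functional only.\<close>

definition good :: "coins \<Rightarrow> (coin \<Rightarrow> nat) \<Rightarrow> om1 \<Rightarrow> bool" where
  "good w h \<alpha> \<longleftrightarrow> (\<forall>m>0. \<exists>j. covers (\<lambda>i. w (\<alpha>, i)) (\<lambda>i. h (\<alpha>, i)) j m)"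

text \<open>If no block is good, \<open>covblk\<close> is a junk value and \<open>covlen\<close> is 0.\<close>

definition covblk :: "coins \<Rightarrow> (coin \<Rightarrow> nat) \<Rightarrow> om1" where
  "covblk w h = (LEAST \<alpha>. good w h \<alpha>)"

definition covlen :: "coins \<Rightarrow> (coin \<Rightarrow> nat) \<Rightarrow> nat \<Rightarrow> nat" where
  "covlen w h m = (if \<exists>\<alpha>. good w h \<alpha>
     then Suc (LEAST j. covers (\<lambda>i. w (covblk w h, i)) (\<lambda>i. h (covblk w h, i)) j m) else 0)"

definition funD :: "(nat \<Rightarrow> nat) \<Rightarrow> D" where "funD r = lm (\<lambda>x. bnd x (\<lambda>n. num (r n)))"

definition coinD :: "coins \<Rightarrow> coin \<Rightarrow> D" where "coinD w c = funD (\<lambda>n. of_bool (w c n))"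

definition blockD :: "coins \<Rightarrow> om1 \<Rightarrow> D" where
  "blockD w \<alpha> = lm (\<lambda>x. bnd x (\<lambda>n. coinD w (\<alpha>, n)))"

section \<open>Typed terms\<close>

datatype rty = NN | FF rty rty (infixr "\<rightarrow>\<^sub>r" 70) | LL rty | PP rty rty (infixr "\<times>\<^sub>r" 72)

datatype rconst = RZero | RSuc | RRec rty | RPair rty rty | RFst rty rty | RSnd rty rty
  | RNil rty | RCons rty | RLRec rty rty | RMu | RCov | RPar nat | RAll

type_synonym rvar = "nat \<times> rty"

datatype rtm = RV rvar | RC rconst | RA rtm rtm (infixl "\<star>" 100) | RL rvar rtm

primrec tyc :: "rconst \<Rightarrow> rty" where
  "tyc RZero = NN"
| "tyc RSuc = NN \<rightarrow>\<^sub>r NN"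
| "tyc (RRec \<tau>) = NN \<rightarrow>\<^sub>r \<tau> \<rightarrow>\<^sub>r (\<tau> \<rightarrow>\<^sub>r NN \<rightarrow>\<^sub>r \<tau>) \<rightarrow>\<^sub>r \<tau>"
| "tyc (RPair \<sigma> \<tau>) = \<sigma> \<rightarrow>\<^sub>r \<tau> \<rightarrow>\<^sub>r \<sigma> \<times>\<^sub>r \<tau>"
| "tyc (RFst \<sigma> \<tau>) = \<sigma> \<times>\<^sub>r \<tau> \<rightarrow>\<^sub>r \<sigma>"
| "tyc (RSnd \<sigma> \<tau>) = \<sigma> \<times>\<^sub>r \<tau> \<rightarrow>\<^sub>r \<tau>"
| "tyc (RNil \<sigma>) = LL \<sigma>"
| "tyc (RCons \<sigma>) = \<sigma> \<rightarrow>\<^sub>r LL \<sigma> \<rightarrow>\<^sub>r LL \<sigma>"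
| "tyc (RLRec \<sigma> \<tau>) = LL \<sigma> \<rightarrow>\<^sub>r \<tau> \<rightarrow>\<^sub>r (\<tau> \<rightarrow>\<^sub>r \<sigma> \<rightarrow>\<^sub>r \<tau>) \<rightarrow>\<^sub>r \<tau>"
| "tyc RMu = (NN \<rightarrow>\<^sub>r NN) \<rightarrow>\<^sub>r NN"
| "tyc RCov = ((NN \<rightarrow>\<^sub>r NN) \<rightarrow>\<^sub>r NN) \<rightarrow>\<^sub>r NN \<rightarrow>\<^sub>r LL (NN \<rightarrow>\<^sub>r NN)"
| "tyc (RPar i) = NN \<rightarrow>\<^sub>r NN"
| "tyc RAll = NN \<rightarrow>\<^sub>r NN"

primrec tyr :: "rtm \<Rightarrow> rty option" where
  "tyr (RV v) = Some (snd v)"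
| "tyr (RC c) = Some (tyc c)"
| "tyr (s \<star> t) = (case tyr s of Some (\<sigma> \<rightarrow>\<^sub>r \<tau>) \<Rightarrow> if tyr t = Some \<sigma> then Some \<tau> else None | _ \<Rightarrow> None)"
| "tyr (RL v t) = map_option (\<lambda>\<tau>. snd v \<rightarrow>\<^sub>r \<tau>) (tyr t)"

primrec fvr :: "rtm \<Rightarrow> rvar set" where
  "fvr (RV v) = {v}"
| "fvr (RC c) = {}"
| "fvr (s \<star> t) = fvr s \<union> fvr t"
| "fvr (RL v t) = fvr t - {v}"

lemma tyr_RA: "tyr (s \<star> t) = Some \<tau> \<longleftrightarrow> (\<exists>\<sigma>. tyr s = Some (\<sigma> \<rightarrow>\<^sub>r \<tau>) \<and> tyr t = Some \<sigma>)"
  by (auto split: option.splits rty.splits)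

primrec zeroR :: "rty \<Rightarrow> D" where
  "zeroR NN = num 0"
| "zeroR (\<sigma> \<rightarrow>\<^sub>r \<tau>) = lm (\<lambda>_. zeroR \<tau>)"
| "zeroR (LL \<sigma>) = pr (num 0) (lm (\<lambda>_. zeroR \<sigma>))"
| "zeroR (\<sigma> \<times>\<^sub>r \<tau>) = pr (zeroR \<sigma>) (zeroR \<tau>)"

text \<open>In \<open>RMu\<close> and \<open>RCov\<close> the union over \<open>h\<close> guesses
  all values of the argument at once; if these are numerals, exactly one guess survives. The guard
  of \<open>RMu\<close> ranges over coins, of which only the second components matter, to fit the
  form of \<open>cont_guard_all\<close>. The constants \<open>RPar\<close> and \<open>RAll\<close>
  make the columns of the real parameter, and the parameter itself, definable.\<close>

primrec cden :: "(nat \<Rightarrow> bool) \<Rightarrow> coins \<Rightarrow> rconst \<Rightarrow> D" where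
  "cden p w RZero = num 0"
| "cden p w RSuc = lm (\<lambda>x. bnd x (\<lambda>n. num (Suc n)))"
| "cden p w (RRec \<tau>) = lm (\<lambda>u. lm (\<lambda>s. lm (\<lambda>f. bnd u (recn s f))))"
| "cden p w (RPair \<sigma> \<tau>) = lm (\<lambda>x. lm (\<lambda>y. pr x y))"
| "cden p w (RFst \<sigma> \<tau>) = lm fstD"
| "cden p w (RSnd \<sigma> \<tau>) = lm sndD"
| "cden p w (RNil \<sigma>) = zeroR (LL \<sigma>)"
| "cden p w (RCons \<sigma>) = lm (\<lambda>a. lm (\<lambda>l. pr (bnd (fstD l) (\<lambda>n. num (Suc n)))
     (lm (\<lambda>i. bnd i (\<lambda>n. case n of 0 \<Rightarrow> a | Suc j \<Rightarrow> sndD l \<cdot> num j)))))"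
| "cden p w (RLRec \<sigma> \<tau>) = lm (\<lambda>l. lm (\<lambda>s. lm (\<lambda>f.
     bnd (fstD l) (\<lambda>n. lrecn s f n (\<lambda>i. sndD l \<cdot> num i)))))"
| "cden p w RMu = lm (\<lambda>f. \<Union>h. if \<forall>c :: coin. TNum (h (snd c)) \<in> f \<cdot> num (snd c) then num (muv h) else {})"
| "cden p w RCov = lm (\<lambda>g. lm (\<lambda>k. bnd k (\<lambda>m.
     \<Union>h. if \<forall>c. TNum (h c) \<in> g \<cdot> coinD w c
       then pr (num (covlen w h m)) (blockD w (covblk w h)) else {})))"
| "cden p w (RPar i) = funD (\<lambda>n. of_bool (p (prod_encode (i, n))))"
| "cden p w RAll = funD (\<lambda>n. of_bool (p n))"

primrec den :: "(nat \<Rightarrow> bool) \<Rightarrow> coins \<Rightarrow> (rvar \<Rightarrow> D) \<Rightarrow> rtm \<Rightarrow> D" where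
  "den p w e (RV v) = e v"
| "den p w e (RC c) = cden p w c"
| "den p w e (s \<star> t) = den p w e s \<cdot> den p w e t"
| "den p w e (RL v t) = lm (\<lambda>x. den p w (e(v := x)) t)"

text \<open>The rules produced by \<open>primrec\<close> contain eta-expanded environments, on which the simplifier
  unfolds function updates.\<close>

lemma den_simps:
  "den p w e (RV v) = e v" "den p w e (RC c) = cden p w c"
  "den p w e (s \<star> t) = den p w e s \<cdot> den p w e t"
  by simp_all

declare den.simps [simp del]
declare den_simps [simp]
declare cden.simps [simp del]
declare cden.simps(1,7) [simp]

lemmas cont_intros = cont_const cont_id cont_ap cont_lm cont_bnd cont_pr cont_fstD cont_sndD
  cont_recn cont_lrecn cont_Union cont_guard_all

lemma cont_den: "cont (\<lambda>x. den p w (e(v := x)) t)"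
proof (induction t arbitrary: e)
  case (RV u)
  then show ?case by (cases "u = v") (auto intro: cont_intros)
next
  case (RL u t)
  show ?case
  proof (cases "u = v")
    case True
    then have "(\<lambda>x. den p w (e(v := x)) (RL u t)) = (\<lambda>x. den p w e (RL u t))"
      using True by (simp add: den.simps(4))
    then show ?thesis by (simp only: cont_const)
  next
    case False
    have "cont (\<lambda>x. den p w (e(v := x, u := y)) t)" for y
      using RL[of "e(u := y)"] by (simp only: fun_upd_twist[OF False[symmetric]])
    then show ?thesis unfolding den.simps(4) by (rule cont_lm)
  qed
qed (auto intro: cont_intros)

lemma den_RL [simp]: "den p w e (RL v t) \<cdot> x = den p w (e(v := x)) t"
  by (simp add: ap_lm cont_den den.simps(4))

lemma den_cong: "(\<And>v. v \<in> fvr t \<Longrightarrow> e v = e' v) \<Longrightarrow> den p w e t = den p w e' t"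
proof (induction t arbitrary: e e')
  case (RL v t)
  have "den p w (e(v := x)) t = den p w (e'(v := x)) t" for x
    by (rule RL(1)) (use RL(2) in auto)
  then show ?case by (simp add: den.simps(4))
next
  case (RA s t)
  then show ?case by (metis UnCI den.simps(3) fvr.simps(3))
qed auto

lemma den_closed: "fvr t = {} \<Longrightarrow> den p w e t = den p w e' t"
  by (rule den_cong) simp

lemma sucD [simp]: "cden p w RSuc \<cdot> num n = num (Suc n)"
  by (simp add: cden.simps ap_lm cont_intros)
lemma recD: "cden p w (RRec \<tau>) \<cdot> num n \<cdot> s \<cdot> f = recn s f n"
  by (simp add: cden.simps ap_lm cont_intros)
lemma pairD [simp]: "cden p w (RPair \<sigma> \<tau>) \<cdot> x \<cdot> y = pr x y"
  by (simp add: cden.simps ap_lm cont_intros)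
lemma cfstD [simp]: "cden p w (RFst \<sigma> \<tau>) \<cdot> x = fstD x"
  by (simp add: cden.simps ap_lm cont_intros)
lemma csndD [simp]: "cden p w (RSnd \<sigma> \<tau>) \<cdot> x = sndD x"
  by (simp add: cden.simps ap_lm cont_intros)
lemma funD [simp]: "funD r \<cdot> num n = num (r n)"
  unfolding funD_def by (simp add: ap_lm cont_intros)
lemma coinD [simp]: "coinD w c \<cdot> num n = num (of_bool (w c n))"
  unfolding coinD_def by simp
lemma blockD [simp]: "blockD w \<alpha> \<cdot> num n = coinD w (\<alpha>, n)"
  unfolding blockD_def by (simp add: ap_lm cont_intros)
lemma const_lm [simp]: "lm (\<lambda>_. c) \<cdot> x = c"
  by (simp add: ap_lm cont_intros)

lemma muD:
  assumes "\<And>n. f \<cdot> num n = num (h n)"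
  shows "cden p w RMu \<cdot> f = num (muv h)"
proof -
  have "(\<forall>c :: coin. TNum (h' (snd c)) \<in> f \<cdot> num (snd c)) \<longleftrightarrow> h' = h" for h'
    by (auto simp: assms fun_eq_iff)
  moreover have "cden p w RMu \<cdot> f
    = (\<Union>h. if \<forall>c :: coin. TNum (h (snd c)) \<in> f \<cdot> num (snd c) then num (muv h) else {})"
    by (unfold cden.simps, rule ap_lm, intro cont_intros)
  ultimately show ?thesis by simp
qed

lemma covD:
  assumes "\<And>c. g \<cdot> coinD w c = num (h c)"
  shows "cden p w RCov \<cdot> g \<cdot> num m = pr (num (covlen w h m)) (blockD w (covblk w h))"
proof -
  have "(\<forall>c. TNum (h' c) \<in> g \<cdot> coinD w c) \<longleftrightarrow> h' = h" for h'
    by (auto simp: assms fun_eq_iff)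
  moreover have "cden p w RCov \<cdot> g = lm (\<lambda>k. bnd k (\<lambda>m.
     \<Union>h. if \<forall>c. TNum (h c) \<in> g \<cdot> coinD w c
       then pr (num (covlen w h m)) (blockD w (covblk w h)) else {}))"
    by (unfold cden.simps, rule ap_lm, intro cont_intros)
  moreover have "lm (\<lambda>k. bnd k (\<lambda>m.
     \<Union>h. if \<forall>c. TNum (h c) \<in> g \<cdot> coinD w c
       then pr (num (covlen w h m)) (blockD w (covblk w h)) else {})) \<cdot> num m
    = bnd (num m) (\<lambda>m. \<Union>h. if \<forall>c. TNum (h c) \<in> g \<cdot> coinD w c
       then pr (num (covlen w h m)) (blockD w (covblk w h)) else {})"
    by (rule ap_lm, intro cont_intros)
  ultimately show ?thesis by simp
qed

section \<open>Lists\<close>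

definition isl :: "D \<Rightarrow> bool" where "isl x \<longleftrightarrow> (\<exists>n. fstD x = num n)"

text \<open>A list is a pair of a length and an indexing function whose values beyond the length are
  irrelevant. Different elements of \<open>D\<close> may thus represent the same list, and
  \<open>dl\<close> extracts what counts.\<close>

definition dl :: "D \<Rightarrow> D list" where
  "dl x = map (\<lambda>i. sndD x \<cdot> num i) [0..<(THE n. fstD x = num n)]"

lemma dl_num: "fstD x = num n \<Longrightarrow> dl x = map (\<lambda>i. sndD x \<cdot> num i) [0..<n]"
  by (simp add: dl_def)

lemma isl_zeroR [simp]: "isl (zeroR (LL \<sigma>))" by (simp add: isl_def)
lemma dl_zeroR [simp]: "dl (zeroR (LL \<sigma>)) = []" by (simp add: dl_num[where n = 0])
declare zeroR.simps(3) [simp del]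

lemma consD_eq: "cden p w (RCons \<sigma>) \<cdot> a \<cdot> l = pr (bnd (fstD l) (\<lambda>n. num (Suc n)))
     (lm (\<lambda>i. bnd i (\<lambda>n. case n of 0 \<Rightarrow> a | Suc j \<Rightarrow> sndD l \<cdot> num j)))"
proof -
  have 1: "cont (\<lambda>a. case n of 0 \<Rightarrow> a | Suc j \<Rightarrow> sndD l \<cdot> num j)" for n l
    by (cases n) (auto intro: cont_intros)
  have 2: "cont (\<lambda>l. case n of 0 \<Rightarrow> a | Suc j \<Rightarrow> sndD l \<cdot> num j)" for n a
    by (cases n) (auto intro!: cont_intros)
  have "cden p w (RCons \<sigma>) \<cdot> a = lm (\<lambda>l. pr (bnd (fstD l) (\<lambda>n. num (Suc n)))
     (lm (\<lambda>i. bnd i (\<lambda>n. case n of 0 \<Rightarrow> a | Suc j \<Rightarrow> sndD l \<cdot> num j))))"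
    by (unfold cden.simps, rule ap_lm, intro cont_intros 1)
  moreover have "\<dots> \<cdot> l = pr (bnd (fstD l) (\<lambda>n. num (Suc n)))
     (lm (\<lambda>i. bnd i (\<lambda>n. case n of 0 \<Rightarrow> a | Suc j \<Rightarrow> sndD l \<cdot> num j)))"
    by (rule ap_lm, intro cont_intros 2)
  ultimately show ?thesis by simp
qed

lemma sndD_consD: "sndD (cden p w (RCons \<sigma>) \<cdot> a \<cdot> l) \<cdot> num n =
  (case n of 0 \<Rightarrow> a | Suc j \<Rightarrow> sndD l \<cdot> num j)"
  unfolding consD_eq by (simp add: ap_lm cont_intros)

lemma fstD_consD: "fstD l = num n \<Longrightarrow> fstD (cden p w (RCons \<sigma>) \<cdot> a \<cdot> l) = num (Suc n)"
  unfolding consD_eq by simp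

lemma isl_consD [simp]: "isl l \<Longrightarrow> isl (cden p w (RCons \<sigma>) \<cdot> a \<cdot> l)"
  unfolding isl_def using fstD_consD by blast

lemma dl_consD [simp]:
  assumes "isl l" shows "dl (cden p w (RCons \<sigma>) \<cdot> a \<cdot> l) = a # dl l"
proof -
  obtain n where n: "fstD l = num n" using assms by (auto simp: isl_def)
  show ?thesis
    unfolding dl_num[OF n] dl_num[OF fstD_consD[OF n]]
    by (rule nth_equalityI) (auto simp: sndD_consD nth_Cons simp del: upt_Suc split: nat.splits)
qed

lemma lrecn_foldr:
  "lrecn s f n h = foldr (\<lambda>a acc. f \<cdot> acc \<cdot> a) (map h [0..<n]) s"
proof (induction n arbitrary: h)
  case (Suc n)
  have "map h [0..<Suc n] = h 0 # map (\<lambda>i. h (Suc i)) [0..<n]"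
    by (rule nth_equalityI) (auto simp: nth_Cons simp del: upt_Suc split: nat.splits)
  then show ?case using Suc by (simp del: upt_Suc)
qed simp

lemma lrecD_eq: "cden p w (RLRec \<sigma> \<tau>) \<cdot> l \<cdot> s \<cdot> f =
  bnd (fstD l) (\<lambda>n. lrecn s f n (\<lambda>i. sndD l \<cdot> num i))"
  by (simp add: cden.simps ap_lm cont_intros)

lemma lrecD: "isl l \<Longrightarrow> cden p w (RLRec \<sigma> \<tau>) \<cdot> l \<cdot> s \<cdot> f = foldr (\<lambda>a acc. f \<cdot> acc \<cdot> a) (dl l) s"
  unfolding lrecD_eq by (auto simp: isl_def dl_num lrecn_foldr)

section \<open>Extensional equality\<close>

text \<open>A partial equivalence relation whose field consists of the hereditarily total and
  extensional objects. The quantifiers of the language of P range over this field.\<close>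

fun E :: "rty \<Rightarrow> D \<Rightarrow> D \<Rightarrow> bool" where
  "E NN x y \<longleftrightarrow> (\<exists>n. x = num n \<and> y = num n)"
| "E (\<sigma> \<rightarrow>\<^sub>r \<tau>) f g \<longleftrightarrow> (\<forall>x y. E \<sigma> x y \<longrightarrow> E \<tau> (f \<cdot> x) (g \<cdot> y))"
| "E (\<sigma> \<times>\<^sub>r \<tau>) x y \<longleftrightarrow> E \<sigma> (fstD x) (fstD y) \<and> E \<tau> (sndD x) (sndD y)"
| "E (LL \<sigma>) x y \<longleftrightarrow> isl x \<and> isl y \<and> list_all2 (E \<sigma>) (dl x) (dl y)"

lemma E_sym: "E \<sigma> x y \<Longrightarrow> E \<sigma> y x"
proof (induction \<sigma> arbitrary: x y)
  case (LL \<sigma>)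
  then have "list_all2 (E \<sigma>) (dl x) (dl y)" "isl x" "isl y" by auto
  then have "list_all2 (E \<sigma>) (dl y) (dl x)"
    using LL(1) by (simp add: list_all2_conv_all_nth)
  then show ?case using LL.prems by simp
qed (auto simp del: E.simps(4))

lemma E_trans: "E \<sigma> x y \<Longrightarrow> E \<sigma> y z \<Longrightarrow> E \<sigma> x z"
proof (induction \<sigma> arbitrary: x y z)
  case (FF \<sigma> \<tau>)
  show ?case
  proof (simp, intro allI impI)
    fix a b assume ab: "E \<sigma> a b"
    then have "E \<sigma> b b" using FF(1) E_sym by blast
    then show "E \<tau> (x \<cdot> a) (z \<cdot> b)" using FF ab by (meson E.simps(2))
  qed
next
  case (LL \<sigma>)
  from LL(2) have 1: "isl x" "length (dl x) = length (dl y)" "\<And>i. i < length (dl x) \<Longrightarrow> E \<sigma> (dl x ! i) (dl y ! i)"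
    by (simp_all add: list_all2_conv_all_nth)
  from LL(3) have 2: "isl z" "length (dl y) = length (dl z)" "\<And>i. i < length (dl y) \<Longrightarrow> E \<sigma> (dl y ! i) (dl z ! i)"
    by (simp_all add: list_all2_conv_all_nth)
  have "E \<sigma> (dl x ! i) (dl z ! i)" if "i < length (dl x)" for i
    using LL(1)[OF 1(3)[OF that] 2(3)] that 1(2) by simp
  then show ?case using 1(1,2) 2(1,2) by (simp add: list_all2_conv_all_nth)
next
  case (PP \<sigma> \<tau>)
  then show ?case by (metis E.simps(3))
qed auto

lemma E_refl1: "E \<sigma> x y \<Longrightarrow> E \<sigma> x x" using E_sym E_trans by blast
lemma E_refl2: "E \<sigma> x y \<Longrightarrow> E \<sigma> y y" using E_sym E_trans by blast

lemma E_ap: "E (\<sigma> \<rightarrow>\<^sub>r \<tau>) f g \<Longrightarrow> E \<sigma> x y \<Longrightarrow> E \<tau> (f \<cdot> x) (g \<cdot> y)" by simp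

lemma E_FF: "(\<And>x y. E \<sigma> x y \<Longrightarrow> E \<tau> (f \<cdot> x) (g \<cdot> y)) \<Longrightarrow> E (\<sigma> \<rightarrow>\<^sub>r \<tau>) f g" by simp

lemma E_dl: "E (LL \<sigma>) x x \<Longrightarrow> y \<in> set (dl x) \<Longrightarrow> E \<sigma> y y"
  by (auto simp: list_all2_conv_all_nth in_set_conv_nth)

lemma E_zeroR: "E \<sigma> (zeroR \<sigma>) (zeroR \<sigma>)"
  by (induction \<sigma>) auto

lemma E_funD: "E (NN \<rightarrow>\<^sub>r NN) (funD r) (funD r)" by auto

lemma dl_pr: "dl (pr (num n) f) = map (\<lambda>i. f \<cdot> num i) [0..<n]"
  by (simp add: dl_num[where n = n])

lemma E_recn: "E \<tau> s s' \<Longrightarrow> E (\<tau> \<rightarrow>\<^sub>r NN \<rightarrow>\<^sub>r \<tau>) f f' \<Longrightarrow> E \<tau> (recn s f n) (recn s' f' n)"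
  by (induction n) auto

lemma E_foldr:
  assumes "E \<tau> s s'" "E (\<tau> \<rightarrow>\<^sub>r \<sigma> \<rightarrow>\<^sub>r \<tau>) f f'" "list_all2 (E \<sigma>) xs ys"
  shows "E \<tau> (foldr (\<lambda>a acc. f \<cdot> acc \<cdot> a) xs s) (foldr (\<lambda>a acc. f' \<cdot> acc \<cdot> a) ys s')"
  using assms(3) by (induction rule: list_all2_induct) (use assms in auto)

text \<open>The constants \<open>RMu\<close> and \<open>RCov\<close> are extensional because they
  use their functional argument only through the numerals it returns, at all numbers for
  \<open>RMu\<close> and at all coins for \<open>RCov\<close>.\<close>

lemma E_cden: "E (tyc c) (cden p w c) (cden p w c)"
proof (cases c)
  case (RRec \<tau>)
  have "E \<tau> (cden p w c \<cdot> u \<cdot> s \<cdot> f) (cden p w c \<cdot> u' \<cdot> s' \<cdot> f')"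
    if "E NN u u'" "E \<tau> s s'" "E (\<tau> \<rightarrow>\<^sub>r NN \<rightarrow>\<^sub>r \<tau>) f f'" for u u' s s' f f'
    using that(1) E_recn[OF that(2,3)] by (auto simp: recD RRec)
  then show ?thesis unfolding RRec tyc.simps by (intro E_FF) (simp only: RRec)
next
  case (RCons \<sigma>)
  have "E (LL \<sigma>) (cden p w c \<cdot> a \<cdot> l) (cden p w c \<cdot> a' \<cdot> l')"
    if "E \<sigma> a a'" "E (LL \<sigma>) l l'" for a l a' l'
    using that by (simp add: RCons)
  then show ?thesis unfolding RCons tyc.simps by (intro E_FF) (simp only: RCons)
next
  case (RLRec \<sigma> \<tau>)
  have "E \<tau> (cden p w c \<cdot> l \<cdot> s \<cdot> f) (cden p w c \<cdot> l' \<cdot> s' \<cdot> f')"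
    if "E (LL \<sigma>) l l'" "E \<tau> s s'" "E (\<tau> \<rightarrow>\<^sub>r \<sigma> \<rightarrow>\<^sub>r \<tau>) f f'" for l l' s s' f f'
    using that(1) E_foldr[OF that(2,3)] by (auto simp: lrecD RLRec)
  then show ?thesis unfolding RLRec tyc.simps by (intro E_FF) (simp only: RLRec)
next
  case RMu
  have "E NN (cden p w c \<cdot> f) (cden p w c \<cdot> f')" if f: "E (NN \<rightarrow>\<^sub>r NN) f f'" for f f'
  proof -
    have "\<forall>n. \<exists>h. f \<cdot> num n = num h \<and> f' \<cdot> num n = num h" using f by auto
    then obtain h where "\<And>n. f \<cdot> num n = num (h n) \<and> f' \<cdot> num n = num (h n)" by metis
    then show ?thesis using muD[of f h] muD[of f' h] by (simp add: RMu)
  qed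
  then show ?thesis unfolding RMu tyc.simps by (intro E_FF) (simp only: RMu)
next
  case RCov
  have "E (LL (NN \<rightarrow>\<^sub>r NN)) (cden p w c \<cdot> g \<cdot> k) (cden p w c \<cdot> g' \<cdot> k')"
    if g: "E ((NN \<rightarrow>\<^sub>r NN) \<rightarrow>\<^sub>r NN) g g'" and k: "E NN k k'" for g g' k k'
  proof -
    have "E (NN \<rightarrow>\<^sub>r NN) (coinD w c) (coinD w c)" for c by (simp only: coinD_def E_funD)
    then have "E NN (g \<cdot> coinD w c) (g' \<cdot> coinD w c)" for c using E_ap[OF g] by blast
    then have "\<forall>c. \<exists>h. g \<cdot> coinD w c = num h \<and> g' \<cdot> coinD w c = num h" by auto
    then obtain h where "\<And>c. g \<cdot> coinD w c = num (h c) \<and> g' \<cdot> coinD w c = num (h c)" by metis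
    moreover obtain m where "k = num m" "k' = num m" using k by auto
    ultimately show ?thesis
      using covD[of g w h] covD[of g' w h] by (auto simp: RCov isl_def dl_pr list_all2_same)
  qed
  then show ?thesis unfolding RCov tyc.simps by (intro E_FF) (simp only: RCov)
next
  case (RNil \<sigma>)
  then show ?thesis by simp
next
  case (RPar i)
  then show ?thesis by (auto simp: cden.simps)
next
  case RAll
  then show ?thesis by (auto simp: cden.simps)
qed auto

lemma E_den:
  "tyr t = Some \<sigma> \<Longrightarrow> (\<And>v. v \<in> fvr t \<Longrightarrow> E (snd v) (e v) (e' v)) \<Longrightarrow> E \<sigma> (den p w e t) (den p w e' t)"
proof (induction t arbitrary: \<sigma> e e')
  case (RA s t)
  from RA(3) obtain \<rho> where \<rho>: "tyr s = Some (\<rho> \<rightarrow>\<^sub>r \<sigma>)" "tyr t = Some \<rho>" unfolding tyr_RA by (elim exE conjE)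
  have "E (\<rho> \<rightarrow>\<^sub>r \<sigma>) (den p w e s) (den p w e' s)" by (rule RA(1)[OF \<rho>(1)]) (rule RA(4), simp)
  moreover have "E \<rho> (den p w e t) (den p w e' t)" by (rule RA(2)[OF \<rho>(2)]) (rule RA(4), simp)
  ultimately show ?case unfolding den.simps by (rule E_ap)
next
  case (RL v t)
  then obtain \<tau> where \<tau>: "tyr t = Some \<tau>" "\<sigma> = snd v \<rightarrow>\<^sub>r \<tau>" by auto
  have "E \<tau> (den p w (e(v := x)) t) (den p w (e'(v := y)) t)" if "E (snd v) x y" for x y
    by (rule RL(1)[OF \<tau>(1)]) (use RL(3) that in auto)
  then show ?case unfolding \<tau>(2) by (intro E_FF) simp
qed (auto simp: E_cden)

section \<open>Terms for lists and pairs\<close>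

abbreviation ht :: "rtm \<Rightarrow> rty \<Rightarrow> bool" where "ht t \<sigma> \<equiv> tyr t = Some \<sigma>"

lemma ht_RA: "ht s (\<sigma> \<rightarrow>\<^sub>r \<tau>) \<Longrightarrow> ht t \<sigma> \<Longrightarrow> ht (s \<star> t) \<tau>" by simp
lemma ht_RL: "ht t \<tau> \<Longrightarrow> ht (RL (n, \<sigma>) t) (\<sigma> \<rightarrow>\<^sub>r \<tau>)" by simp
lemma ht_RV: "ht (RV (n, \<sigma>)) \<sigma>" by simp
lemma ht_RC: "tyc c = \<sigma> \<Longrightarrow> ht (RC c) \<sigma>" by simp

declare tyr.simps(3,4) [simp del]

abbreviation tyt :: "rtm \<Rightarrow> rty" where "tyt t \<equiv> the (tyr t)"

primrec rzero :: "rty \<Rightarrow> rtm" where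
  "rzero NN = RC RZero"
| "rzero (\<sigma> \<rightarrow>\<^sub>r \<tau>) = RL (0, \<sigma>) (rzero \<tau>)"
| "rzero (LL \<sigma>) = RC (RNil \<sigma>)"
| "rzero (\<sigma> \<times>\<^sub>r \<tau>) = RC (RPair \<sigma> \<tau>) \<star> rzero \<sigma> \<star> rzero \<tau>"

definition rsing :: "rtm \<Rightarrow> rtm" where
  "rsing t = RC (RCons (tyt t)) \<star> t \<star> RC (RNil (tyt t))"

definition rcons :: "rtm \<Rightarrow> rtm \<Rightarrow> rtm" where
  "rcons s t = RC (RCons (tyt s)) \<star> s \<star> t"

definition rpair :: "rtm \<Rightarrow> rtm \<Rightarrow> rtm" where
  "rpair s t = RC (RPair (tyt s) (tyt t)) \<star> s \<star> t"

definition rfst :: "rtm \<Rightarrow> rtm" where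
  "rfst t = (case tyt t of \<sigma> \<times>\<^sub>r \<tau> \<Rightarrow> RC (RFst \<sigma> \<tau>) | _ \<Rightarrow> RC (RFst NN NN)) \<star> t"

definition rsnd :: "rtm \<Rightarrow> rtm" where
  "rsnd t = (case tyt t of \<sigma> \<times>\<^sub>r \<tau> \<Rightarrow> RC (RSnd \<sigma> \<tau>) | _ \<Rightarrow> RC (RSnd NN NN)) \<star> t"

definition rappendc :: "rty \<Rightarrow> rtm" where
  "rappendc \<sigma> = RL (0, LL \<sigma>) (RL (1, LL \<sigma>) (RC (RLRec \<sigma> (LL \<sigma>)) \<star> RV (0, LL \<sigma>) \<star> RV (1, LL \<sigma>)
     \<star> RL (2, LL \<sigma>) (RL (3, \<sigma>) (RC (RCons \<sigma>) \<star> RV (3, \<sigma>) \<star> RV (2, LL \<sigma>)))))"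

definition rbindc :: "rty \<Rightarrow> rty \<Rightarrow> rtm" where
  "rbindc \<sigma> \<tau> = RL (0, \<sigma> \<rightarrow>\<^sub>r LL \<tau>) (RL (1, LL \<sigma>) (RC (RLRec \<sigma> (LL \<tau>)) \<star> RV (1, LL \<sigma>) \<star> RC (RNil \<tau>)
     \<star> RL (2, LL \<tau>) (RL (3, \<sigma>)
         (rappendc \<tau> \<star> (RV (0, \<sigma> \<rightarrow>\<^sub>r LL \<tau>) \<star> RV (3, \<sigma>)) \<star> RV (2, LL \<tau>)))))"

text \<open>The bind operation of the list monad. Every candidate for an intermediate witness is
  tried, so that lists of candidates can be combined without deciding which candidate is
  correct.\<close>

definition rbind :: "rvar \<Rightarrow> rtm \<Rightarrow> rtm \<Rightarrow> rtm" where
  "rbind v l b = rbindc (snd v) (case tyt b of LL \<tau> \<Rightarrow> \<tau> | _ \<Rightarrow> NN) \<star> RL v b \<star> l"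

lemmas ht_basic = ht_RA ht_RL ht_RV ht_RC

lemma ht_rzero: "ht (rzero \<sigma>) \<sigma>"
  by (induction \<sigma>) (auto intro!: ht_basic simp: tyr.simps)

lemma fvr_rzero [simp]: "fvr (rzero \<sigma>) = {}"
  by (induction \<sigma>) auto

lemma ht_rsing: "ht t \<sigma> \<Longrightarrow> ht (rsing t) (LL \<sigma>)" by (simp add: rsing_def tyr.simps)
lemma ht_rcons: "ht s \<sigma> \<Longrightarrow> ht t (LL \<sigma>) \<Longrightarrow> ht (rcons s t) (LL \<sigma>)" by (simp add: rcons_def tyr.simps)
lemma ht_rpair: "ht s \<sigma> \<Longrightarrow> ht t \<tau> \<Longrightarrow> ht (rpair s t) (\<sigma> \<times>\<^sub>r \<tau>)" by (simp add: rpair_def tyr.simps)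
lemma ht_rfst: "ht t (\<sigma> \<times>\<^sub>r \<tau>) \<Longrightarrow> ht (rfst t) \<sigma>" by (simp add: rfst_def tyr.simps)
lemma ht_rsnd: "ht t (\<sigma> \<times>\<^sub>r \<tau>) \<Longrightarrow> ht (rsnd t) \<tau>" by (simp add: rsnd_def tyr.simps)
lemma ht_rappendc: "ht (rappendc \<sigma>) (LL \<sigma> \<rightarrow>\<^sub>r LL \<sigma> \<rightarrow>\<^sub>r LL \<sigma>)" by (simp add: rappendc_def tyr.simps)
lemma ht_rbindc: "ht (rbindc \<sigma> \<tau>) ((\<sigma> \<rightarrow>\<^sub>r LL \<tau>) \<rightarrow>\<^sub>r LL \<sigma> \<rightarrow>\<^sub>r LL \<tau>)"
  by (simp add: rbindc_def tyr.simps ht_rappendc)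
lemma ht_rbind: "ht l (LL \<sigma>) \<Longrightarrow> ht b (LL \<tau>) \<Longrightarrow> ht (rbind (n, \<sigma>) l b) (LL \<tau>)"
  by (simp add: rbind_def tyr.simps ht_rbindc)

lemmas ht_intros = ht_basic ht_rzero ht_rsing ht_rcons ht_rpair ht_rfst ht_rsnd ht_rbind

lemma fvr_rsing [simp]: "fvr (rsing t) = fvr t" by (simp add: rsing_def)
lemma fvr_rcons [simp]: "fvr (rcons s t) = fvr s \<union> fvr t" by (simp add: rcons_def)
lemma fvr_rpair [simp]: "fvr (rpair s t) = fvr s \<union> fvr t" by (simp add: rpair_def)
lemma fvr_rfst [simp]: "fvr (rfst t) = fvr t" by (simp add: rfst_def split: rty.split)
lemma fvr_rsnd [simp]: "fvr (rsnd t) = fvr t" by (simp add: rsnd_def split: rty.split)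
lemma fvr_rappendc [simp]: "fvr (rappendc \<sigma>) = {}" by (auto simp: rappendc_def)
lemma fvr_rbindc [simp]: "fvr (rbindc \<sigma> \<tau>) = {}" by (auto simp: rbindc_def)
lemma fvr_rbind [simp]: "fvr (rbind v l b) = fvr l \<union> (fvr b - {v})" by (auto simp: rbind_def)

section \<open>Terms of the language of P\<close>

primrec emb :: "ty \<Rightarrow> rty" where
  "emb N = NN"
| "emb (\<sigma> \<rightarrow>\<^sub>t \<tau>) = emb \<sigma> \<rightarrow>\<^sub>r emb \<tau>"
| "emb (Seq \<sigma>) = LL (emb \<sigma>)"

lemma emb_inject [simp]: "emb \<sigma> = emb \<tau> \<longleftrightarrow> \<sigma> = \<tau>"
proof (induction \<sigma> arbitrary: \<tau>)
  case N then show ?case by (cases \<tau>) auto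
next
  case (Fn \<sigma>1 \<sigma>2) then show ?case by (cases \<tau>) auto
next
  case (Seq \<sigma>) then show ?case by (cases \<tau>) auto
qed

definition ev :: "var \<Rightarrow> rvar" where "ev x = (fst x, emb (snd x))"

lemma ev_inject [simp]: "ev x = ev y \<longleftrightarrow> x = y"
  by (cases x; cases y) (simp add: ev_def)

lemma snd_ev [simp]: "snd (ev x) = emb (snd x)" by (simp add: ev_def)

primrec ctrm :: "const \<Rightarrow> rtm" where
  "ctrm CZero = RC RZero"
| "ctrm CSuc = RC RSuc"
| "ctrm (CK \<sigma> \<tau>) = RL (0, emb \<sigma>) (RL (1, emb \<tau>) (RV (0, emb \<sigma>)))"
| "ctrm (CS \<rho> \<sigma> \<tau>) = (let s = (0, emb (\<rho> \<rightarrow>\<^sub>t \<sigma> \<rightarrow>\<^sub>t \<tau>)); t = (1, emb (\<rho> \<rightarrow>\<^sub>t \<sigma>)); u = (2, emb \<rho>) in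
     RL s (RL t (RL u (RV s \<star> RV u \<star> (RV t \<star> RV u)))))"
| "ctrm (CRec \<tau>) = RC (RRec (emb \<tau>))"
| "ctrm (CNil \<sigma>) = RC (RNil (emb \<sigma>))"
| "ctrm (CCons \<sigma>) = RC (RCons (emb \<sigma>))"
| "ctrm (CLRec \<sigma> \<tau>) = RC (RLRec (emb \<sigma>) (emb \<tau>))"

primrec trm :: "tm \<Rightarrow> rtm" where
  "trm (Var x) = RV (ev x)"
| "trm (Cst c) = ctrm c"
| "trm (s \<bullet> t) = trm s \<star> trm t"

lemma ht_ctrm: "ht (ctrm c) (emb (ty_const c))"
  by (cases c) (auto simp: tyr.simps Let_def)

lemma fvr_ctrm [simp]: "fvr (ctrm c) = {}"
  by (cases c) (auto simp: Let_def)

lemma ht_trm: "wt t \<Longrightarrow> ht (trm t) (emb (ty_of t))"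
  by (induction t) (auto simp: ht_ctrm tyr.simps)

lemma fvr_trm: "fvr (trm t) = ev ` tv t"
  by (induction t) auto

section \<open>Standard objects\<close>

locale model =
  fixes p :: "nat \<Rightarrow> bool" and w :: coins
begin

abbreviation dn :: "(rvar \<Rightarrow> D) \<Rightarrow> rtm \<Rightarrow> D" where "dn \<equiv> den p w"

definition vld :: "(rvar \<Rightarrow> D) \<Rightarrow> bool" where "vld e \<longleftrightarrow> (\<forall>v. E (snd v) (e v) (e v))"

lemma vldD: "vld e \<Longrightarrow> E (snd v) (e v) (e v)" unfolding vld_def by blast

lemma vld_upd: "vld e \<Longrightarrow> E (snd v) x x \<Longrightarrow> vld (e(v := x))"
  by (simp add: vld_def del: split_paired_All)

lemma E_dn: "vld e \<Longrightarrow> ht t \<sigma> \<Longrightarrow> E \<sigma> (dn e t) (dn e t)"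
  by (rule E_den) (auto dest: vldD)

definition e0 :: "rvar \<Rightarrow> D" where "e0 v = zeroR (snd v)"

lemma vld_e0: "vld e0" by (simp add: vld_def e0_def E_zeroR)

lemma dn_rsing_eq: "dn e (rsing t) = cden p w (RCons (tyt t)) \<cdot> dn e t \<cdot> zeroR (LL (tyt t))"
  by (simp add: rsing_def)

lemma dl_rsing [simp]: "dl (dn e (rsing t)) = [dn e t]"
  by (simp add: dn_rsing_eq)

lemma isl_dn: "vld e \<Longrightarrow> ht t (LL \<sigma>) \<Longrightarrow> isl (dn e t)"
  using E_dn[of e t "LL \<sigma>"] by simp

lemma dl_rcons [simp]: "isl (dn e t) \<Longrightarrow> dl (dn e (rcons s t)) = dn e s # dl (dn e t)"
  by (simp add: rcons_def)

lemma dn_rpair [simp]: "dn e (rpair s t) = pr (dn e s) (dn e t)"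
  by (simp add: rpair_def)

lemma dn_rfst [simp]: "dn e (rfst t) = fstD (dn e t)"
  by (simp add: rfst_def split: rty.split)

lemma dn_rsnd [simp]: "dn e (rsnd t) = sndD (dn e t)"
  by (simp add: rsnd_def split: rty.split)

lemma foldr_append: 
  assumes "isl y"
  shows "isl (foldr (\<lambda>a acc. dn e' (RL (2, LL \<sigma>) (RL (3, \<sigma>) (RC (RCons \<sigma>) \<star> RV (3, \<sigma>) \<star> RV (2, LL \<sigma>)))) \<cdot> acc \<cdot> a) xs y)
    \<and> dl (foldr (\<lambda>a acc. dn e' (RL (2, LL \<sigma>) (RL (3, \<sigma>) (RC (RCons \<sigma>) \<star> RV (3, \<sigma>) \<star> RV (2, LL \<sigma>)))) \<cdot> acc \<cdot> a) xs y)
     = xs @ dl y"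
  using assms by (induction xs) auto

lemma rappendc:
  assumes "isl x" "isl y"
  shows "isl (dn e (rappendc \<sigma>) \<cdot> x \<cdot> y)" "dl (dn e (rappendc \<sigma>) \<cdot> x \<cdot> y) = dl x @ dl y"
  using foldr_append[OF assms(2)] unfolding rappendc_def by (simp_all add: lrecD assms)

lemma rbindc:
  assumes "isl x" "\<And>a. a \<in> set (dl x) \<Longrightarrow> isl (f \<cdot> a)"
  shows "dl (dn e (rbindc \<sigma> \<tau>) \<cdot> f \<cdot> x) = concat (map (\<lambda>a. dl (f \<cdot> a)) (dl x))"
proof -
  let ?e = "e((0, \<sigma> \<rightarrow>\<^sub>r LL \<tau>) := f, (1, LL \<sigma>) := x)"
  let ?s = "RL (2, LL \<tau>) (RL (3, \<sigma>)
         (rappendc \<tau> \<star> (RV (0, \<sigma> \<rightarrow>\<^sub>r LL \<tau>) \<star> RV (3, \<sigma>)) \<star> RV (2, LL \<tau>)))"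
  have "isl (foldr (\<lambda>a acc. dn ?e ?s \<cdot> acc \<cdot> a) xs (zeroR (LL \<tau>)))
    \<and> dl (foldr (\<lambda>a acc. dn ?e ?s \<cdot> acc \<cdot> a) xs (zeroR (LL \<tau>))) = concat (map (\<lambda>a. dl (f \<cdot> a)) xs)"
    if "set xs \<subseteq> set (dl x)" for xs
    using that by (induction xs) (use assms in \<open>auto simp: rappendc\<close>)
  from this[of "dl x"] show ?thesis unfolding rbindc_def by (simp add: lrecD assms)
qed

lemma dl_rbind:
  assumes "vld e" "ht l (LL \<sigma>)" "ht b (LL \<tau>)"
  shows "dl (dn e (rbind (n, \<sigma>) l b)) = concat (map (\<lambda>a. dl (dn (e((n, \<sigma>) := a)) b)) (dl (dn e l)))"
proof -
  have "isl (dn e (RL (n, \<sigma>) b) \<cdot> a)" if "a \<in> set (dl (dn e l))" for a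
  proof -
    have "E \<sigma> a a" by (rule E_dl[OF E_dn[OF assms(1,2)] that])
    then have "vld (e((n, \<sigma>) := a))" using assms(1) by (simp add: vld_upd)
    then show ?thesis using isl_dn[OF _ assms(3)] by simp
  qed
  then show ?thesis
    unfolding rbind_def using rbindc[OF isl_dn[OF assms(1,2)]] by (simp add: assms(3))
qed

lemma in_rbind:
  assumes "vld e" "ht l (LL \<sigma>)" "ht b (LL \<tau>)"
    and "a \<in> set (dl (dn e l))" "y \<in> set (dl (dn (e((n, \<sigma>) := a)) b))"
  shows "y \<in> set (dl (dn e (rbind (n, \<sigma>) l b)))"
  unfolding dl_rbind[OF assms(1-3)] using assms(4,5) by auto

text \<open>An object is interpreted as standard if it is extensionally equal to one satisfying \<open>R\<close>.\<close>

definition R :: "rty \<Rightarrow> D \<Rightarrow> bool" where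
  "R \<sigma> x \<longleftrightarrow> (\<exists>t. fvr t = {} \<and> ht t \<sigma> \<and> x = dn e0 t)"

lemma R_E: "R \<sigma> x \<Longrightarrow> E \<sigma> x x"
  by (auto simp: R_def intro: E_dn vld_e0)

lemma R_closed: "fvr t = {} \<Longrightarrow> ht t \<sigma> \<Longrightarrow> R \<sigma> (dn e t)"
  unfolding R_def using den_closed by blast

lemma R_ap: "R (\<sigma> \<rightarrow>\<^sub>r \<tau>) f \<Longrightarrow> R \<sigma> x \<Longrightarrow> R \<tau> (f \<cdot> x)"
  unfolding R_def by (metis den.simps(3) fvr.simps(3) ht_RA sup_bot.right_neutral)

text \<open>The free variables are abstracted one at a time, and each abstraction is applied to the
  standard value of its variable.\<close>

lemma R_dn:
  assumes "ht t \<sigma>" "\<And>v. v \<in> fvr t \<Longrightarrow> R (snd v) (e v)"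
  shows "R \<sigma> (dn e t)"
proof -
  have fin: "finite (fvr t)" for t by (induction t) auto
  have "\<forall>t \<sigma>. ht t \<sigma> \<longrightarrow> fvr t = A \<longrightarrow> (\<forall>v\<in>A. R (snd v) (e v)) \<longrightarrow> R \<sigma> (dn e t)"
    if "finite A" for A
    using that
  proof (induction A)
    case empty
    then show ?case using R_closed by blast
  next
    case (insert v A)
    show ?case
    proof (intro allI impI)
      fix t \<sigma> assume t: "ht t \<sigma>" "fvr t = insert v A" and R: "\<forall>u\<in>insert v A. R (snd u) (e u)"
      have "ht (RL v t) (snd v \<rightarrow>\<^sub>r \<sigma>)" using t(1) by (simp add: tyr.simps)
      moreover have "fvr (RL v t) = A" using t(2) insert(2) by auto
      ultimately have "R (snd v \<rightarrow>\<^sub>r \<sigma>) (dn e (RL v t))" using insert(3) R by simp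
      from R_ap[OF this] have "R \<sigma> (dn (e(v := e v)) t)" using R by (metis den_RL insertI1)
      then show "R \<sigma> (dn e t)" by simp
    qed
  qed
  then show ?thesis using fin assms by blast
qed

lemma R_fst: "R (\<sigma> \<times>\<^sub>r \<tau>) x \<Longrightarrow> R \<sigma> (fstD x)"
  using R_ap[of "\<sigma> \<times>\<^sub>r \<tau>" \<sigma> "dn e0 (RC (RFst \<sigma> \<tau>))" x] R_closed[of "RC (RFst \<sigma> \<tau>)"] by simp

lemma R_snd: "R (\<sigma> \<times>\<^sub>r \<tau>) x \<Longrightarrow> R \<tau> (sndD x)"
  using R_ap[of "\<sigma> \<times>\<^sub>r \<tau>" \<tau> "dn e0 (RC (RSnd \<sigma> \<tau>))" x] R_closed[of "RC (RSnd \<sigma> \<tau>)"] by simp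

lemma R_pr: "R \<sigma> x \<Longrightarrow> R \<tau> y \<Longrightarrow> R (\<sigma> \<times>\<^sub>r \<tau>) (pr x y)"
  using R_ap[of \<tau> "\<sigma> \<times>\<^sub>r \<tau>" "dn e0 (RC (RPair \<sigma> \<tau>)) \<cdot> x" y]
    R_ap[of \<sigma> "\<tau> \<rightarrow>\<^sub>r \<sigma> \<times>\<^sub>r \<tau>" "dn e0 (RC (RPair \<sigma> \<tau>))" x] R_closed[of "RC (RPair \<sigma> \<tau>)"] by simp

primrec numR :: "nat \<Rightarrow> rtm" where
  "numR 0 = RC RZero"
| "numR (Suc n) = RC RSuc \<star> numR n"

lemma dn_numR [simp]: "dn e (numR n) = num n" by (induction n) auto
lemma ht_numR: "ht (numR n) NN" by (induction n) (auto intro: ht_intros)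
lemma fvr_numR [simp]: "fvr (numR n) = {}" by (induction n) auto

lemma R_num: "R NN (num n)" using R_closed[OF fvr_numR ht_numR] by simp

definition nthR :: "rty \<Rightarrow> rtm" where
  "nthR \<sigma> = RL (0, LL \<sigma>) (RC (RLRec \<sigma> (NN \<rightarrow>\<^sub>r \<sigma>)) \<star> RV (0, LL \<sigma>) \<star> rzero (NN \<rightarrow>\<^sub>r \<sigma>)
     \<star> RL (1, NN \<rightarrow>\<^sub>r \<sigma>) (RL (2, \<sigma>) (RL (3, NN)
         (RC (RRec \<sigma>) \<star> RV (3, NN) \<star> RV (2, \<sigma>)
           \<star> RL (4, \<sigma>) (RL (5, NN) (RV (1, NN \<rightarrow>\<^sub>r \<sigma>) \<star> RV (5, NN)))))))"

lemma dn_nthR: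
  assumes "isl x" "i < length (dl x)" shows "dn e (nthR \<sigma>) \<cdot> x \<cdot> num i = dl x ! i"
proof -
  let ?e = "e((0, LL \<sigma>) := x)"
  let ?s = "dn ?e (RL (1, NN \<rightarrow>\<^sub>r \<sigma>) (RL (2, \<sigma>) (RL (3, NN)
         (RC (RRec \<sigma>) \<star> RV (3, NN) \<star> RV (2, \<sigma>)
           \<star> RL (4, \<sigma>) (RL (5, NN) (RV (1, NN \<rightarrow>\<^sub>r \<sigma>) \<star> RV (5, NN)))))))"
  have "foldr (\<lambda>a acc. ?s \<cdot> acc \<cdot> a) xs z \<cdot> num i = xs ! i" if "i < length xs" for xs z
    using that
  proof (induction xs arbitrary: i)
    case (Cons a xs)
    then show ?case by (cases i) (auto simp: recD)
  qed simp
  then show ?thesis unfolding nthR_def using assms by (simp add: lrecD)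
qed

text \<open>An index is a numeral and hence definable, and so is the indexing functional. This is
  why responses taken from a definable list may be used as definable challenges in turn.\<close>

lemma R_dl:
  assumes "R (LL \<sigma>) x" "y \<in> set (dl x)" shows "R \<sigma> y"
proof -
  obtain i where i: "i < length (dl x)" "y = dl x ! i" using assms(2) by (metis in_set_conv_nth)
  have "isl x" using R_E[OF assms(1)] by simp
  have "ht (nthR \<sigma>) (LL \<sigma> \<rightarrow>\<^sub>r NN \<rightarrow>\<^sub>r \<sigma>)" by (simp add: nthR_def tyr.simps ht_rzero)
  moreover have "fvr (nthR \<sigma>) = {}" by (auto simp: nthR_def)
  ultimately have "R (LL \<sigma> \<rightarrow>\<^sub>r NN \<rightarrow>\<^sub>r \<sigma>) (dn e0 (nthR \<sigma>))" using R_closed by blast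
  from R_ap[OF R_ap[OF this assms(1)] R_num[of i]] show ?thesis
    using dn_nthR[OF \<open>isl x\<close> i(1)] i(2) by metis
qed

end

section \<open>The functional interpretation\<close>

text \<open>
  A formula is interpreted as a problem: given a challenge of type \<open>xt A\<close>, find a finite list of
  responses of type \<open>yt A\<close>, one of which meets the challenge.
\<close>

primrec xyt :: "fm \<Rightarrow> rty \<times> rty" where
  "xyt (s \<^bold>= t) = (NN, NN)"
| "xyt (St t) = (NN, emb (ty_of t))"
| "xyt Bot = (NN, NN)"
| "xyt (A \<^bold>\<longrightarrow> B) = ((fst (xyt A) \<rightarrow>\<^sub>r LL (snd (xyt A))) \<times>\<^sub>r fst (xyt B), fst (xyt A) \<times>\<^sub>r snd (xyt B))"
| "xyt (Forall v A) = (fst (xyt A), LL (snd (xyt A)))"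

definition xt :: "fm \<Rightarrow> rty" where "xt A = fst (xyt A)"
definition yt :: "fm \<Rightarrow> rty" where "yt A = snd (xyt A)"

lemma xyt_simps [simp]:
  "xt (s \<^bold>= t) = NN" "yt (s \<^bold>= t) = NN"
  "xt (St t) = NN" "yt (St t) = emb (ty_of t)"
  "xt Bot = NN" "yt Bot = NN"
  "xt (A \<^bold>\<longrightarrow> B) = (xt A \<rightarrow>\<^sub>r LL (yt A)) \<times>\<^sub>r xt B" "yt (A \<^bold>\<longrightarrow> B) = xt A \<times>\<^sub>r yt B"
  "xt (Forall v A) = xt A" "yt (Forall v A) = LL (yt A)"
  by (simp_all add: xt_def yt_def)

context model
begin

text \<open>An implication is challenged by a list-valued strategy for \<open>A\<close> together
  with a challenge to \<open>B\<close>. A response puts a challenge to that strategy, and has to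
  succeed in \<open>B\<close> only if the strategy meets it. The response to a quantified formula is
  a single list that must serve every \<open>a\<close>: realisers do not see quantified objects, and
  only a premise \<open>St\<close> supplies candidates for them.\<close>

primrec itp :: "(rvar \<Rightarrow> D) \<Rightarrow> fm \<Rightarrow> D \<Rightarrow> D \<Rightarrow> bool" where
  "itp e (s \<^bold>= t) = (\<lambda>x y. E (emb (ty_of s)) (dn e (trm s)) (dn e (trm t)))"
| "itp e (St t) = (\<lambda>x y. E (emb (ty_of t)) (dn e (trm t)) y)"
| "itp e Bot = (\<lambda>x y. False)"
| "itp e (A \<^bold>\<longrightarrow> B) = (\<lambda>x y. (\<exists>a\<in>set (dl (fstD x \<cdot> fstD y)). itp e A (fstD y) a) \<longrightarrow>
     itp e B (sndD x) (sndD y))"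
| "itp e (Forall v A) = (\<lambda>x y. \<forall>a. E (emb (snd v)) a a \<longrightarrow>
     (\<exists>b\<in>set (dl y). itp (e(ev v := a)) A x b))"

lemma itp_simps:
  "itp e (s \<^bold>= t) x y = E (emb (ty_of s)) (dn e (trm s)) (dn e (trm t))"
  "itp e (St t) x y = E (emb (ty_of t)) (dn e (trm t)) y"
  "itp e Bot x y = False"
  "itp e (A \<^bold>\<longrightarrow> B) x y = ((\<exists>a\<in>set (dl (fstD x \<cdot> fstD y)). itp e A (fstD y) a) \<longrightarrow>
     itp e B (sndD x) (sndD y))"
  "itp e (Forall v A) x y = (\<forall>a. E (emb (snd v)) a a \<longrightarrow> (\<exists>b\<in>set (dl y). itp (e(ev v := a)) A x b))"
  by simp_all

declare itp.simps [simp del]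
declare itp_simps [simp]

text \<open>Only definable challenges have to be met. More cannot be asked for, since a covering
  block is available for definable functionals only.\<close>

definition Rl :: "(rvar \<Rightarrow> D) \<Rightarrow> fm \<Rightarrow> D \<Rightarrow> bool" where
  "Rl e A t \<longleftrightarrow> R (xt A \<rightarrow>\<^sub>r LL (yt A)) t \<and> (\<forall>x. R (xt A) x \<longrightarrow> (\<exists>y\<in>set (dl (t \<cdot> x)). itp e A x y))"

text \<open>One realiser serves all assignments, including those by nonstandard objects, as
  generalisation over free variables requires.\<close>

definition Real :: "fm \<Rightarrow> bool" where
  "Real A \<longleftrightarrow> (\<exists>t. \<forall>e. vld e \<longrightarrow> Rl e A t)"

lemma RealI:
  assumes "ht b (LL (yt A))" "fvr b \<subseteq> {(0, xt A)}"
    and "\<And>e d. vld e \<Longrightarrow> vld d \<Longrightarrow> R (xt A) (d (0, xt A)) \<Longrightarrow>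
      \<exists>y\<in>set (dl (dn d b)). itp e A (d (0, xt A)) y"
  shows "Real A"
  unfolding Real_def Rl_def
proof (intro exI allI impI conjI)
  show "R (xt A \<rightarrow>\<^sub>r LL (yt A)) (dn e0 (RL (0, xt A) b))"
    by (rule R_closed) (use assms(1,2) in \<open>auto intro!: ht_intros\<close>)
next
  fix e x assume "vld e" "R (xt A) x"
  then show "\<exists>y\<in>set (dl (dn e0 (RL (0, xt A) b) \<cdot> x)). itp e A x y"
    using assms(3)[of e "e0((0, xt A) := x)"] vld_upd[OF vld_e0, of "(0, xt A)" x] R_E by simp
qed

lemma RealE:
  assumes "Real A"
  obtains t where "fvr t = {}" "ht t (xt A \<rightarrow>\<^sub>r LL (yt A))"
    "\<And>e d x. vld e \<Longrightarrow> R (xt A) x \<Longrightarrow> \<exists>y\<in>set (dl (dn d t \<cdot> x)). itp e A x y"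
proof -
  obtain r where r: "\<And>e. vld e \<Longrightarrow> Rl e A r" using assms by (auto simp: Real_def)
  obtain t where t: "fvr t = {}" "ht t (xt A \<rightarrow>\<^sub>r LL (yt A))" "r = dn e0 t"
    using r[OF vld_e0] by (auto simp: Rl_def R_def)
  have "r = dn d t" for d using t(3) den_closed[OF t(1)] by simp
  then show ?thesis using that[OF t(1,2)] r by (auto simp: Rl_def)
qed

lemma vld_trm: "vld e \<Longrightarrow> wt t \<Longrightarrow> E (emb (ty_of t)) (dn e (trm t)) (dn e (trm t))"
  by (rule E_dn[OF _ ht_trm])

lemma vld_ev: "vld e \<Longrightarrow> E (emb (snd x)) a a \<Longrightarrow> vld (e(ev x := a))"
  by (rule vld_upd) simp_all

lemma dn_tsubst: "dn e (trm (tsubst s x u)) = dn (e(ev x := dn e (trm u))) (trm s)"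
proof (induction s)
  case (Cst c)
  then show ?case by (simp add: den_closed[of "ctrm c" p w e])
qed auto

lemma ty_of_tsubst: "ty_of u = snd x \<Longrightarrow> ty_of (tsubst s x u) = ty_of s"
  by (induction s) auto

lemma xt_subst: "ty_of u = snd x \<Longrightarrow> xt (subst A x u) = xt A \<and> yt (subst A x u) = yt A"
  by (induction A) (auto simp: ty_of_tsubst)

lemma dn_trm_cong: "(\<And>x. x \<in> tv t \<Longrightarrow> e (ev x) = e' (ev x)) \<Longrightarrow> dn e (trm t) = dn e' (trm t)"
  by (rule den_cong) (auto simp: fvr_trm)

lemma itp_cong: "(\<And>x. x \<in> fv A \<Longrightarrow> e (ev x) = e' (ev x)) \<Longrightarrow> itp e A = itp e' A"
proof (induction A arbitrary: e e')
  case (Eq s t)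
  then show ?case using dn_trm_cong[of s e e'] dn_trm_cong[of t e e'] by (simp add: fun_eq_iff)
next
  case (St t)
  then show ?case using dn_trm_cong[of t e e'] by (simp add: fun_eq_iff)
next
  case (Imp A B)
  have "itp e A = itp e' A" "itp e B = itp e' B"
    using Imp(3) by (auto intro!: Imp(1,2))
  then show ?case by (simp add: fun_eq_iff)
next
  case (Forall x A)
  have "itp (e(ev x := a)) A = itp (e'(ev x := a)) A" for a
    using Forall(2) by (auto intro!: Forall(1))
  then show ?case by (simp add: fun_eq_iff)
qed (simp add: fun_eq_iff)

lemma itp_subst:
  assumes "ty_of u = snd x"
  shows "free_for u x A \<Longrightarrow> itp e (subst A x u) = itp (e(ev x := dn e (trm u))) A"
proof (induction A arbitrary: e)
  case (Forall y A)
  show ?case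
  proof (cases "y = x")
    case True
    then show ?thesis by (simp add: fun_eq_iff del: fun_upd_apply)
  next
    case ne: False
    show ?thesis
    proof (cases "x \<in> fv A")
      case True
      then have y: "y \<notin> tv u" "free_for u x A" using Forall(2) ne by auto
      have "dn (e(ev y := a)) (trm u) = dn e (trm u)" for a
        by (rule dn_trm_cong) (use y(1) in auto)
      moreover have "ev y \<noteq> ev x" using ne by simp
      ultimately have *: "itp (e(ev y := a)) (subst A x u) = itp (e(ev x := dn e (trm u), ev y := a)) A" for a
        unfolding Forall(1)[OF y(2)] using fun_upd_twist[of "ev y" "ev x" e a "dn e (trm u)"] by simp
      then show ?thesis using ne by (simp add: fun_eq_iff del: fun_upd_apply)
    next
      case False
      \<comment> \<open>Here \<open>free_for\<close> says nothing about \<open>u\<close>, but the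
        substitution has no effect on the formula, nor has the update on its interpretation.\<close>
      have "itp e (subst B x u) = itp e B" if "x \<notin> fv B" for B e
        using that
      proof (induction B arbitrary: e)
        case (Eq s t)
        have "dn (e(ev x := a)) (trm r) = dn e (trm r)" if "x \<notin> tv r" for r a
          by (rule dn_trm_cong) (use that in auto)
        then show ?case using Eq by (simp add: fun_eq_iff dn_tsubst ty_of_tsubst[OF assms])
      next
        case (St t)
        have "dn (e(ev x := a)) (trm r) = dn e (trm r)" if "x \<notin> tv r" for r a
          by (rule dn_trm_cong) (use that in auto)
        then show ?case using St by (simp add: fun_eq_iff dn_tsubst ty_of_tsubst[OF assms])
      qed (auto simp: fun_eq_iff)
      moreover have "itp (e(ev x := a)) (Forall y A) = itp e (Forall y A)" for a
        by (rule itp_cong) (use False in auto)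
      ultimately show ?thesis using False ne by (metis Diff_iff fv.simps(5))
    qed
  qed
qed (auto simp: fun_eq_iff dn_tsubst ty_of_tsubst[OF assms])

end

section \<open>Soundness of the logical rules\<close>

context model
begin

lemma itp_ImpE:
  assumes "\<not> itp e (A \<^bold>\<longrightarrow> B) x y"
  obtains a where "a \<in> set (dl (fstD x \<cdot> fstD y))" "itp e A (fstD y) a" "\<not> itp e B (sndD x) (sndD y)"
  using assms by auto

lemma itp_ImpD:
  "itp e (A \<^bold>\<longrightarrow> B) x y \<Longrightarrow> a \<in> set (dl (fstD x \<cdot> fstD y)) \<Longrightarrow> itp e A (fstD y) a \<Longrightarrow>
    itp e B (sndD x) (sndD y)"
  by auto

lemma itp_ImpN: "\<not> itp e (A \<^bold>\<longrightarrow> B) x y \<Longrightarrow> \<not> itp e B (sndD x) (sndD y)"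
  by auto

declare itp_simps(4) [simp del]

text \<open>A response to an implication can fail only if the strategy for the premise meets the
  challenge in it. Therefore the list starts with a response \<open>?d\<close> containing dummies:
  either it succeeds, or its failure provides an entry \<open>v\<close> of the strategy from which a
  proper response is built. The same device is used for most of the axioms below.\<close>

lemma Real_weaken: "Real (A \<^bold>\<longrightarrow> B \<^bold>\<longrightarrow> A)"
proof -
  let ?A = "A \<^bold>\<longrightarrow> B \<^bold>\<longrightarrow> A"
  let ?c = "RV (0, xt ?A)"
  let ?u = "rsnd (rsnd ?c)"
  let ?l = "rfst ?c \<star> ?u"
  let ?r = "rsing (rpair ?u (rpair (rzero (xt B)) (RV (1, yt A))))"
  let ?d = "rpair ?u (rpair (rzero (xt B)) (rzero (yt A)))"
  let ?t = "rcons ?d (rbind (1, yt A) ?l ?r)"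
  have hl: "ht ?l (LL (yt A))" unfolding xyt_simps by (rule ht_intros)+
  have hr: "ht ?r (LL (yt ?A))" unfolding xyt_simps by (rule ht_intros)+
  have hd: "ht ?d (yt ?A)" unfolding xyt_simps by (rule ht_intros)+
  show ?thesis
  proof (rule RealI)
    show "ht ?t (LL (yt ?A))" by (rule ht_rcons[OF hd ht_rbind[OF hl hr]])
    show "fvr ?t \<subseteq> {(0, xt ?A)}" by auto
    fix e d assume V: "vld d" and "R (xt ?A) (d (0, xt ?A))"
    let ?x = "d (0, xt ?A)"
    have D: "dl (dn d ?t) = dn d ?d # dl (dn d (rbind (1, yt A) ?l ?r))"
      by (rule dl_rcons[OF isl_dn[OF V ht_rbind[OF hl hr]]])
    show "\<exists>y\<in>set (dl (dn d ?t)). itp e ?A ?x y"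
    proof (rule ccontr)
      assume *: "\<not> ?thesis"
      then have "\<not> itp e ?A ?x (dn d ?d)" unfolding D by simp
      then obtain v where "v \<in> set (dl (fstD ?x \<cdot> fstD (dn d ?d)))" "itp e A (fstD (dn d ?d)) v"
        by (rule itp_ImpE)
      then have v: "v \<in> set (dl (dn d ?l))" "itp e A (sndD (sndD ?x)) v" by simp_all
      have "dn (d((1, yt A) := v)) (rpair ?u (rpair (rzero (xt B)) (RV (1, yt A))))
        \<in> set (dl (dn d (rbind (1, yt A) ?l ?r)))"
        by (rule in_rbind[OF V hl hr v(1)]) simp
      then have "\<not> itp e ?A ?x (dn (d((1, yt A) := v)) (rpair ?u (rpair (rzero (xt B)) (RV (1, yt A)))))"
        using * unfolding D by (meson list.set_intros(2))
      then show False using itp_ImpN[OF itp_ImpN] v(2) by fastforce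
    qed
  qed
qed

text \<open>The premise \<open>A\<close> is needed twice, and the two uses may put different
  challenges to the strategy for it. Responses with either challenge are included in the list; if
  all fail, the strategy has met both challenges, and then \<open>C\<close> is met after
  all.\<close>

lemma Real_distr: "Real ((A \<^bold>\<longrightarrow> B \<^bold>\<longrightarrow> C) \<^bold>\<longrightarrow> (A \<^bold>\<longrightarrow> B) \<^bold>\<longrightarrow> A \<^bold>\<longrightarrow> C)"
proof -
  let ?A = "(A \<^bold>\<longrightarrow> B \<^bold>\<longrightarrow> C) \<^bold>\<longrightarrow> (A \<^bold>\<longrightarrow> B) \<^bold>\<longrightarrow> A \<^bold>\<longrightarrow> C"
  let ?c = "RV (0, xt ?A)"
  let ?F = "rfst ?c" let ?G = "rfst (rsnd ?c)"
  let ?f = "rfst (rsnd (rsnd ?c))" let ?u = "rsnd (rsnd (rsnd ?c))"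
  let ?qt = "xt A \<times>\<^sub>r yt B" let ?yt = "xt A \<times>\<^sub>r xt B \<times>\<^sub>r yt C"
  let ?g = "?G \<star> rpair ?f (RV (1, xt B))"
  let ?h = "RL (1, xt B) (rbind (2, ?qt) ?g (rsing (rsnd (RV (2, ?qt)))))"
  let ?P = "rpair ?f (rpair ?h ?u)"
  let ?y = "RV (3, ?yt)"
  let ?r = "\<lambda>a. rpair ?P (rpair (rpair ?f (rfst (rsnd ?y))) (rpair a (rsnd (rsnd ?y))))"
  let ?l = "?F \<star> ?P"
  let ?m = "?G \<star> rpair ?f (rfst (rsnd ?y))"
  let ?i = "rsing (?r (rfst (RV (2, ?qt))))"
  let ?k = "rcons (?r (rfst ?y)) (rbind (2, ?qt) ?m ?i)"
  let ?d = "rpair ?P (rzero (xt (A \<^bold>\<longrightarrow> B) \<times>\<^sub>r xt A \<times>\<^sub>r yt C))"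
  let ?t = "rcons ?d (rbind (3, ?yt) ?l ?k)"
  have hg: "ht ?g (LL ?qt)" unfolding xyt_simps by (rule ht_intros)+
  have hl: "ht ?l (LL ?yt)" unfolding xyt_simps by (rule ht_intros)+
  have hm: "ht ?m (LL ?qt)" unfolding xyt_simps by (rule ht_intros)+
  have hr: "ht a (xt A) \<Longrightarrow> ht (?r a) (yt ?A)" for a unfolding xyt_simps by (rule ht_intros | assumption)+
  have hi: "ht ?i (LL (yt ?A))" by (rule ht_rsing[OF hr]) (rule ht_intros)+
  have hy: "ht (rfst ?y) (xt A)" by (rule ht_intros)+
  have hk: "ht ?k (LL (yt ?A))" by (rule ht_rcons[OF hr[OF hy] ht_rbind[OF hm hi]])
  have hd: "ht ?d (yt ?A)" unfolding xyt_simps by (rule ht_intros)+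
  show ?thesis
  proof (rule RealI)
    show "ht ?t (LL (yt ?A))" by (rule ht_rcons[OF hd ht_rbind[OF hl hk]])
    show "fvr ?t \<subseteq> {(0, xt ?A)}" by auto
    fix e d assume V: "vld d" and "R (xt ?A) (d (0, xt ?A))"
    let ?x = "d (0, xt ?A)"
    let ?dP = "dn d ?P"
    have D: "dl (dn d ?t) = dn d ?d # dl (dn d (rbind (3, ?yt) ?l ?k))"
      by (rule dl_rcons[OF isl_dn[OF V ht_rbind[OF hl hk]]])
    show "\<exists>y\<in>set (dl (dn d ?t)). itp e ?A ?x y"
    proof (rule ccontr)
      assume *: "\<not> ?thesis"
      then have "\<not> itp e ?A ?x (dn d ?d)" unfolding D by simp
      then obtain y where "y \<in> set (dl (fstD ?x \<cdot> fstD (dn d ?d)))"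
        "itp e (A \<^bold>\<longrightarrow> B \<^bold>\<longrightarrow> C) (fstD (dn d ?d)) y" by (rule itp_ImpE)
      then have y: "y \<in> set (dl (dn d ?l))" "itp e (A \<^bold>\<longrightarrow> B \<^bold>\<longrightarrow> C) ?dP y" by simp_all
      let ?d1 = "d((3, ?yt) := y)"
      have V1: "vld ?d1" by (rule vld_upd[OF V]) (use E_dl[OF E_dn[OF V hl] y(1)] in simp)
      have D1: "dl (dn ?d1 ?k) = dn ?d1 (?r (rfst ?y)) # dl (dn ?d1 (rbind (2, ?qt) ?m ?i))"
        by (rule dl_rcons[OF isl_dn[OF V1 ht_rbind[OF hm hi]]])
      have in1: "z \<in> set (dl (dn ?d1 ?k)) \<Longrightarrow> z \<in> set (dl (dn d ?t))" for z
        unfolding D using in_rbind[OF V hl hk y(1)] by simp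
      let ?z = "dn ?d1 (?r (rfst ?y))"
      have 1: "\<not> itp e ?A ?x ?z" using * in1 unfolding D1 by simp
      obtain q where "q \<in> set (dl (fstD (sndD ?x) \<cdot> fstD (sndD ?z)))" "itp e (A \<^bold>\<longrightarrow> B) (fstD (sndD ?z)) q"
        by (rule itp_ImpE[OF itp_ImpN[OF 1]])
      then have q: "q \<in> set (dl (dn ?d1 ?m))" "itp e (A \<^bold>\<longrightarrow> B) (pr (dn d ?f) (fstD (sndD y))) q"
        by simp_all
      obtain a where "a \<in> set (dl (fstD (sndD (sndD ?x)) \<cdot> fstD (sndD (sndD ?z))))"
        "itp e A (fstD (sndD (sndD ?z))) a" "\<not> itp e C (sndD (sndD (sndD ?x))) (sndD (sndD (sndD ?z)))"
        by (rule itp_ImpE[OF itp_ImpN[OF itp_ImpN[OF 1]]])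
      then have a: "a \<in> set (dl (dn d ?f \<cdot> fstD y))" "itp e A (fstD y) a"
        and nC: "\<not> itp e C (dn d ?u) (sndD (sndD y))" by simp_all
      let ?z' = "dn (?d1((2, ?qt) := q)) (?r (rfst (RV (2, ?qt))))"
      have "?z' \<in> set (dl (dn ?d1 ?k))"
        unfolding D1 by (rule list.set_intros(2), rule in_rbind[OF V1 hm hi q(1)]) simp
      then have 2: "\<not> itp e ?A ?x ?z'" using * in1 by blast
      obtain a' where "a' \<in> set (dl (fstD (sndD (sndD ?x)) \<cdot> fstD (sndD (sndD ?z'))))"
        "itp e A (fstD (sndD (sndD ?z'))) a'"
        by (rule itp_ImpE[OF itp_ImpN[OF itp_ImpN[OF 2]]])
      then have a': "a' \<in> set (dl (dn d ?f \<cdot> fstD q))" "itp e A (fstD q) a'" by simp_all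
      have B: "itp e B (fstD (sndD y)) (sndD q)"
        using itp_ImpD[OF q(2), of a'] a' by simp
      have Vb: "vld (d((1, xt B) := fstD (sndD y)))"
        by (rule vld_upd[OF V]) (use E_dl[OF E_dn[OF V hl] y(1)] in simp)
      have "sndD q \<in> set (dl (dn d ?h \<cdot> fstD (sndD y)))"
        unfolding den_RL
        by (rule in_rbind[OF Vb hg, of _ "yt B" q]) (use q(1) in \<open>auto intro!: ht_intros simp: tyr.simps\<close>)
      then have "itp e C (dn d ?u) (sndD (sndD y))"
        using itp_ImpD[OF itp_ImpD[OF y(2), of a], of "sndD q"] a B by simp
      then show False using nC by simp
    qed
  qed
qed

text \<open>The strategy for \<open>Neg (Neg A)\<close> is confronted with \<open>?F\<close>, whose
  strategy for \<open>Neg A\<close> always challenges \<open>A\<close> with \<open>?u\<close>. Its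
  responses contain strategies for \<open>A\<close>, which are then asked at
  \<open>?u\<close>.\<close>

lemma Real_dneg: "Real (Neg (Neg A) \<^bold>\<longrightarrow> A)"
proof -
  let ?A = "Neg (Neg A) \<^bold>\<longrightarrow> A"
  let ?c = "RV (0, xt ?A)"
  let ?H = "rfst ?c" let ?u = "rsnd ?c"
  let ?F = "rpair (RL (1, xt (Neg A)) (rsing (rpair ?u (RC RZero)))) (RC RZero)"
  let ?l = "?H \<star> ?F"
  let ?gt = "xt (Neg A) \<times>\<^sub>r NN"
  let ?m = "rfst (rfst (RV (2, ?gt))) \<star> ?u"
  let ?r = "rsing (rpair ?F (RV (3, yt A)))"
  let ?k = "rbind (3, yt A) ?m ?r"
  let ?d = "rpair ?F (rzero (yt A))"
  let ?t = "rcons ?d (rbind (2, ?gt) ?l ?k)"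
  have Z: "ht (RC RZero) NN" by simp
  have hl: "ht ?l (LL ?gt)" unfolding xyt_simps by (rule Z ht_intros)+
  have hm: "ht ?m (LL (yt A))" unfolding xyt_simps by (rule ht_intros)+
  have hr: "ht ?r (LL (yt ?A))" unfolding xyt_simps by (rule Z ht_intros)+
  have hd: "ht ?d (yt ?A)" unfolding xyt_simps by (rule Z ht_intros)+
  note hk = ht_rbind[OF hm hr, of 3]
  show ?thesis
  proof (rule RealI)
    show "ht ?t (LL (yt ?A))" by (rule ht_rcons[OF hd ht_rbind[OF hl hk]])
    show "fvr ?t \<subseteq> {(0, xt ?A)}" by auto
    fix e d assume V: "vld d" and "R (xt ?A) (d (0, xt ?A))"
    let ?x = "d (0, xt ?A)"
    have D: "dl (dn d ?t) = dn d ?d # dl (dn d (rbind (2, ?gt) ?l ?k))"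
      by (rule dl_rcons[OF isl_dn[OF V ht_rbind[OF hl hk]]])
    show "\<exists>y\<in>set (dl (dn d ?t)). itp e ?A ?x y"
    proof (rule ccontr)
      assume *: "\<not> ?thesis"
      then have "\<not> itp e ?A ?x (dn d ?d)" unfolding D by simp
      then obtain g where "g \<in> set (dl (fstD ?x \<cdot> fstD (dn d ?d)))"
        "itp e (Neg (Neg A)) (fstD (dn d ?d)) g" by (rule itp_ImpE)
      then have g: "g \<in> set (dl (dn d ?l))" "itp e (Neg (Neg A)) (dn d ?F) g" by simp_all
      have "\<not> itp e (Neg A) (fstD g) (pr (dn d ?u) (num 0))"
        using itp_ImpD[OF g(2), of "pr (dn d ?u) (num 0)"] by auto
      then obtain v where v: "v \<in> set (dl (fstD (fstD g) \<cdot> dn d ?u))" "itp e A (dn d ?u) v"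
        by (rule itp_ImpE) simp
      let ?d1 = "d((2, ?gt) := g)"
      have V1: "vld ?d1" by (rule vld_upd[OF V]) (use E_dl[OF E_dn[OF V hl] g(1)] in simp)
      have "dn (?d1((3, yt A) := v)) (rpair ?F (RV (3, yt A))) \<in> set (dl (dn ?d1 ?k))"
        by (rule in_rbind[OF V1 hm hr]) (use v(1) in simp_all)
      then have "dn (?d1((3, yt A) := v)) (rpair ?F (RV (3, yt A))) \<in> set (dl (dn d ?t))"
        unfolding D using in_rbind[OF V hl hk g(1)] by simp
      with * have "\<not> itp e ?A ?x (dn (?d1((3, yt A) := v)) (rpair ?F (RV (3, yt A))))" by blast
      from itp_ImpN[OF this] show False using v(2) by simp
    qed
  qed
qed

lemma Real_inst:
  assumes "wt t" "ty_of t = snd v" "free_for t v A"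
  shows "Real (Forall v A \<^bold>\<longrightarrow> subst A v t)"
proof -
  let ?A = "Forall v A \<^bold>\<longrightarrow> subst A v t"
  have S: "xt (subst A v t) = xt A" "yt (subst A v t) = yt A" using xt_subst[OF assms(2)] by auto
  let ?c = "RV (0, xt ?A)"
  let ?f = "rfst ?c" let ?u = "rsnd ?c"
  let ?l = "?f \<star> ?u"
  let ?m = "RV (1, LL (yt A))"
  let ?r = "rsing (rpair ?u (RV (2, yt A)))"
  let ?k = "rbind (2, yt A) ?m ?r"
  let ?d = "rpair ?u (rzero (yt A))"
  let ?t = "rcons ?d (rbind (1, LL (yt A)) ?l ?k)"
  have hl: "ht ?l (LL (LL (yt A)))" unfolding xyt_simps S by (rule ht_intros)+
  have hm: "ht ?m (LL (yt A))" by (rule ht_intros)+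
  have hr: "ht ?r (LL (yt ?A))" unfolding xyt_simps S by (rule ht_intros)+
  have hd: "ht ?d (yt ?A)" unfolding xyt_simps S by (rule ht_intros)+
  note hk = ht_rbind[OF hm hr, of 2]
  show ?thesis
  proof (rule RealI)
    show "ht ?t (LL (yt ?A))" by (rule ht_rcons[OF hd ht_rbind[OF hl hk]])
    show "fvr ?t \<subseteq> {(0, xt ?A)}" by auto
    fix e d assume Ve: "vld e" and V: "vld d" and "R (xt ?A) (d (0, xt ?A))"
    let ?x = "d (0, xt ?A)"
    have D: "dl (dn d ?t) = dn d ?d # dl (dn d (rbind (1, LL (yt A)) ?l ?k))"
      by (rule dl_rcons[OF isl_dn[OF V ht_rbind[OF hl hk]]])
    show "\<exists>y\<in>set (dl (dn d ?t)). itp e ?A ?x y"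
    proof (rule ccontr)
      assume *: "\<not> ?thesis"
      then have "\<not> itp e ?A ?x (dn d ?d)" unfolding D by simp
      then obtain g where "g \<in> set (dl (fstD ?x \<cdot> fstD (dn d ?d)))"
        "itp e (Forall v A) (fstD (dn d ?d)) g" by (rule itp_ImpE)
      then have g: "g \<in> set (dl (dn d ?l))" "itp e (Forall v A) (dn d ?u) g" by simp_all
      have "E (emb (snd v)) (dn e (trm t)) (dn e (trm t))" using vld_trm[OF Ve assms(1)] assms(2) by simp
      with g(2) obtain b where b: "b \<in> set (dl g)" "itp (e(ev v := dn e (trm t))) A (dn d ?u) b"
        by auto
      have b2: "itp e (subst A v t) (dn d ?u) b"
        unfolding itp_subst[OF assms(2,3)] by (rule b(2))
      let ?d1 = "d((1, LL (yt A)) := g)"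
      have V1: "vld ?d1" by (rule vld_upd[OF V]) (use E_dl[OF E_dn[OF V hl] g(1)] in \<open>simp only: snd_conv\<close>)
      have "dn (?d1((2, yt A) := b)) (rpair ?u (RV (2, yt A))) \<in> set (dl (dn ?d1 ?k))"
        by (rule in_rbind[OF V1 hm hr]) (use b(1) in simp_all)
      then have "dn (?d1((2, yt A) := b)) (rpair ?u (RV (2, yt A))) \<in> set (dl (dn d ?t))"
        unfolding D using in_rbind[OF V hl hk g(1)] by simp
      with * have "\<not> itp e ?A ?x (dn (?d1((2, yt A) := b)) (rpair ?u (RV (2, yt A))))" by blast
      from itp_ImpN[OF this] show False using b2 by simp
    qed
  qed
qed

text \<open>The response list for \<open>Forall v B\<close> collects the second components of a
  whole list returned by \<open>?F\<close>, whereas the challenge to \<open>A\<close> is taken from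
  one entry of it, each entry being tried. Which entry is relevant depends on the value of
  \<open>v\<close>, but whether \<open>A\<close> is met does not.\<close>

lemma Real_distr_all:
  assumes "v \<notin> fv A"
  shows "Real (Forall v (A \<^bold>\<longrightarrow> B) \<^bold>\<longrightarrow> A \<^bold>\<longrightarrow> Forall v B)"
proof -
  let ?A = "Forall v (A \<^bold>\<longrightarrow> B) \<^bold>\<longrightarrow> A \<^bold>\<longrightarrow> Forall v B"
  let ?c = "RV (0, xt ?A)"
  let ?F = "rfst ?c" let ?f = "rfst (rsnd ?c)" let ?u = "rsnd (rsnd ?c)"
  let ?P = "rpair ?f ?u"
  let ?qt = "xt A \<times>\<^sub>r yt B"
  let ?w = "RV (1, LL ?qt)"
  let ?l = "?F \<star> ?P"
  let ?ws = "rbind (3, ?qt) ?w (rsing (rsnd (RV (3, ?qt))))"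
  let ?r = "rsing (rpair ?P (rpair (rfst (RV (2, ?qt))) ?ws))"
  let ?k = "rbind (2, ?qt) ?w ?r"
  let ?d = "rpair ?P (rzero (xt A \<times>\<^sub>r LL (yt B)))"
  let ?t = "rcons ?d (rbind (1, LL ?qt) ?l ?k)"
  have hl: "ht ?l (LL (LL ?qt))" unfolding xyt_simps by (rule ht_intros)+
  have hw: "ht ?w (LL ?qt)" by (rule ht_intros)+
  have hs: "ht (rsing (rsnd (RV (3, ?qt)))) (LL (yt B))" by (rule ht_intros)+
  have hr: "ht ?r (LL (yt ?A))" unfolding xyt_simps by (rule ht_intros)+
  have hd: "ht ?d (yt ?A)" unfolding xyt_simps by (rule ht_intros)+
  note hk = ht_rbind[OF hw hr, of 2]
  show ?thesis
  proof (rule RealI)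
    show "ht ?t (LL (yt ?A))" by (rule ht_rcons[OF hd ht_rbind[OF hl hk]])
    show "fvr ?t \<subseteq> {(0, xt ?A)}" by auto
    fix e d assume Ve: "vld e" and V: "vld d" and "R (xt ?A) (d (0, xt ?A))"
    let ?x = "d (0, xt ?A)"
    have D: "dl (dn d ?t) = dn d ?d # dl (dn d (rbind (1, LL ?qt) ?l ?k))"
      by (rule dl_rcons[OF isl_dn[OF V ht_rbind[OF hl hk]]])
    show "\<exists>y\<in>set (dl (dn d ?t)). itp e ?A ?x y"
    proof (rule ccontr)
      assume *: "\<not> ?thesis"
      then have "\<not> itp e ?A ?x (dn d ?d)" unfolding D by simp
      then obtain g where "g \<in> set (dl (fstD ?x \<cdot> fstD (dn d ?d)))"
        "itp e (Forall v (A \<^bold>\<longrightarrow> B)) (fstD (dn d ?d)) g" by (rule itp_ImpE)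
      then have g: "g \<in> set (dl (dn d ?l))" "itp e (Forall v (A \<^bold>\<longrightarrow> B)) (dn d ?P) g" by simp_all
      let ?d1 = "d((1, LL ?qt) := g)"
      have V1: "vld ?d1" by (rule vld_upd[OF V]) (use E_dl[OF E_dn[OF V hl] g(1)] in \<open>simp only: snd_conv\<close>)
      let ?z = "\<lambda>q. dn (?d1((2, ?qt) := q)) (rpair ?P (rpair (rfst (RV (2, ?qt))) ?ws))"
      have bad: "\<not> itp e ?A ?x (?z q)" if "q \<in> set (dl g)" for q
      proof -
        have "?z q \<in> set (dl (dn ?d1 ?k))"
          by (rule in_rbind[OF V1 hw hr]) (use that in simp_all)
        then have "?z q \<in> set (dl (dn d ?t))"
          unfolding D using in_rbind[OF V hl hk g(1)] by simp
        with * show ?thesis by blast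
      qed
      have ws: "set (dl (dn (?d1((2, ?qt) := q)) ?ws)) = sndD ` set (dl g)" if "q \<in> set (dl g)" for q
      proof -
        have "E ?qt q q" using E_dl[OF E_dn[OF V1 hw], of q] that by simp
        then have "vld (?d1((2, ?qt) := q))" using vld_upd[OF V1, of "(2, ?qt)" q] by simp
        from dl_rbind[OF this hw hs] show ?thesis by auto
      qed
      have nA: "\<exists>a\<in>set (dl (dn d ?f \<cdot> fstD q)). itp e A (fstD q) a" if "q \<in> set (dl g)" for q
        by (rule itp_ImpE[OF itp_ImpN[OF bad[OF that]]]) auto
      have nB: "\<not> itp e (Forall v B) (dn d ?u) (dn (?d1((2, ?qt) := q)) ?ws)" if "q \<in> set (dl g)" for q
        using itp_ImpN[OF itp_ImpN[OF bad[OF that]]] by simp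
      have "\<exists>q\<in>set (dl g). itp e' (A \<^bold>\<longrightarrow> B) (dn d ?P) q"
        if "e' = e(ev v := a)" "E (emb (snd v)) a a" for a e' using g(2) that by simp
      note ex = this
      \<comment> \<open>The list is nonempty because it serves at least one object, and every type
        contains its zero.\<close>
      obtain q where q: "q \<in> set (dl g)" using ex[OF refl E_zeroR] by blast
      obtain a where a: "E (emb (snd v)) a a"
        "\<And>b. b \<in> set (dl g) \<Longrightarrow> \<not> itp (e(ev v := a)) B (dn d ?u) (sndD b)"
        using nB[OF q] unfolding itp_simps ws[OF q] by blast
      obtain q' where q': "q' \<in> set (dl g)" "itp (e(ev v := a)) (A \<^bold>\<longrightarrow> B) (dn d ?P) q'"
        using ex[OF refl a(1)] by blast
      obtain c where c: "c \<in> set (dl (dn d ?f \<cdot> fstD q'))" "itp e A (fstD q') c" using nA[OF q'(1)] by blast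
      have "itp (e(ev v := a)) A = itp e A" by (rule itp_cong) (use assms in auto)
      then show False using itp_ImpD[OF q'(2), of c] c a(2)[OF q'(1)] by simp
    qed
  qed
qed

text \<open>The challenge that a response puts to \<open>A\<close> is not given from outside. It is
  an entry of a definable list, hence definable, so that the realiser of \<open>A\<close> is obliged
  to meet it.\<close>

lemma Real_mp: 
  assumes "Real (A \<^bold>\<longrightarrow> B)" "Real A" shows "Real B"
proof -
  obtain s where s: "fvr s = {}" "ht s (xt (A \<^bold>\<longrightarrow> B) \<rightarrow>\<^sub>r LL (yt (A \<^bold>\<longrightarrow> B)))"
    "\<And>e d x. vld e \<Longrightarrow> R (xt (A \<^bold>\<longrightarrow> B)) x \<Longrightarrow> \<exists>y\<in>set (dl (dn d s \<cdot> x)). itp e (A \<^bold>\<longrightarrow> B) x y"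
    using assms(1) by (rule RealE) (rule that)
  obtain t where t: "fvr t = {}" "ht t (xt A \<rightarrow>\<^sub>r LL (yt A))"
    "\<And>e d x. vld e \<Longrightarrow> R (xt A) x \<Longrightarrow> \<exists>y\<in>set (dl (dn d t \<cdot> x)). itp e A x y"
    using assms(2) by (rule RealE) (rule that)
  let ?qt = "xt A \<times>\<^sub>r yt B"
  let ?l = "s \<star> rpair t (RV (0, xt B))"
  let ?r = "rsing (rsnd (RV (1, ?qt)))"
  have hl: "ht ?l (LL ?qt)" by (rule ht_RA[OF s(2)[unfolded xyt_simps]]) (rule t(2) ht_intros)+
  have hr: "ht ?r (LL (yt B))" by (rule ht_intros)+
  show ?thesis
  proof (rule RealI)
    show "ht (rbind (1, ?qt) ?l ?r) (LL (yt B))" by (rule ht_rbind[OF hl hr])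
    show "fvr (rbind (1, ?qt) ?l ?r) \<subseteq> {(0, xt B)}" using s(1) t(1) by auto
    fix e d assume Ve: "vld e" and V: "vld d" and x: "R (xt B) (d (0, xt B))"
    let ?x = "pr (dn d t) (d (0, xt B))"
    have "R (xt (A \<^bold>\<longrightarrow> B)) ?x" unfolding xyt_simps by (rule R_pr[OF R_closed[OF t(1,2)] x])
    from s(3)[OF Ve this] obtain y where
      y: "y \<in> set (dl (dn d ?l))" "itp e (A \<^bold>\<longrightarrow> B) ?x y" by auto
    have "E (xt A) (fstD y) (fstD y)" using E_dl[OF E_dn[OF V hl] y(1)] by simp
    have "itp e B (d (0, xt B)) (sndD y)" if "R (xt A) (fstD y)"
      using t(3)[OF Ve that] itp_ImpD[OF y(2)] by fastforce
    moreover have "R (LL ?qt) (dn d ?l)"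
      by (rule R_dn[OF hl]) (use s(1) t(1) x in auto)
    ultimately have "itp e B (d (0, xt B)) (sndD y)" using R_fst[OF R_dl[OF _ y(1)]] by simp
    moreover have "dn (d((1, ?qt) := y)) (rsnd (RV (1, ?qt))) \<in> set (dl (dn d (rbind (1, ?qt) ?l ?r)))"
      by (rule in_rbind[OF V hl hr y(1)]) simp
    ultimately show "\<exists>y\<in>set (dl (dn d (rbind (1, ?qt) ?l ?r))). itp e B (d (0, xt B)) y" by fastforce
  qed
qed

lemma Real_gen:
  assumes "Real A" shows "Real (Forall v A)"
proof -
  obtain t where t: "fvr t = {}" "ht t (xt A \<rightarrow>\<^sub>r LL (yt A))"
    "\<And>e d x. vld e \<Longrightarrow> R (xt A) x \<Longrightarrow> \<exists>y\<in>set (dl (dn d t \<cdot> x)). itp e A x y"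
    using assms by (rule RealE) (rule that)
  let ?b = "rsing (t \<star> RV (0, xt A))"
  show ?thesis
  proof (rule RealI)
    show "ht ?b (LL (yt (Forall v A)))" unfolding xyt_simps by (rule ht_rsing[OF ht_RA[OF t(2) ht_RV]])
    show "fvr ?b \<subseteq> {(0, xt (Forall v A))}" using t(1) by auto
    fix e d assume "vld e" "vld d" "R (xt (Forall v A)) (d (0, xt (Forall v A)))"
    then show "\<exists>y\<in>set (dl (dn d ?b)). itp e (Forall v A) (d (0, xt (Forall v A))) y"
      using t(3)[OF vld_ev] by simp
  qed
qed

theorem proves_Real:
  assumes "\<Gamma> \<^bold>\<turnstile> A" "\<And>B. B \<in> \<Gamma> \<Longrightarrow> wff B \<Longrightarrow> Real B"
  shows "Real A"
  using assms(1)
  by induction (auto intro: assms(2) Real_weaken Real_distr Real_dneg Real_inst Real_distr_all Real_mp Real_gen)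

end

section \<open>Internal formulas\<close>

text \<open>
  An internal formula has a canonical challenge \<open>cch\<close>, which can only be met if the formula is
  true, and a canonical response \<open>crs\<close>, which meets every challenge if the formula is true.
\<close>

primrec ccr :: "fm \<Rightarrow> rtm \<times> rtm" where
  "ccr (s \<^bold>= t) = (RC RZero, RC RZero)"
| "ccr (St t) = (RC RZero, rzero (emb (ty_of t)))"
| "ccr Bot = (RC RZero, RC RZero)"
| "ccr (A \<^bold>\<longrightarrow> B) = (rpair (RL (0, xt A) (rsing (snd (ccr A)))) (fst (ccr B)),
     rpair (fst (ccr A)) (snd (ccr B)))"
| "ccr (Forall v A) = (fst (ccr A), rsing (snd (ccr A)))"

definition cch :: "fm \<Rightarrow> rtm" where "cch A = fst (ccr A)"
definition crs :: "fm \<Rightarrow> rtm" where "crs A = snd (ccr A)"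

lemma ccr_simps:
  "cch (s \<^bold>= t) = RC RZero" "crs (s \<^bold>= t) = RC RZero"
  "cch (St t) = RC RZero" "crs (St t) = rzero (emb (ty_of t))"
  "cch Bot = RC RZero" "crs Bot = RC RZero"
  "cch (A \<^bold>\<longrightarrow> B) = rpair (RL (0, xt A) (rsing (crs A))) (cch B)" "crs (A \<^bold>\<longrightarrow> B) = rpair (cch A) (crs B)"
  "cch (Forall v A) = cch A" "crs (Forall v A) = rsing (crs A)"
  by (simp_all add: cch_def crs_def)

lemma ht_ccr: "ht (cch A) (xt A) \<and> ht (crs A) (yt A)"
  by (induction A) (auto simp: ccr_simps intro!: ht_intros)

lemmas ht_cch = ht_ccr[THEN conjunct1] and ht_crs = ht_ccr[THEN conjunct2]

lemma fvr_ccr [simp]: "fvr (cch A) = {}" "fvr (crs A) = {}"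
proof -
  have "fvr (cch A) = {} \<and> fvr (crs A) = {}" by (induction A) (auto simp: ccr_simps)
  then show "fvr (cch A) = {}" "fvr (crs A) = {}" by auto
qed

lemma ccr_subst:
  assumes "ty_of u = snd x" shows "cch (subst A x u) = cch A \<and> crs (subst A x u) = crs A"
  by (induction A) (auto simp: ccr_simps model.xt_subst[OF assms] model.ty_of_tsubst[OF assms])

lemma free_for_self: "tv u \<subseteq> {x} \<Longrightarrow> free_for u x A"
  by (induction A) auto

context model
begin

text \<open>Truth in the model of total extensional objects. It is meant for internal formulas; the
  value at \<open>St\<close> is a dummy.\<close>

primrec tsat :: "(rvar \<Rightarrow> D) \<Rightarrow> fm \<Rightarrow> bool" where
  "tsat e (s \<^bold>= t) = E (emb (ty_of s)) (dn e (trm s)) (dn e (trm t))"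
| "tsat e (St t) = False"
| "tsat e Bot = False"
| "tsat e (A \<^bold>\<longrightarrow> B) = (tsat e A \<longrightarrow> tsat e B)"
| "tsat e (Forall v A) = (\<forall>a. E (emb (snd v)) a a \<longrightarrow> tsat (e(ev v := a)) A)"

lemma tsat_simps:
  "tsat e (s \<^bold>= t) = E (emb (ty_of s)) (dn e (trm s)) (dn e (trm t))"
  "tsat e (St t) = False"
  "tsat e Bot = False"
  "tsat e (A \<^bold>\<longrightarrow> B) = (tsat e A \<longrightarrow> tsat e B)"
  "tsat e (Forall v A) = (\<forall>a. E (emb (snd v)) a a \<longrightarrow> tsat (e(ev v := a)) A)"
  by simp_all

declare tsat.simps [simp del]
declare tsat_simps [simp]

lemma internal_itp:
  "internal A \<Longrightarrow> (tsat e A \<longrightarrow> itp e A x (dn d (crs A))) \<and> (itp e A (dn d (cch A)) y \<longrightarrow> tsat e A)"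
proof (induction A arbitrary: e x y d)
  case (Imp A B)
  then show ?case by (auto simp: ccr_simps itp_simps(4))
next
  case (Forall v A)
  then show ?case by (fastforce simp: ccr_simps)
qed (auto simp: ccr_simps)

lemma itp_crs: "internal A \<Longrightarrow> tsat e A \<Longrightarrow> itp e A x (dn d (crs A))"
  using internal_itp by blast

lemma itp_cch: "internal A \<Longrightarrow> itp e A (dn d (cch A)) y \<Longrightarrow> tsat e A"
  using internal_itp by blast

text \<open>Truth becomes an instance of the interpretation, so that substitution and coincidence
  are inherited from \<open>itp_subst\<close> and \<open>itp_cong\<close>.\<close>

lemma tsat_itp: "internal A \<Longrightarrow> tsat e A \<longleftrightarrow> itp e A (dn e0 (cch A)) (dn e0 (crs A))"
  using internal_itp by blast

lemma Real_internal:
  assumes "internal A" "\<And>e. vld e \<Longrightarrow> tsat e A"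
  shows "Real A"
proof (rule RealI)
  show "ht (rsing (crs A)) (LL (yt A))" by (rule ht_rsing[OF ht_crs])
qed (use itp_crs assms in auto)

lemma tsat_subst:
  assumes "internal A" "ty_of u = snd x" "free_for u x A"
  shows "tsat e (subst A x u) \<longleftrightarrow> tsat (e(ev x := dn e (trm u))) A"
proof -
  have "internal (subst A x u)" using assms(1) by (induction A) auto
  then show ?thesis
    using itp_subst[OF assms(2,3)] ccr_subst[OF assms(2)] assms(1) by (simp only: tsat_itp)
qed

lemma tsat_cong:
  assumes "internal A" "\<And>x. x \<in> fv A \<Longrightarrow> e (ev x) = e' (ev x)"
  shows "tsat e A \<longleftrightarrow> tsat e' A"
proof -
  have "itp e A = itp e' A" by (rule itp_cong) (rule assms(2))
  then show ?thesis using assms(1) by (simp only: tsat_itp)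
qed

definition eqv :: "(rvar \<Rightarrow> D) \<Rightarrow> (rvar \<Rightarrow> D) \<Rightarrow> bool" where
  "eqv e e' \<longleftrightarrow> (\<forall>v. E (snd v) (e v) (e' v))"

lemma eqv_upd: "eqv e e' \<Longrightarrow> E (snd v) x y \<Longrightarrow> eqv (e(v := x)) (e'(v := y))"
  by (simp add: eqv_def del: split_paired_All)

lemma eqv_refl: "vld e \<Longrightarrow> eqv e e"
  unfolding eqv_def vld_def .

lemma tsat_eqv: "wff A \<Longrightarrow> eqv e e' \<Longrightarrow> tsat e A \<longleftrightarrow> tsat e' A"
proof (induction A arbitrary: e e')
  case (Eq s t)
  have *: "E (emb (ty_of r)) (dn e (trm r)) (dn e' (trm r))" if "wt r" for r
    by (rule E_den[OF ht_trm[OF that]]) (use Eq(2) in \<open>unfold eqv_def, blast\<close>)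
  show ?case using *[of s] *[of t] Eq(1) E_sym E_trans by (metis tsat_simps(1) wff.simps(1))
next
  case (Forall v A)
  have "tsat (e(ev v := a)) A \<longleftrightarrow> tsat (e'(ev v := a)) A" if "E (emb (snd v)) a a" for a
    by (rule Forall(1)[OF _ eqv_upd]) (use Forall(2,3) that in simp_all)
  then show ?case by auto
qed auto

lemma dn_upd: "x \<notin> tv t \<Longrightarrow> dn (e(ev x := a)) (trm t) = dn e (trm t)"
  by (rule dn_trm_cong) (metis ev_inject fun_upd_other)

section \<open>The axioms of \<open>E-PA\<^sup>\<omega>*\<close>\<close>

lemma ex_list:
  assumes "\<forall>a\<in>set as. E \<sigma> a a" shows "\<exists>y. E (LL \<sigma>) y y \<and> dl y = as"
  using assms
proof (induction as)
  case Nil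
  then show ?case by (intro exI[of _ "zeroR (LL \<sigma>)"]) simp
next
  case (Cons a as)
  then obtain y where "E (LL \<sigma>) y y" "dl y = as" by auto
  then show ?case using Cons(2) by (intro exI[of _ "cden p w (RCons \<sigma>) \<cdot> a \<cdot> y"]) simp
qed

lemma wt_ty: "wt (s \<bullet> t) \<Longrightarrow> ty_of s = ty_of t \<rightarrow>\<^sub>t ty_of (s \<bullet> t)"
  by auto

lemma vld_trm_app:
  assumes "vld e" "wt (s \<bullet> t)"
  shows "E (emb (ty_of t) \<rightarrow>\<^sub>r emb (ty_of (s \<bullet> t))) (dn e (trm s)) (dn e (trm s))"
  using vld_trm[OF assms(1), of s] assms(2) wt_ty[OF assms(2)] by (metis emb.simps(2) wt.simps(3))

lemma EPA_internal: "A \<in> EPA \<Longrightarrow> internal A"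
proof (induction rule: EPA.induct)
  case (induction A n)
  have "internal (subst A n u)" for u using induction(1) by (induction A) auto
  then show ?case using induction(1) by simp
qed auto

lemma EPA_tsat: "A \<in> EPA \<Longrightarrow> wff A \<Longrightarrow> vld e \<Longrightarrow> tsat e A"
proof (induction rule: EPA.induct)
  case (eq_refl s)
  then show ?case using vld_trm by simp
next
  case (eq_eucl s t u)
  then show ?case by (auto simp del: E.simps intro: E_trans[OF E_sym])
next
  case (eq_cong f g s t)
  then have ty: "wt (f \<bullet> s)" "wt (g \<bullet> t)" "ty_of f = ty_of g" "ty_of s = ty_of t" by auto
  show ?case
  proof (simp only: tsat_simps, intro impI)
    assume fg: "E (emb (ty_of f)) (dn e (trm f)) (dn e (trm g))"
      and st: "E (emb (ty_of s)) (dn e (trm s)) (dn e (trm t))"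
    have "E (emb (ty_of s) \<rightarrow>\<^sub>r emb (ty_of (f \<bullet> s))) (dn e (trm f)) (dn e (trm g))"
      using fg unfolding wt_ty[OF ty(1)] by simp
    from E_ap[OF this st] show "E (emb (ty_of (f \<bullet> s))) (dn e (trm (f \<bullet> s))) (dn e (trm (g \<bullet> t)))"
      by simp
  qed
next
  case (extensionality x f g)
  then have ty: "wt (f \<bullet> Var x)" "wt (g \<bullet> Var x)" "ty_of f = ty_of g" by auto
  let ?\<tau> = "emb (ty_of (f \<bullet> Var x))"
  have T: "emb (ty_of f) = emb (snd x) \<rightarrow>\<^sub>r ?\<tau>" using arg_cong[OF wt_ty[OF ty(1)], of emb] by (simp only: emb.simps ty_of.simps(1))
  have fx: "dn (e(ev x := a)) (trm f) = dn e (trm f)" "dn (e(ev x := a)) (trm g) = dn e (trm g)" for a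
    using extensionality(1) by (simp_all add: dn_upd)
  show ?case
  proof (simp only: tsat_simps, intro impI, unfold T, rule E_FF)
    fix a b assume *: "\<forall>a. E (emb (snd x)) a a \<longrightarrow>
      E ?\<tau> (dn (e(ev x := a)) (trm (f \<bullet> Var x))) (dn (e(ev x := a)) (trm (g \<bullet> Var x)))"
      and ab: "E (emb (snd x)) a b"
    then have "E ?\<tau> (dn e (trm f) \<cdot> a) (dn e (trm g) \<cdot> a)" using E_refl1 by (fastforce simp: fx)
    \<comment> \<open>The assumption compares the functions at one and the same argument. The
      passage from \<open>a\<close> to the equal argument \<open>b\<close> uses that
      \<open>g\<close> itself is extensional.\<close>
    moreover have "E ?\<tau> (dn e (trm g) \<cdot> a) (dn e (trm g) \<cdot> b)"
    proof -
      have "ty_of (g \<bullet> Var x) = ty_of (f \<bullet> Var x)" using ty(3) by simp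
      then show ?thesis
        using E_ap[OF vld_trm_app[OF extensionality(3) ty(2)]] ab by (simp only: ty_of.simps(1))
    qed
    ultimately show "E ?\<tau> (dn e (trm f) \<cdot> a) (dn e (trm g) \<cdot> b)" by (rule E_trans)
  qed
next
  case (suc_nonzero s)
  then have "E NN (dn e (trm s)) (dn e (trm s))" using vld_trm[of e s] by auto
  then show ?case by auto
next
  case (suc_inj s t)
  then have "E NN (dn e (trm s)) (dn e (trm s))" "E NN (dn e (trm t)) (dn e (trm t))" "ty_of s = N"
    using vld_trm[of e s] vld_trm[of e t] by auto
  then show ?case by auto
next
  case (induction A n)
  have "tsat (e(ev n := a)) A"
    if 0: "tsat e (subst A n Zero)" and E: "E (emb (snd n)) a a"
      and S: "\<forall>a. E (emb (snd n)) a a \<longrightarrow> tsat (e(ev n := a)) A \<longrightarrow>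
        tsat (e(ev n := a)) (subst A n (Cst CSuc \<bullet> Var n))" for a
  proof -
    \<comment> \<open>The total objects of type 0 are exactly the numerals, so induction in the
      metatheory is enough.\<close>
    have "tsat (e(ev n := num m)) A" for m
    proof (induction m)
      case 0
      have "free_for Zero n A" by (rule free_for_self) simp
      with \<open>tsat e (subst A n Zero)\<close> show ?case
        using tsat_subst[OF induction(1), of Zero n e] induction(2) by (simp del: fun_upd_apply)
    next
      case (Suc m)
      have "free_for (Succ (Var n)) n A" by (rule free_for_self) simp
      with Suc S show ?case
        using tsat_subst[OF induction(1), of "Succ (Var n)" n "e(ev n := num m)"] induction(2) by (simp add: fun_upd_same del: fun_upd_apply)
    qed
    then show ?thesis using E induction(2) by (auto simp del: fun_upd_apply)
  qed
  then show ?case unfolding tsat_simps by blast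
next
  case (k \<sigma> \<tau> s t)
  then show ?case using vld_trm[of e s] by auto
next
  case (s \<rho> \<sigma> \<tau> s t u)
  then have "wt (s \<bullet> u \<bullet> (t \<bullet> u))" by auto
  then show ?case using vld_trm[of e "s \<bullet> u \<bullet> (t \<bullet> u)"] s by (auto simp: Let_def)
next
  case (rec_zero \<tau> s t)
  then show ?case using vld_trm[of e s] by (auto simp: recD)
next
  case (rec_suc \<tau> u s t)
  let ?t = "t \<bullet> (Cst (CRec \<tau>) \<bullet> u \<bullet> s \<bullet> t) \<bullet> u"
  have "wt u" "ty_of u = N" "wt ?t" "ty_of ?t = \<tau>"
  proof -
    have 1: "wt (Succ u)" "wt ?t" "ty_of (Cst (CRec \<tau>) \<bullet> Succ u \<bullet> s \<bullet> t) = ty_of ?t"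
      using rec_suc(1) by (simp_all only: wff.simps wt.simps)
    then show "wt u" "ty_of u = N" "wt ?t" by auto
    show "ty_of ?t = \<tau>" unfolding 1(3)[symmetric] by simp
  qed
  have "E NN (dn e (trm u)) (dn e (trm u))"
    using vld_trm[OF rec_suc(2) \<open>wt u\<close>] unfolding \<open>ty_of u = N\<close> by simp
  then obtain n where "dn e (trm u) = num n" by auto
  then show ?case using vld_trm[OF rec_suc(2) \<open>wt ?t\<close>] \<open>ty_of ?t = \<tau>\<close> by (simp add: recD)
next
  case (lrec_nil \<sigma> \<tau> s t)
  then show ?case using vld_trm[of e s] by (auto simp: lrecD)
next
  case (lrec_cons \<sigma> \<tau> a u s t)
  let ?t = "t \<bullet> (Cst (CLRec \<sigma> \<tau>) \<bullet> u \<bullet> s \<bullet> t) \<bullet> a"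
  have "wt u" "ty_of u = Seq \<sigma>" "wt ?t" "ty_of ?t = \<tau>"
  proof -
    have 1: "wt (Cst (CCons \<sigma>) \<bullet> a \<bullet> u)" "wt ?t"
      "ty_of (Cst (CLRec \<sigma> \<tau>) \<bullet> (Cst (CCons \<sigma>) \<bullet> a \<bullet> u) \<bullet> s \<bullet> t) = ty_of ?t"
      using lrec_cons(1) by (simp_all only: wff.simps wt.simps)
    then show "wt u" "ty_of u = Seq \<sigma>" "wt ?t" by auto
    show "ty_of ?t = \<tau>" unfolding 1(3)[symmetric] by simp
  qed
  have "isl (dn e (trm u))"
    using vld_trm[OF lrec_cons(2) \<open>wt u\<close>] unfolding \<open>ty_of u = Seq \<sigma>\<close> by simp
  then show ?case using vld_trm[OF lrec_cons(2) \<open>wt ?t\<close>] \<open>ty_of ?t = \<tau>\<close> by (simp add: lrecD)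
next
  case (seq_cases x s y \<sigma>)
  then have ty: "wt s" "ty_of s = Seq \<sigma>" "snd x = \<sigma>" "snd y = Seq \<sigma>" by auto
  have fx: "dn (e(ev x := a, ev y := b)) (trm s) = dn e (trm s)" for a b
    using seq_cases(1,2) by (simp add: dn_upd)
  have E: "E (LL (emb \<sigma>)) (dn e (trm s)) (dn e (trm s))"
    using vld_trm[OF seq_cases(4) ty(1)] ty(2) by simp
  show ?case
  proof (cases "dl (dn e (trm s))")
    case Nil
    then show ?thesis using E ty by simp
  next
    case (Cons a as)
    have as: "\<forall>b\<in>set (a # as). E (emb \<sigma>) b b" using E_dl[OF E] Cons by auto
    then obtain b where b: "E (LL (emb \<sigma>)) b b" "dl b = as" using ex_list[of as] by auto
    have "x \<noteq> y" using ty by auto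
    have "E (LL (emb \<sigma>)) (dn e (trm s)) (cden p w (RCons (emb \<sigma>)) \<cdot> a \<cdot> b)"
      using E as b Cons by (simp add: list_all2_same)
    moreover have "E (emb \<sigma>) a a" using as by simp
    ultimately show ?thesis
      using ty b(1) \<open>x \<noteq> y\<close> by (simp add: fx del: E.simps(4)) blast
  qed
qed

lemma Real_EPA: "A \<in> EPA \<Longrightarrow> wff A \<Longrightarrow> Real A"
  by (rule Real_internal[OF EPA_internal EPA_tsat])

end

section \<open>Propositional reasoning in the calculus\<close>

primrec pval :: "(fm \<Rightarrow> bool) \<Rightarrow> fm \<Rightarrow> bool" where
  "pval v (s \<^bold>= t) = v (s \<^bold>= t)"
| "pval v (St t) = v (St t)"
| "pval v Bot = False"
| "pval v (A \<^bold>\<longrightarrow> B) = (pval v A \<longrightarrow> pval v B)"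
| "pval v (Forall x A) = v (Forall x A)"

primrec atoms :: "fm \<Rightarrow> fm set" where
  "atoms (s \<^bold>= t) = {s \<^bold>= t}"
| "atoms (St t) = {St t}"
| "atoms Bot = {}"
| "atoms (A \<^bold>\<longrightarrow> B) = atoms A \<union> atoms B"
| "atoms (Forall x A) = {Forall x A}"

text \<open>Generalisation is confined to the derivable formulas, which leaves the deduction theorem
  free of conditions on variables.\<close>

inductive hyp_proves :: "fm set \<Rightarrow> fm set \<Rightarrow> fm \<Rightarrow> bool" for \<Gamma> H where
  assm: "A \<in> H \<Longrightarrow> wff A \<Longrightarrow> hyp_proves \<Gamma> H A"
| derived: "\<Gamma> \<^bold>\<turnstile> A \<Longrightarrow> wff A \<Longrightarrow> hyp_proves \<Gamma> H A"
| mp: "hyp_proves \<Gamma> H (A \<^bold>\<longrightarrow> B) \<Longrightarrow> hyp_proves \<Gamma> H A \<Longrightarrow> hyp_proves \<Gamma> H B"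

lemma hyp_proves_wff: "hyp_proves \<Gamma> H A \<Longrightarrow> wff A"
  by (induction rule: hyp_proves.induct) auto

lemma hyp_proves_empty: "hyp_proves \<Gamma> {} A \<Longrightarrow> \<Gamma> \<^bold>\<turnstile> A"
  by (induction rule: hyp_proves.induct) (auto intro: proves.mp)

lemma hyp_weaken: "hyp_proves \<Gamma> H B \<Longrightarrow> wff A \<Longrightarrow> hyp_proves \<Gamma> H (A \<^bold>\<longrightarrow> B)"
  by (rule hyp_proves.mp[OF hyp_proves.derived[OF proves.weaken]]) (use hyp_proves_wff in auto)

lemma deduction: "hyp_proves \<Gamma> (insert A H) B \<Longrightarrow> wff A \<Longrightarrow> hyp_proves \<Gamma> H (A \<^bold>\<longrightarrow> B)"
proof (induction rule: hyp_proves.induct)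
  case (assm B)
  show ?case
  proof (cases "B = A")
    case True
    have "hyp_proves \<Gamma> H ((A \<^bold>\<longrightarrow> (A \<^bold>\<longrightarrow> A) \<^bold>\<longrightarrow> A) \<^bold>\<longrightarrow> (A \<^bold>\<longrightarrow> A \<^bold>\<longrightarrow> A) \<^bold>\<longrightarrow> A \<^bold>\<longrightarrow> A)"
      using assm by (auto intro!: hyp_proves.derived proves.distr)
    moreover have "hyp_proves \<Gamma> H (A \<^bold>\<longrightarrow> (A \<^bold>\<longrightarrow> A) \<^bold>\<longrightarrow> A)" "hyp_proves \<Gamma> H (A \<^bold>\<longrightarrow> A \<^bold>\<longrightarrow> A)"
      using assm by (auto intro!: hyp_proves.derived proves.weaken)
    ultimately show ?thesis unfolding True using hyp_proves.mp by blast
  next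
    case False
    then show ?thesis using assm by (auto intro: hyp_weaken hyp_proves.assm)
  qed
next
  case (derived B)
  then show ?case by (auto intro: hyp_weaken hyp_proves.derived)
next
  case (mp C B)
  have "wff (A \<^bold>\<longrightarrow> C \<^bold>\<longrightarrow> B)" using mp hyp_proves_wff by blast
  then have "hyp_proves \<Gamma> H ((A \<^bold>\<longrightarrow> C \<^bold>\<longrightarrow> B) \<^bold>\<longrightarrow> (A \<^bold>\<longrightarrow> C) \<^bold>\<longrightarrow> A \<^bold>\<longrightarrow> B)"
    by (intro hyp_proves.derived proves.distr) auto
  then show ?case using mp hyp_proves.mp by blast
qed

lemma hyp_efq: "hyp_proves \<Gamma> H Bot \<Longrightarrow> wff A \<Longrightarrow> hyp_proves \<Gamma> H A"
  using hyp_weaken[of \<Gamma> H Bot "Neg A"] hyp_proves.derived[OF proves.dneg[of A \<Gamma>]] hyp_proves.mp by fastforce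

lemma hyp_mono: "hyp_proves \<Gamma> H A \<Longrightarrow> H \<subseteq> H' \<Longrightarrow> hyp_proves \<Gamma> H' A"
  by (induction rule: hyp_proves.induct) (auto intro: hyp_proves.intros)

lemma hyp_cases:
  assumes "hyp_proves \<Gamma> (insert A H) B" "hyp_proves \<Gamma> (insert (Neg A) H) B" "wff A"
  shows "hyp_proves \<Gamma> H B"
proof -
  have B: "wff B" using assms(1) hyp_proves_wff by blast
  let ?H = "insert (Neg B) H"
  have n: "hyp_proves \<Gamma> H' (Neg B)" if "Neg B \<in> H'" for H' by (rule hyp_proves.assm) (use B that in auto)
  have "hyp_proves \<Gamma> (insert A ?H) Bot"
    by (rule hyp_proves.mp[OF n hyp_mono[OF assms(1)]]) auto
  then have 1: "hyp_proves \<Gamma> ?H (Neg A)" by (rule deduction[OF _ assms(3)])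
  have "hyp_proves \<Gamma> (insert (Neg A) ?H) Bot"
    by (rule hyp_proves.mp[OF n hyp_mono[OF assms(2)]]) auto
  then have 2: "hyp_proves \<Gamma> ?H (Neg (Neg A))" by (rule deduction) (use assms(3) in simp)
  have "hyp_proves \<Gamma> H (Neg (Neg B))" by (rule deduction[OF hyp_proves.mp[OF 2 1]]) (use B in simp)
  then show ?thesis using hyp_proves.derived[OF proves.dneg[OF B]] B hyp_proves.mp by fastforce
qed

definition lit :: "(fm \<Rightarrow> bool) \<Rightarrow> fm \<Rightarrow> fm" where "lit v A = (if pval v A then A else Neg A)"

text \<open>The lemma of Kalmar's completeness proof: the literals fixed by a valuation decide every
  formula over these atoms.\<close>

lemma hyp_lit: "wff A \<Longrightarrow> hyp_proves \<Gamma> (lit v ` atoms A) (lit v A)"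
proof (induction A)
  case (Imp A B)
  let ?H = "lit v ` atoms (A \<^bold>\<longrightarrow> B)"
  have A: "hyp_proves \<Gamma> ?H (lit v A)" and B: "hyp_proves \<Gamma> ?H (lit v B)"
    using Imp by (auto intro: hyp_mono)
  have w: "wff A" "wff B" using Imp by auto
  consider "pval v B" | "\<not> pval v A" | "pval v A" "\<not> pval v B" by blast
  then show ?case
  proof cases
    case 1
    then show ?thesis using B w by (auto simp: lit_def intro: hyp_weaken)
  next
    case 2
    have "hyp_proves \<Gamma> (insert A ?H) Bot"
      by (rule hyp_proves.mp[OF hyp_mono[of _ ?H "Neg A"] hyp_proves.assm])
        (use A 2 w in \<open>auto simp: lit_def\<close>)
    from deduction[OF hyp_efq[OF this w(2)] w(1)] show ?thesis using 2 by (simp add: lit_def)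
  next
    case 3
    let ?H' = "insert (A \<^bold>\<longrightarrow> B) ?H"
    have "hyp_proves \<Gamma> ?H' B"
      by (rule hyp_proves.mp[OF hyp_proves.assm hyp_mono[of _ ?H A]]) (use A 3 w in \<open>auto simp: lit_def\<close>)
    moreover have "hyp_proves \<Gamma> ?H' (Neg B)"
      by (rule hyp_mono[of _ ?H]) (use B 3 w in \<open>auto simp: lit_def\<close>)
    ultimately have "hyp_proves \<Gamma> ?H' Bot" by (rule hyp_proves.mp[rotated])
    from deduction[OF this] show ?thesis using 3 w by (simp add: lit_def)
  qed
next
  case Bot
  have "hyp_proves \<Gamma> {} (Bot \<^bold>\<longrightarrow> Bot)" by (rule deduction[OF hyp_proves.assm]) auto
  then show ?case by (simp add: lit_def)
qed (auto simp: lit_def intro: hyp_proves.assm)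

lemma finite_atoms: "finite (atoms A)" by (induction A) auto

lemma wff_atoms: "wff A \<Longrightarrow> B \<in> atoms A \<Longrightarrow> wff B \<and> atoms B = {B}" by (induction A) auto

lemma atomic_pval: "atoms B = {B} \<Longrightarrow> pval v B = v B"
proof (cases B)
  case (Imp A C)
  assume B: "atoms B = {B}"
  \<comment> \<open>Atoms of a formula are no larger than the formula, so that an implication cannot
    be an atom of itself.\<close>
  have "size D \<le> size A" if "D \<in> atoms A" for D A using that by (induction A) auto
  then have "B \<notin> atoms A \<union> atoms C" using Imp by fastforce
  then show ?thesis using B Imp by auto
qed auto

text \<open>The literals are discharged one atom at a time. For each atom both literals are
  available from valuations that agree elsewhere, and \<open>hyp_cases\<close> removes it.\<close>

theorem proves_taut:
  assumes "wff A" "\<And>v. pval v A" shows "\<Gamma> \<^bold>\<turnstile> A"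
proof -
  have main: "(\<forall>v. hyp_proves \<Gamma> (lit v ` S) A) \<longrightarrow> hyp_proves \<Gamma> {} A"
    if "finite S" "\<forall>B\<in>S. wff B \<and> atoms B = {B}" for S
    using that
  proof (induction S)
    case (insert B S)
    show ?case
    proof
      assume *: "\<forall>v. hyp_proves \<Gamma> (lit v ` insert B S) A"
      have B: "wff B" "\<And>v. pval v B = v B" using insert.prems atomic_pval by auto
      have same: "lit (v(B := b)) ` S = lit v ` S" for v b
        by (rule image_cong) (use insert.prems insert.hyps atomic_pval in \<open>auto simp: lit_def\<close>)
      have "hyp_proves \<Gamma> (lit v ` S) A" for v
        by (rule hyp_cases[of _ B])
          (use *[rule_format, of "v(B := True)"] *[rule_format, of "v(B := False)"] B same
            in \<open>auto simp: lit_def[of _ B]\<close>)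
      then show "hyp_proves \<Gamma> {} A" using insert by auto
    qed
  qed auto
  have at: "\<forall>B\<in>atoms A. wff B \<and> atoms B = {B}" using wff_atoms[OF assms(1)] by blast
  have "lit v A = A" for v using assms(2) by (simp add: lit_def)
  then have "\<forall>v. hyp_proves \<Gamma> (lit v ` atoms A) A" using hyp_lit[OF assms(1)] by metis
  with main[OF finite_atoms at] have "hyp_proves \<Gamma> {} A" ..
  then show ?thesis by (rule hyp_proves_empty)
qed

lemma proves_taut1:
  "\<Gamma> \<^bold>\<turnstile> A \<Longrightarrow> wff (A \<^bold>\<longrightarrow> B) \<Longrightarrow> (\<And>v. pval v A \<Longrightarrow> pval v B) \<Longrightarrow> \<Gamma> \<^bold>\<turnstile> B"
  by (rule proves.mp[OF proves_taut]) auto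

lemma proves_taut2:
  "\<Gamma> \<^bold>\<turnstile> A \<Longrightarrow> \<Gamma> \<^bold>\<turnstile> B \<Longrightarrow> wff (A \<^bold>\<longrightarrow> B \<^bold>\<longrightarrow> C) \<Longrightarrow> (\<And>v. pval v A \<Longrightarrow> pval v B \<Longrightarrow> pval v C) \<Longrightarrow> \<Gamma> \<^bold>\<turnstile> C"
  by (rule proves.mp[OF proves.mp[OF proves_taut[of "A \<^bold>\<longrightarrow> B \<^bold>\<longrightarrow> C" \<Gamma>]]]) auto

lemma free_for_Var: "free_for (Var x) x A" by (rule free_for_self) simp

lemma tsubst_Var: "tsubst t x (Var x) = t" by (induction t) auto

lemma subst_Var: "subst A x (Var x) = A" by (induction A) (auto simp: tsubst_Var)

lemma proves_spec: "wff A \<Longrightarrow> \<Gamma> \<^bold>\<turnstile> Forall x A \<^bold>\<longrightarrow> A"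
  using proves.inst[of A "Var x" x \<Gamma>] by (simp add: free_for_Var subst_Var)

lemma proves_all_mono:
  assumes "\<Gamma> \<^bold>\<turnstile> A \<^bold>\<longrightarrow> B" "wff A" "wff B" shows "\<Gamma> \<^bold>\<turnstile> Forall x A \<^bold>\<longrightarrow> Forall x B"
proof -
  have "\<Gamma> \<^bold>\<turnstile> Forall x A \<^bold>\<longrightarrow> B"
    by (rule proves_taut2[OF proves_spec[OF assms(2), of _ x] assms(1)]) (use assms in auto)
  from proves.mp[OF proves.distr_all proves.gen[OF this]] show ?thesis using assms by simp
qed

lemma proves_Forall_imp:
  assumes "\<Gamma> \<^bold>\<turnstile> A \<^bold>\<longrightarrow> B" "wff A" "wff B" "x \<notin> fv A" shows "\<Gamma> \<^bold>\<turnstile> A \<^bold>\<longrightarrow> Forall x B"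
  using proves.mp[OF proves.distr_all[OF assms(2-4)] proves.gen[OF assms(1)]] .

section \<open>The realised formulas as a deductively closed theory\<close>

context model
begin

text \<open>Realised formulas may be used as axioms, since provability preserves realisability.
  Derivations in the calculus then replace the explicit construction of further realisers.\<close>

definition Th :: "fm set" where "Th = {A. Real A}"

lemma proves_Th: "Th \<^bold>\<turnstile> A \<Longrightarrow> Real A"
  by (rule proves_Real) (auto simp: Th_def)

lemma Th_proves: "Real A \<Longrightarrow> wff A \<Longrightarrow> Th \<^bold>\<turnstile> A"
  by (rule proves.axiom) (auto simp: Th_def)

end

section \<open>Arithmetical terms\<close>

lemma lam_type: "wt t \<Longrightarrow> wt (lam x t) \<and> ty_of (lam x t) = snd x \<rightarrow>\<^sub>t ty_of t"
  by (induction t) auto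

lemma ty_of_lam [simp]: "wt t \<Longrightarrow> ty_of (lam x t) = snd x \<rightarrow>\<^sub>t ty_of t"
  and wt_lam [simp]: "wt t \<Longrightarrow> wt (lam x t)"
  using lam_type by auto

declare lam.simps [simp del]

lemma zero_tm_type [simp]: "wt (zero_tm \<sigma>)" "ty_of (zero_tm \<sigma>) = \<sigma>"
proof -
  have "wt (zero_tm \<sigma>) \<and> ty_of (zero_tm \<sigma>) = \<sigma>" by (induction \<sigma>) auto
  then show "wt (zero_tm \<sigma>)" "ty_of (zero_tm \<sigma>) = \<sigma>" by auto
qed

lemma closed_types [simp]:
  "wt plus_c" "ty_of plus_c = N \<rightarrow>\<^sub>t N \<rightarrow>\<^sub>t N"
  "wt times_c" "ty_of times_c = N \<rightarrow>\<^sub>t N \<rightarrow>\<^sub>t N"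
  "wt pred_c" "ty_of pred_c = N \<rightarrow>\<^sub>t N"
  "wt monus_c" "ty_of monus_c = N \<rightarrow>\<^sub>t N \<rightarrow>\<^sub>t N"
  "wt pow2_c" "ty_of pow2_c = N \<rightarrow>\<^sub>t N"
  "wt (len_c \<sigma>)" "ty_of (len_c \<sigma>) = Seq \<sigma> \<rightarrow>\<^sub>t N"
  "wt (nth_c \<sigma>)" "ty_of (nth_c \<sigma>) = Seq \<sigma> \<rightarrow>\<^sub>t N \<rightarrow>\<^sub>t \<sigma>"
  by (simp_all add: plus_c_def times_c_def pred_c_def monus_c_def pow2_c_def len_c_def nth_c_def)

context model
begin

lemma dn_lam: "dn e (trm (lam x t)) \<cdot> a = dn (e(ev x := a)) (trm t)"
proof (induction t)
  case (Var y)
  then show ?case by (auto simp: lam.simps Let_def)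
next
  case (Cst c)
  then show ?case using den_closed[OF fvr_ctrm] by (simp add: lam.simps)
next
  case (App s t)
  show ?case
  proof (cases "x \<in> tv s \<union> tv t")
    case True
    then show ?thesis using App by (simp add: lam.simps Let_def)
  next
    case False
    then have "x \<notin> tv (s \<bullet> t)" by simp
    moreover have "dn e (trm (lam x (s \<bullet> t))) \<cdot> a = dn e (trm (s \<bullet> t))" using False by (simp add: lam.simps)
    ultimately show ?thesis by (metis dn_upd)
  qed
qed

lemma ev_nv [simp]: "ev (i, \<sigma>) = (i, emb \<sigma>)" by (simp add: ev_def)

lemma dn_plus [simp]: "dn e (trm plus_c) \<cdot> num a \<cdot> num b = num (a + b)"
proof -
  let ?e = "e((0, NN) := num a, (1, NN) := num b)"
  have "recn (num a) (dn ?e (trm (lam (nv 2) (lam (nv 3) (Succ (V 2)))))) n = num (a + n)" for n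
    by (induction n) (simp_all add: dn_lam)
  then show ?thesis by (simp add: plus_c_def dn_lam recD)
qed

lemma dn_times [simp]: "dn e (trm times_c) \<cdot> num a \<cdot> num b = num (a * b)"
proof -
  let ?e = "e((0, NN) := num a, (1, NN) := num b)"
  have "recn (num 0) (dn ?e (trm (lam (nv 2) (lam (nv 3) (plus_tm (V 2) (V 0)))))) n = num (a * n)" for n
    by (induction n) (simp_all add: dn_lam add.commute)
  then show ?thesis by (simp add: times_c_def dn_lam recD)
qed

lemma dn_pred [simp]: "dn e (trm pred_c) \<cdot> num a = num (a - 1)"
  by (cases a) (simp_all add: pred_c_def dn_lam recD)

lemma dn_monus [simp]: "dn e (trm monus_c) \<cdot> num a \<cdot> num b = num (a - b)"
proof -
  let ?e = "e((0, NN) := num a, (1, NN) := num b)"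
  have "recn (num a) (dn ?e (trm (lam (nv 2) (lam (nv 3) (pred_c \<bullet> V 2))))) n = num (a - n)" for n
    by (induction n) (simp_all add: dn_lam)
  then show ?thesis by (simp add: monus_c_def dn_lam recD)
qed

lemma dn_pow2 [simp]: "dn e (trm pow2_c) \<cdot> num a = num (2 ^ a)"
proof -
  let ?e = "e((0, NN) := num a)"
  have "recn (num 1) (dn ?e (trm (lam (nv 2) (lam (nv 3) (plus_tm (V 2) (V 2)))))) n = num (2 ^ n)" for n
    by (induction n) (simp_all add: dn_lam mult_2)
  then show ?thesis by (simp add: pow2_c_def dn_lam recD)
qed

lemma dn_len:
  assumes "isl l" shows "dn e (trm (len_c \<sigma>)) \<cdot> l = num (length (dl l))"
proof -
  let ?e = "e((0, LL (emb \<sigma>)) := l)"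
  have "foldr (\<lambda>a acc. dn ?e (trm (lam (nv 1) (lam (2, \<sigma>) (Succ (V 1))))) \<cdot> acc \<cdot> a) xs (num 0)
    = num (length xs)" for xs
    by (induction xs) (simp_all add: dn_lam)
  then show ?thesis by (simp add: len_c_def dn_lam lrecD assms)
qed

lemma dn_nth:
  assumes "isl l" "i < length (dl l)" shows "dn e (trm (nth_c \<sigma>)) \<cdot> l \<cdot> num i = dl l ! i"
proof -
  let ?e = "e((0, LL (emb \<sigma>)) := l)"
  let ?s = "dn ?e (trm (lam (1, N \<rightarrow>\<^sub>t \<sigma>) (lam (2, \<sigma>) (lam (nv 3)
           (Cst (CRec \<sigma>) \<bullet> V 3 \<bullet> Var (2, \<sigma>)
             \<bullet> lam (4, \<sigma>) (lam (nv 5) (Var (1, N \<rightarrow>\<^sub>t \<sigma>) \<bullet> V 5)))))))"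
  have "foldr (\<lambda>a acc. ?s \<cdot> acc \<cdot> a) xs z \<cdot> num i = xs ! i" if "i < length xs" for xs z
    using that
  proof (induction xs arbitrary: i)
    case (Cons a xs)
    then show ?case by (cases i) (auto simp: recD dn_lam)
  qed simp
  then show ?thesis unfolding nth_c_def using assms by (simp add: lrecD dn_lam)
qed

end

declare fun_upd_apply [simp del] fun_upd_same [simp] fun_upd_other [simp]

section \<open>The axioms for standardness and external induction\<close>

lemma finite_tv: "finite (tv t)" by (induction t) auto

lemma fresh_nv: "nv (LEAST i. nv i \<notin> tv s \<union> tv t) \<notin> tv s \<union> tv t"
proof -
  have "\<exists>i. nv i \<notin> tv s \<union> tv t"
  proof (rule ccontr)
    assume "\<not> ?thesis"
    then have "range nv \<subseteq> tv s \<union> tv t" by blast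
    then have "finite (range nv)" using finite_tv finite_subset by blast
    then show False by (rule finite_imageD[THEN infinite_UNIV_nat[THEN notE]]) (auto simp: inj_on_def)
  qed
  then show ?thesis by (rule LeastI_ex)
qed

lemma tv_lam [simp]: "tv (lam x t) = tv t - {x}"
  by (induction t) (auto simp: lam.simps)

lemma tv_zero_tm [simp]: "tv (zero_tm \<sigma>) = {}" by (induction \<sigma>) auto

lemma closed_tv [simp]:
  "tv plus_c = {}" "tv times_c = {}" "tv pred_c = {}" "tv monus_c = {}" "tv pow2_c = {}"
  "tv (len_c \<sigma>) = {}" "tv (nth_c \<sigma>) = {}"
  by (auto simp: plus_c_def times_c_def pred_c_def monus_c_def pow2_c_def len_c_def nth_c_def)

lemma internal_elem [simp]: "internal (elem s t)" by (simp add: elem_def Let_def)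

context model
begin

lemma tsat_elem:
  assumes "vld e" "wt s" "wt t" "ty_of t = Seq (ty_of s)"
  shows "tsat e (elem s t) \<longleftrightarrow> (\<exists>a\<in>set (dl (dn e (trm t))). E (emb (ty_of s)) (dn e (trm s)) a)"
proof -
  define i where "i = nv (LEAST i. nv i \<notin> tv s \<union> tv t)"
  have i: "i \<notin> tv s" "i \<notin> tv t" "snd i = N" using fresh_nv[of s t] by (auto simp: i_def)
  have "E (LL (emb (ty_of s))) (dn e (trm t)) (dn e (trm t))"
    using vld_trm[OF assms(1,3)] assms(4) by simp
  then have l: "isl (dn e (trm t))" by simp
  let ?l = "dl (dn e (trm t))"
  have *: "tsat e (elem s t) \<longleftrightarrow> (\<exists>m. Suc m \<le> length ?l \<and>
     E (emb (ty_of s)) (dn e (trm s)) (dn e (trm (nth_c (ty_of s))) \<cdot> dn e (trm t) \<cdot> num m))"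
  proof -
    show ?thesis
      unfolding elem_def Let_def i_def[symmetric]
      apply (auto simp: i dn_upd dn_len[OF l])
      subgoal for m by (rule exI[of _ "num m"]) simp
      done
  qed
  also have "\<dots> \<longleftrightarrow> (\<exists>m<length ?l. E (emb (ty_of s)) (dn e (trm s)) (?l ! m))"
    by (metis Suc_le_eq dn_nth[OF l])
  also have "\<dots> \<longleftrightarrow> (\<exists>a\<in>set ?l. E (emb (ty_of s)) (dn e (trm s)) a)"
    by (metis in_set_conv_nth)
  finally show ?thesis .
qed

lemma Real_St:
  assumes "tv t = {}" "wt t" shows "Real (St t)"
proof (rule RealI)
  show "ht (rsing (trm t)) (LL (yt (St t)))" unfolding xyt_simps by (rule ht_rsing[OF ht_trm[OF assms(2)]])
  show "fvr (rsing (trm t)) \<subseteq> {(0, xt (St t))}" by (simp add: fvr_trm assms(1))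
  fix e d assume e: "vld e"
  have "dn d (trm t) = dn e (trm t)" by (rule den_closed) (simp add: fvr_trm assms(1))
  then show "\<exists>y\<in>set (dl (dn d (rsing (trm t)))). itp e (St t) (d (0, xt (St t))) y"
    using vld_trm[OF e assms(2)] by simp
qed

lemma Real_St_eq:
  assumes "wff (s \<^bold>= t)" shows "Real (St s \<^bold>\<longrightarrow> s \<^bold>= t \<^bold>\<longrightarrow> St t)"
proof -
  let ?A = "St s \<^bold>\<longrightarrow> s \<^bold>= t \<^bold>\<longrightarrow> St t"
  let ?\<sigma> = "emb (ty_of s)"
  have ty: "ty_of t = ty_of s" using assms by simp
  let ?c = "RV (0, xt ?A)"
  let ?l = "rfst ?c \<star> rzero NN"
  let ?r = "rsing (rpair (rzero NN) (rpair (rzero NN) (RV (1, ?\<sigma>))))"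
  let ?t = "rcons (rzero (yt ?A)) (rbind (1, ?\<sigma>) ?l ?r)"
  have hl: "ht ?l (LL ?\<sigma>)" unfolding xyt_simps by (rule ht_intros)+
  have hr: "ht ?r (LL (yt ?A))" unfolding xyt_simps ty by (rule ht_intros)+
  show ?thesis
  proof (rule RealI)
    show "ht ?t (LL (yt ?A))" by (rule ht_rcons[OF ht_rzero ht_rbind[OF hl hr]])
    show "fvr ?t \<subseteq> {(0, xt ?A)}" by auto
    fix e d assume V: "vld d" and "R (xt ?A) (d (0, xt ?A))"
    let ?x = "d (0, xt ?A)"
    have D: "dl (dn d ?t) = dn d (rzero (yt ?A)) # dl (dn d (rbind (1, ?\<sigma>) ?l ?r))"
      by (rule dl_rcons[OF isl_dn[OF V ht_rbind[OF hl hr]]])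
    show "\<exists>y\<in>set (dl (dn d ?t)). itp e ?A ?x y"
    proof (rule ccontr)
      assume *: "\<not> ?thesis"
      then have "\<not> itp e ?A ?x (dn d (rzero (yt ?A)))" unfolding D by simp
      then obtain v where "v \<in> set (dl (fstD ?x \<cdot> fstD (dn d (rzero (yt ?A)))))"
        "itp e (St s) (fstD (dn d (rzero (yt ?A)))) v" by (rule itp_ImpE)
      then have v: "v \<in> set (dl (dn d ?l))" "E ?\<sigma> (dn e (trm s)) v" by simp_all
      let ?z = "dn (d((1, ?\<sigma>) := v)) (rpair (rzero NN) (rpair (rzero NN) (RV (1, ?\<sigma>))))"
      have "?z \<in> set (dl (dn d (rbind (1, ?\<sigma>) ?l ?r)))"
        by (rule in_rbind[OF V hl hr v(1)]) simp
      then have "\<not> itp e ?A ?x ?z" using * unfolding D by (meson list.set_intros(2))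
      then have 1: "\<not> itp e (s \<^bold>= t \<^bold>\<longrightarrow> St t) (sndD ?x) (sndD ?z)" by (rule itp_ImpN)
      have "\<not> E ?\<sigma> (dn e (trm t)) v" using itp_ImpN[OF 1] ty by simp
      moreover have "E ?\<sigma> (dn e (trm s)) (dn e (trm t))" by (rule itp_ImpE[OF 1]) simp
      ultimately show False using v(2) E_sym E_trans by blast
    qed
  qed
qed

lemma Real_St_app:
  assumes "wt (f \<bullet> s)" shows "Real (St f \<^bold>\<longrightarrow> St s \<^bold>\<longrightarrow> St (f \<bullet> s))"
proof -
  let ?A = "St f \<^bold>\<longrightarrow> St s \<^bold>\<longrightarrow> St (f \<bullet> s)"
  let ?\<sigma> = "emb (ty_of s)" and ?\<tau> = "emb (ty_of (f \<bullet> s))"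
  let ?\<phi> = "?\<sigma> \<rightarrow>\<^sub>r ?\<tau>"
  have ty: "emb (ty_of f) = ?\<phi>" using arg_cong[OF wt_ty[OF assms], of emb] by (simp only: emb.simps)
  let ?c = "RV (0, xt ?A)"
  let ?l = "rfst ?c \<star> rzero NN" and ?m = "rfst (rsnd ?c) \<star> rzero NN"
  let ?p = "rpair (rzero NN) (rpair (rzero NN) (RV (1, ?\<phi>) \<star> RV (2, ?\<sigma>)))"
  let ?k = "rbind (2, ?\<sigma>) ?m (rsing ?p)"
  let ?t = "rcons (rzero (yt ?A)) (rbind (1, ?\<phi>) ?l ?k)"
  have hl: "ht ?l (LL ?\<phi>)" unfolding xyt_simps ty by (rule ht_intros)+
  have hm: "ht ?m (LL ?\<sigma>)" unfolding xyt_simps by (rule ht_intros)+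
  have hr: "ht (rsing ?p) (LL (yt ?A))" unfolding xyt_simps by (rule ht_intros)+
  note hk = ht_rbind[OF hm hr, of 2]
  show ?thesis
  proof (rule RealI)
    show "ht ?t (LL (yt ?A))" by (rule ht_rcons[OF ht_rzero ht_rbind[OF hl hk]])
    show "fvr ?t \<subseteq> {(0, xt ?A)}" by auto
    fix e d assume V: "vld d" and "R (xt ?A) (d (0, xt ?A))"
    let ?x = "d (0, xt ?A)"
    have D: "dl (dn d ?t) = dn d (rzero (yt ?A)) # dl (dn d (rbind (1, ?\<phi>) ?l ?k))"
      by (rule dl_rcons[OF isl_dn[OF V ht_rbind[OF hl hk]]])
    show "\<exists>y\<in>set (dl (dn d ?t)). itp e ?A ?x y"
    proof (rule ccontr)
      assume *: "\<not> ?thesis"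
      then have 1: "\<not> itp e ?A ?x (dn d (rzero (yt ?A)))" unfolding D by simp
      then obtain v where "v \<in> set (dl (fstD ?x \<cdot> fstD (dn d (rzero (yt ?A)))))"
        "itp e (St f) (fstD (dn d (rzero (yt ?A)))) v" by (rule itp_ImpE)
      then have v: "v \<in> set (dl (dn d ?l))" "E ?\<phi> (dn e (trm f)) v" using ty by simp_all
      obtain u where "u \<in> set (dl (fstD (sndD ?x) \<cdot> fstD (sndD (dn d (rzero (yt ?A))))))"
        "itp e (St s) (fstD (sndD (dn d (rzero (yt ?A))))) u" by (rule itp_ImpE[OF itp_ImpN[OF 1]])
      then have u: "u \<in> set (dl (dn d ?m))" "E ?\<sigma> (dn e (trm s)) u" by simp_all
      let ?d1 = "d((1, ?\<phi>) := v)"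
      have V1: "vld ?d1"
        by (rule vld_upd[OF V]) (use E_refl2[OF v(2)] in \<open>simp only: snd_conv\<close>)
      let ?z = "dn (?d1((2, ?\<sigma>) := u)) ?p"
      have "?z \<in> set (dl (dn ?d1 ?k))"
        by (rule in_rbind[OF V1 hm hr]) (use u(1) in simp_all)
      then have "?z \<in> set (dl (dn d (rbind (1, ?\<phi>) ?l ?k)))"
        by (rule in_rbind[OF V hl hk v(1)])
      then have "\<not> itp e ?A ?x ?z" using * unfolding D by (meson list.set_intros(2))
      then have "\<not> itp e (St (f \<bullet> s)) (sndD (sndD ?x)) (sndD (sndD ?z))" by (rule itp_ImpN[OF itp_ImpN])
      then show False using E_ap[OF v(2) u(2)] by simp
    qed
  qed
qed

text \<open>Strategies for \<open>A\<close> form an ordinary type, over which the recursor is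
  available whether or not \<open>A\<close> is internal. The realiser of the step is iterated up to
  each number offered as a candidate for \<open>n\<close>.\<close>

lemma Real_ind:
  assumes n: "snd n = N" and 0: "Real (subst A n Zero)"
    and S: "Real (St (Var n) \<^bold>\<longrightarrow> A \<^bold>\<longrightarrow> subst A n (Succ (Var n)))"
  shows "Real (St (Var n) \<^bold>\<longrightarrow> A)"
proof -
  let ?S = "St (Var n) \<^bold>\<longrightarrow> A \<^bold>\<longrightarrow> subst A n (Succ (Var n))"
  have tn [simp]: "ty_of (Var n) = N" "emb (snd n) = NN" using n by simp_all
  have X: "xt (subst A n Zero) = xt A" "yt (subst A n Zero) = yt A"
    "xt (subst A n (Succ (Var n))) = xt A" "yt (subst A n (Succ (Var n))) = yt A"
    using xt_subst[of Zero n A] xt_subst[of "Succ (Var n)" n A] n by simp_all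
  have sub: "itp e (subst A n Zero) = itp (e(ev n := num 0)) A"
    "itp e (subst A n (Succ (Var n))) = itp (e(ev n := cden p w RSuc \<cdot> e (ev n))) A" for e
    using itp_subst[of Zero n A e] itp_subst[of "Succ (Var n)" n A e]
      free_for_self[of Zero n A] free_for_self[of "Succ (Var n)" n A] n by simp_all
  obtain t0 where t0: "fvr t0 = {}" "ht t0 (xt A \<rightarrow>\<^sub>r LL (yt A))"
    "\<And>e d x. vld e \<Longrightarrow> R (xt A) x \<Longrightarrow> \<exists>y\<in>set (dl (dn d t0 \<cdot> x)). itp e (subst A n Zero) x y"
    using RealE[OF 0] unfolding X by blast
  obtain t1 where t1: "fvr t1 = {}" "ht t1 (xt ?S \<rightarrow>\<^sub>r LL (yt ?S))"
    "\<And>e d x. vld e \<Longrightarrow> R (xt ?S) x \<Longrightarrow> \<exists>y\<in>set (dl (dn d t1 \<cdot> x)). itp e ?S x y"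
    using RealE[OF S] by blast
  let ?f = "xt A \<rightarrow>\<^sub>r LL (yt A)" and ?q = "yt ?S"
  \<comment> \<open>The realiser of the step receives the current number as the only candidate in
    its evidence for \<open>St\<close>, the strategy reached so far, and the challenge to the next
    instance.\<close>
  let ?g = "t1 \<star> rpair (RL (3, NN) (rsing (RV (2, NN)))) (rpair (RV (1, ?f)) (RV (4, xt A)))"
  let ?h = "rsing (rsnd (rsnd (RV (5, ?q))))"
  let ?s = "RL (1, ?f) (RL (2, NN) (RL (4, xt A) (rbind (5, ?q) ?g ?h)))"
  let ?r = "RL (2, NN) (RC (RRec ?f) \<star> RV (2, NN) \<star> t0 \<star> ?s)"
  have hg: "ht ?g (LL ?q)"
    by (rule ht_RA[OF t1(2)]) (unfold xyt_simps X tn emb.simps, (rule ht_intros)+)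
  have hh: "ht ?h (LL (yt A))" unfolding xyt_simps X by (rule ht_intros)+
  have hr: "ht ?r (NN \<rightarrow>\<^sub>r ?f)"
    by (rule ht_RL, rule ht_RA, rule ht_RA, rule ht_RA, rule ht_RC, simp, rule ht_RV, rule t0(2),
      (rule ht_RL)+, rule ht_rbind[OF hg hh])
  have fr: "fvr ?r = {}" using t0(1) t1(1) by auto
  have rec: "vld d \<Longrightarrow> R ?f (dn d ?r \<cdot> num m) \<and> (\<forall>e x. vld e \<longrightarrow> R (xt A) x \<longrightarrow>
      (\<exists>y\<in>set (dl (dn d ?r \<cdot> num m \<cdot> x)). itp (e(ev n := num m)) A x y))" for d m
  proof (induction m)
    case 0
    then show ?case using t0(3)[unfolded sub] R_closed[OF t0(1,2)] by (simp add: recD)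
  next
    case (Suc m)
    note Vd0 = Suc.prems and Suc = Suc.IH[OF Suc.prems]
    let ?rm = "dn d ?r \<cdot> num m"
    have R1: "R ?f (dn d ?r \<cdot> num (Suc m))" by (rule R_ap[OF R_closed[OF fr hr] R_num])
    have "\<exists>y\<in>set (dl (dn d ?r \<cdot> num (Suc m) \<cdot> x)). itp (e(ev n := num (Suc m))) A x y"
      if e: "vld e" and x: "R (xt A) x" for e x
    proof -
      let ?d = "d((2, NN) := num m, (1, ?f) := ?rm, (4, xt A) := x)"
      let ?e = "e(ev n := num m)"
      have Ve: "vld ?e" using vld_ev[OF e, of n "num m"] by simp
      have Rc: "R (xt ?S) (dn ?d (rpair (RL (3, NN) (rsing (RV (2, NN)))) (rpair (RV (1, ?f)) (RV (4, xt A)))))"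
      proof (rule R_dn)
        show "ht (rpair (RL (3, NN) (rsing (RV (2, NN)))) (rpair (RV (1, ?f)) (RV (4, xt A)))) (xt ?S)"
          unfolding xyt_simps X tn emb.simps by (rule ht_intros)+
      qed (use Suc x R_num in auto)
      obtain y where y: "y \<in> set (dl (dn ?d ?g))"
        "itp ?e ?S (dn ?d (rpair (RL (3, NN) (rsing (RV (2, NN)))) (rpair (RV (1, ?f)) (RV (4, xt A))))) y"
        using t1(3)[OF Ve Rc, of ?d] by auto
      have Rg: "R (LL ?q) (dn ?d ?g)"
        by (rule R_dn[OF hg]) (use t1(1) Suc x R_num in auto)
      have "R (xt A) (fstD (sndD y))"
        using R_fst[OF R_snd[OF R_dl[OF Rg y(1), unfolded xyt_simps]]] .
      then obtain a where a: "a \<in> set (dl (?rm \<cdot> fstD (sndD y)))" "itp ?e A (fstD (sndD y)) a"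
        using Suc e by blast
      have "itp ?e (A \<^bold>\<longrightarrow> subst A n (Succ (Var n))) (pr ?rm x) (sndD y)"
        using itp_ImpD[OF y(2), of "num m"] by simp
      from itp_ImpD[OF this, of a] have res: "itp (e(ev n := num (Suc m))) A x (sndD (sndD y))"
        using a by (simp add: sub)
      have D: "dn d ?r \<cdot> num (Suc m) \<cdot> x = dn ?d (rbind (5, ?q) ?g ?h)"
      proof -
        have "dn (d((2, NN) := num (Suc m))) t0 = dn (d((2, NN) := num m)) t0"
          "dn (d((2, NN) := num (Suc m))) ?s = dn (d((2, NN) := num m)) ?s"
          using t0(1) t1(1) by (auto intro!: den_cong)
        then have "dn d ?r \<cdot> num (Suc m) \<cdot> x = dn (d((2, NN) := num m)) ?s \<cdot> ?rm \<cdot> num m \<cdot> x"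
          by (simp only: den_RL den_simps recD recn.simps fun_upd_same)
        also have "\<dots> = dn (d((2, NN) := num m, (1, ?f) := ?rm, (2, NN) := num m, (4, xt A) := x)) (rbind (5, ?q) ?g ?h)"
          by (simp only: den_RL)
        also have "d((2, NN) := num m, (1, ?f) := ?rm, (2, NN) := num m, (4, xt A) := x) = ?d"
          by (rule ext) (simp add: fun_upd_apply)
        finally show ?thesis .
      qed
      have "E ?f ?rm ?rm" "E (xt A) x x" using Suc x R_E by blast+
      then have Vd: "vld ?d"
        by (intro vld_upd Vd0) (simp_all only: snd_conv E.simps(1), simp)
      have "sndD (sndD y) \<in> set (dl (dn ?d (rbind (5, ?q) ?g ?h)))"
        by (rule in_rbind[OF Vd hg hh y(1)]) simp
      with res show ?thesis unfolding D by blast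
    qed
    then show ?case using R1 by blast
  qed
  let ?A = "St (Var n) \<^bold>\<longrightarrow> A"
  let ?c = "RV (0, xt ?A)"
  let ?l = "rfst ?c \<star> rzero NN" and ?m = "?r \<star> RV (1, NN) \<star> rsnd ?c"
  let ?p = "rpair (rzero NN) (RV (3, yt A))"
  let ?k = "rbind (3, yt A) ?m (rsing ?p)"
  let ?t = "rcons (rzero (yt ?A)) (rbind (1, NN) ?l ?k)"
  have hl: "ht ?l (LL NN)" unfolding xyt_simps tn emb.simps by (rule ht_intros)+
  have hm: "ht ?m (LL (yt A))" by (rule ht_RA[OF ht_RA[OF hr ht_RV]]) (unfold xyt_simps, (rule ht_intros)+)
  have hp: "ht (rsing ?p) (LL (yt ?A))" unfolding xyt_simps by (rule ht_intros)+
  note hk = ht_rbind[OF hm hp, of 3]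
  show ?thesis
  proof (rule RealI)
    show "ht ?t (LL (yt ?A))" by (rule ht_rcons[OF ht_rzero ht_rbind[OF hl hk]])
    show "fvr ?t \<subseteq> {(0, xt ?A)}" using fr by auto
    fix e d assume Ve: "vld e" and V: "vld d" and x: "R (xt ?A) (d (0, xt ?A))"
    let ?x = "d (0, xt ?A)"
    have D: "dl (dn d ?t) = dn d (rzero (yt ?A)) # dl (dn d (rbind (1, NN) ?l ?k))"
      by (rule dl_rcons[OF isl_dn[OF V ht_rbind[OF hl hk]]])
    show "\<exists>y\<in>set (dl (dn d ?t)). itp e ?A ?x y"
    proof (rule ccontr)
      assume *: "\<not> ?thesis"
      then have 1: "\<not> itp e ?A ?x (dn d (rzero (yt ?A)))" unfolding D by simp
      then obtain v where "v \<in> set (dl (fstD ?x \<cdot> fstD (dn d (rzero (yt ?A)))))"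
        "itp e (St (Var n)) (fstD (dn d (rzero (yt ?A)))) v" by (rule itp_ImpE)
      then obtain m where v: "num m \<in> set (dl (dn d ?l))" "e (ev n) = num m" by auto
      let ?d1 = "d((1, NN) := num m)"
      have V1: "vld ?d1" by (rule vld_upd[OF V]) simp
      have "dn ?d1 ?r = dn d ?r" by (rule den_closed[OF fr])
      moreover have "e(ev n := num m) = e" using v(2) by (metis fun_upd_triv)
      moreover have "R (xt A) (sndD ?x)" using R_snd[OF x[unfolded xyt_simps]] by simp
      ultimately obtain y where y: "y \<in> set (dl (dn ?d1 ?m))" "itp e A (sndD ?x) y"
        using rec[OF V, of m] Ve by fastforce
      let ?z = "dn (?d1((3, yt A) := y)) ?p"
      have "?z \<in> set (dl (dn ?d1 ?k))" by (rule in_rbind[OF V1 hm hp y(1)]) simp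
      then have "?z \<in> set (dl (dn d (rbind (1, NN) ?l ?k)))"
        by (rule in_rbind[OF V hl hk v(1)])
      then have "\<not> itp e ?A ?x ?z" using * unfolding D by (meson list.set_intros(2))
      from itp_ImpN[OF this] show False using y(2) by simp
    qed
  qed
qed

end

lemma Seq_neq: "Seq \<sigma> \<noteq> \<sigma>" by (induction \<sigma>) auto

lemma tsubst_fresh: "x \<notin> tv t \<Longrightarrow> tsubst t x u = t" by (induction t) auto

lemma subst_fresh: "x \<notin> fv A \<Longrightarrow> subst A x u = A"
  by (induction A) (auto simp: tsubst_fresh)

lemma tv_tsubst: "x \<notin> tv u \<Longrightarrow> x \<notin> tv (tsubst t x u)" by (induction t) auto

lemma fv_subst: "x \<notin> tv u \<Longrightarrow> x \<notin> fv (subst A x u)"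
  by (induction A) (auto simp: tv_tsubst)

context model
begin

text \<open>\<open>Real_ind\<close> is only a rule. It is applied to the formula with the premises
  \<open>?C\<close> of the axiom put in front, in which \<open>n\<close> is not free.\<close>

lemma Real_external_induction:
  assumes n: "snd n = N"
    and wf: "wff (subst A n Zero \<^bold>\<and> ForallSt n (A \<^bold>\<longrightarrow> subst A n (Succ (Var n))) \<^bold>\<longrightarrow> ForallSt n A)"
  shows "Real (subst A n Zero \<^bold>\<and> ForallSt n (A \<^bold>\<longrightarrow> subst A n (Succ (Var n))) \<^bold>\<longrightarrow> ForallSt n A)"
proof -
  let ?A1 = "subst A n (Succ (Var n))"
  let ?S = "St (Var n) \<^bold>\<longrightarrow> A \<^bold>\<longrightarrow> ?A1"
  let ?C = "subst A n Zero \<^bold>\<and> Forall n ?S"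
  let ?P = "?C \<^bold>\<longrightarrow> A"
  have w: "wff A" "wff (subst A n Zero)" "wff ?A1" "wff ?C" "wff ?S" using wf by auto
  have nC: "n \<notin> fv ?C" using fv_subst[of n Zero A] by auto
  have sub: "subst ?P n u = (?C \<^bold>\<longrightarrow> subst A n u)" for u
    using subst_fresh[OF nC, of u] by simp
  have "Real (subst ?P n Zero)" unfolding sub
    by (rule proves_Th, rule proves_taut) (use w in auto)
  moreover have "Real (St (Var n) \<^bold>\<longrightarrow> ?P \<^bold>\<longrightarrow> subst ?P n (Succ (Var n)))" unfolding sub
    by (rule proves_Th, rule proves_taut1[OF proves_spec[OF w(5), of _ n]]) (use w in auto)
  ultimately have "Real (St (Var n) \<^bold>\<longrightarrow> ?P)" by (rule Real_ind[OF n])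
  then have "Th \<^bold>\<turnstile> St (Var n) \<^bold>\<longrightarrow> ?P" by (rule Th_proves) (use w in auto)
  then have "Th \<^bold>\<turnstile> ?C \<^bold>\<longrightarrow> St (Var n) \<^bold>\<longrightarrow> A" by (rule proves_taut1) (use w in auto)
  then have "Th \<^bold>\<turnstile> ?C \<^bold>\<longrightarrow> ForallSt n A"
    by (rule proves_Forall_imp) (use w nC in auto)
  then show ?thesis by (rule proves_Th)
qed

lemma tsat_elem_Var:
  assumes "vld e" "snd v = Seq (snd z)" "e (ev v) = W" "e (ev z) = z0" 
  shows "tsat e (elem (Var z) (Var v)) \<longleftrightarrow> (\<exists>a\<in>set (dl W). E (emb (snd z)) z0 a)"
  using tsat_elem[OF assms(1), of "Var z" "Var v"] assms(2-) by simp

section \<open>Idealisation\<close>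

text \<open>A strategy against the conclusion answers with lists that do not depend on
  \<open>y\<close>, and their entries offer finitely many standard candidates for \<open>z\<close>.
  All of these are gathered in one definable list \<open>?W\<close> before any \<open>y\<close> is
  known. The premise at \<open>?W\<close> gives a \<open>y0\<close> suitable for every candidate,
  and at this \<open>y0\<close> the strategy fails.\<close>

lemma Real_idealisation:
  assumes A: "internal A" and yz: "y \<noteq> z" and w: "snd v = Seq (snd z)" "v \<notin> fv A" "v \<noteq> y"
  shows "Real (ForallSt v (Exists y (Forall z (elem (Var z) (Var v) \<^bold>\<longrightarrow> A))) \<^bold>\<longrightarrow> Exists y (ForallSt z A))"
proof -
  define el where "el = elem (Var z) (Var v)"
  let ?B = "Exists y (Forall z (el \<^bold>\<longrightarrow> A))"
  let ?P = "ForallSt v ?B"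
  let ?D = "ForallSt z A"
  let ?C = "Forall y (Neg ?D)"
  let ?A = "?P \<^bold>\<longrightarrow> Neg ?C"
  let ?\<sigma> = "emb (snd z)"
  have tw: "emb (ty_of (Var v)) = LL ?\<sigma>" "emb (snd v) = LL ?\<sigma>" "ty_of (Var z) = snd z"
    using w(1) by simp_all
  let ?c = "RV (0, xt ?A)"
  let ?K = "rfst (rsnd ?c)"
  let ?cC = "rpair (RL (1, xt ?D) (rsing (rsing (rpair (rzero NN) (crs A))))) (rzero NN)"
  let ?l = "?K \<star> ?cC"
  let ?dt = "xt ?D \<times>\<^sub>r NN"
  let ?m = "rfst (rfst (RV (2, ?dt))) \<star> rzero NN"
  let ?k = "rbind (2, ?dt) (RV (1, LL ?dt)) ?m"
  let ?w = "rbind (1, LL ?dt) ?l ?k"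
  let ?cP = "rpair (RL (1, NN) (rsing ?w)) (cch ?B)"
  let ?t = "rsing (rpair ?cP (rpair ?cC (rzero NN)))"
  have hcC: "ht ?cC (xt ?C)" unfolding xyt_simps tw by (rule ht_crs ht_intros)+
  have hl: "ht ?l (LL (LL ?dt))"
    by (rule ht_RA[OF _ hcC]) (unfold xyt_simps tw, (rule ht_intros)+)
  have hm: "ht ?m (LL ?\<sigma>)" unfolding xyt_simps tw by (rule ht_intros)+
  have hv: "ht (RV (1, LL ?dt)) (LL ?dt)" by (rule ht_RV)
  note hk = ht_rbind[OF hv hm, of 2]
  note hw = ht_rbind[OF hl hk, of 1]
  have xP: "xt ?P = (NN \<rightarrow>\<^sub>r LL (LL ?\<sigma>)) \<times>\<^sub>r xt ?B" using tw by simp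
  have hcP: "ht ?cP (xt ?P)"
    unfolding xP by (rule ht_rpair[OF ht_RL[OF ht_rsing[OF hw]] ht_cch])
  have ht: "ht ?t (LL (yt ?A))"
    unfolding xyt_simps(8)[of ?P] by (rule ht_rsing[OF ht_rpair[OF hcP]]) 
      (unfold xyt_simps(8)[of ?C], rule ht_rpair[OF hcC], unfold xyt_simps, rule ht_rzero)
  show ?thesis
    unfolding el_def[symmetric]
  proof (rule RealI)
    show "ht ?t (LL (yt ?A))" by (rule ht)
    show "fvr ?t \<subseteq> {(0, xt ?A)}" by auto
    fix e d assume Ve: "vld e" and V: "vld d" and x: "R (xt ?A) (d (0, xt ?A))"
    let ?x = "d (0, xt ?A)"
    let ?W = "dn d ?w"
    have EW: "E (LL ?\<sigma>) ?W ?W" by (rule E_dn[OF V hw])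
    have inW: "a \<in> set (dl ?W)"
      if "g \<in> set (dl (dn d ?l))" "q \<in> set (dl g)" "a \<in> set (dl (fstD (fstD q) \<cdot> num 0))" for g q a
    proof -
      let ?d1 = "d((1, LL ?dt) := g)"
      have V1: "vld ?d1" by (rule vld_upd[OF V]) (use E_dl[OF E_dn[OF V hl] that(1)] in \<open>simp only: snd_conv\<close>)
      show ?thesis
        by (rule in_rbind[OF V hl hk that(1)], rule in_rbind[OF V1 hv hm]) (use that(2,3) in simp_all)
    qed
    show "\<exists>y\<in>set (dl (dn d ?t)). itp e ?A ?x y"
    proof (rule ccontr)
      assume *: "\<not> ?thesis"
      let ?z = "dn d (rpair ?cP (rpair ?cC (rzero NN)))"
      have 1: "\<not> itp e ?A ?x ?z" using * by (simp only: dl_rsing) simp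
      obtain a where "itp e ?P (fstD ?z) a" by (rule itp_ImpE[OF 1])
      then have a: "itp e ?P (dn d ?cP) a" by simp
      have "\<exists>b\<in>set (dl a). itp (e(ev v := ?W)) (St (Var v) \<^bold>\<longrightarrow> ?B) (dn d ?cP) b"
        using a EW unfolding itp_simps tw by blast
      then obtain b where b: "itp (e(ev v := ?W)) (St (Var v) \<^bold>\<longrightarrow> ?B) (dn d ?cP) b" by blast
      have "dn (d((1, NN) := fstD b)) ?w = ?W" by (rule den_cong) auto
      then have "itp (e(ev v := ?W)) ?B (sndD (dn d ?cP)) (sndD b)"
        using itp_ImpD[OF b, of ?W] EW tw by simp
      then have "tsat (e(ev v := ?W)) ?B"
        using itp_cch[of ?B "e(ev v := ?W)" d "sndD b"] A by (simp add: el_def)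
      then obtain y0 where y0: "E (emb (snd y)) y0 y0"
        "\<And>z0. E ?\<sigma> z0 z0 \<Longrightarrow> tsat (e(ev v := ?W, ev y := y0, ev z := z0)) el \<Longrightarrow>
          tsat (e(ev v := ?W, ev y := y0, ev z := z0)) A"
        by auto
      have sat: "tsat (e(ev y := y0, ev z := z0)) A" if "E ?\<sigma> z0 u" "u \<in> set (dl ?W)" for z0 u
      proof -
        let ?e = "e(ev v := ?W, ev y := y0, ev z := z0)"
        have z0: "E ?\<sigma> z0 z0" using that(1) E_refl1 by blast
        have "v \<noteq> z" using w(1) Seq_neq by metis
        then have ew: "?e (ev v) = ?W" using w(3) by simp
        have vE: "vld ?e" using Ve EW y0(1) z0 tw by (intro vld_ev) auto
        have el: "tsat e' el \<longleftrightarrow> tsat e' (elem (Var z) (Var v))" for e' by (simp add: el_def)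
        have "tsat ?e el \<longleftrightarrow> (\<exists>a\<in>set (dl ?W). E ?\<sigma> z0 a)"
          unfolding el by (rule tsat_elem_Var[OF vE w(1)], rule ew, rule fun_upd_same)
        then have "tsat ?e el" using that by blast
        then have "tsat ?e A" using y0(2) z0 by blast
        moreover have "tsat ?e A \<longleftrightarrow> tsat (e(ev y := y0, ev z := z0)) A"
        proof (rule tsat_cong[OF A])
          fix u assume "u \<in> fv A"
          then have "u \<noteq> v" using w(2) by blast
          then show "?e (ev u) = (e(ev y := y0, ev z := z0)) (ev u)" by (simp only: fun_upd_apply ev_inject if_False)
        qed
        ultimately show ?thesis by simp
      qed
      obtain g where "g \<in> set (dl (fstD (sndD ?x) \<cdot> fstD (sndD ?z)))" "itp e ?C (fstD (sndD ?z)) g"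
        by (rule itp_ImpE[OF itp_ImpN[OF 1]])
      then have g: "g \<in> set (dl (dn d ?l))" "itp e ?C (dn d ?cC) g" by simp_all
      then obtain q where q: "q \<in> set (dl g)" "itp (e(ev y := y0)) (Neg ?D) (dn d ?cC) q"
        using y0(1) by auto
      have "itp (e(ev y := y0)) ?D (fstD q) (dn (d((1, xt ?D) := fstD q)) (rsing (rpair (rzero NN) (crs A))))"
        unfolding itp_simps(5) dl_rsing
      proof (intro allI impI, rule bexI)
        fix z0 assume "E (emb (snd z)) z0 z0"
        let ?r = "dn (d((1, xt ?D) := fstD q)) (rpair (rzero NN) (crs A))"
        show "itp (e(ev y := y0, ev z := z0)) (St (Var z) \<^bold>\<longrightarrow> A) (fstD q) ?r"
        proof (rule ccontr)
          assume "\<not> ?thesis"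
          then obtain u where u: "u \<in> set (dl (fstD (fstD q) \<cdot> fstD ?r))"
            "itp (e(ev y := y0, ev z := z0)) (St (Var z)) (fstD ?r) u"
            "\<not> itp (e(ev y := y0, ev z := z0)) A (sndD (fstD q)) (sndD ?r)" by (rule itp_ImpE)
          have "u \<in> set (dl ?W)" by (rule inW[OF g(1) q(1)]) (use u(1) in simp)
          then have "tsat (e(ev y := y0, ev z := z0)) A" using sat[of z0 u] u(2) by simp
          then show False using u(3) itp_crs[OF A] by simp
        qed
      qed simp
      with itp_ImpD[OF q(2), of "dn (d((1, xt ?D) := fstD q)) (rsing (rpair (rzero NN) (crs A)))"]
      show False by simp
    qed
  qed
qed

end

section \<open>Choice and transfer\<close>

lemma Fn_neq: "\<sigma> \<rightarrow>\<^sub>t \<tau> \<noteq> \<sigma>"  "\<sigma> \<rightarrow>\<^sub>t Seq \<tau> \<noteq> \<tau>"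
proof -
  show "\<sigma> \<rightarrow>\<^sub>t \<tau> \<noteq> \<sigma>" by (induction \<sigma> arbitrary: \<tau>) auto
  have "size (\<sigma> \<rightarrow>\<^sub>t Seq \<tau>) > size \<tau>" by simp
  then show "\<sigma> \<rightarrow>\<^sub>t Seq \<tau> \<noteq> \<tau>" by force
qed

context model
begin

lemma itp_ForallE:
  assumes "itp e (Forall v A) x y" "E (emb (snd v)) a a"
  obtains b where "b \<in> set (dl y)" "itp (e(ev v := a)) A x b"
  using assms by auto

text \<open>\<open>F\<close> sends \<open>x\<close> to the list of all candidates for
  \<open>y\<close> which the strategy for the premise offers at \<open>x\<close>. This is a
  definable functional of the given challenge. What has to be known about the internal formulas is
  isolated in \<open>key\<close>, so that the elimination of existential abbreviations can be done
  separately.\<close>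

lemma Real_choice_aux:
  fixes x y F :: var
  assumes B: "internal B" and C: "internal C" and F: "snd F = snd x \<rightarrow>\<^sub>t Seq (snd y)"
    and key: "\<And>e f a x0 y0 u. vld e \<Longrightarrow> E (emb (snd F)) f f \<Longrightarrow> E (emb (snd x)) x0 a \<Longrightarrow>
      E (emb (snd y)) y0 u \<Longrightarrow> u \<in> set (dl (f \<cdot> a)) \<Longrightarrow> \<not> tsat (e(ev x := a, ev y := y0)) B \<Longrightarrow>
      tsat (e(ev F := f, ev x := x0)) C"
  shows "Real (ForallSt x (Neg (Forall y (St (Var y) \<^bold>\<longrightarrow> B))) \<^bold>\<longrightarrow>
    Neg (Forall F (St (Var F) \<^bold>\<longrightarrow> Neg (ForallSt x C))))"
proof -
  let ?Q = "Forall y (St (Var y) \<^bold>\<longrightarrow> B)"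
  let ?H = "ForallSt x (Neg ?Q)"
  let ?G = "ForallSt x C"
  let ?Z = "Forall F (St (Var F) \<^bold>\<longrightarrow> Neg ?G)"
  let ?A = "?H \<^bold>\<longrightarrow> Neg ?Z"
  let ?\<rho> = "emb (snd x)" and ?\<tau> = "emb (snd y)"
  let ?\<phi> = "?\<rho> \<rightarrow>\<^sub>r LL ?\<tau>"
  have tF: "emb (snd F) = ?\<phi>" using F(1) by simp
  let ?c = "RV (0, xt ?A)"
  let ?q = "rpair (RL (1, xt ?Q) (rsing (rsing (rpair (rzero NN) (crs B))))) (rzero NN)"
  let ?ch = "\<lambda>a. rpair (RL (1, NN) (rsing a)) ?q"
  let ?x = "RV (5, ?\<rho>)"
  let ?gt = "NN \<times>\<^sub>r (xt ?Q \<times>\<^sub>r NN)"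
  let ?l2 = "rfst ?c \<star> ?ch ?x"
  let ?v2 = "RV (2, LL ?gt)"
  let ?l3 = "rfst (rfst (rsnd (RV (3, ?gt)))) \<star> rzero NN"
  let ?b3 = "rbind (3, ?gt) ?v2 ?l3"
  let ?Fb = "rbind (2, LL ?gt) ?l2 ?b3"
  let ?F = "RL (5, ?\<rho>) ?Fb"
  let ?z = "rpair (RL (1, NN) (rsing ?F))
    (rpair (RL (1, xt ?G) (rsing (rsing (rpair (rzero NN) (crs C))))) (rzero NN))"
  let ?zt = "NN \<times>\<^sub>r (xt ?G \<times>\<^sub>r NN)"
  let ?l6 = "rfst (rsnd ?c) \<star> ?z"
  let ?v6 = "RV (6, LL ?zt)"
  let ?l5 = "rfst (rfst (rsnd (RV (7, ?zt)))) \<star> rzero NN"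
  let ?p = "\<lambda>a. rpair (?ch a) (rpair ?z (rzero NN))"
  let ?r5 = "rsing (?p ?x)"
  let ?b5 = "rbind (5, ?\<rho>) ?l5 ?r5"
  let ?b7 = "rbind (7, ?zt) ?v6 ?b5"
  let ?b6 = "rbind (6, LL ?zt) ?l6 ?b7"
  let ?t = "rcons (?p (rzero ?\<rho>)) ?b6"
  have hch: "ht a ?\<rho> \<Longrightarrow> ht (?ch a) (xt ?H)" for a
    unfolding xyt_simps ty_of.simps by (rule ht_crs ht_intros | assumption)+
  have hl2: "ht ?l2 (LL (LL ?gt))"
    by (rule ht_RA[OF _ hch[OF ht_RV]]) (unfold xyt_simps, (rule ht_intros)+)
  have hl3: "ht ?l3 (LL ?\<tau>)" unfolding xyt_simps ty_of.simps by (rule ht_intros)+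
  note hv2 = ht_RV[of 2 "LL ?gt"]
  note hb3 = ht_rbind[OF hv2 hl3, of 3]
  note hFb = ht_rbind[OF hl2 hb3, of 2]
  note hF = ht_RL[OF hFb, of 5 ?\<rho>]
  have hz: "ht ?z (xt ?Z)"
    unfolding xyt_simps ty_of.simps tF
    by (rule hF[unfolded xyt_simps ty_of.simps] ht_crs ht_intros)+
  have hl6: "ht ?l6 (LL (LL ?zt))"
    by (rule ht_RA[OF _ hz]) (unfold xyt_simps, (rule ht_intros)+)
  have hl5: "ht ?l5 (LL ?\<rho>)" unfolding xyt_simps ty_of.simps by (rule ht_intros)+
  note hv6 = ht_RV[of 6 "LL ?zt"]
  have hp: "ht a ?\<rho> \<Longrightarrow> ht (?p a) (yt ?A)" for a
    unfolding xyt_simps(8)[of ?H] xyt_simps(8)[of ?Z] xyt_simps(6)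
    by (rule ht_rpair[OF hch ht_rpair[OF hz ht_rzero]])
  note hr5 = ht_rsing[OF hp[OF ht_RV[of 5]]]
  note hb5 = ht_rbind[OF hl5 hr5, of 5]
  note hb7 = ht_rbind[OF hv6 hb5, of 7]
  note hb6 = ht_rbind[OF hl6 hb7, of 6]
  have fq: "fvr ?q = {}" by auto
  show ?thesis
  proof (rule RealI)
    show "ht ?t (LL (yt ?A))" by (rule ht_rcons[OF hp[OF ht_rzero] hb6])
    show "fvr ?t \<subseteq> {(0, xt ?A)}" by auto
    fix e d assume Ve: "vld e" and V: "vld d" and x: "R (xt ?A) (d (0, xt ?A))"
    define X where "X = d (0, xt ?A)"
    define f where "f = dn d ?F"
    define q where "q = dn d ?q"
    define z where "z = dn d ?z"
    have Ef: "E ?\<phi> f f" unfolding f_def by (rule E_dn[OF V hF])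
    have zf: "dn (d((1, NN) := a)) ?F = f" for a unfolding f_def by (rule den_cong) auto
    have D: "dl (dn d ?t) = dn d (?p (rzero ?\<rho>)) # dl (dn d ?b6)"
      by (rule dl_rcons[OF isl_dn[OF V hb6]])
    show "\<exists>y\<in>set (dl (dn d ?t)). itp e ?A (d (0, xt ?A)) y"
    proof (rule ccontr)
      assume *: "\<not> ?thesis"
      then have 1: "\<not> itp e ?A X (dn d (?p (rzero ?\<rho>)))" unfolding D X_def by simp
      have sz: "fstD (sndD (dn d (?p (rzero ?\<rho>)))) = z" by (simp add: z_def)
      obtain l where "l \<in> set (dl (fstD (sndD X) \<cdot> z))" "itp e ?Z z l"
        using itp_ImpE[OF itp_ImpN[OF 1]] unfolding sz by blast
      then have l: "l \<in> set (dl (dn d ?l6))" "itp e ?Z z l" by (simp_all add: z_def X_def)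
      from l(2) obtain b where b: "b \<in> set (dl l)" "itp (e(ev F := f)) (St (Var F) \<^bold>\<longrightarrow> Neg ?G) z b"
        by (rule itp_ForallE[of _ _ _ _ _ f]) (simp only: tF Ef)
      have "itp (e(ev F := f)) (Neg ?G) (sndD z) (sndD b)"
        by (rule itp_ImpD[OF b(2), of f]) (use Ef tF zf in \<open>simp_all add: z_def\<close>)
      then have nG: "\<not> itp (e(ev F := f)) ?G (fstD (sndD b)) (dn (d((1, xt ?G) := fstD (sndD b))) (rsing (rpair (rzero NN) (crs C))))"
        using itp_ImpD[of "e(ev F := f)" ?G Bot "sndD z" "sndD b" "dn (d((1, xt ?G) := fstD (sndD b))) (rsing (rpair (rzero NN) (crs C)))"]
        by (auto simp: z_def)
      then obtain x0 where x0: "E ?\<rho> x0 x0" "\<not> itp (e(ev F := f, ev x := x0)) (St (Var x) \<^bold>\<longrightarrow> C) (fstD (sndD b))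
          (dn (d((1, xt ?G) := fstD (sndD b))) (rpair (rzero NN) (crs C)))"
        unfolding itp_simps(5) dl_rsing by auto
      obtain a where a: "a \<in> set (dl (fstD (fstD (sndD b)) \<cdot> num 0))" "E ?\<rho> x0 a"
        "\<not> tsat (e(ev F := f, ev x := x0)) C"
        by (rule itp_ImpE[OF x0(2)]) (use itp_crs[OF C] in auto)
      let ?d6 = "d((6, LL ?zt) := l)"
      let ?d7 = "?d6((7, ?zt) := b)"
      let ?d5 = "?d7((5, ?\<rho>) := a)"
      have V6: "vld ?d6" by (rule vld_upd[OF V]) (use E_dl[OF E_dn[OF V hl6] l(1)] in \<open>simp only: snd_conv\<close>)
      have V7: "vld ?d7"
        by (rule vld_upd[OF V6]) (use E_dl[OF E_dn[OF V6 hv6], of b] b(1) in simp)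
      define r where "r = dn ?d5 (?p ?x)"
      have "r \<in> set (dl (dn ?d7 ?b5))"
        unfolding r_def by (rule in_rbind[OF V7 hl5 hr5]) (use a(1) in simp_all)
      then have "r \<in> set (dl (dn ?d6 ?b7))" by (rule in_rbind[OF V6 hv6 hb5, rotated]) (use b(1) in simp)
      then have "r \<in> set (dl (dn d ?b6))" by (rule in_rbind[OF V hl6 hb7 l(1)])
      then have 2: "\<not> itp e ?A X r" using * unfolding D X_def by auto
      let ?da = "d((5, ?\<rho>) := a)"
      have y1: "fstD r = dn ?da (?ch ?x)" 
        unfolding r_def dn_rpair[of _ "?ch ?x"] fstD_pr by (rule den_cong) auto
      have Va: "vld ?da" by (rule vld_upd[OF V]) (use a(2) E_refl2 in auto)
      obtain h where "h \<in> set (dl (fstD X \<cdot> fstD r))" "itp e ?H (fstD r) h" by (rule itp_ImpE[OF 2])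
      then have h: "h \<in> set (dl (dn ?da ?l2))" "itp e ?H (dn ?da (?ch ?x)) h"
        by (simp_all add: X_def y1)
      have "E ?\<rho> a a" using a(2) by (rule E_refl2)
      then obtain g where g: "g \<in> set (dl h)" "itp (e(ev x := a)) (St (Var x) \<^bold>\<longrightarrow> Neg ?Q) (dn ?da (?ch ?x)) g"
        by (rule itp_ForallE[OF h(2)])
      have "itp (e(ev x := a)) (Neg ?Q) (sndD (dn ?da (?ch ?x))) (sndD g)"
        by (rule itp_ImpD[OF g(2), of a]) (use \<open>E ?\<rho> a a\<close> in simp_all)
      then have nQ: "\<not> itp (e(ev x := a)) ?Q (fstD (sndD g)) (dn (?da((1, xt ?Q) := fstD (sndD g))) (rsing (rpair (rzero NN) (crs B))))"
        using itp_ImpD[of "e(ev x := a)" ?Q Bot "sndD (dn ?da (?ch ?x))" "sndD g" "dn (?da((1, xt ?Q) := fstD (sndD g))) (rsing (rpair (rzero NN) (crs B)))"]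
        by auto
      then obtain y0 where y0: "E ?\<tau> y0 y0" "\<not> itp (e(ev x := a, ev y := y0)) (St (Var y) \<^bold>\<longrightarrow> B) (fstD (sndD g))
          (dn (?da((1, xt ?Q) := fstD (sndD g))) (rpair (rzero NN) (crs B)))"
        unfolding itp_simps(5) dl_rsing by auto
      obtain u where u: "u \<in> set (dl (fstD (fstD (sndD g)) \<cdot> num 0))" "E ?\<tau> y0 u"
        "\<not> tsat (e(ev x := a, ev y := y0)) B"
        by (rule itp_ImpE[OF y0(2)]) (use itp_crs[OF B] in auto)
      let ?d2 = "?da((2, LL ?gt) := h)"
      have V2: "vld ?d2" by (rule vld_upd[OF Va]) (use E_dl[OF E_dn[OF Va hl2] h(1)] in \<open>simp only: snd_conv\<close>)
      have "u \<in> set (dl (dn ?d2 ?b3))"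
        by (rule in_rbind[OF V2 hv2 hl3]) (use g(1) u(1) in simp_all)
      then have "u \<in> set (dl (dn ?da ?Fb))" by (rule in_rbind[OF Va hl2 hb3 h(1)])
      then have "u \<in> set (dl (f \<cdot> a))" unfolding f_def by simp
      then show False using key[OF Ve _ a(2) u(2) _ u(3), of f] Ef tF a(3) by simp
    qed
  qed
qed

lemma list_all2_E_ex:
  "list_all2 (E \<sigma>) xs ys \<Longrightarrow> u \<in> set ys \<Longrightarrow> \<exists>b\<in>set xs. E \<sigma> b u"
  by (metis in_set_conv_nth list_all2_conv_all_nth)

lemma Real_HAC:
  fixes x y F :: var
  assumes A: "internal A" and wA: "wff A" and xy: "x \<noteq> y"
    and F: "snd F = snd x \<rightarrow>\<^sub>t Seq (snd y)" "F \<notin> fv A"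
  shows "Real (ForallSt x (ExistsSt y A) \<^bold>\<longrightarrow>
    ExistsSt F (ForallSt x (Exists y (elem (Var y) (Var F \<bullet> Var x) \<^bold>\<and> A))))"
proof -
  let ?el = "elem (Var y) (Var F \<bullet> Var x)"
  let ?C = "Exists y (?el \<^bold>\<and> A)"
  let ?\<rho> = "emb (snd x)" and ?\<tau> = "emb (snd y)"
  have wt: "wt (Var F \<bullet> Var x)" "ty_of (Var F \<bullet> Var x) = Seq (snd y)" using F by auto
  have Fxy: "F \<noteq> x" "F \<noteq> y" using F(1) Fn_neq by metis+
  have w: "wff ?el"
    using F(1) by (simp add: elem_def Let_def)
  have "Real (ForallSt x (Neg (Forall y (St (Var y) \<^bold>\<longrightarrow> Neg A))) \<^bold>\<longrightarrow>
    Neg (Forall F (St (Var F) \<^bold>\<longrightarrow> Neg (ForallSt x ?C))))"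
  proof (rule Real_choice_aux[OF _ _ F(1)])
    fix e f a x0 y0 u
    assume e: "vld e" "E (emb (snd F)) f f" "E ?\<rho> x0 a" "E ?\<tau> y0 u" "u \<in> set (dl (f \<cdot> a))"
      "\<not> tsat (e(ev x := a, ev y := y0)) (Neg A)"
    let ?e = "e(ev F := f, ev x := x0, ev y := y0)"
    have E: "E ?\<rho> x0 x0" "E ?\<rho> a a" "E ?\<tau> y0 y0" using e E_refl1 E_refl2 by blast+
    have vE: "vld ?e" by (intro vld_ev e(1,2) E)
    \<comment> \<open>The object \<open>x0\<close> is only equal to the candidate \<open>a\<close>,
      so the entry found in \<open>f \<cdot> a\<close> has to be transported to
      \<open>f \<cdot> x0\<close>.\<close>
    have "E (LL ?\<tau>) (f \<cdot> x0) (f \<cdot> a)" using e(2,3) F(1) by (auto simp del: E.simps(4))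
    then have "list_all2 (E ?\<tau>) (dl (f \<cdot> x0)) (dl (f \<cdot> a))" by simp
    then obtain b where b: "b \<in> set (dl (f \<cdot> x0))" "E ?\<tau> b u" using list_all2_E_ex e(5) by blast
    have "dn ?e (trm (Var F \<bullet> Var x)) = f \<cdot> x0" "dn ?e (trm (Var y)) = y0"
      using xy Fxy by (simp_all add: fun_upd_apply)
    moreover have "E ?\<tau> y0 b" using e(4) b(2) E_sym E_trans by blast
    moreover have "tsat ?e ?el \<longleftrightarrow> (\<exists>a\<in>set (dl (dn ?e (trm (Var F \<bullet> Var x)))). E (emb (ty_of (Var y))) (dn ?e (trm (Var y))) a)"
      by (rule tsat_elem[OF vE _ wt(1)]) (use wt(2) in auto)
    ultimately have 1: "tsat ?e ?el" using b(1) by (simp only: ty_of.simps) blast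
    have "tsat ?e A \<longleftrightarrow> tsat (e(ev x := x0, ev y := y0)) A"
    proof (rule tsat_cong[OF A])
      fix v assume "v \<in> fv A"
      then have "v \<noteq> F" using F(2) by blast
      then show "?e (ev v) = (e(ev x := x0, ev y := y0)) (ev v)" by (simp only: fun_upd_apply ev_inject if_False)
    qed
    also have "\<dots> \<longleftrightarrow> tsat (e(ev x := a, ev y := y0)) A"
      by (rule tsat_eqv[OF wA]) (intro eqv_upd eqv_refl e(1), use e(3) E in simp_all)
    finally have 2: "tsat ?e A" using e(6) by simp
    show "tsat (e(ev F := f, ev x := x0)) ?C" using 1 2 E(3) by auto
  qed (use A in simp_all)
  note R1 = this
  let ?S = "\<lambda>v B. St (Var v) \<^bold>\<longrightarrow> B"
  have wn: "wff (?S y (Neg A))" "wff (Neg (St (Var y) \<^bold>\<and> A))" "wff ?C" using wA w by simp_all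
  have a: "Th \<^bold>\<turnstile> Forall y (?S y (Neg A)) \<^bold>\<longrightarrow> Forall y (Neg (St (Var y) \<^bold>\<and> A))"
    by (rule proves_all_mono[OF proves_taut]) (use wn in auto)
  have b: "Th \<^bold>\<turnstile> ForallSt x (ExistsSt y A) \<^bold>\<longrightarrow> ForallSt x (Neg (Forall y (?S y (Neg A))))"
    by (rule proves_all_mono[OF proves_taut1[OF a]]) (use wn in auto)
  have c: "Th \<^bold>\<turnstile> Forall F (Neg (St (Var F) \<^bold>\<and> ForallSt x ?C)) \<^bold>\<longrightarrow> Forall F (?S F (Neg (ForallSt x ?C)))"
    by (rule proves_all_mono[OF proves_taut]) (use wn in auto)
  have "Th \<^bold>\<turnstile> ForallSt x (ExistsSt y A) \<^bold>\<longrightarrow> Neg (Forall F (?S F (Neg (ForallSt x ?C))))"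
    by (rule proves_taut2[OF b Th_proves[OF R1]]) (use wn in auto)
  then have "Th \<^bold>\<turnstile> ForallSt x (ExistsSt y A) \<^bold>\<longrightarrow> ExistsSt F (ForallSt x ?C)"
    by (rule proves_taut2[OF _ c]) (use wn in auto)
  then show ?thesis by (rule proves_Th)
qed

text \<open>If the conclusion fails, the function has a zero and the functional \<open>\<mu>\<close>
  finds one, which is a standard number at which the premise is false. The name of the number
  variable is left open because transfer is needed under quantifiers with other names in
  \<open>sq_transfer\<close>.\<close>

lemma Real_TRANS_var:
  "Real (ForallSt (0, T1) (ForallSt (nv k) (Neg (Var (0, T1) \<bullet> V k \<^bold>= Zero)) \<^bold>\<longrightarrow>
     Forall (nv k) (Neg (Var (0, T1) \<bullet> V k \<^bold>= Zero))))"
proof -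
  let ?f = "(0, T1)"
  let ?I = "Neg (Var ?f \<bullet> V k \<^bold>= Zero)"
  let ?Q = "ForallSt (nv k) ?I" and ?J = "Forall (nv k) ?I"
  let ?A = "ForallSt ?f (?Q \<^bold>\<longrightarrow> ?J)"
  let ?c = "RV (0, xt ?A)"
  let ?ft = "NN \<rightarrow>\<^sub>r NN"
  let ?l = "rfst ?c \<star> rzero NN"
  let ?q = "rpair (RL (2, NN) (rsing (RC RMu \<star> RV (1, ?ft)))) (cch ?I)"
  let ?p = "rpair (rzero NN) (rpair ?q (crs ?J))"
  let ?dt = "NN \<times>\<^sub>r xt ?Q \<times>\<^sub>r yt ?J"
  let ?b = "rbind (1, ?ft) ?l (rsing ?p)"
  let ?w = "rcons (rzero ?dt) ?b"
  let ?t = "rsing ?w"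
  have iI: "internal ?I" "internal ?J" by simp_all
  have xA: "xt ?A = (NN \<rightarrow>\<^sub>r LL ?ft) \<times>\<^sub>r (xt ?Q \<rightarrow>\<^sub>r LL (yt ?Q)) \<times>\<^sub>r xt ?J" "yt ?A = LL ?dt"
    "xt ?Q = (NN \<rightarrow>\<^sub>r LL NN) \<times>\<^sub>r xt ?I" by simp_all
  have hMu: "ht (RC RMu \<star> RV (1, ?ft)) NN" by (rule ht_RA[OF ht_RC ht_RV]) simp
  have hl: "ht ?l (LL ?ft)" unfolding xA by (rule ht_intros)+
  have hp: "ht ?p ?dt" unfolding xA by (rule hMu ht_cch[of ?I] ht_crs[of ?J] ht_rzero ht_rsing ht_rpair ht_RL)+
  note hb = ht_rbind[OF hl ht_rsing[OF hp]]
  have "Real ?A"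
  proof (rule RealI)
    show "ht ?t (LL (yt ?A))" unfolding xA(2) by (rule ht_rsing[OF ht_rcons[OF ht_rzero hb]])
    show "fvr ?t \<subseteq> {(0, xt ?A)}" by auto
    fix e d assume Ve: "vld e" and V: "vld d" and "R (xt ?A) (d (0, xt ?A))"
    define X where "X = d (0, xt ?A)"
    have D: "dl (dn d ?w) = dn d (rzero ?dt) # dl (dn d ?b)"
      by (rule dl_rcons[OF isl_dn[OF V hb]])
    show "\<exists>y\<in>set (dl (dn d ?t)). itp e ?A (d (0, xt ?A)) y"
      unfolding X_def[symmetric] itp_simps(5) dl_rsing
    proof (rule bexI[of _ "dn d ?w"], intro allI impI)
      fix f assume f: "E (emb (snd ?f)) f f"
      let ?e = "e(ev ?f := f)"
      show "\<exists>y\<in>set (dl (dn d ?w)). itp ?e (St (Var ?f) \<^bold>\<longrightarrow> ?Q \<^bold>\<longrightarrow> ?J) X y"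
      proof (rule ccontr)
        assume *: "\<not> ?thesis"
        then have "\<not> itp ?e (St (Var ?f) \<^bold>\<longrightarrow> ?Q \<^bold>\<longrightarrow> ?J) X (dn d (rzero ?dt))" unfolding D by auto
        then obtain g where "g \<in> set (dl (fstD X \<cdot> fstD (dn d (rzero ?dt))))"
          "itp ?e (St (Var ?f)) (fstD (dn d (rzero ?dt))) g" by (rule itp_ImpE)
        then have g: "g \<in> set (dl (dn d ?l))" "E ?ft f g" by (simp_all add: X_def)
        let ?d1 = "d((1, ?ft) := g)"
        define y where "y = dn ?d1 ?p"
        have "y \<in> set (dl (dn d ?b))"
          unfolding y_def by (rule in_rbind[OF V hl ht_rsing[OF hp] g(1)]) simp
        then have 1: "\<not> itp ?e (St (Var ?f) \<^bold>\<longrightarrow> ?Q \<^bold>\<longrightarrow> ?J) X y" using * unfolding D by auto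
        have "\<forall>n. \<exists>h. f \<cdot> num n = num h \<and> g \<cdot> num n = num h" using g(2) by auto
        then obtain h where h: "\<And>n. f \<cdot> num n = num (h n)" "\<And>n. g \<cdot> num n = num (h n)" by metis
        have sI: "tsat (?e(ev (nv k) := num n)) ?I \<longleftrightarrow> h n \<noteq> 0" for n
          by (simp add: h)
        have "tsat ?e ?J \<longleftrightarrow> (\<forall>n. tsat (?e(ev (nv k) := num n)) ?I)"
          unfolding tsat_simps(5)[of ?e "nv 0"] by auto
        then have sJ: "tsat ?e ?J \<longleftrightarrow> (\<forall>n. h n \<noteq> 0)" by (simp only: sI)
        have y: "fstD (sndD y) = dn ?d1 ?q" "sndD (sndD y) = dn ?d1 (crs ?J)" by (simp_all add: y_def)
        have nJ: "\<not> tsat ?e ?J" using itp_ImpN[OF itp_ImpN[OF 1]] itp_crs[OF iI(2)] unfolding y by blast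
        then obtain n where "h n = 0" using sJ by auto
        then have m0: "h (muv h) = 0" unfolding muv_def by (rule LeastI)
        obtain r where r: "itp ?e ?Q (fstD (sndD y)) r"
          by (rule itp_ImpE[OF itp_ImpN[OF 1]])
        have "E (emb (snd (nv k))) (num (muv h)) (num (muv h))" by simp
        with r obtain b where b: "itp (?e(ev (nv k) := num (muv h))) (St (V k) \<^bold>\<longrightarrow> ?I) (dn ?d1 ?q) b"
          unfolding y by (rule itp_ForallE)
        have "itp (?e(ev (nv k) := num (muv h))) ?I (dn ?d1 (cch ?I)) (sndD b)"
          using itp_ImpD[OF b, of "num (muv h)"] muD[of g h p w] h(2) by simp
        then show False using itp_cch[OF iI(1)] sI m0 by blast
      qed
    qed simp
  qed
  then show ?thesis .
qed

lemma Real_TRANS: "Real Pi01_TRANS"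
  using Real_TRANS_var[of 0] by (simp add: Pi01_TRANS_def Let_def)

lemma Real_sysP: "A \<in> sysP \<Longrightarrow> wff A \<Longrightarrow> Real A"
proof (induction rule: sysP.induct)
  case (EPA A)
  then show ?case by (rule Real_EPA)
next
  case (st_eq s t)
  then have w: "wff (St s \<^bold>\<longrightarrow> s \<^bold>= t \<^bold>\<longrightarrow> St t)" by simp
  show ?case
    by (rule proves_Th, rule proves_taut1[OF Th_proves[OF Real_St_eq w]]) (use st_eq in auto)
next
  case (st_closed t)
  then show ?case by (simp add: Real_St)
next
  case (st_app f s)
  then have w: "wff (St f \<^bold>\<longrightarrow> St s \<^bold>\<longrightarrow> St (f \<bullet> s))" "wt (f \<bullet> s)" by auto
  show ?case
    by (rule proves_Th, rule proves_taut1[OF Th_proves[OF Real_St_app[OF w(2)] w(1)]]) (use st_app in auto)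
next
  case (external_induction n A)
  then show ?case by (rule Real_external_induction)
next
  case (idealisation A y z v)
  then show ?case by (intro Real_idealisation)
next
  case (HAC_int A x y F)
  then have "wff A" by simp
  with HAC_int show ?case by (intro Real_HAC)
qed

end

section \<open>Binary sequences and measure\<close>

text \<open>The coding of binary sequences on which \<open>initseg_c\<close> and
  \<open>count_c\<close> are based, transferred to lists.\<close>

definition bcode :: "bool list \<Rightarrow> nat" where
  "bcode xs = foldl (\<lambda>a b. Suc (a + a + of_bool b)) 0 xs"

lemma bcode_Nil [simp]: "bcode [] = 0" by (simp add: bcode_def)
lemma bcode_snoc [simp]: "bcode (xs @ [b]) = Suc (bcode xs + bcode xs + of_bool b)"
  by (simp add: bcode_def)

lemma bcode_bounds: "2 ^ length xs \<le> Suc (bcode xs) \<and> Suc (bcode xs) < 2 * 2 ^ length xs"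
  by (induction xs rule: rev_induct) auto

lemma bcode_inj: "bcode xs = bcode ys \<Longrightarrow> length xs = length ys \<Longrightarrow> xs = ys"
proof (induction xs arbitrary: ys rule: rev_induct)
  case (snoc b xs)
  then obtain zs c where ys: "ys = zs @ [c]" "length zs = length xs" by (cases ys rule: rev_cases) auto
  have "bcode xs + bcode xs + of_bool b = bcode zs + bcode zs + of_bool c"
    using snoc.prems(1) unfolding ys by simp
  then have "bcode xs = bcode zs \<and> b = c" by (cases b; cases c) (simp_all, presburger+)
  then show ?case using snoc.IH ys by auto
qed simp

lemma card_bool_lists: "card {s :: bool list. length s = L} = 2 ^ L" "finite {s :: bool list. length s = L}"
  using card_lists_length_eq[of "UNIV :: bool set" L] finite_lists_length_eq[of "UNIV :: bool set" L]
  by auto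

lemma bcode_image: "bcode ` {s. length s = L} = {2 ^ L - 1..<2 ^ L - 1 + 2 ^ L}"
proof (rule card_subset_eq)
  show "bcode ` {s. length s = L} \<subseteq> {2 ^ L - 1..<2 ^ L - 1 + 2 ^ L}"
  proof
    fix c assume "c \<in> bcode ` {s. length s = L}"
    then obtain s where "c = bcode s" "length s = L" by blast
    then have "2 ^ L \<le> Suc c" "Suc c < 2 * 2 ^ L" using bcode_bounds[of s] by auto
    then show "c \<in> {2 ^ L - 1..<2 ^ L - 1 + 2 ^ L}" by auto
  qed
  have "inj_on bcode {s. length s = L}" by (auto simp: inj_on_def intro: bcode_inj)
  then show "card (bcode ` {s. length s = L}) = card {2 ^ L - 1..<2 ^ L - 1 + 2 ^ L :: nat}"
    by (simp add: card_image card_bool_lists)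
qed simp

lemma count_card:
  fixes t :: "nat \<Rightarrow> nat"
  assumes "\<And>n. t n \<le> 1"
  shows "(\<Sum>i<2 ^ L. t (2 ^ L - 1 + i)) = card {s. length s = L \<and> t (bcode s) = 1}"
proof -
  have inj: "inj_on bcode {s. length s = L}" by (auto simp: inj_on_def intro: bcode_inj)
  have "(\<Sum>i<2 ^ L. t (2 ^ L - 1 + i)) = (\<Sum>c\<in>{2 ^ L - 1..<2 ^ L - 1 + 2 ^ L}. t c)"
    by (rule sum.reindex_bij_witness[of _ "\<lambda>c. c - (2 ^ L - 1)" "\<lambda>i. 2 ^ L - 1 + i"]) auto
  also have "\<dots> = (\<Sum>s | length s = L. t (bcode s))"
    unfolding bcode_image[symmetric] by (rule sum.reindex_cong[OF inj]) auto
  also have "\<dots> = (\<Sum>s | length s = L. if t (bcode s) = 1 then 1 else 0)"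
    by (rule sum.cong) (use assms in \<open>auto simp: le_Suc_eq\<close>)
  also have "\<dots> = card {s. length s = L \<and> t (bcode s) = 1}"
    by (simp add: sum.If_cases card_bool_lists Int_def)
  finally show ?thesis .
qed

lemma bcode_take:
  fixes t :: "nat \<Rightarrow> nat"
  assumes "\<And>n b. t (Suc (n + n + of_bool b)) = 1 \<Longrightarrow> t n = 1" "t (bcode s) = 1"
  shows "t (bcode (take m s)) = 1"
  using assms(2)
proof (induction s arbitrary: m rule: rev_induct)
  case (snoc b s)
  show ?case
  proof (cases "m \<le> length s")
    case True
    have "t (bcode s) = 1" using snoc.prems assms(1)[of "bcode s" b] by simp
    then show ?thesis using snoc.IH[of m] True by simp
  next
    case False
    then show ?thesis using snoc.prems by simp
  qed
qed simp

text \<open>A tree of measure at least \<open>1/m\<close> meets a union of neighbourhoods of measure greater than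
  \<open>1 - 1/m\<close>.\<close>

lemma covers_tree:
  fixes t :: "nat \<Rightarrow> nat"
  assumes bin: "\<And>n. t n \<le> 1" and tree: "\<And>n b. t (Suc (n + n + of_bool b)) = 1 \<Longrightarrow> t n = 1"
    and cov: "covers x h j m" and "m > 0"
    and meas: "2 ^ L \<le> m * (\<Sum>i<2 ^ L. t (2 ^ L - 1 + i))" and Ldef: "L = (\<Sum>i\<le>j. h i)"
  shows "\<exists>i\<le>j. \<forall>k\<le>h i. t (bcode (map (x i) [0..<k])) = 1"
proof -
  let ?A = "{s. length s = L \<and> (\<exists>i\<le>j. \<forall>l<h i. s ! l = x i l)}"
  let ?B = "{s. length s = L \<and> t (bcode s) = 1}"
  have A: "(m - 1) * 2 ^ L < m * card ?A" using cov Ldef by (simp add: covers_def Let_def)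
  have B: "2 ^ L \<le> m * card ?B" using meas count_card[of t, OF bin] by simp
  have fin: "finite ?A" "finite ?B" using card_bool_lists(2)[of L] by simp_all
  have "?A \<inter> ?B \<noteq> {}"
  proof
    assume "?A \<inter> ?B = {}"
    then have "card ?A + card ?B = card (?A \<union> ?B)" by (rule card_Un_disjoint[OF fin, symmetric])
    also have "\<dots> \<le> 2 ^ L" unfolding card_bool_lists(1)[symmetric]
      by (rule card_mono[OF card_bool_lists(2)]) auto
    finally have "m * card ?A + m * card ?B \<le> m * 2 ^ L" by (simp add: distrib_left[symmetric])
    moreover have "m * 2 ^ L = (m - 1) * 2 ^ L + 2 ^ L" using \<open>m > 0\<close> by (cases m) auto
    ultimately show False using A B by linarith
  qed
  then obtain s i where s: "length s = L" "t (bcode s) = 1" "i \<le> j" "\<forall>l<h i. s ! l = x i l" by auto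
  have "h i \<le> L" unfolding Ldef using s(3) by (intro member_le_sum) auto
  have "t (bcode (map (x i) [0..<k])) = 1" if "k \<le> h i" for k
  proof -
    have "take k s = map (x i) [0..<k]"
      using s that \<open>h i \<le> L\<close> by (auto intro!: nth_equalityI)
    then show ?thesis using bcode_take[where t = t and m = k, OF tree s(2)] by simp
  qed
  then show ?thesis using s(3) by blast
qed

lemma closed_types2 [simp]:
  "wt initseg_c" "ty_of initseg_c = T1 \<rightarrow>\<^sub>t N \<rightarrow>\<^sub>t N"
  "wt count_c" "ty_of count_c = T1 \<rightarrow>\<^sub>t N \<rightarrow>\<^sub>t N"
  "tv initseg_c = {}" "tv count_c = {}"
  by (auto simp: initseg_c_def count_c_def)

definition natof :: "D \<Rightarrow> nat" where "natof x = (THE n. x = num n)"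

lemma natof_num [simp]: "natof (num n) = n" by (simp add: natof_def)

text \<open>Sums serve as upper bounds in two places: for the finitely many levels offered by a
  strategy, and for the lengths of the neighbourhoods in a finite list of points.\<close>

definition rsum :: "rtm \<Rightarrow> rtm" where
  "rsum l = RC (RLRec NN NN) \<star> l \<star> RC RZero \<star>
     RL (0, NN) (RL (1, NN) (trm plus_c \<star> RV (0, NN) \<star> RV (1, NN)))"

lemma ht_plus: "ht (trm plus_c) (NN \<rightarrow>\<^sub>r NN \<rightarrow>\<^sub>r NN)" using ht_trm[of plus_c] by simp

lemma ht_rsum: "ht l (LL NN) \<Longrightarrow> ht (rsum l) NN"
  unfolding rsum_def by (rule ht_intros ht_plus tyc.simps | assumption)+

lemma fvr_rsum [simp]: "fvr (rsum l) = fvr l" by (auto simp: rsum_def fvr_trm)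

context model
begin

lemma dn_count:
  assumes "\<And>n. f \<cdot> num n = num (t n)"
  shows "dn e (trm count_c) \<cdot> f \<cdot> num n = num (\<Sum>i<2 ^ n. t (2 ^ n - 1 + i))"
proof -
  let ?e = "e((0, NN \<rightarrow>\<^sub>r NN) := f, (1, NN) := num n)"
  have "recn (num 0) (dn ?e (trm (lam (nv 2) (lam (nv 3)
    (plus_tm (V 2) (Var (0, T1) \<bullet> plus_tm (pred_c \<bullet> (pow2_c \<bullet> V 1)) (V 3))))))) m
    = num (\<Sum>i<m. t (2 ^ n - 1 + i))" for m
    by (induction m) (simp_all add: dn_lam assms)
  then show ?thesis by (simp add: count_c_def dn_lam recD)
qed

lemma dn_initseg:
  assumes "\<And>n. f \<cdot> num n = num (of_bool (x n))"
  shows "dn e (trm initseg_c) \<cdot> f \<cdot> num n = num (bcode (map x [0..<n]))"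
proof -
  let ?e = "e((0, NN \<rightarrow>\<^sub>r NN) := f, (1, NN) := num n)"
  have "recn (num 0) (dn ?e (trm (lam (nv 2) (lam (nv 3)
     (Succ (plus_tm (plus_tm (V 2) (V 2)) (Var (0, T1) \<bullet> V 3))))))) m
    = num (bcode (map x [0..<m]))" for m
    by (induction m) (simp_all add: dn_lam assms)
  then show ?thesis by (simp add: initseg_c_def dn_lam recD)
qed

lemma dn_rsum:
  assumes "isl (dn e l)" "\<forall>a\<in>set (dl (dn e l)). \<exists>n. a = num n"
  shows "dn e (rsum l) = num (sum_list (map natof (dl (dn e l))))"
proof -
  let ?f = "dn e (RL (0, NN) (RL (1, NN) (trm plus_c \<star> RV (0, NN) \<star> RV (1, NN))))"
  have "foldr (\<lambda>a acc. ?f \<cdot> acc \<cdot> a) xs (num 0) = num (sum_list (map natof xs))"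
    if "\<forall>a\<in>set xs. \<exists>n. a = num n" for xs
    using that by (induction xs) (auto simp: add.commute)
  then show ?thesis unfolding rsum_def using assms by (simp add: lrecD)
qed

end

section \<open>LMP\<close>

context model
begin

abbreviation cov :: "D \<Rightarrow> nat \<Rightarrow> D" where "cov g m \<equiv> cden p w RCov \<cdot> g \<cdot> num m"

lemma itp_ForallN:
  assumes "\<not> itp e (Forall v A) x y"
  obtains a where "E (emb (snd v)) a a" "\<forall>b\<in>set (dl y). \<not> itp (e(ev v := a)) A x b"
  using assms unfolding itp_simps(5) by blast

text \<open>A strategy against the conclusion offers, for each standard path, finitely many levels
  at which the path should have left the tree. The term \<open>?G\<close> adds these levels, and
  thus defines a functional \<open>g\<close> bounding them. The covering constant turns
  \<open>g\<close> into a finite list of points. The hypothesis on the measure is used at the single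
  level \<open>?N\<close>, the sum of the values of \<open>g\<close> at these points. By
  \<open>key\<close> one of the points stays in the tree up to the bound given by \<open>g\<close>,
  against every level offered for it.\<close>

lemma Real_LMP_aux:
  fixes a1 a2 I bn J :: fm
  defines "Tv \<equiv> (0, T1)" and "bv \<equiv> (1, T1)"
  assumes int: "internal a1" "internal a2" "internal I" "internal bn" "internal J"
    and key: "\<And>e g m. vld e \<Longrightarrow> R ((NN \<rightarrow>\<^sub>r NN) \<rightarrow>\<^sub>r NN) g \<Longrightarrow> tsat e a1 \<Longrightarrow> tsat (e(ev (nv 0) := num m)) a2 \<Longrightarrow>
      \<exists>b\<in>set (dl (cov g m)).
        tsat (e(ev (nv 0) := num m, ev (nv 1) := num (\<Sum>b\<leftarrow>dl (cov g m). natof (g \<cdot> b)))) I \<longrightarrow>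
        tsat (e(ev (nv 0) := num m, ev bv := b)) bn \<and>
        (\<forall>i\<le>natof (g \<cdot> b). tsat (e(ev (nv 0) := num m, ev bv := b, ev (nv 0) := num i)) J)"
  shows "Real (Forall Tv (a1 \<^bold>\<longrightarrow> ForallSt (nv 0) (a2 \<^bold>\<longrightarrow> ForallSt (nv 1) I \<^bold>\<longrightarrow>
    Neg (ForallSt bv (bn \<^bold>\<longrightarrow> Neg (ForallSt (nv 0) J))))))"
proof -
  let ?Q = "ForallSt (nv 1) I"
  let ?W = "ForallSt (nv 0) J"
  let ?Z = "ForallSt bv (bn \<^bold>\<longrightarrow> Neg ?W)"
  let ?k = "St (V 0) \<^bold>\<longrightarrow> a2 \<^bold>\<longrightarrow> ?Q \<^bold>\<longrightarrow> Neg ?Z"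
  let ?K = "Forall (nv 0) ?k"
  let ?A = "Forall Tv (a1 \<^bold>\<longrightarrow> ?K)"
  let ?bt = "NN \<rightarrow>\<^sub>r NN"
  have tb: "emb (ty_of (Var bv)) = ?bt" by (simp add: bv_def)
  let ?c = "RV (0, xt ?A)"
  let ?kc = "rsnd ?c"
  let ?hk = "rfst ?kc \<star> rzero NN"
  let ?Kr = "rfst (rsnd (rsnd (rsnd ?kc)))"
  let ?w0 = "rpair (RL (1, xt ?W) (rsing (rsing (rpair (rzero NN) (crs J))))) (rzero NN)"
  let ?zb = "\<lambda>b. rpair (RL (1, NN) (rsing b)) (rpair (RL (1, xt bn) (rsing (crs bn))) ?w0)"
  let ?et = "NN \<times>\<^sub>r xt bn \<times>\<^sub>r xt ?W \<times>\<^sub>r NN"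
  let ?v5 = "RV (5, ?bt)" and ?v2 = "RV (2, LL ?et)"
  let ?l2 = "?Kr \<star> ?zb ?v5"
  let ?l3 = "rfst (rfst (rsnd (rsnd (RV (3, ?et))))) \<star> rzero NN"
  let ?b3 = "rbind (3, ?et) ?v2 ?l3"
  let ?ml = "rbind (2, LL ?et) ?l2 ?b3"
  let ?G = "RL (5, ?bt) (rsum ?ml)"
  let ?cl = "RC RCov \<star> ?G \<star> RV (6, NN)"
  let ?N = "rsum (rbind (5, ?bt) ?cl (rsing (?G \<star> ?v5)))"
  let ?q = "rpair (RL (1, NN) (rsing ?N)) (cch I)"
  let ?u = "\<lambda>b. rpair (rzero NN) (rpair (cch a2) (rpair ?q (rpair (?zb b) (rzero NN))))"
  let ?ut = "NN \<times>\<^sub>r xt a2 \<times>\<^sub>r xt ?Q \<times>\<^sub>r xt ?Z \<times>\<^sub>r NN"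
  let ?r7 = "rsing (?u (RV (7, ?bt)))"
  let ?b7 = "rbind (7, ?bt) ?cl ?r7"
  let ?b6 = "rbind (6, NN) ?hk ?b7"
  let ?dm = "rpair (rzero NN) (rpair (cch a2) (rzero (xt ?Q \<times>\<^sub>r xt ?Z \<times>\<^sub>r NN)))"
  let ?L = "rcons ?dm ?b6"
  let ?y = "rpair (cch a1) ?L"
  let ?t = "rsing (rsing ?y)"
  have hW: "ht ?w0 (xt (Neg ?W))" unfolding xyt_simps ty_of.simps by (rule ht_crs ht_intros)+
  have xZ: "xt ?Z = (NN \<rightarrow>\<^sub>r LL ?bt) \<times>\<^sub>r (xt bn \<rightarrow>\<^sub>r LL (yt bn)) \<times>\<^sub>r xt (Neg ?W)" using tb by simp
  have hz: "ht b ?bt \<Longrightarrow> ht (?zb b) (xt ?Z)" for b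
    unfolding xZ by (rule hW ht_crs ht_rsing ht_rpair ht_RL | assumption)+
  have xA: "xt ?A = (xt a1 \<rightarrow>\<^sub>r LL (yt a1)) \<times>\<^sub>r (NN \<rightarrow>\<^sub>r LL NN) \<times>\<^sub>r (xt a2 \<rightarrow>\<^sub>r LL (yt a2)) \<times>\<^sub>r
     (xt ?Q \<rightarrow>\<^sub>r LL (yt ?Q)) \<times>\<^sub>r (xt ?Z \<rightarrow>\<^sub>r LL (LL ?et)) \<times>\<^sub>r NN"
    and yA: "yt ?A = LL (xt a1 \<times>\<^sub>r LL ?ut)" by simp_all
  have hl2: "ht ?l2 (LL (LL ?et))"
    by (rule ht_RA[OF _ hz[OF ht_RV]]) (unfold xA, (rule ht_intros)+)
  have hl3: "ht ?l3 (LL NN)"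
  proof -
    have "xt ?W = (NN \<rightarrow>\<^sub>r LL NN) \<times>\<^sub>r xt J" by simp
    then show ?thesis by (simp only:) (rule ht_intros)+
  qed
  note hv2 = ht_RV[of 2 "LL ?et"]
  note hb3 = ht_rbind[OF hv2 hl3, of 3]
  note hml = ht_rbind[OF hl2 hb3, of 2]
  note hsm = ht_rsum[OF hml]
  note hG = ht_RL[OF hsm, of 5 ?bt]
  have hcl: "ht ?cl (LL ?bt)"
    by (rule ht_RA[OF ht_RA[OF ht_RC hG] ht_RV]) simp
  have hGv: "ht (rsing (?G \<star> ?v5)) (LL NN)" by (rule ht_rsing[OF ht_RA[OF hG ht_RV]])
  note hbN = ht_rbind[OF hcl hGv, of 5]
  note hN = ht_rsum[OF hbN]
  have hq: "ht ?q (xt ?Q)"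
  proof -
    have "xt ?Q = (NN \<rightarrow>\<^sub>r LL NN) \<times>\<^sub>r xt I" by simp
    then show ?thesis by (simp only:) (rule ht_rpair[OF ht_RL[OF ht_rsing[OF hN]] ht_cch])
  qed
  have hu: "ht b ?bt \<Longrightarrow> ht (?u b) ?ut" for b
    by (rule ht_rpair[OF ht_rzero ht_rpair[OF ht_cch ht_rpair[OF hq ht_rpair[OF hz ht_rzero]]]])
  note hr7 = ht_rsing[OF hu[OF ht_RV[of 7]]]
  note hb7 = ht_rbind[OF hcl hr7, of 7]
  have hhk: "ht ?hk (LL NN)" unfolding xA by (rule ht_intros)+
  note hb6 = ht_rbind[OF hhk hb7, of 6]
  have hdm: "ht ?dm ?ut" by (rule ht_rpair[OF ht_rzero ht_rpair[OF ht_cch ht_rzero]])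
  note hL = ht_rcons[OF hdm hb6]
  show ?thesis
  proof (rule RealI)
    show "ht ?t (LL (yt ?A))" unfolding yA by (rule ht_rsing[OF ht_rsing[OF ht_rpair[OF ht_cch hL]]])
    show "fvr ?t \<subseteq> {(0, xt ?A)}" by auto
    fix e d assume Ve: "vld e" and V: "vld d" and x: "R (xt ?A) (d (0, xt ?A))"
    define X where "X = d (0, xt ?A)"
    define g where "g = dn d ?G"
    have Rg: "R (?bt \<rightarrow>\<^sub>r NN) g"
      unfolding g_def by (rule R_dn[OF hG]) (use x in auto)
    have D: "dl (dn d ?L) = dn d ?dm # dl (dn d ?b6)"
      by (rule dl_rcons[OF isl_dn[OF V hb6]])
    show "\<exists>y\<in>set (dl (dn d ?t)). itp e ?A (d (0, xt ?A)) y"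
      unfolding X_def[symmetric] itp_simps(5) dl_rsing
    proof (rule bexI[of _ "dn d (rsing ?y)"], intro allI impI, unfold dl_rsing, rule bexI[of _ "dn d ?y"])
      \<comment> \<open>The tree may be nonstandard: the response has already been fixed and does
        not depend on it.\<close>
      fix \<tau> assume \<tau>: "E (emb (snd Tv)) \<tau> \<tau>"
      define e1 where "e1 = e(ev Tv := \<tau>)"
      have Ve1: "vld e1" unfolding e1_def by (rule vld_ev[OF Ve \<tau>])
      show "itp (e(ev Tv := \<tau>)) (a1 \<^bold>\<longrightarrow> ?K) X (dn d ?y)"
        unfolding e1_def[symmetric]
      proof (rule ccontr)
        assume *: "\<not> itp e1 (a1 \<^bold>\<longrightarrow> ?K) X (dn d ?y)"
        obtain v1 where "itp e1 a1 (fstD (dn d ?y)) v1" by (rule itp_ImpE[OF *]) (rule that)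
        then have s1: "tsat e1 a1" using itp_cch[OF int(1)] by simp
        have **: "\<not> itp e1 ?K (sndD X) (dn d ?L)" using itp_ImpN[OF *] by simp
        obtain \<kappa> where \<kappa>: "E (emb (snd (nv 0))) \<kappa> \<kappa>"
          and bad: "\<forall>b\<in>set (dl (dn d ?L)). \<not> itp (e1(ev (nv 0) := \<kappa>)) ?k (sndD X) b"
          by (rule itp_ForallN[OF **])
        obtain m where m: "\<kappa> = num m" using \<kappa> by auto
        define e2 where "e2 = e1(ev (nv 0) := num m)"
        have Ve2: "vld e2" unfolding e2_def by (rule vld_ev[OF Ve1]) simp
        have bad: "\<not> itp e2 ?k (sndD X) b" if "b \<in> set (dl (dn d ?L))" for b
          using bspec[OF bad that] unfolding e2_def m .
        have b1: "\<not> itp e2 ?k (sndD X) (dn d ?dm)" by (rule bad) (simp only: D list.set insertI1)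
        obtain n where "n \<in> set (dl (fstD (sndD X) \<cdot> fstD (dn d ?dm)))" "itp e2 (St (V 0)) (fstD (dn d ?dm)) n"
          by (rule itp_ImpE[OF b1])
        then have n: "num m \<in> set (dl (dn d ?hk))" by (auto simp: X_def e2_def)
        obtain v2 where "itp e2 a2 (fstD (sndD (dn d ?dm))) v2" by (rule itp_ImpE[OF itp_ImpN[OF b1]]) (rule that)
        then have s2: "tsat e2 a2" using itp_cch[OF int(2)] by simp
        let ?d6 = "d((6, NN) := num m)"
        have V6: "vld ?d6" by (rule vld_upd[OF V]) simp
        have g6: "dn ?d6 ?G = g" unfolding g_def by (rule den_cong) auto
        have gcong: "dn d' ?G = g" if "d' (0, xt ?A) = d (0, xt ?A)" for d'
          unfolding g_def by (rule den_cong) (use that in auto)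
        have cl: "dn ?d6 ?cl = cov g m" by (simp only: den.simps(1-3) g6 fun_upd_same)
        obtain b where b: "b \<in> set (dl (cov g m))" and
          kb: "tsat (e2(ev (nv 1) := num (\<Sum>b\<leftarrow>dl (cov g m). natof (g \<cdot> b)))) I \<Longrightarrow>
            tsat (e2(ev bv := b)) bn \<and> (\<forall>i\<le>natof (g \<cdot> b). tsat (e2(ev bv := b, ev (nv 0) := num i)) J)"
          using key[OF Ve1 Rg s1, of m] s2 unfolding e2_def by blast
        have Eb: "E ?bt b b" using E_dl[OF E_dn[OF V6 hcl], unfolded cl] b by blast
        have gb: "\<exists>i. g \<cdot> b = num i" if "b \<in> set (dl (cov g m))" for b
          using E_ap[OF R_E[OF Rg] E_dl[OF E_dn[OF V6 hcl], unfolded cl, OF that]] by auto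
        have Nv: "dn (d'((6, NN) := num m)) ?N = num (\<Sum>b\<leftarrow>dl (cov g m). natof (g \<cdot> b))"
          if "vld d'" "d' (0, xt ?A) = d (0, xt ?A)" for d'
        proof -
          let ?d = "d'((6, NN) := num m)"
          have V': "vld ?d" by (rule vld_upd[OF that(1)]) simp
          have "dn ?d ?G = g" by (rule gcong) (use that(2) in simp)
          then have c: "dn ?d ?cl = cov g m" by (simp only: den.simps(1-3) fun_upd_same)
          have l: "dl (dn ?d (rbind (5, ?bt) ?cl (rsing (?G \<star> ?v5)))) = map (\<lambda>b. g \<cdot> b) (dl (cov g m))"
            unfolding dl_rbind[OF V' hcl hGv] c
          proof -
            have "dn (?d((5, ?bt) := a)) ?G = g" for a by (rule gcong) (use that(2) in simp)
            then show "concat (map (\<lambda>a. dl (dn (?d((5, ?bt) := a)) (rsing (?G \<star> ?v5)))) (dl (cov g m)))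
              = map (\<lambda>b. g \<cdot> b) (dl (cov g m))"
              by (simp add: concat_map_singleton del: den_RL)
          qed
          have "dn ?d ?N = num (sum_list (map natof (map (\<lambda>b. g \<cdot> b) (dl (cov g m)))))"
            unfolding l[symmetric] by (rule dn_rsum[OF isl_dn[OF V' hbN]]) (unfold l, use gb in auto)
          then show ?thesis by (simp add: o_def)
        qed
        let ?d7 = "?d6((7, ?bt) := b)"
        define z where "z = dn ?d7 (?u (RV (7, ?bt)))"
        have "z \<in> set (dl (dn ?d6 ?b7))"
          unfolding z_def by (rule in_rbind[OF V6 hcl hr7]) (use b cl in simp_all)
        then have "z \<in> set (dl (dn d ?b6))" by (rule in_rbind[OF V hhk hb7 n])
        then have b2: "\<not> itp e2 ?k (sndD X) z" by (intro bad) (simp only: D list.set insertI2)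
        have z: "fstD (sndD (sndD z)) = dn ?d7 ?q" "fstD (sndD (sndD (sndD z))) = dn ?d7 (?zb (RV (7, ?bt)))"
          by (simp_all add: z_def)
        obtain r where r: "itp e2 ?Q (dn ?d7 ?q) r"
          by (rule itp_ImpE[OF itp_ImpN[OF itp_ImpN[OF b2]]]) (simp add: z)
        let ?M = "\<Sum>b\<leftarrow>dl (cov g m). natof (g \<cdot> b)"
        have "E (emb (snd (nv 1))) (num ?M) (num ?M)" by simp
        with r obtain s where s: "itp (e2(ev (nv 1) := num ?M)) (St (V 1) \<^bold>\<longrightarrow> I) (dn ?d7 ?q) s"
          by (rule itp_ForallE)
        have V7: "vld ?d7" by (rule vld_upd[OF V6]) (use Eb in \<open>simp only: snd_conv\<close>)
        have "dn (?d7((1, NN) := fstD s)) ?N = dn (d((6, NN) := num m)) ?N" by (rule den_cong) auto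
        then have "itp (e2(ev (nv 1) := num ?M)) I (dn ?d7 (cch I)) (sndD s)"
          using itp_ImpD[OF s, of "num ?M"] Nv[OF V refl] by simp
        then have kb: "tsat (e2(ev bv := b)) bn"
          "\<And>i. i \<le> natof (g \<cdot> b) \<Longrightarrow> tsat (e2(ev bv := b, ev (nv 0) := num i)) J"
          using kb itp_cch[OF int(3)] by blast+
        let ?zz = "dn ?d7 (?zb (RV (7, ?bt)))"
        have "\<not> itp e2 (Neg ?Z) (sndD (sndD (sndD (sndD X)))) (sndD (sndD (sndD z)))"
          by (rule itp_ImpN[OF itp_ImpN[OF itp_ImpN[OF b2]]])
        then obtain l where l: "l \<in> set (dl (fstD (sndD (sndD (sndD (sndD X)))) \<cdot> ?zz))" "itp e2 ?Z ?zz l"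
          unfolding z(2)[symmetric] by (rule itp_ImpE)
        have "E (emb (snd bv)) b b" using Eb by (simp add: bv_def)
        with l(2) obtain o1 where o1: "o1 \<in> set (dl l)" "itp (e2(ev bv := b)) (St (Var bv) \<^bold>\<longrightarrow> bn \<^bold>\<longrightarrow> Neg ?W) ?zz o1"
          by (rule itp_ForallE)
        have i1: "itp (e2(ev bv := b)) (bn \<^bold>\<longrightarrow> Neg ?W) (sndD ?zz) (sndD o1)"
          by (rule itp_ImpD[OF o1(2), of b]) (use Eb tb in simp_all)
        have "dn (?d7((1, xt bn) := fstD (sndD o1))) (crs bn) \<in> set (dl (fstD (sndD ?zz) \<cdot> fstD (sndD o1)))"
          by simp
        from itp_ImpD[OF i1 this] have "itp (e2(ev bv := b)) (Neg ?W) (sndD (sndD ?zz)) (sndD (sndD o1))"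
          using itp_crs[OF int(4) kb(1)] by blast
        then have nW: "\<not> itp (e2(ev bv := b)) ?W (fstD (sndD (sndD o1)))
            (dn (?d7((1, xt ?W) := fstD (sndD (sndD o1)))) (rsing (rpair (rzero NN) (crs J))))"
          using itp_ImpD[of "e2(ev bv := b)" ?W Bot "sndD (sndD ?zz)" "sndD (sndD o1)"
            "dn (?d7((1, xt ?W) := fstD (sndD (sndD o1)))) (rsing (rpair (rzero NN) (crs J)))"] by auto
        then obtain i0 where i0: "E NN i0 i0" "\<not> itp (e2(ev bv := b, ev (nv 0) := i0)) (St (V 0) \<^bold>\<longrightarrow> J)
            (fstD (sndD (sndD o1))) (dn (?d7((1, xt ?W) := fstD (sndD (sndD o1)))) (rpair (rzero NN) (crs J)))"
          unfolding itp_simps(5) dl_rsing by auto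
        then obtain i where i: "i0 = num i" by auto
        have j: "num i \<in> set (dl (fstD (fstD (sndD (sndD o1))) \<cdot> num 0))"
          "\<not> tsat (e2(ev bv := b, ev (nv 0) := num i)) J"
          by (rule itp_ImpE[OF i0(2)], use itp_crs[OF int(5)] i in auto)+
        let ?d5 = "d((5, ?bt) := b)"
        have V5: "vld ?d5" by (rule vld_upd[OF V]) (use Eb in \<open>simp only: snd_conv\<close>)
        have zz: "dn ?d5 (?zb ?v5) = ?zz"
        proof -
          have "dn ?d5 (RL (1, NN) (rsing ?v5)) = dn ?d7 (RL (1, NN) (rsing (RV (7, ?bt))))"
            by (simp add: den.simps(4) dn_rsing_eq)
          moreover have "dn ?d5 (rpair (RL (1, xt bn) (rsing (crs bn))) ?w0) = dn ?d7 (rpair (RL (1, xt bn) (rsing (crs bn))) ?w0)"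
            by (rule den_cong) auto
          ultimately show ?thesis by (simp only: dn_rpair)
        qed
        have l2: "l \<in> set (dl (dn ?d5 ?l2))"
          using l(1) unfolding zz[symmetric] by (simp add: X_def)
        let ?d2 = "?d5((2, LL ?et) := l)"
        have V2: "vld ?d2" by (rule vld_upd[OF V5]) (use E_dl[OF E_dn[OF V5 hl2] l2] in \<open>simp only: snd_conv\<close>)
        have "num i \<in> set (dl (dn ?d2 ?b3))"
          by (rule in_rbind[OF V2 hv2 hl3]) (use o1(1) j(1) in simp_all)
        then have iml: "num i \<in> set (dl (dn ?d5 ?ml))" by (rule in_rbind[OF V5 hl2 hb3 l2])
        have "\<forall>a\<in>set (dl (dn ?d5 ?ml)). \<exists>n. a = num n"
          using E_dl[OF E_dn[OF V5 hml]] by auto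
        from dn_rsum[OF isl_dn[OF V5 hml] this]
        have "natof (g \<cdot> b) = sum_list (map natof (dl (dn ?d5 ?ml)))" unfolding g_def by simp
        \<comment> \<open>The level offered against the point \<open>b\<close> is one of the
          summands of \<open>g \<cdot> b\<close>, and hence within the range in which
          \<open>b\<close> stays in the tree.\<close>
        moreover have "natof (num i) \<le> sum_list (map natof (dl (dn ?d5 ?ml)))"
          by (rule member_le_sum_list) (use iml in \<open>auto simp del: natof_num\<close>)
        ultimately show False using kb(2)[of i] j(2) by simp
      qed
    qed simp_all
  qed
qed

text \<open>The only property of the coins on which the realisation of \<open>LMP\<close> depends.
  That it holds with probability 1 is shown in \<open>AE_Good\<close>.\<close>

definition Good :: bool where
  "Good \<longleftrightarrow> (\<forall>g. R ((NN \<rightarrow>\<^sub>r NN) \<rightarrow>\<^sub>r NN) g \<longrightarrow> (\<exists>\<alpha>. good w (\<lambda>c. natof (g \<cdot> coinD w c)) \<alpha>))"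

lemma tsat_ForallN: "tsat e (Forall (nv i) A) \<longleftrightarrow> (\<forall>n. tsat (e((i, NN) := num n)) A)"
  unfolding tsat_simps(5) by auto

lemma R_coinD: "R ((NN \<rightarrow>\<^sub>r NN) \<rightarrow>\<^sub>r NN) g \<Longrightarrow> g \<cdot> coinD w c = num (natof (g \<cdot> coinD w c))"
proof -
  assume g: "R ((NN \<rightarrow>\<^sub>r NN) \<rightarrow>\<^sub>r NN) g"
  have "E (NN \<rightarrow>\<^sub>r NN) (coinD w c) (coinD w c)" by (simp only: coinD_def E_funD)
  from E_ap[OF R_E[OF g] this] obtain n where "g \<cdot> coinD w c = num n" by auto
  then show ?thesis by (simp only: natof_num)
qed

lemma cov_dl:
  assumes Good "R ((NN \<rightarrow>\<^sub>r NN) \<rightarrow>\<^sub>r NN) g" "m > 0"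
  defines "h \<equiv> \<lambda>c. natof (g \<cdot> coinD w c)"
  obtains \<alpha> j where "dl (cov g m) = map (\<lambda>i. coinD w (\<alpha>, i)) [0..<Suc j]"
    "covers (\<lambda>i. w (\<alpha>, i)) (\<lambda>i. h (\<alpha>, i)) j m"
proof -
  let ?\<alpha> = "covblk w h"
  have ex: "\<exists>\<alpha>. good w h \<alpha>" using assms unfolding Good_def by blast
  then have gd: "good w h ?\<alpha>" unfolding covblk_def by (rule LeastI_ex)
  obtain j where j: "covlen w h m = Suc j" and c: "covers (\<lambda>i. w (?\<alpha>, i)) (\<lambda>i. h (?\<alpha>, i)) j m"
    using gd[unfolded good_def] assms(3) ex LeastI_ex[of "\<lambda>j. covers (\<lambda>i. w (?\<alpha>, i)) (\<lambda>i. h (?\<alpha>, i)) j m"]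
    by (auto simp: covlen_def)
  have "g \<cdot> coinD w c = num (h c)" for c unfolding h_def by (rule R_coinD[OF assms(2)])
  from covD[OF this] have "dl (cov g m) = map (\<lambda>i. coinD w (?\<alpha>, i)) [0..<Suc j]"
    by (simp add: j dl_pr del: upt_Suc)
  with c show thesis by (rule that[rotated])
qed

text \<open>The semantic content is in \<open>key\<close>, by \<open>covers_tree\<close>. What
  follows it is derivation in the calculus: the nested existential abbreviations of
  \<open>LMP\<close> are unfolded into the curried form treated in
  \<open>Real_LMP_aux\<close>.\<close>

lemma Real_LMP: assumes Good shows "Real LMP"
proof -
  let ?a1 = "tree 0" and ?a2 = "Zero \<^bold>< V 0"
  let ?I = "pow2_c \<bullet> V 1 \<^bold>\<le> times_tm (V 0) (count_c \<bullet> Var (0, T1) \<bullet> V 1)"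
  let ?bn = "Defs.binary 1" and ?J = "Var (0, T1) \<bullet> (initseg_c \<bullet> Var (1, T1) \<bullet> V 0) \<^bold>= Succ Zero"
  let ?Q = "ForallSt (nv 1) ?I" and ?W = "ForallSt (nv 0) ?J" and ?b = "(1, T1) :: var"
  let ?Z = "ForallSt ?b (?bn \<^bold>\<longrightarrow> Neg ?W)"
  let ?Z' = "Forall ?b (Neg (St (Var ?b) \<^bold>\<and> ?bn \<^bold>\<and> ?W))"
  let ?k = "St (V 0) \<^bold>\<longrightarrow> ?a2 \<^bold>\<longrightarrow> ?Q \<^bold>\<longrightarrow> Neg ?Z"
  let ?K = "Forall (nv 0) ?k"
  let ?P = "Neg (St (V 0) \<^bold>\<and> ?a2 \<^bold>\<and> ?Q)"
  have wb: "wff (tree 0)" "wff (Defs.binary 1)" "wff (Defs.binary (Suc 0))" by (simp_all add: tree_def Defs.binary_def)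
  have key: "\<exists>b\<in>set (dl (cov g m)).
        tsat (e(ev (nv 0) := num m, ev (nv 1) := num (\<Sum>b\<leftarrow>dl (cov g m). natof (g \<cdot> b)))) ?I \<longrightarrow>
        tsat (e(ev (nv 0) := num m, ev ?b := b)) ?bn \<and>
        (\<forall>i\<le>natof (g \<cdot> b). tsat (e(ev (nv 0) := num m, ev ?b := b, ev (nv 0) := num i)) ?J)"
    if Ve: "vld e" and Rg: "R ((NN \<rightarrow>\<^sub>r NN) \<rightarrow>\<^sub>r NN) g" and s1: "tsat e ?a1"
      and s2: "tsat (e(ev (nv 0) := num m)) ?a2" for e g m
  proof -
    have m: "m > 0" using s2 by (simp add: Suc_le_eq)
    obtain \<alpha> j where dl: "dl (cov g m) = map (\<lambda>i. coinD w (\<alpha>, i)) [0..<Suc j]"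
      and c: "covers (\<lambda>i. w (\<alpha>, i)) (\<lambda>i. natof (g \<cdot> coinD w (\<alpha>, i))) j m"
      by (rule cov_dl[OF assms Rg m])
    have "E (NN \<rightarrow>\<^sub>r NN) (e (0, NN \<rightarrow>\<^sub>r NN)) (e (0, NN \<rightarrow>\<^sub>r NN))" using Ve by (simp add: vld_def)
    then have "\<exists>k. e (0, NN \<rightarrow>\<^sub>r NN) \<cdot> num n = num k" for n using E_ap[of NN NN _ _ "num n" "num n"] by fastforce
    then obtain t where t: "\<And>n. e (0, NN \<rightarrow>\<^sub>r NN) \<cdot> num n = num (t n)" by metis
    have "tsat e (tree 0) \<longleftrightarrow> (\<forall>n. t n \<le> 1) \<and> (\<forall>n k. k \<le> 1 \<longrightarrow> t (Suc (n + n + k)) = 1 \<longrightarrow> t n = 1)"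
      by (simp add: tree_def Defs.binary_def tsat_ForallN t del: tsat_simps(5)) metis
    then have tr: "\<forall>n. t n \<le> 1" "\<forall>n k. k \<le> 1 \<longrightarrow> t (Suc (n + n + k)) = 1 \<longrightarrow> t n = 1"
      using s1 by blast+
    have bin: "t n \<le> 1" for n using tr(1) by blast
    have tree: "t n = 1" if "t (Suc (n + n + of_bool b)) = 1" for n b
      by (rule tr(2)[rule_format, OF _ that]) simp
    let ?L = "\<Sum>b\<leftarrow>dl (cov g m). natof (g \<cdot> b)"
    have L: "?L = (\<Sum>i\<le>j. natof (g \<cdot> coinD w (\<alpha>, i)))"
      by (simp add: dl interv_sum_list_conv_sum_set_nat o_def atMost_atLeast0 atLeastLessThanSuc_atLeastAtMost del: upt_Suc)
    let ?e = "e(ev (nv 0) := num m, ev (nv 1) := num ?L)"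
    show ?thesis
    proof (cases "tsat ?e ?I")
      case False
      \<comment> \<open>Any entry will do here. The list is nonempty because its length is a
        successor.\<close>
      have "coinD w (\<alpha>, 0) \<in> set (dl (cov g m))" by (auto simp: dl simp del: upt_Suc)
      with False show ?thesis by blast
    next
      case True
      then have meas: "2 ^ ?L \<le> m * (\<Sum>i<2 ^ ?L. t (2 ^ ?L - 1 + i))"
        by (simp add: dn_count[where t = t] t)
      have "\<exists>i\<le>j. \<forall>k\<le>natof (g \<cdot> coinD w (\<alpha>, i)). t (bcode (map (w (\<alpha>, i)) [0..<k])) = 1"
        by (rule covers_tree[of t "\<lambda>i. w (\<alpha>, i)" "\<lambda>i. natof (g \<cdot> coinD w (\<alpha>, i))" j m ?L])
          (fact bin tree c m meas L)+
      then obtain i where i: "i \<le> j" "\<forall>k\<le>natof (g \<cdot> coinD w (\<alpha>, i)). t (bcode (map (w (\<alpha>, i)) [0..<k])) = 1"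
        by auto
      have "coinD w (\<alpha>, i) \<in> set (dl (cov g m))" using i(1) by (auto simp: dl simp del: upt_Suc)
      moreover have "tsat (e(ev (nv 0) := num m, ev ?b := coinD w (\<alpha>, i))) ?bn"
        by (simp add: Defs.binary_def tsat_ForallN del: tsat_simps(5))
      moreover have "tsat (e(ev (nv 0) := num m, ev ?b := coinD w (\<alpha>, i), ev (nv 0) := num k)) ?J"
        if "k \<le> natof (g \<cdot> coinD w (\<alpha>, i))" for k
        using i(2) that by (simp add: dn_initseg t)
      ultimately show ?thesis by blast
    qed
  qed
  have "Real (Forall (0, T1) (?a1 \<^bold>\<longrightarrow> ?K))"
    by (rule Real_LMP_aux[OF _ _ _ _ _ key]) (simp_all add: tree_def Defs.binary_def)
  then have 1: "Th \<^bold>\<turnstile> Forall (0, T1) (?a1 \<^bold>\<longrightarrow> ?K)" by (rule Th_proves) (simp add: wb)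
  have Z: "Th \<^bold>\<turnstile> ?Z' \<^bold>\<longrightarrow> ?Z"
    by (rule proves_all_mono[OF proves_taut]) (auto simp: wb)
  have "Th \<^bold>\<turnstile> (?Z' \<^bold>\<and> ?K) \<^bold>\<longrightarrow> ?P"
    by (rule proves_taut2[OF Z proves_spec[of ?k _ "nv 0"]]) (simp_all add: wb, blast)
  then have "Th \<^bold>\<turnstile> (?Z' \<^bold>\<and> ?K) \<^bold>\<longrightarrow> Forall (nv 0) ?P"
    by (rule proves_Forall_imp) (simp_all add: wb, simp add: Defs.binary_def)
  then have "Th \<^bold>\<turnstile> (?a1 \<^bold>\<longrightarrow> ?K) \<^bold>\<longrightarrow> (?a1 \<^bold>\<longrightarrow> Neg (Forall (nv 0) ?P) \<^bold>\<longrightarrow> Neg ?Z')"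
    by (rule proves_taut1) (simp_all add: wb, blast)
  from proves_all_mono[OF this]
  have "Th \<^bold>\<turnstile> Forall (0, T1) (?a1 \<^bold>\<longrightarrow> ?K) \<^bold>\<longrightarrow> LMP"
    unfolding LMP_def Let_def positive_measure_def by (simp add: wb)
  from proves_Th[OF proves.mp[OF this 1]] show ?thesis .
qed

lemma proves_LMP_Real:
  assumes Good "sysP \<union> {Pi01_TRANS, LMP} \<^bold>\<turnstile> A" shows "Real A"
  by (rule proves_Real[OF assms(2)]) (use Real_sysP Real_TRANS Real_LMP[OF assms(1)] in auto)

end

section \<open>Truth of formulas about standard objects\<close>

context model
begin

text \<open>Realisability at one assignment, by a realiser that may depend on it. A standard object
  assigned to a variable can thus be used as its own evidence for \<open>St\<close>.\<close>

definition Rle :: "(rvar \<Rightarrow> D) \<Rightarrow> fm \<Rightarrow> bool" where "Rle e A \<longleftrightarrow> (\<exists>t. Rl e A t)"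

lemma RleI:
  assumes ht: "ht b (LL (yt A))" and R: "\<And>v. v \<in> fvr b \<Longrightarrow> v \<noteq> (0, xt A) \<Longrightarrow> R (snd v) (d v)"
    and y: "\<And>x. R (xt A) x \<Longrightarrow> \<exists>y\<in>set (dl (dn (d((0, xt A) := x)) b)). itp e A x y"
  shows "Rle e A"
  unfolding Rle_def Rl_def
proof (intro exI conjI allI impI)
  show "R (xt A \<rightarrow>\<^sub>r LL (yt A)) (dn d (RL (0, xt A) b))"
  proof (rule R_dn)
    show "ht (RL (0, xt A) b) (xt A \<rightarrow>\<^sub>r LL (yt A))" by (rule ht_RL[OF ht])
  qed (use R in auto)
  fix x assume "R (xt A) x"
  from y[OF this] show "\<exists>y\<in>set (dl (dn d (RL (0, xt A) b) \<cdot> x)). itp e A x y" by simp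
qed

lemma Rle_Real: "Real A \<Longrightarrow> vld e \<Longrightarrow> Rle e A"
  unfolding Real_def Rle_def by blast

lemma Rle_mp: assumes "Rle e (A \<^bold>\<longrightarrow> B)" "Rle e A" shows "Rle e B"
proof -
  obtain s t where s: "Rl e (A \<^bold>\<longrightarrow> B) s" and t: "Rl e A t" using assms by (auto simp: Rle_def)
  let ?q = "xt A \<times>\<^sub>r yt B"
  let ?S = "(2, (xt A \<rightarrow>\<^sub>r LL (yt A)) \<times>\<^sub>r xt B \<rightarrow>\<^sub>r LL ?q)" and ?T = "(3, xt A \<rightarrow>\<^sub>r LL (yt A))"
  let ?l = "RV ?S \<star> rpair (RV ?T) (RV (0, xt B))"
  let ?r = "rsing (rsnd (RV (1, ?q)))"
  let ?d = "e0(?S := s, ?T := t)"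
  have Rs: "R (snd ?S) s" and Rt: "R (snd ?T) t" using s t by (simp_all add: Rl_def)
  have hl: "ht ?l (LL ?q)" by (rule ht_intros)+
  have hr: "ht ?r (LL (yt B))" by (rule ht_intros)+
  have V: "vld ?d" by (intro vld_upd vld_e0 R_E Rs Rt)
  show ?thesis
  proof (rule RleI[where d = ?d])
    show "ht (rbind (1, ?q) ?l ?r) (LL (yt B))" by (rule ht_rbind[OF hl hr])
    show "R (snd v) (?d v)" if "v \<in> fvr (rbind (1, ?q) ?l ?r)" "v \<noteq> (0, xt B)" for v
      using that Rs Rt by auto
    fix x assume x: "R (xt B) x"
    let ?dx = "?d((0, xt B) := x)"
    have V: "vld ?dx" by (rule vld_upd[OF V]) (simp only: snd_conv R_E[OF x])
    have "R (xt (A \<^bold>\<longrightarrow> B)) (pr t x)" unfolding xyt_simps by (rule R_pr) (use Rt x in simp_all)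
    then obtain y where y: "y \<in> set (dl (s \<cdot> pr t x))" "itp e (A \<^bold>\<longrightarrow> B) (pr t x) y"
      using s by (auto simp: Rl_def)
    have dnl: "dn ?dx ?l = s \<cdot> pr t x" by simp
    have "R (LL ?q) (s \<cdot> pr t x)" by (rule R_ap[OF Rs[unfolded snd_conv] R_pr]) (use Rt x in simp_all)
    then have "R (xt A) (fstD y)" using R_fst[OF R_dl[OF _ y(1)]] by blast
    then obtain a where "a \<in> set (dl (t \<cdot> fstD y))" "itp e A (fstD y) a" using t by (auto simp: Rl_def)
    then have "itp e B x (sndD y)" using itp_ImpD[OF y(2)] by simp
    moreover have "dn (?dx((1, ?q) := y)) (rsnd (RV (1, ?q))) \<in> set (dl (dn ?dx (rbind (1, ?q) ?l ?r)))"
      by (rule in_rbind[OF V hl hr, of y]) (simp_all only: dnl y(1) dl_rsing list.set insertI1)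
    ultimately show "\<exists>y\<in>set (dl (dn ?dx (rbind (1, ?q) ?l ?r))). itp e B x y" by fastforce
  qed
qed

lemma Rle_spec:
  assumes "Rle e (Forall v A)" "E (emb (snd v)) a a" shows "Rle (e(ev v := a)) A"
proof -
  obtain s where s: "Rl e (Forall v A) s" using assms by (auto simp: Rle_def)
  let ?S = "(2, xt A \<rightarrow>\<^sub>r LL (LL (yt A)))"
  let ?l = "RV ?S \<star> RV (0, xt A)"
  let ?r = "RV (1, LL (yt A))"
  let ?d = "e0(?S := s)"
  have Rs: "R (snd ?S) s" using s by (simp add: Rl_def)
  have hl: "ht ?l (LL (LL (yt A)))" by (rule ht_intros)+
  have hr: "ht ?r (LL (yt A))" by (rule ht_intros)+
  show ?thesis
  proof (rule RleI[where d = ?d])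
    show "ht (rbind (1, LL (yt A)) ?l ?r) (LL (yt A))" by (rule ht_rbind[OF hl hr])
    show "R (snd v) (?d v)" if "v \<in> fvr (rbind (1, LL (yt A)) ?l ?r)" "v \<noteq> (0, xt A)" for v
      using that Rs by auto
    fix x assume x: "R (xt A) x"
    let ?dx = "?d((0, xt A) := x)"
    have V: "vld ?dx" by (intro vld_upd vld_e0 R_E Rs) (use x in simp)
    obtain y where y: "y \<in> set (dl (s \<cdot> x))" "itp e (Forall v A) x y"
      using s x by (auto simp: Rl_def)
    obtain b where b: "b \<in> set (dl y)" "itp (e(ev v := a)) A x b"
      using itp_ForallE[OF y(2) assms(2)] by blast
    have "b \<in> set (dl (dn ?dx (rbind (1, LL (yt A)) ?l ?r)))"
      by (rule in_rbind[OF V hl hr]) (use y(1) b(1) in simp_all)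
    then show "\<exists>y\<in>set (dl (dn ?dx (rbind (1, LL (yt A)) ?l ?r))). itp (e(ev v := a)) A x y"
      using b(2) by blast
  qed
qed

lemma Rle_internal: assumes "internal A" "tsat e A" shows "Rle e A"
proof (rule RleI[where b = "rsing (crs A)"])
  show "ht (rsing (crs A)) (LL (yt A))" by (rule ht_rsing[OF ht_crs])
qed (use itp_crs assms in auto)

lemma Rle_St: assumes "R (emb (snd v)) (e (ev v))" shows "Rle e (St (Var v))"
proof (rule RleI[where b = "rsing (RV (1, emb (snd v)))" and d = "e0((1, emb (snd v)) := e (ev v))"])
  show "ht (rsing (RV (1, emb (snd v)))) (LL (yt (St (Var v))))" unfolding xyt_simps ty_of.simps
    by (rule ht_intros)+
qed (use assms R_E in auto)

lemma Rle_Bot: "\<not> Rle e Bot"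
proof
  assume "Rle e Bot"
  then obtain t where "Rl e Bot t" by (auto simp: Rle_def)
  then show False using R_num[of 0] by (auto simp: Rl_def)
qed

text \<open>All candidates that a definable challenge offers for \<open>v\<close> are definable. If
  every definable object satisfied \<open>J\<close>, a constant response would therefore realise the
  universal statement, contrary to the realised negation and \<open>Rle_Bot\<close>.\<close>

lemma Rle_standard_witness:
  assumes Ve: "vld e" and J: "internal J" "wff J" and h: "Rle e (Neg (ForallSt v J))"
  obtains a where "R (emb (snd v)) a" "\<not> tsat (e(ev v := a)) J"
proof -
  let ?\<sigma> = "emb (snd v)"
  let ?b = "rsing (rsing (rpair (rzero NN) (crs J)))"
  let ?A = "ForallSt v J"
  have xA: "xt ?A = (NN \<rightarrow>\<^sub>r LL ?\<sigma>) \<times>\<^sub>r xt J" by simp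
  have "Rle e ?A" if all: "\<And>a. R ?\<sigma> a \<Longrightarrow> tsat (e(ev v := a)) J"
  proof (rule RleI[where b = ?b])
    show "ht ?b (LL (yt ?A))" unfolding xyt_simps by (rule ht_crs ht_intros)+
    fix x assume x: "R (xt ?A) x"
    let ?d = "e0((0, xt ?A) := x)"
    let ?r = "dn ?d (rpair (rzero NN) (crs J))"
    have "itp (e(ev v := a)) (St (Var v) \<^bold>\<longrightarrow> J) x ?r" if a: "E ?\<sigma> a a" for a
    proof (rule ccontr)
      assume *: "\<not> itp (e(ev v := a)) (St (Var v) \<^bold>\<longrightarrow> J) x ?r"
      then obtain g where g: "g \<in> set (dl (fstD x \<cdot> num 0))" "E ?\<sigma> a g"
        by (rule itp_ImpE) simp
      have "R (LL ?\<sigma>) (fstD x \<cdot> num 0)" by (rule R_ap[OF R_fst[OF x[unfolded xA]] R_num])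
      then have "tsat (e(ev v := g)) J" by (rule all[OF R_dl[OF _ g(1)]])
      then have "tsat (e(ev v := a)) J"
        using tsat_eqv[OF J(2) eqv_upd[OF eqv_refl[OF Ve], of "ev v" a g]] g(2) by simp
      then show False using itp_crs[OF J(1)] itp_ImpN[OF *] by simp
    qed
    then show "\<exists>y\<in>set (dl (dn ?d ?b)). itp e ?A x y" by simp
  qed auto
  then show thesis using Rle_mp[OF h] Rle_Bot that by blast
qed

end

section \<open>Transfer for arithmetical formulas\<close>

lemma wff_subst: "wff A \<Longrightarrow> wt u \<Longrightarrow> ty_of u = snd x \<Longrightarrow> wff (subst A x u)"
proof (induction A)
  case (Eq s t)
  have "wt r \<Longrightarrow> wt (tsubst r x u) \<and> ty_of (tsubst r x u) = ty_of r" for r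
    by (induction r) (use Eq(2,3) in auto)
  then show ?case using Eq by auto
next
  case (St t)
  have "wt r \<Longrightarrow> wt (tsubst r x u) \<and> ty_of (tsubst r x u) = ty_of r" for r
    by (induction r) (use St(2,3) in auto)
  then show ?case using St by auto
qed auto

lemma proves_wff: "\<Gamma> \<^bold>\<turnstile> A \<Longrightarrow> wff A"
proof (induction rule: proves.induct)
  case (inst A t x)
  then show ?case using wff_subst by simp
qed auto

lemma proves_mono_under:
  assumes "\<Gamma> \<^bold>\<turnstile> C \<^bold>\<longrightarrow> A \<^bold>\<longrightarrow> B" "x \<notin> fv C" shows "\<Gamma> \<^bold>\<turnstile> C \<^bold>\<longrightarrow> Forall x A \<^bold>\<longrightarrow> Forall x B"
proof -
  have w: "wff A" "wff B" "wff C" using proves_wff[OF assms(1)] by auto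
  have "\<Gamma> \<^bold>\<turnstile> (C \<^bold>\<and> Forall x A) \<^bold>\<longrightarrow> B"
    by (rule proves_taut2[OF proves_spec[OF w(1), of _ x] assms(1)]) (use w in auto)
  then have "\<Gamma> \<^bold>\<turnstile> (C \<^bold>\<and> Forall x A) \<^bold>\<longrightarrow> Forall x B"
    by (rule proves_Forall_imp) (use w assms(2) in auto)
  then show ?thesis by (rule proves_taut1) (use w in auto)
qed

lemma proves_equiv_Imp:
  assumes "\<Gamma> \<^bold>\<turnstile> C \<^bold>\<longrightarrow> ((A' \<^bold>\<longrightarrow> A) \<^bold>\<and> (A \<^bold>\<longrightarrow> A'))" "\<Gamma> \<^bold>\<turnstile> C \<^bold>\<longrightarrow> ((B' \<^bold>\<longrightarrow> B) \<^bold>\<and> (B \<^bold>\<longrightarrow> B'))"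
  shows "\<Gamma> \<^bold>\<turnstile> C \<^bold>\<longrightarrow> (((A' \<^bold>\<longrightarrow> B') \<^bold>\<longrightarrow> (A \<^bold>\<longrightarrow> B)) \<^bold>\<and> ((A \<^bold>\<longrightarrow> B) \<^bold>\<longrightarrow> (A' \<^bold>\<longrightarrow> B')))"
proof (rule proves_taut2[OF assms])
  fix v
  assume "pval v (C \<^bold>\<longrightarrow> ((A' \<^bold>\<longrightarrow> A) \<^bold>\<and> (A \<^bold>\<longrightarrow> A')))" "pval v (C \<^bold>\<longrightarrow> ((B' \<^bold>\<longrightarrow> B) \<^bold>\<and> (B \<^bold>\<longrightarrow> B')))"
  then show "pval v (C \<^bold>\<longrightarrow> (((A' \<^bold>\<longrightarrow> B') \<^bold>\<longrightarrow> (A \<^bold>\<longrightarrow> B)) \<^bold>\<and> ((A \<^bold>\<longrightarrow> B) \<^bold>\<longrightarrow> (A' \<^bold>\<longrightarrow> B'))))"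
    unfolding pval.simps by blast
qed (use proves_wff[OF assms(1)] proves_wff[OF assms(2)] in simp)

lemma proves_equivI:
  assumes "\<Gamma> \<^bold>\<turnstile> C \<^bold>\<longrightarrow> A \<^bold>\<longrightarrow> B" "\<Gamma> \<^bold>\<turnstile> C \<^bold>\<longrightarrow> B \<^bold>\<longrightarrow> A"
  shows "\<Gamma> \<^bold>\<turnstile> C \<^bold>\<longrightarrow> ((A \<^bold>\<longrightarrow> B) \<^bold>\<and> (B \<^bold>\<longrightarrow> A))"
  by (rule proves_taut2[OF assms]) (use proves_wff[OF assms(1)] in simp, unfold pval.simps, blast)

primrec Conj :: "fm list \<Rightarrow> fm" where
  "Conj [] = Neg Bot"
| "Conj (A # L) = A \<^bold>\<and> Conj L"

lemma pval_Conj [simp]: "pval v (Conj L) \<longleftrightarrow> (\<forall>A\<in>set L. pval v A)" by (induction L) auto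
lemma wff_Conj [simp]: "wff (Conj L) \<longleftrightarrow> (\<forall>A\<in>set L. wff A)" by (induction L) auto
lemma fv_Conj [simp]: "fv (Conj L) = (\<Union>A\<in>set L. fv A)" by (induction L) auto

text \<open>The standard functional \<open>\<mu>\<close> is named by a variable, so that arithmetical formulas have
  characteristic terms.\<close>

abbreviation Mv :: var where "Mv \<equiv> (0, T1 \<rightarrow>\<^sub>t N)"

definition MuAx :: fm where
  "MuAx = Forall (0, T1) (Forall (nv 0)
     (Var (0, T1) \<bullet> V 0 \<^bold>= Zero \<^bold>\<longrightarrow> Var (0, T1) \<bullet> (Var Mv \<bullet> Var (0, T1)) \<^bold>= Zero))"

lemma MuAx [simp]: "wff MuAx" "internal MuAx" "fv MuAx = {Mv}" by (auto simp: MuAx_def)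

abbreviation monus_tm :: "tm \<Rightarrow> tm \<Rightarrow> tm" where "monus_tm s t \<equiv> monus_c \<bullet> s \<bullet> t"

text \<open>The value 0 stands for truth. For a quantifier, \<open>\<mu>\<close> is applied to one
  minus the characteristic function of the body, so that it searches for a counterexample, and the
  body is evaluated at the number found.\<close>

primrec chi :: "fm \<Rightarrow> tm" where
  "chi (s \<^bold>= t) = monus_tm (Succ Zero) (monus_tm (Succ Zero) (plus_tm (monus_tm s t) (monus_tm t s)))"
| "chi (St t) = Zero"
| "chi Bot = Succ Zero"
| "chi (A \<^bold>\<longrightarrow> B) = times_tm (monus_tm (Succ Zero) (chi A)) (chi B)"
| "chi (Forall x A) = lam x (chi A) \<bullet> (Var Mv \<bullet> lam x (monus_tm (Succ Zero) (chi A)))"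

primrec arithf :: "fm \<Rightarrow> bool" where
  "arithf (s \<^bold>= t) \<longleftrightarrow> wt s \<and> wt t \<and> ty_of s = N \<and> ty_of t = N"
| "arithf (St t) \<longleftrightarrow> False"
| "arithf Bot \<longleftrightarrow> True"
| "arithf (A \<^bold>\<longrightarrow> B) \<longleftrightarrow> arithf A \<and> arithf B"
| "arithf (Forall x A) \<longleftrightarrow> snd x = N \<and> arithf A"

primrec stf :: "fm \<Rightarrow> fm" where
  "stf (s \<^bold>= t) = (s \<^bold>= t)"
| "stf (St t) = St t"
| "stf Bot = Bot"
| "stf (A \<^bold>\<longrightarrow> B) = (stf A \<^bold>\<longrightarrow> stf B)"
| "stf (Forall x A) = ForallSt x (stf A)"

lemma wff_stf [simp]: "wff (stf A) = wff A" by (induction A) auto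

lemma arithf_wff: "arithf A \<Longrightarrow> wff A \<and> internal A" by (induction A) auto

lemma chi_type: "arithf A \<Longrightarrow> wt (chi A) \<and> ty_of (chi A) = N" by (induction A) auto

lemma tv_chi: "arithf A \<Longrightarrow> tv (chi A) \<subseteq> insert Mv (fv A)" by (induction A) auto

context model
begin

lemma chi_tsat:
  "vld e \<Longrightarrow> tsat e MuAx \<Longrightarrow> arithf A \<Longrightarrow> dn e (trm (chi A)) = num (of_bool (\<not> tsat e A))"
proof (induction A arbitrary: e)
  case (Eq s t)
  have "\<exists>k. dn e (trm r) = num k" if "wt r" "ty_of r = N" for r
    using vld_trm[OF Eq(1) that(1)] that(2) by auto
  then obtain a b where "dn e (trm s) = num a" "dn e (trm t) = num b" using Eq(3) by (metis arithf.simps(1))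
  then show ?case using Eq(3) by auto
next
  case (Forall x A)
  then obtain n where n: "x = nv n" by (cases x) auto
  have A: "arithf A" using Forall(4) by simp
  have MuAx: "tsat (e(ev x := a)) MuAx" for a
    using Forall(3) tsat_cong[of MuAx e "e(ev x := a)"] by (simp add: n)
  have IH: "dn (e(ev x := num k)) (trm (chi A)) = num (of_bool (\<not> tsat (e(ev x := num k)) A))" for k
    by (rule Forall(1)[OF vld_ev[OF Forall(2)] MuAx A]) (simp add: n)
  define g where "g = dn e (trm (lam x (monus_tm (Succ Zero) (chi A))))"
  have wt: "wt (lam x (monus_tm (Succ Zero) (chi A)))" "ty_of (lam x (monus_tm (Succ Zero) (chi A))) = T1"
    using chi_type[OF A] by (auto simp: n)
  have Eg: "E (emb (snd (0, T1))) g g" using vld_trm[OF Forall(2) wt(1)] wt(2) by (simp add: g_def)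
  have g: "g \<cdot> num k = num (of_bool (tsat (e(ev x := num k)) A))" for k
    by (simp add: g_def dn_lam IH)
  have "E NN (e (ev Mv) \<cdot> g) (e (ev Mv) \<cdot> g)"
  proof -
    have "E ((NN \<rightarrow>\<^sub>r NN) \<rightarrow>\<^sub>r NN) (e (ev Mv)) (e (ev Mv))" using vldD[OF Forall(2), of "ev Mv"] by simp
    then show ?thesis by (rule E_ap) (use Eg in simp)
  qed
  then obtain m where m: "e (ev Mv) \<cdot> g = num m" by auto
  have Mu: "g \<cdot> num k = num 0 \<Longrightarrow> g \<cdot> num m = num 0" for k
  proof -
    have "tsat (e(ev (0, T1) := g, ev (nv 0) := num k)) (Var (0, T1) \<bullet> V 0 \<^bold>= Zero \<^bold>\<longrightarrow>
      Var (0, T1) \<bullet> (Var Mv \<bullet> Var (0, T1)) \<^bold>= Zero)"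
      using Forall(3) Eg unfolding MuAx_def tsat_simps(5) by fastforce
    then show "g \<cdot> num k = num 0 \<Longrightarrow> g \<cdot> num m = num 0" using m by simp
  qed
  have "tsat (e(ev x := num m)) A \<longleftrightarrow> tsat e (Forall x A)"
  proof
    assume *: "tsat (e(ev x := num m)) A"
    have "tsat (e(ev x := num k)) A" for k
      using Mu[of k] * unfolding g by (cases "tsat (e(ev x := num k)) A") auto
    then show "tsat e (Forall x A)" by (auto simp: n)
  qed (auto simp: n)
  then show ?case using m by (simp add: dn_lam IH g_def[symmetric])
qed simp_all

lemma sq_taut0:
  assumes "\<forall>A\<in>set L. wff A" "wff C" "\<And>v. \<forall>A\<in>set L. pval v A \<Longrightarrow> pval v C"
  shows "Th \<^bold>\<turnstile> Conj L \<^bold>\<longrightarrow> C"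
  by (rule proves_taut) (use assms in auto)

lemma sq_mono:
  assumes "Th \<^bold>\<turnstile> Conj L \<^bold>\<longrightarrow> A" "set L \<subseteq> set L'" "\<forall>A\<in>set L'. wff A" shows "Th \<^bold>\<turnstile> Conj L' \<^bold>\<longrightarrow> A"
  by (rule proves_taut1[OF assms(1)]) (use proves_wff[OF assms(1)] assms(2,3) in auto)

lemma sq_St:
  assumes "\<forall>A\<in>set L. wff A"
  shows "wt t \<Longrightarrow> \<forall>v\<in>tv t. St (Var v) \<in> set L \<Longrightarrow> Th \<^bold>\<turnstile> Conj L \<^bold>\<longrightarrow> St t"
proof (induction t)
  case (Var v)
  then show ?case by (intro sq_taut0) (use assms in auto)
next
  case (Cst c)
  have "Th \<^bold>\<turnstile> St (Cst c)" by (rule Th_proves[OF Real_St]) auto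
  then show ?case by (rule proves_taut1) (use assms in auto)
next
  case (App f s)
  have "Th \<^bold>\<turnstile> St f \<^bold>\<longrightarrow> St s \<^bold>\<longrightarrow> St (f \<bullet> s)" by (rule Th_proves[OF Real_St_app[OF App(3)]]) (use App(3) in auto)
  moreover have "Th \<^bold>\<turnstile> Conj L \<^bold>\<longrightarrow> (St f \<^bold>\<and> St s)"
    by (rule proves_taut2[OF App(1,2)]) (use App(3,4) assms in auto)
  ultimately show ?case by (rule proves_taut2) (use App(3) assms in auto)
qed

text \<open>The characteristic function of \<open>B\<close> is given by a term in standard
  parameters, one of them being \<open>\<mu>\<close>, and is therefore standard. Transfer for a
  single function then amounts to transfer for \<open>B\<close>.\<close>

lemma sq_transfer:
  assumes B: "arithf B" and n: "n = nv k" and L: "\<forall>A\<in>set L. wff A" "MuAx \<in> set L"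
    "\<forall>v\<in>insert Mv (fv B - {n}). St (Var v) \<in> set L"
  shows "Th \<^bold>\<turnstile> Conj L \<^bold>\<longrightarrow> ForallSt n B \<^bold>\<longrightarrow> Forall n B"
proof -
  define \<phi> where "\<phi> = lam n (monus_tm (Succ Zero) (chi B))"
  have wB: "wff B" "internal B" using arithf_wff[OF B] by auto
  have \<phi>: "wt \<phi>" "ty_of \<phi> = T1" "tv \<phi> \<subseteq> insert Mv (fv B - {n})" "n \<notin> tv \<phi>"
    using chi_type[OF B] tv_chi[OF B] by (auto simp: \<phi>_def n)
  let ?C = "Neg (\<phi> \<bullet> Var n \<^bold>= Zero)"
  let ?T = "\<lambda>f. ForallSt n (Neg (f \<bullet> Var n \<^bold>= Zero)) \<^bold>\<longrightarrow> Forall n (Neg (f \<bullet> Var n \<^bold>= Zero))"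
  have wC: "wff ?C" "internal ?C" using \<phi> by (auto simp: n)
  have sem: "tsat e ?C \<longleftrightarrow> tsat e B" if "vld e" "tsat e MuAx" for e
  proof -
    have "E NN (e (ev n)) (e (ev n))" using vldD[OF that(1), of "ev n"] by (simp add: n)
    then obtain m where m: "e (ev n) = num m" by auto
    have "e(ev n := num m) = e" using m by (metis fun_upd_triv)
    then have "dn e (trm \<phi>) \<cdot> e (ev n) = num (1 - of_bool (\<not> tsat e B))"
      using chi_tsat[OF that B] m by (simp add: \<phi>_def dn_lam)
    then show ?thesis by (simp add: \<phi>(2))
  qed
  have a: "Th \<^bold>\<turnstile> MuAx \<^bold>\<longrightarrow> B \<^bold>\<longrightarrow> ?C"
    by (rule Th_proves[OF Real_internal]) (use wB wC sem in auto)
  have b: "Th \<^bold>\<turnstile> MuAx \<^bold>\<longrightarrow> ?C \<^bold>\<longrightarrow> B"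
    by (rule Th_proves[OF Real_internal]) (use wB wC sem in auto)
  have "Th \<^bold>\<turnstile> MuAx \<^bold>\<longrightarrow> (St (Var n) \<^bold>\<longrightarrow> B) \<^bold>\<longrightarrow> (St (Var n) \<^bold>\<longrightarrow> ?C)"
    by (rule proves_taut1[OF a]) (use wB wC in auto)
  from proves_mono_under[OF this, of n]
  have a: "Th \<^bold>\<turnstile> MuAx \<^bold>\<longrightarrow> ForallSt n B \<^bold>\<longrightarrow> ForallSt n ?C" by (simp add: n)
  from proves_mono_under[OF b, of n]
  have b: "Th \<^bold>\<turnstile> MuAx \<^bold>\<longrightarrow> Forall n ?C \<^bold>\<longrightarrow> Forall n B" by (simp add: n)
  have TR: "Th \<^bold>\<turnstile> Forall (0, T1) (St (Var (0, T1)) \<^bold>\<longrightarrow> ?T (Var (0, T1)))"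
    using Th_proves[OF Real_TRANS_var[of k]] by (simp add: n)
  have "Th \<^bold>\<turnstile> Forall (0, T1) (St (Var (0, T1)) \<^bold>\<longrightarrow> ?T (Var (0, T1)))
      \<^bold>\<longrightarrow> subst (St (Var (0, T1)) \<^bold>\<longrightarrow> ?T (Var (0, T1))) (0, T1) \<phi>"
    by (rule proves.inst) (use \<phi>(1,2,4) in \<open>auto simp: n\<close>)
  from proves.mp[OF this TR] have c: "Th \<^bold>\<turnstile> St \<phi> \<^bold>\<longrightarrow> ?T \<phi>" by (simp add: n)
  have d: "Th \<^bold>\<turnstile> Conj L \<^bold>\<longrightarrow> St \<phi>" by (rule sq_St[OF L(1) \<phi>(1)]) (use L(3) \<phi>(3) in auto)
  have "Th \<^bold>\<turnstile> Conj L \<^bold>\<longrightarrow> ?T \<phi>"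
    by (rule proves_taut2[OF c d]) (use wC L(1) \<phi>(1) in auto)
  moreover have "Th \<^bold>\<turnstile> Conj L \<^bold>\<longrightarrow> ?T \<phi> \<^bold>\<longrightarrow> ForallSt n B \<^bold>\<longrightarrow> Forall n B"
    by (rule proves_taut2[OF a b]) (use wB wC L(1,2) in auto)
  ultimately show ?thesis by (rule proves_taut2) (use wB wC L(1) in auto)
qed

lemma sq_stf:
  "arithf B \<Longrightarrow> \<forall>A\<in>set L. wff A \<Longrightarrow> MuAx \<in> set L \<Longrightarrow> \<forall>v\<in>insert Mv (fv B). St (Var v) \<in> set L \<Longrightarrow>
    Th \<^bold>\<turnstile> Conj L \<^bold>\<longrightarrow> ((stf B \<^bold>\<longrightarrow> B) \<^bold>\<and> (B \<^bold>\<longrightarrow> stf B))"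
proof (induction B arbitrary: L)
  case (Eq s t)
  then show ?case by (intro sq_taut0) auto
next
  case (Imp A B)
  have "Th \<^bold>\<turnstile> Conj L \<^bold>\<longrightarrow> ((stf A \<^bold>\<longrightarrow> A) \<^bold>\<and> (A \<^bold>\<longrightarrow> stf A))"
    and "Th \<^bold>\<turnstile> Conj L \<^bold>\<longrightarrow> ((stf B \<^bold>\<longrightarrow> B) \<^bold>\<and> (B \<^bold>\<longrightarrow> stf B))"
    using Imp.prems by (intro Imp.IH; simp)+
  from proves_equiv_Imp[OF this] show ?case by simp
next
  case (Forall n B)
  obtain k where n: "n = nv k" using Forall.prems(1) by (cases n) auto
  have B: "arithf B" "wff B" using Forall.prems(1) arithf_wff by auto
  \<comment> \<open>Hypotheses mentioning the bound variable speak of an outer variable of the same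
    name and have to be dropped. The needed ones survive.\<close>
  define L' where "L' = filter (\<lambda>A. n \<notin> fv A) L"
  have L': "\<forall>A\<in>set L'. wff A" "MuAx \<in> set L'" "\<forall>v\<in>insert Mv (fv B - {n}). St (Var v) \<in> set L'"
    "n \<notin> fv (Conj L')" "set L' \<subseteq> set L"
    using Forall.prems by (auto simp: L'_def n)
  have "Th \<^bold>\<turnstile> Conj (St (Var n) # L') \<^bold>\<longrightarrow> ((stf B \<^bold>\<longrightarrow> B) \<^bold>\<and> (B \<^bold>\<longrightarrow> stf B))"
    by (rule Forall.IH[OF B(1)]) (use L' in auto)
  then have a: "Th \<^bold>\<turnstile> Conj L' \<^bold>\<longrightarrow> (St (Var n) \<^bold>\<longrightarrow> stf B) \<^bold>\<longrightarrow> (St (Var n) \<^bold>\<longrightarrow> B)"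
    and b: "Th \<^bold>\<turnstile> Conj L' \<^bold>\<longrightarrow> B \<^bold>\<longrightarrow> (St (Var n) \<^bold>\<longrightarrow> stf B)"
    by (rule proves_taut1; use B L'(1) in auto)+
  have "Th \<^bold>\<turnstile> Conj L' \<^bold>\<longrightarrow> ForallSt n (stf B) \<^bold>\<longrightarrow> Forall n B"
    by (rule proves_taut2[OF proves_mono_under[OF a L'(4)] sq_transfer[OF B(1) n L'(1-3)]])
      (use B L'(1) in auto)
  from proves_equivI[OF this proves_mono_under[OF b L'(4)]]
  have "Th \<^bold>\<turnstile> Conj L' \<^bold>\<longrightarrow> ((stf (Forall n B) \<^bold>\<longrightarrow> Forall n B) \<^bold>\<and> (Forall n B \<^bold>\<longrightarrow> stf (Forall n B)))"
    by simp
  then show ?case by (rule sq_mono[OF _ L'(5) Forall.prems(2)])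
qed (auto intro: sq_taut0)

lemma Rle_sq:
  assumes V: "vld e" and "Th \<^bold>\<turnstile> Conj L \<^bold>\<longrightarrow> A" "\<forall>B\<in>set L. Rle e B" shows "Rle e A"
proof -
  have "wff (Conj L)" using proves_wff[OF assms(2)] by simp
  with assms(3) have "Rle e (Conj L)"
  proof (induction L)
    case Nil
    then show ?case by (intro Rle_internal) auto
  next
    case (Cons B L)
    have "Th \<^bold>\<turnstile> B \<^bold>\<longrightarrow> Conj L \<^bold>\<longrightarrow> Conj (B # L)" by (rule proves_taut) (use Cons.prems in auto)
    from Rle_Real[OF proves_Th[OF this] V] have "Rle e (Conj L \<^bold>\<longrightarrow> Conj (B # L))"
      by (rule Rle_mp) (use Cons.prems in simp)
    then show ?case by (rule Rle_mp) (use Cons in simp)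
  qed
  then show ?thesis using Rle_mp[OF Rle_Real[OF proves_Th[OF assms(2)] V]] by blast
qed

end

section \<open>Arithmetical transfinite recursion with standard parameters\<close>

primrec tval :: "(nat \<Rightarrow> nat) \<Rightarrow> ntm \<Rightarrow> nat" where
  "tval \<nu> (NV n) = \<nu> n"
| "tval \<nu> N0 = 0"
| "tval \<nu> N1 = 1"
| "tval \<nu> (Add s t) = tval \<nu> s + tval \<nu> t"
| "tval \<nu> (Mul s t) = tval \<nu> s * tval \<nu> t"

primrec sosat :: "(nat \<Rightarrow> nat) \<Rightarrow> (nat \<Rightarrow> nat set) \<Rightarrow> sofm \<Rightarrow> bool" where
  "sosat \<nu> S (s =\<^sub>2 t) \<longleftrightarrow> tval \<nu> s = tval \<nu> t"
| "sosat \<nu> S (s <\<^sub>2 t) \<longleftrightarrow> tval \<nu> s < tval \<nu> t"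
| "sosat \<nu> S (t \<in>\<^sub>2 X) \<longleftrightarrow> tval \<nu> t \<in> S X"
| "sosat \<nu> S SBot \<longleftrightarrow> False"
| "sosat \<nu> S (A \<longrightarrow>\<^sub>2 B) \<longleftrightarrow> (sosat \<nu> S A \<longrightarrow> sosat \<nu> S B)"
| "sosat \<nu> S (AllN n A) \<longleftrightarrow> (\<forall>k. sosat (\<nu>(n := k)) S A)"
| "sosat \<nu> S (BAllN n t A) \<longleftrightarrow> (\<forall>k<tval \<nu> t. sosat (\<nu>(n := k)) S A)"
| "sosat \<nu> S (AllS X A) \<longleftrightarrow> (\<forall>T. sosat \<nu> (S(X := T)) A)"

text \<open>The formulas whose translation \<open>st_tr\<close> is the plain relativisation
  \<open>stf\<close> of an internal arithmetical formula, see \<open>pure_int_tr\<close>.\<close>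

primrec pure :: "sofm \<Rightarrow> bool" where
  "pure (s =\<^sub>2 t) = True"
| "pure (s <\<^sub>2 t) = True"
| "pure (t \<in>\<^sub>2 X) = True"
| "pure SBot = True"
| "pure (A \<longrightarrow>\<^sub>2 B) = (pure A \<and> pure B)"
| "pure (AllN n A) = pure A"
| "pure (BAllN n t A) = False"
| "pure (AllS X A) = False"

primrec int_tr :: "sofm \<Rightarrow> fm" where
  "int_tr (s =\<^sub>2 t) = (tr_tm s \<^bold>= tr_tm t)"
| "int_tr (s <\<^sub>2 t) = (tr_tm s \<^bold>< tr_tm t)"
| "int_tr (t \<in>\<^sub>2 X) = (Var (X, T1) \<bullet> tr_tm t \<^bold>= Succ Zero)"
| "int_tr SBot = Bot"
| "int_tr (A \<longrightarrow>\<^sub>2 B) = (int_tr A \<^bold>\<longrightarrow> int_tr B)"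
| "int_tr (AllN n A) = Forall (nv n) (int_tr A)"
| "int_tr (BAllN n t A) = Bot"
| "int_tr (AllS X A) = Bot"

lemma tr_tm_type [simp]: "wt (tr_tm t)" "ty_of (tr_tm t) = N"
proof -
  have "wt (tr_tm t) \<and> ty_of (tr_tm t) = N" by (induction t) auto
  then show "wt (tr_tm t)" "ty_of (tr_tm t) = N" by auto
qed

lemma pure_int_tr: "pure A \<Longrightarrow> arithf (int_tr A) \<and> stf (int_tr A) = st_tr A"
  by (induction A) auto

lemma tv_tr_tm: "v \<in> tv (tr_tm t) \<Longrightarrow> snd v = N" by (induction t) auto

lemma fv_int_tr: "v \<in> fv (int_tr A) \<Longrightarrow> snd v = N \<or> snd v = T1"
  by (induction A) (auto dest: tv_tr_tm)

lemma finite_fv: "finite (fv A)" by (induction A) (auto simp: finite_tv)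

lemma pure_set_subst: "pure A \<Longrightarrow> (\<And>t. pure (r t)) \<Longrightarrow> pure (set_subst A Z r)"
  by (induction A) auto

lemma pure_H_iter: "pure \<theta> \<Longrightarrow> pure (H_iter n Z \<theta> j k m i X Y)"
  by (auto simp: H_iter_def less_in_def le_in_def field_in_def in_part_def intro!: pure_set_subst)

definition hyps :: "var set \<Rightarrow> fm list" where
  "hyps W = MuAx # map (\<lambda>v. St (Var v)) (SOME vs. set vs = insert Mv W)"

lemma set_hyps: "finite W \<Longrightarrow> set (hyps W) = insert MuAx ((\<lambda>v. St (Var v)) ` insert Mv W)"
  using someI_ex[OF finite_list[of "insert Mv W"]] by (simp add: hyps_def)

lemma wff_hyps [simp]: "finite W \<Longrightarrow> A \<in> set (hyps W) \<Longrightarrow> wff A" by (auto simp: set_hyps)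

lemma fv_hyps: "finite W \<Longrightarrow> x \<notin> insert Mv W \<Longrightarrow> x \<notin> fv (Conj (hyps W))" by (auto simp: set_hyps)

context model
begin

lemma dn_tr_tm: "(\<And>n. e (n, NN) = num (\<nu> n)) \<Longrightarrow> dn e (trm (tr_tm t)) = num (tval \<nu> t)"
  by (induction t) auto

lemma tsat_int_tr:
  "pure A \<Longrightarrow> (\<And>n. e (n, NN) = num (\<nu> n)) \<Longrightarrow> (\<And>X. S X = {k. e (X, NN \<rightarrow>\<^sub>r NN) \<cdot> num k = num 1}) \<Longrightarrow>
    vld e \<Longrightarrow> tsat e (int_tr A) \<longleftrightarrow> sosat \<nu> S A"
proof (induction A arbitrary: e \<nu>)
  case (SMem t X)
  have "E (NN \<rightarrow>\<^sub>r NN) (e (X, NN \<rightarrow>\<^sub>r NN)) (e (X, NN \<rightarrow>\<^sub>r NN))" using vldD[OF SMem(4), of "(X, NN \<rightarrow>\<^sub>r NN)"] by simp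
  then have "E NN (e (X, NN \<rightarrow>\<^sub>r NN) \<cdot> num k) (e (X, NN \<rightarrow>\<^sub>r NN) \<cdot> num k)" for k by (rule E_ap) simp
  then have "\<exists>m. e (X, NN \<rightarrow>\<^sub>r NN) \<cdot> num k = num m" for k by simp
  then obtain h where "\<And>k. e (X, NN \<rightarrow>\<^sub>r NN) \<cdot> num k = num (h k)" by metis
  then show ?case by (auto simp: dn_tr_tm[of e \<nu>] SMem(2,3))
next
  case (AllN n A)
  have "tsat (e((n, NN) := num k)) (int_tr A) \<longleftrightarrow> sosat (\<nu>(n := k)) S A" for k
  proof (rule AllN.IH)
    show "(e((n, NN) := num k)) (m, NN) = num ((\<nu>(n := k)) m)" for m
      using AllN.prems(2) by (cases "m = n") auto
    show "vld (e((n, NN) := num k))" by (rule vld_upd[OF AllN.prems(4)]) simp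
  qed (use AllN.prems in auto)
  then show ?case by (simp add: tsat_ForallN del: tsat_simps(5))
qed (auto simp: dn_tr_tm Suc_le_eq)

definition stdenv :: "(rvar \<Rightarrow> D) \<Rightarrow> (nat \<Rightarrow> nat) \<Rightarrow> (nat \<Rightarrow> nat set) \<Rightarrow> bool" where
  "stdenv e \<nu> S \<longleftrightarrow> vld e \<and> e (ev Mv) = dn e0 (RC RMu) \<and> (\<forall>n. e (n, NN) = num (\<nu> n)) \<and>
     (\<forall>X. R (NN \<rightarrow>\<^sub>r NN) (e (X, NN \<rightarrow>\<^sub>r NN)) \<and> (\<forall>k. e (X, NN \<rightarrow>\<^sub>r NN) \<cdot> num k = num (of_bool (k \<in> S X))))"

lemma tsat_stdenv:
  assumes "stdenv e \<nu> S" "pure A" shows "tsat e (int_tr A) \<longleftrightarrow> sosat \<nu> S A"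
proof (rule tsat_int_tr[OF assms(2)])
  show "S X = {k. e (X, NN \<rightarrow>\<^sub>r NN) \<cdot> num k = num 1}" for X
    using assms(1) by (auto simp: stdenv_def)
qed (use assms(1) in \<open>auto simp: stdenv_def\<close>)

lemma tsat_stdenv_upd:
  assumes "stdenv e \<nu> S" "pure A" "E (NN \<rightarrow>\<^sub>r NN) a a"
  shows "tsat (e(ev (X, T1) := a)) (int_tr A) \<longleftrightarrow> sosat \<nu> (S(X := {k. a \<cdot> num k = num 1})) A"
proof (rule tsat_int_tr[OF assms(2)])
  show "(S(X := {k. a \<cdot> num k = num 1})) Y = {k. (e(ev (X, T1) := a)) (Y, NN \<rightarrow>\<^sub>r NN) \<cdot> num k = num 1}" for Y
    using assms(1) by (cases "Y = X") (auto simp: stdenv_def)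
  show "vld (e(ev (X, T1) := a))" by (rule vld_ev) (use assms in \<open>simp_all add: stdenv_def\<close>)
qed (use assms(1) in \<open>auto simp: stdenv_def\<close>)

lemma Rle_hyps:
  assumes e: "stdenv e \<nu> S" and W: "finite W" "W \<subseteq> fv (int_tr A)" shows "\<forall>B\<in>set (hyps W). Rle e B"
proof -
  have "tsat e MuAx"
  proof -
    have "e (ev Mv) = cden p w RMu" using e by (simp add: stdenv_def)
    moreover have "f \<cdot> (cden p w RMu \<cdot> f) = num 0" if "E (NN \<rightarrow>\<^sub>r NN) f f" "f \<cdot> num n = num 0" for f n
    proof -
      have "E NN (f \<cdot> num k) (f \<cdot> num k)" for k by (rule E_ap[OF that(1)]) simp
      then have "\<exists>m. f \<cdot> num k = num m" for k by simp
      then obtain h where h: "\<And>k. f \<cdot> num k = num (h k)" by metis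
      have "h (muv h) = 0" unfolding muv_def by (rule LeastI[of _ n]) (use h that(2) in simp)
      then show ?thesis using muD[of f h] h by simp
    qed
    ultimately show ?thesis
      by (simp add: MuAx_def tsat_simps(5)[of _ "(0, T1)"] tsat_ForallN del: tsat_simps(5) E.simps(2))
  qed
  then have "Rle e MuAx" by (intro Rle_internal) auto
  moreover have "Rle e (St (Var v))" if v: "v \<in> insert Mv W" for v
  proof (rule Rle_St)
    consider "v = Mv" | n where "v = (n, N)" | n where "v = (n, T1)" using v W(2) fv_int_tr[of v A] by (cases v) auto
    then show "R (emb (snd v)) (e (ev v))"
    proof cases
      case 1
      have "R (emb (T1 \<rightarrow>\<^sub>t N)) (dn e0 (RC RMu))" by (rule R_closed) (auto intro!: ht_RC simp: tyc.simps)
      then show ?thesis using e 1 by (simp add: stdenv_def)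
    qed (use e R_num in \<open>auto simp: stdenv_def\<close>)
  qed
  ultimately show ?thesis by (auto simp: set_hyps[OF W(1)])
qed

lemma Rle_pure:
  assumes e: "stdenv e \<nu> S" and A: "pure A" "sosat \<nu> S A" shows "Rle e (st_tr A)"
proof -
  let ?L = "hyps (fv (int_tr A))"
  have ar: "arithf (int_tr A)" "stf (int_tr A) = st_tr A" using pure_int_tr[OF A(1)] by auto
  have "Th \<^bold>\<turnstile> Conj ?L \<^bold>\<longrightarrow> ((stf (int_tr A) \<^bold>\<longrightarrow> int_tr A) \<^bold>\<and> (int_tr A \<^bold>\<longrightarrow> stf (int_tr A)))"
    by (rule sq_stf[OF ar(1)]) (auto simp: finite_fv set_hyps)
  moreover have "wff (Conj ?L)" "wff (int_tr A)" using arithf_wff[OF ar(1)] wff_hyps[OF finite_fv] by auto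
  ultimately have "Th \<^bold>\<turnstile> Conj (int_tr A # ?L) \<^bold>\<longrightarrow> stf (int_tr A)"
    by (elim proves_taut1) (auto simp del: wff_Conj pval_Conj)
  from Rle_sq[OF _ this] show ?thesis
    using Rle_hyps[OF e finite_fv subset_refl] Rle_internal[of "int_tr A" e] tsat_stdenv[OF e A(1)] A(2)
      arithf_wff[OF ar(1)] e ar(2)
    by (simp add: stdenv_def)
qed

text \<open>Every total object of type 1 determines a set, so the internal statement
  \<open>Forall ?x (Neg ?B)\<close> is true in the extensional model and hence realised. In this way
  actual well-foundedness is turned into realised well-foundedness.\<close>

lemma Rle_no_set:
  assumes e: "stdenv e \<nu> S" and A: "pure A" "\<And>T. \<not> sosat \<nu> (S(X := T)) A" shows "Rle e (st_tr (SNeg (ExS X A)))"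
proof -
  let ?x = "(X, T1)"
  let ?B = "int_tr A"
  let ?L = "hyps (fv ?B - {?x})"
  let ?b = "ForallSt (nv 0) (Var ?x \<bullet> V 0 \<^bold>\<le> Succ Zero)"
  have ar: "arithf ?B" "stf ?B = st_tr A" using pure_int_tr[OF A(1)] by auto
  have fin: "finite (fv ?B - {?x})" by (simp add: finite_fv)
  have "Th \<^bold>\<turnstile> Conj (St (Var ?x) # ?L) \<^bold>\<longrightarrow> ((stf ?B \<^bold>\<longrightarrow> ?B) \<^bold>\<and> (?B \<^bold>\<longrightarrow> stf ?B))"
    by (rule sq_stf[OF ar(1)]) (auto simp: finite_fv set_hyps)
  moreover have w: "wff (Conj ?L)" "wff ?B" using arithf_wff[OF ar(1)] wff_hyps[OF fin] by auto
  ultimately have "Th \<^bold>\<turnstile> Conj ?L \<^bold>\<longrightarrow> Neg ?B \<^bold>\<longrightarrow> (St (Var ?x) \<^bold>\<longrightarrow> ?b \<^bold>\<longrightarrow> Neg (stf ?B))"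
    by (elim proves_taut1) (auto simp del: wff_Conj pval_Conj)
  then have "Th \<^bold>\<turnstile> Conj ?L \<^bold>\<longrightarrow> Forall ?x (Neg ?B) \<^bold>\<longrightarrow> ForallSt ?x (?b \<^bold>\<longrightarrow> Neg (stf ?B))"
    by (rule proves_mono_under) (rule fv_hyps, auto simp: finite_fv)
  then have "Th \<^bold>\<turnstile> Conj (Forall ?x (Neg ?B) # ?L) \<^bold>\<longrightarrow> Neg (Neg (ForallSt ?x (?b \<^bold>\<longrightarrow> Neg (stf ?B))))"
    by (rule proves_taut1) (use w in \<open>auto simp del: wff_Conj pval_Conj\<close>)
  moreover have "Rle e (Forall ?x (Neg ?B))"
  proof (rule Rle_internal)
    show "tsat e (Forall ?x (Neg ?B))"
      unfolding tsat_simps using tsat_stdenv_upd[OF e A(1)] A(2) by simp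
  qed (use arithf_wff[OF ar(1)] in simp)
  ultimately have "Rle e (Neg (Neg (ForallSt ?x (?b \<^bold>\<longrightarrow> Neg (stf ?B)))))"
    by (elim Rle_sq[rotated]) (use e Rle_hyps[OF e fin, of A] in \<open>auto simp: stdenv_def\<close>)
  then show ?thesis by (simp add: ar(2))
qed

text \<open>In \<open>st_tr\<close> the condition that the function is binary is relativised, and so
  is the arithmetical matrix. Both are made internal by transfer, after which a definable witness
  can be extracted.\<close>

lemma Rle_ex_set:
  assumes e: "stdenv e \<nu> S" and A: "pure A" and h: "Rle e (st_tr (ExS X A))"
  obtains a T where "R (NN \<rightarrow>\<^sub>r NN) a" "\<And>k. a \<cdot> num k = num (of_bool (k \<in> T))" "sosat \<nu> (S(X := T)) A"
proof -
  let ?x = "(X, T1)"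
  let ?B = "int_tr A"
  let ?L = "hyps (fv ?B - {?x})"
  let ?c = "Var ?x \<bullet> V 0 \<^bold>\<le> Succ Zero"
  let ?b = "ForallSt (nv 0) ?c"
  let ?J = "Forall (nv 0) ?c \<^bold>\<longrightarrow> Neg ?B"
  let ?N = "?b \<^bold>\<longrightarrow> Neg (stf ?B)"
  have ar: "arithf ?B" "stf ?B = st_tr A" using pure_int_tr[OF A(1)] by auto
  have fin: "finite (fv ?B - {?x})" by (simp add: finite_fv)
  have V: "vld e" using e by (simp add: stdenv_def)
  have 1: "Th \<^bold>\<turnstile> Conj (St (Var ?x) # ?L) \<^bold>\<longrightarrow> ((stf ?B \<^bold>\<longrightarrow> ?B) \<^bold>\<and> (?B \<^bold>\<longrightarrow> stf ?B))"
    by (rule sq_stf[OF ar(1)]) (auto simp: finite_fv set_hyps)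
  have 2: "Th \<^bold>\<turnstile> Conj (St (Var ?x) # ?L) \<^bold>\<longrightarrow> ?b \<^bold>\<longrightarrow> Forall (nv 0) ?c"
    by (rule sq_transfer[OF _ refl]) (auto simp: finite_fv set_hyps)
  have w: "wff (Conj ?L)" "wff ?B" using arithf_wff[OF ar(1)] wff_hyps[OF fin] by auto
  have "Th \<^bold>\<turnstile> Conj ?L \<^bold>\<longrightarrow> (St (Var ?x) \<^bold>\<longrightarrow> ?J) \<^bold>\<longrightarrow> (St (Var ?x) \<^bold>\<longrightarrow> ?N)"
    by (rule proves_taut2[OF 1 2]) (use w in \<open>auto simp del: wff_Conj pval_Conj\<close>)
  then have "Th \<^bold>\<turnstile> Conj ?L \<^bold>\<longrightarrow> ForallSt ?x ?J \<^bold>\<longrightarrow> ForallSt ?x ?N"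
    by (rule proves_mono_under) (rule fv_hyps, auto simp: finite_fv)
  then have "Th \<^bold>\<turnstile> Conj (Neg (ForallSt ?x ?N) # ?L) \<^bold>\<longrightarrow> Neg (ForallSt ?x ?J)"
    by (rule proves_taut1) (use w in \<open>auto simp del: wff_Conj pval_Conj\<close>)
  moreover have "Rle e (Neg (ForallSt ?x ?N))" using h by (simp add: ar(2))
  ultimately have "Rle e (Neg (ForallSt ?x ?J))"
    by (elim Rle_sq[OF V]) (use e Rle_hyps[OF e fin, of A] in \<open>auto simp: stdenv_def\<close>)
  then obtain a where a: "R (emb (snd ?x)) a" "\<not> tsat (e(ev ?x := a)) ?J"
    by (rule Rle_standard_witness[OF V, rotated 2]) (use arithf_wff[OF ar(1)] in simp_all)
  have Ra: "R (NN \<rightarrow>\<^sub>r NN) a" using a(1) by simp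
  have "E NN (a \<cdot> num k) (a \<cdot> num k)" for k by (rule E_ap[OF R_E[OF Ra]]) simp
  then have "\<exists>m. a \<cdot> num k = num m" for k by simp
  then obtain h where h: "\<And>k. a \<cdot> num k = num (h k)" by metis
  have "tsat (e(ev ?x := a)) (Forall (nv 0) ?c)" using a(2) by simp
  then have "\<forall>k. h k \<le> 1" by (simp add: h tsat_ForallN del: tsat_simps(5))
  then have "h k = 0 \<or> h k = 1" for k by (metis le_neq_implies_less less_one)
  then have T: "a \<cdot> num k = num (of_bool (k \<in> {k. a \<cdot> num k = num 1}))" for k
    by (cases "h k = 1") (auto simp: h)
  have "sosat \<nu> (S(X := {k. a \<cdot> num k = num 1})) A"
    using tsat_stdenv_upd[OF e A R_E[OF Ra]] a(2) by simp
  with Ra T show thesis by (rule that)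
qed

lemma Rle_AllS:
  assumes e: "stdenv e \<nu> S" and h: "Rle e (st_tr (AllS X A))" and w: "wff (st_tr A)" shows "Rle e (st_tr A)"
proof -
  let ?x = "(X, T1)"
  let ?c = "Var ?x \<bullet> V 0 \<^bold>\<le> Succ Zero"
  have V: "vld e" using e by (simp add: stdenv_def)
  have ex: "R (emb (snd ?x)) (e (ev ?x))" "\<And>k. e (X, NN \<rightarrow>\<^sub>r NN) \<cdot> num k = num (of_bool (k \<in> S X))"
    using e by (simp_all add: stdenv_def)
  have "Rle (e(ev ?x := e (ev ?x))) (St (Var ?x) \<^bold>\<longrightarrow> ForallSt (nv 0) ?c \<^bold>\<longrightarrow> st_tr A)"
    by (rule Rle_spec) (use h R_E[OF ex(1)] in simp_all)
  then have "Rle e (St (Var ?x) \<^bold>\<longrightarrow> ForallSt (nv 0) ?c \<^bold>\<longrightarrow> st_tr A)" by (simp only: fun_upd_triv)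
  then have 1: "Rle e (ForallSt (nv 0) ?c \<^bold>\<longrightarrow> st_tr A)" by (rule Rle_mp) (rule Rle_St[of ?x e, OF ex(1)])
  have "Rle e (Forall (nv 0) ?c)"
    by (rule Rle_internal) (simp_all add: tsat_ForallN ex(2) del: tsat_simps(5))
  moreover have "Th \<^bold>\<turnstile> Forall (nv 0) ?c \<^bold>\<longrightarrow> ForallSt (nv 0) ?c"
    by (rule proves_all_mono[OF proves_taut]) auto
  ultimately have "Rle e (ForallSt (nv 0) ?c)" using Rle_mp[OF Rle_Real[OF proves_Th V]] by blast
  with 1 show ?thesis by (rule Rle_mp)
qed

lemma wff_st_tr [simp]: "wff (st_tr A)" by (induction A) auto

text \<open>The hypothesis \<open>WO X\<close> is true of actual sets and has to be converted into a
  realised formula. Its two conjuncts need different reasons: \<open>LO X\<close> is arithmetical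
  and transfers, while \<open>WF X\<close> holds because no descending sequence exists at
  all.\<close>

lemma ATR_solution:
  assumes Th: "Th \<^bold>\<turnstile> st_tr (foldr AllS Xs (AllS X (WO X \<longrightarrow>\<^sub>2 ExS Y B)))"
    and e: "stdenv e \<nu> S" and WO: "sosat \<nu> S (WO X)" and B: "pure B"
  obtains a T where "R (NN \<rightarrow>\<^sub>r NN) a" "\<And>k. a \<cdot> num k = num (of_bool (k \<in> T))" "sosat \<nu> (S(Y := T)) B"
proof -
  have V: "vld e" using e by (simp add: stdenv_def)
  have "Rle e (st_tr (foldr AllS Xs (AllS X (WO X \<longrightarrow>\<^sub>2 ExS Y B))))" by (rule Rle_Real[OF proves_Th[OF Th] V])
  then have "Rle e (st_tr (AllS X (WO X \<longrightarrow>\<^sub>2 ExS Y B)))"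
  proof (induction Xs)
    case (Cons Z Xs)
    from Rle_AllS[OF e Cons(2)[unfolded foldr.simps comp_apply] wff_st_tr] show ?case by (rule Cons(1))
  qed simp
  then have 1: "Rle e (st_tr (WO X) \<^bold>\<longrightarrow> st_tr (ExS Y B))" using Rle_AllS[OF e _ wff_st_tr] by (metis st_tr.simps(5))
  have "Rle e (st_tr (LO X))"
    by (rule Rle_pure[OF e]) (use WO in \<open>simp_all add: WO_def LO_def Let_def le_in_def field_in_def\<close>)
  moreover have "Rle e (st_tr (WF X))"
    unfolding WF_def Let_def
    by (rule Rle_no_set[OF e]) (use WO in \<open>simp_all add: WO_def WF_def Let_def le_in_def less_in_def\<close>)
  moreover have "Th \<^bold>\<turnstile> st_tr (LO X) \<^bold>\<longrightarrow> st_tr (WF X) \<^bold>\<longrightarrow> st_tr (WO X)"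
    by (rule proves_taut) (simp_all add: WO_def)
  ultimately have "Rle e (st_tr (WO X))" using Rle_mp Rle_Real[OF proves_Th V] by blast
  from Rle_ex_set[OF e B Rle_mp[OF 1 this]] show thesis using that by blast
qed

end

section \<open>Coin tossing\<close>

definition bitM :: "bool measure" where "bitM = measure_pmf (pmf_of_set UNIV)"
definition seqM :: "(nat \<Rightarrow> bool) measure" where "seqM = PiM UNIV (\<lambda>_. bitM)"
definition seqsM :: "(nat \<Rightarrow> nat \<Rightarrow> bool) measure" where "seqsM = PiM UNIV (\<lambda>_. seqM)"
definition coinsM :: "coins measure" where "coinsM = PiM UNIV (\<lambda>_. seqM)"

lemma prob_space_bitM: "prob_space bitM"
  unfolding bitM_def by (rule prob_space_measure_pmf)
lemma prob_space_seqM: "prob_space seqM"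
  unfolding seqM_def by (rule prob_space_PiM) (rule prob_space_bitM)
lemma prob_space_seqsM: "prob_space seqsM"
  unfolding seqsM_def by (rule prob_space_PiM) (rule prob_space_seqM)
lemma prob_space_coinsM: "prob_space coinsM"
  unfolding coinsM_def by (rule prob_space_PiM) (rule prob_space_seqM)

lemma space_coin [simp]:
  "space bitM = UNIV" "space seqM = UNIV" "space seqsM = UNIV" "space coinsM = UNIV"
  by (auto simp: bitM_def seqM_def seqsM_def coinsM_def space_PiM)

lemma sets_bitM [measurable_cong]: "sets bitM = sets (count_space UNIV)"
  by (simp add: bitM_def)

lemma sets_bitM' [simp]: "A \<in> sets bitM" by (simp add: sets_bitM)

lemma measurable_seqM_component [measurable]:
  "(\<lambda>x. x n) \<in> seqM \<rightarrow>\<^sub>M count_space UNIV"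
proof -
  have "(\<lambda>x. x n) \<in> seqM \<rightarrow>\<^sub>M bitM" unfolding seqM_def by measurable
  then show ?thesis by (simp add: measurable_cong_sets[OF refl sets_bitM])
qed

lemma measurable_seqsM_component [measurable]: "(\<lambda>x. x n) \<in> seqsM \<rightarrow>\<^sub>M seqM"
  unfolding seqsM_def by measurable

lemma measurable_coinsM_component [measurable]: "(\<lambda>x. x n) \<in> coinsM \<rightarrow>\<^sub>M seqM"
  unfolding coinsM_def by measurable

lemma component_sets:
  assumes "A \<in> sets seqM"
  shows "{z. z i \<in> A} \<in> sets seqsM" "{w. w c \<in> A} \<in> sets coinsM"
  using measurable_sets[OF measurable_seqsM_component[of i] assms]
    measurable_sets[OF measurable_coinsM_component[of c] assms] by (simp_all add: vimage_def)

lemma restrict_UNIV: "restrict f UNIV = f" by (simp add: restrict_def)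

lemma measurable_into_seqsM:
  assumes "\<And>n. (\<lambda>x. f x n) \<in> M \<rightarrow>\<^sub>M seqM" shows "f \<in> M \<rightarrow>\<^sub>M seqsM"
proof -
  have "(\<lambda>x. \<lambda>n\<in>UNIV. f x n) \<in> M \<rightarrow>\<^sub>M seqsM" unfolding seqsM_def using assms by (intro measurable_restrict)
  then show ?thesis by (simp only: restrict_UNIV)
qed

lemma measurable_into_coinsM:
  assumes "\<And>n. (\<lambda>x. f x n) \<in> M \<rightarrow>\<^sub>M seqM" shows "f \<in> M \<rightarrow>\<^sub>M coinsM"
proof -
  have "(\<lambda>x. \<lambda>n\<in>UNIV. f x n) \<in> M \<rightarrow>\<^sub>M coinsM" unfolding coinsM_def using assms by (intro measurable_restrict)
  then show ?thesis by (simp only: restrict_UNIV)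
qed

lemma emeasure_bitM: "emeasure bitM {b} = ennreal (1 / 2)"
  by (simp add: bitM_def emeasure_pmf_single)

lemma cylinder_sets [measurable]: "{x. \<forall>l<n. x l = s l} \<in> sets seqM"
proof -
  have "{x \<in> space seqM. \<forall>l<n. x l = s l} \<in> sets seqM" by measurable
  then show ?thesis by simp
qed

lemma measure_cylinder: "measure seqM {x. \<forall>l<n. x l = s l} = (1 / 2) ^ n"
proof -
  interpret product_prob_space "\<lambda>_ :: nat. bitM" UNIV
    using prob_space_bitM by (simp add: product_prob_space_def product_sigma_finite_def
      product_prob_space_axioms_def prob_space_imp_sigma_finite)
  have "emeasure seqM {x. \<forall>l<n. x l = s l} = (\<Prod>l\<in>{..<n}. emeasure bitM {s l})"
    using emeasure_PiM_Collect[of "{..<n}" "\<lambda>l. {s l}"] unfolding seqM_def[symmetric] by (simp add: Ball_def)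
  also have "\<dots> = ennreal ((1 / 2) ^ n)"
    by (simp only: emeasure_bitM prod_constant card_lessThan) (rule ennreal_power, simp)
  finally show ?thesis by (simp add: measure_def)
qed

lemma bool_list_eq: "map x [0..<length s] = s \<longleftrightarrow> (\<forall>l<length s. x l = s ! l)"
  unfolding list_eq_iff_nth_eq by simp

lemma cylinder_disjoint:
  "length s = n \<Longrightarrow> length t = n \<Longrightarrow> s \<noteq> t \<Longrightarrow> {x. \<forall>l<n. x l = s ! l} \<inter> {x. \<forall>l<n. x l = t ! l} = {}"
  by (auto simp: list_eq_iff_nth_eq)

lemma measure_bool_lists:
  assumes "\<And>s. s \<in> Z \<Longrightarrow> length s = n"
  shows "measure seqM {x. map x [0..<n] \<in> Z} = card Z / 2 ^ n"
    and "{x. map x [0..<n] \<in> Z} \<in> sets seqM"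
proof -
  interpret prob_space seqM by (rule prob_space_seqM)
  have fin: "finite Z" by (rule finite_subset[OF _ card_bool_lists(2)[of n]]) (use assms in auto)
  have eq: "{x. map x [0..<n] \<in> Z} = (\<Union>s\<in>Z. {x. \<forall>l<n. x l = s ! l})"
  proof (rule set_eqI)
    fix x
    have "map x [0..<n] \<in> Z \<longleftrightarrow> (\<exists>s\<in>Z. map x [0..<n] = s)" by auto
    also have "\<dots> \<longleftrightarrow> (\<exists>s\<in>Z. \<forall>l<n. x l = s ! l)"
      by (rule bex_cong[OF refl]) (use bool_list_eq[of x] assms in force)
    finally show "x \<in> {x. map x [0..<n] \<in> Z} \<longleftrightarrow> x \<in> (\<Union>s\<in>Z. {x. \<forall>l<n. x l = s ! l})" by simp
  qed
  have "measure seqM (\<Union>s\<in>Z. {x. \<forall>l<n. x l = s ! l}) = (\<Sum>s\<in>Z. measure seqM {x. \<forall>l<n. x l = s ! l})"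
  proof (rule finite_measure_finite_Union[OF fin])
    show "disjoint_family_on (\<lambda>s. {x. \<forall>l<n. x l = s ! l}) Z"
      unfolding disjoint_family_on_def by (intro ballI impI cylinder_disjoint assms)
  qed auto
  also have "\<dots> = card Z / 2 ^ n" by (simp add: measure_cylinder power_one_over)
  finally show "measure seqM {x. map x [0..<n] \<in> Z} = card Z / 2 ^ n" unfolding eq .
  show "{x. map x [0..<n] \<in> Z} \<in> sets seqM" unfolding eq using fin by auto
qed

lemma covers_iff:
  assumes "m > 0"
  shows "covers x h j m \<longleftrightarrow> measure seqM {y. \<exists>i\<le>j. \<forall>l<h i. y l = x i l} > 1 - 1 / m"
proof -
  let ?N = "\<Sum>i\<le>j. h i"
  let ?Z = "{s. length s = ?N \<and> (\<exists>i\<le>j. \<forall>l<h i. s ! l = x i l)}"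
  have h: "h i \<le> ?N" if "i \<le> j" for i using that by (intro member_le_sum) auto
  have nth: "map y [0..<?N] ! l = y l" if "i \<le> j" "l < h i" for i l and y :: "nat \<Rightarrow> bool"
    using h[OF that(1)] that(2) by simp
  have "map y [0..<?N] \<in> ?Z \<longleftrightarrow> (\<exists>i\<le>j. \<forall>l<h i. y l = x i l)" for y
    unfolding mem_Collect_eq by (simp add: nth del: upt_Suc cong: conj_cong)
  then have "measure seqM {y. \<exists>i\<le>j. \<forall>l<h i. y l = x i l} = card ?Z / 2 ^ ?N"
    using measure_bool_lists(1)[of ?Z ?N] by simp
  then have "measure seqM {y. \<exists>i\<le>j. \<forall>l<h i. y l = x i l} > 1 - 1 / m \<longleftrightarrow>
      (real m - 1) * 2 ^ ?N < m * real (card ?Z)"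
  proof -
    have "1 - 1 / m = (real m - 1) / m" using assms by (simp add: diff_divide_distrib)
    then have "c / 2 ^ ?N > 1 - 1 / m \<longleftrightarrow> (real m - 1) * 2 ^ ?N < m * c" for c :: real
      using assms by (simp add: divide_less_eq less_divide_eq mult.commute)
    with \<open>_ = card ?Z / 2 ^ ?N\<close> show ?thesis by simp
  qed
  also have "\<dots> \<longleftrightarrow> real ((m - 1) * 2 ^ ?N) < real (m * card ?Z)"
    using assms by (simp add: of_nat_diff)
  also have "\<dots> \<longleftrightarrow> covers x h j m" unfolding covers_def Let_def of_nat_less_iff ..
  finally show ?thesis ..
qed

text \<open>For fixed lengths the condition counts bit strings. The random lengths enter only up to
  the index \<open>j\<close>, so that countably many lists of lengths have to be
  distinguished.\<close>

lemma measurable_covers: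
  assumes [measurable]: "\<And>i l. Measurable.pred M (\<lambda>\<omega>. X \<omega> i l)" "\<And>i. (\<lambda>\<omega>. H \<omega> i) \<in> M \<rightarrow>\<^sub>M count_space (UNIV :: nat set)"
  shows "Measurable.pred M (\<lambda>\<omega>. covers (X \<omega>) (H \<omega>) j m)"
proof -
  have *: "Measurable.pred M (\<lambda>\<omega>. covers (X \<omega>) h j m)" for h
  proof -
    let ?N = "\<Sum>i\<le>j. h i"
    let ?C = "\<lambda>\<omega> s. \<exists>i\<le>j. \<forall>l<h i. s ! l = X \<omega> i l"
    have "card {s. length s = ?N \<and> ?C \<omega> s} = (\<Sum>s | length s = ?N. of_bool (?C \<omega> s))" for \<omega>
      using card_bool_lists(2)[of ?N] by (simp add: of_bool_def sum.If_cases Int_def)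
    then show ?thesis unfolding covers_def Let_def by simp
  qed
  have "covers (X \<omega>) (H \<omega>) j m \<longleftrightarrow> covers (X \<omega>) (\<lambda>i. map (H \<omega>) [0..<Suc j] ! i) j m" for \<omega>
  proof -
    have "H \<omega> i = map (H \<omega>) [0..<Suc j] ! i" if "i \<le> j" for i
      using that by (simp del: upt_Suc)
    then have "{s. length s = (\<Sum>i\<le>j. H \<omega> i) \<and> (\<exists>i\<le>j. \<forall>l<H \<omega> i. s ! l = X \<omega> i l)} =
        {s. length s = (\<Sum>i\<le>j. map (H \<omega>) [0..<Suc j] ! i) \<and> (\<exists>i\<le>j. \<forall>l<map (H \<omega>) [0..<Suc j] ! i. s ! l = X \<omega> i l)}"
      and "(\<Sum>i\<le>j. H \<omega> i) = (\<Sum>i\<le>j. map (H \<omega>) [0..<Suc j] ! i)"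
      by (simp_all del: upt_Suc cong: conj_cong)
    then show ?thesis unfolding covers_def Let_def by (simp only:)
  qed
  moreover have "Measurable.pred M (\<lambda>\<omega>. covers (X \<omega>) (\<lambda>i. map (H \<omega>) [0..<Suc j] ! i) j m)"
  proof (rule measurable_compose_countable[of "\<lambda>hs \<omega>. covers (X \<omega>) (\<lambda>i. hs ! i) j m"])
    show "(\<lambda>\<omega>. map (H \<omega>) [0..<Suc j]) \<in> M \<rightarrow>\<^sub>M count_space UNIV"
      unfolding measurable_count_space_eq2_countable
    proof (intro conjI ballI)
      fix hs :: "nat list"
      have "(\<lambda>\<omega>. map (H \<omega>) [0..<Suc j]) -` {hs} \<inter> space M
        = {\<omega> \<in> space M. length hs = Suc j \<and> (\<forall>i<Suc j. H \<omega> i = hs ! i)}"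
        by (auto simp: list_eq_iff_nth_eq simp del: upt_Suc)
      also have "\<dots> \<in> sets M" by measurable
      finally show "(\<lambda>\<omega>. map (H \<omega>) [0..<Suc j]) -` {hs} \<inter> space M \<in> sets M" .
    qed auto
  qed (rule *)
  ultimately show ?thesis by simp
qed

section \<open>Coverings by independent random points\<close>

lemma AE_hits:
  assumes Q: "Q \<in> sets seqM" "measure seqM Q > 0"
  shows "AE z in seqsM. \<exists>i. z i \<in> Q"
proof -
  interpret S: prob_space seqM by (rule prob_space_seqM)
  interpret product_prob_space "\<lambda>_ :: nat. seqM" UNIV
    using prob_space_seqM by (simp add: product_prob_space_def product_sigma_finite_def
      product_prob_space_axioms_def prob_space_imp_sigma_finite)
  interpret SS: prob_space seqsM by (rule prob_space_seqsM)
  let ?q = "measure seqM (UNIV - Q)"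
  have q: "?q < 1" using S.prob_compl[OF Q(1)] Q(2) by simp
  let ?B = "{z. \<forall>i. z i \<notin> Q}"
  have Bm: "?B \<in> sets seqsM"
  proof -
    have "{z \<in> space seqsM. \<forall>i. z i \<notin> Q} \<in> sets seqsM" using Q(1) by measurable
    then show ?thesis by simp
  qed
  have "measure seqsM ?B \<le> ?q ^ n" for n
  proof -
    have "emeasure seqsM {x. \<forall>i\<in>{..<n}. x i \<in> UNIV - Q} = (\<Prod>i\<in>{..<n}. emeasure seqM (UNIV - Q))"
      using emeasure_PiM_Collect[of "{..<n}" "\<lambda>_. UNIV - Q"] Q(1) sets.compl_sets[OF Q(1)]
      unfolding seqsM_def[symmetric] by simp
    also have "\<dots> = ennreal (?q ^ n)" by (simp add: S.emeasure_eq_measure ennreal_power)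
    finally have *: "measure seqsM {x. \<forall>i\<in>{..<n}. x i \<in> UNIV - Q} = ?q ^ n" by (simp add: measure_def)
    have "{z \<in> space seqsM. \<forall>i\<in>{..<n}. z i \<in> UNIV - Q} \<in> sets seqsM"
      by (rule sets.sets_Collect_finite_All) (use sets.compl_sets[OF Q(1)] component_sets(1)[of "UNIV - Q"] in simp_all)
    then have "measure seqsM ?B \<le> measure seqsM {x. \<forall>i\<in>{..<n}. x i \<in> UNIV - Q}"
      by (intro SS.finite_measure_mono) auto
    then show ?thesis unfolding * .
  qed
  moreover have "(\<lambda>n. ?q ^ n) \<longlonglongrightarrow> 0" by (rule LIMSEQ_realpow_zero) (use q in auto)
  ultimately have "measure seqsM ?B \<le> 0" by (intro LIMSEQ_le_const) auto
  then have "emeasure seqsM ?B = 0" by (simp add: SS.emeasure_eq_measure measure_le_0_iff)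
  then have "AE z in seqsM. z \<notin> ?B" using Bm by (intro AE_not_in) (simp add: null_sets_def)
  then show ?thesis by simp
qed

text \<open>Choose \<open>L\<close> such that \<open>g \<le> L\<close> holds outside a set of
  measure less than \<open>1 / m\<close>. Every cylinder of length \<open>L\<close> which meets this
  event in positive measure contains some \<open>z i\<close> satisfying it. The neighbourhood of
  that \<open>z i\<close> is given by at most \<open>L\<close> bits and therefore includes the whole
  cylinder; finitely many cylinders are involved.\<close>

lemma AE_covers:
  assumes g [measurable]: "g \<in> seqM \<rightarrow>\<^sub>M count_space (UNIV :: nat set)"
  shows "AE z in seqsM. \<forall>m>0. \<exists>j. covers z (\<lambda>i. g (z i)) j m"
proof -
  interpret S: prob_space seqM by (rule prob_space_seqM)
  have "AE z in seqsM. m > 0 \<longrightarrow> (\<exists>j. covers z (\<lambda>i. g (z i)) j m)" for m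
  proof (cases "m > 0")
    case True
    have gset: "{x. g x \<le> L} \<in> sets seqM" for L
    proof -
      have "{x \<in> space seqM. g x \<le> L} \<in> sets seqM" by measurable
      then show ?thesis by simp
    qed
    have "(\<lambda>L. measure seqM {x. g x \<le> L}) \<longlonglongrightarrow> measure seqM (\<Union>L. {x. g x \<le> L})"
      by (rule S.finite_Lim_measure_incseq) (use gset in \<open>auto simp: incseq_def\<close>)
    moreover have "(\<Union>L. {x. g x \<le> L}) = space seqM" by auto
    ultimately have "(\<lambda>L. measure seqM {x. g x \<le> L}) \<longlonglongrightarrow> 1" by (simp only: S.prob_space)
    then have "\<forall>\<^sub>F L in sequentially. measure seqM {x. g x \<le> L} > 1 - 1 / m"
      by (rule order_tendstoD) (use True in simp)
    then obtain L where L: "measure seqM {x. g x \<le> L} > 1 - 1 / m"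
      by (auto simp: eventually_sequentially)
    define Q where "Q = (\<lambda>s. {x. g x \<le> L} \<inter> {x. \<forall>l<L. x l = s ! l})"
    define T where "T = {s. length s = L \<and> measure seqM (Q s) > 0}"
    have Qs: "Q s \<in> sets seqM" for s unfolding Q_def by (intro sets.Int gset cylinder_sets)
    have finT: "finite T" by (rule finite_subset[OF _ card_bool_lists(2)[of L]]) (auto simp: T_def)
    have "AE z in seqsM. \<forall>s\<in>T. \<exists>i. z i \<in> Q s"
      by (rule AE_finite_allI[OF finT AE_hits[OF Qs]]) (simp add: T_def)
    then have "AE z in seqsM. \<exists>j. covers z (\<lambda>i. g (z i)) j m"
    proof (rule AE_mp, intro AE_I2 impI)
      fix z :: "nat \<Rightarrow> nat \<Rightarrow> bool" assume "\<forall>s\<in>T. \<exists>i. z i \<in> Q s"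
      then obtain I :: "bool list \<Rightarrow> nat" where I: "\<And>s. s \<in> T \<Longrightarrow> z (I s) \<in> Q s" by metis
      define j where "j = Max (insert 0 (I ` T))"
      have j: "I s \<le> j" if "s \<in> T" for s unfolding j_def using finT that by (intro Max_ge) auto
      let ?U = "{y. \<exists>i\<le>j. \<forall>l<g (z i). y l = z i l}"
      have Um: "?U \<in> sets seqM"
      proof -
        have "{y \<in> space seqM. \<exists>i\<le>j. \<forall>l<g (z i). y l = z i l} \<in> sets seqM" by measurable
        then show ?thesis by simp
      qed
      have sub: "(\<Union>s\<in>T. Q s) \<subseteq> ?U"
      proof
        fix y assume "y \<in> (\<Union>s\<in>T. Q s)"
        then obtain s where s: "s \<in> T" "y \<in> Q s" by blast
        then have "\<forall>l<g (z (I s)). y l = z (I s) l" using I[OF s(1)] by (auto simp: Q_def)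
        then show "y \<in> ?U" using j[OF s(1)] by blast
      qed
      have "{x. g x \<le> L} = (\<Union>s\<in>{s. length s = L}. Q s)"
      proof (rule set_eqI)
        fix x
        have "x \<in> Q (map x [0..<L]) \<longleftrightarrow> g x \<le> L" by (simp add: Q_def)
        then show "x \<in> {x. g x \<le> L} \<longleftrightarrow> x \<in> (\<Union>s\<in>{s. length s = L}. Q s)"
          by (auto simp: Q_def intro!: exI[of _ "map x [0..<L]"])
      qed
      then have "measure seqM {x. g x \<le> L} = measure seqM (\<Union>s\<in>{s. length s = L}. Q s)" by simp
      also have "\<dots> = (\<Sum>s | length s = L. measure seqM (Q s))"
      proof (rule S.finite_measure_finite_Union[OF card_bool_lists(2)])
        show "disjoint_family_on Q {s. length s = L}"
          unfolding disjoint_family_on_def Q_def using cylinder_disjoint[of _ L] by blast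
      qed (use Qs in auto)
      also have "\<dots> = (\<Sum>s\<in>T. measure seqM (Q s))"
        by (rule sum.mono_neutral_right[OF card_bool_lists(2)]) (auto simp: T_def less_le)
      also have "\<dots> = measure seqM (\<Union>s\<in>T. Q s)"
      proof (rule S.finite_measure_finite_Union[OF finT, symmetric])
        show "disjoint_family_on Q T"
          unfolding disjoint_family_on_def Q_def T_def using cylinder_disjoint[of _ L] by blast
      qed (use Qs in auto)
      also have "\<dots> \<le> measure seqM ?U" by (rule S.finite_measure_mono[OF sub Um])
      finally show "\<exists>j. covers z (\<lambda>i. g (z i)) j m"
        using L covers_iff[OF True, of z "\<lambda>i. g (z i)" j] by auto
    qed
    then show ?thesis by simp
  qed simp
  then show ?thesis by (simp add: AE_all_countable)
qed

section \<open>Resampling a block of coins\<close>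

definition override :: "om1 \<Rightarrow> coins \<Rightarrow> (nat \<Rightarrow> nat \<Rightarrow> bool) \<Rightarrow> coins" where
  "override \<beta> w z c = (if fst c = \<beta> then z (snd c) else w c)"

lemma measurable_override [measurable]:
  "(\<lambda>(w, z). override \<beta> w z) \<in> coinsM \<Otimes>\<^sub>M seqsM \<rightarrow>\<^sub>M coinsM"
  by (rule measurable_into_coinsM) (simp add: override_def split_beta)

text \<open>A block of coins is independent of the other coins.\<close>

lemma distr_override: "distr (coinsM \<Otimes>\<^sub>M seqsM) coinsM (\<lambda>(w, z). override \<beta> w z) = coinsM" (is "?D = _")
proof -
  interpret C: product_prob_space "\<lambda>_ :: coin. seqM" UNIV
    using prob_space_seqM by (simp add: product_prob_space_def product_sigma_finite_def
      product_prob_space_axioms_def prob_space_imp_sigma_finite)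
  interpret N: product_prob_space "\<lambda>_ :: nat. seqM" UNIV
    using prob_space_seqM by (simp add: product_prob_space_def product_sigma_finite_def
      product_prob_space_axioms_def prob_space_imp_sigma_finite)
  interpret SS: prob_space seqsM by (rule prob_space_seqsM)
  have "?D = PiM UNIV (\<lambda>_. seqM)"
  proof (rule C.PiM_eq)
    show "sets ?D = sets (PiM UNIV (\<lambda>_ :: coin. seqM))" by (simp add: coinsM_def)
    fix J :: "coin set" and F
    assume J: "finite J" and F: "\<And>j. j \<in> J \<Longrightarrow> F j \<in> sets seqM"
    let ?X = "prod_emb UNIV (\<lambda>_. seqM) J (Pi\<^sub>E J F)"
    let ?J1 = "{c \<in> J. fst c \<noteq> \<beta>}" and ?J2 = "{i. (\<beta>, i) \<in> J}"
    let ?A = "{w \<in> space coinsM. \<forall>c\<in>?J1. w c \<in> F c}" and ?B = "{z \<in> space seqsM. \<forall>i\<in>?J2. z i \<in> F (\<beta>, i)}"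
    have J2: "finite ?J2" by (rule finite_subset[OF _ finite_imageI[OF J, of snd]]) force
    have A: "?A \<in> sets coinsM"
      by (rule sets.sets_Collect_finite_All) (use J F component_sets in simp_all)
    have B: "?B \<in> sets seqsM"
      by (rule sets.sets_Collect_finite_All) (use J2 F component_sets in simp_all)
    have "?X \<in> sets coinsM" unfolding coinsM_def using J F by (intro sets_PiM_I) auto
    then have "emeasure ?D ?X = emeasure (coinsM \<Otimes>\<^sub>M seqsM) ((\<lambda>(w, z). override \<beta> w z) -` ?X \<inter> space (coinsM \<Otimes>\<^sub>M seqsM))"
      by (intro emeasure_distr measurable_override)
    also have "(\<lambda>(w, z). override \<beta> w z) -` ?X \<inter> space (coinsM \<Otimes>\<^sub>M seqsM) = ?A \<times> ?B"
      by (auto simp: prod_emb_def space_pair_measure space_PiM PiE_iff override_def) (fastforce split: if_splits)+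
    also have "emeasure (coinsM \<Otimes>\<^sub>M seqsM) (?A \<times> ?B) = emeasure coinsM ?A * emeasure seqsM ?B"
      by (rule SS.emeasure_pair_measure_Times[OF A B])
    also have "emeasure coinsM ?A = (\<Prod>c\<in>?J1. emeasure seqM (F c))"
      unfolding coinsM_def using J F by (intro C.emeasure_PiM_Collect) auto
    also have "emeasure seqsM ?B = (\<Prod>i\<in>?J2. emeasure seqM (F (\<beta>, i)))"
      unfolding seqsM_def using J2 F by (intro N.emeasure_PiM_Collect) auto
    also have "(\<Prod>i\<in>?J2. emeasure seqM (F (\<beta>, i))) = (\<Prod>c\<in>{c \<in> J. fst c = \<beta>}. emeasure seqM (F c))"
      by (rule prod.reindex_bij_witness[of _ snd "Pair \<beta>"]) auto
    also have "(\<Prod>c\<in>?J1. emeasure seqM (F c)) * \<dots> = (\<Prod>c\<in>J. emeasure seqM (F c))"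
      using prod.inter_filter[OF J] J
      by (subst prod.union_disjoint[symmetric]) (auto intro!: prod.cong)
    finally show "emeasure ?D ?X = (\<Prod>c\<in>J. emeasure seqM (F c))" .
  qed
  then show ?thesis by (simp add: coinsM_def)
qed

text \<open>Replacing the block by a fresh sequence preserves the distribution, so by Fubini it
  suffices to resample the block while all other coins are fixed.\<close>

lemma AE_block:
  assumes m: "{w. \<phi> w} \<in> sets coinsM" and ae: "\<And>w. AE z in seqsM. \<phi> (override \<beta> w z)"
  shows "AE w in coinsM. \<phi> w"
proof -
  interpret SS: prob_space seqsM by (rule prob_space_seqsM)
  interpret CC: prob_space coinsM by (rule prob_space_coinsM)
  interpret pair_sigma_finite coinsM seqsM ..
  have mm: "{x \<in> space coinsM. \<phi> x} \<in> sets coinsM" using m by simp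
  have "{x \<in> space (coinsM \<Otimes>\<^sub>M seqsM). \<phi> (case x of (w, z) \<Rightarrow> override \<beta> w z)} \<in> sets (coinsM \<Otimes>\<^sub>M seqsM)"
    using measurable_sets[OF measurable_override m] by (simp add: vimage_def Int_def conj_commute)
  then have "AE x in coinsM \<Otimes>\<^sub>M seqsM. \<phi> (case x of (w, z) \<Rightarrow> override \<beta> w z)"
    by (rule AE_pair_measure) (use ae in simp)
  then have "AE w in distr (coinsM \<Otimes>\<^sub>M seqsM) coinsM (\<lambda>(w, z). override \<beta> w z). \<phi> w"
    by (subst AE_distr_iff[OF measurable_override mm])
  then show ?thesis by (simp only: distr_override)
qed

section \<open>Almost sure measurability of definable functionals\<close>

text \<open>
  Families of objects depending on the parameter \<open>p\<close>, the coins \<open>w\<close> and a sequence \<open>d\<close> of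
  coins, which serve as additional random arguments.
\<close>

type_synonym fam = "(nat \<Rightarrow> bool) \<Rightarrow> coins \<Rightarrow> (nat \<Rightarrow> coin) \<Rightarrow> D"

definition lowc :: "om1 \<Rightarrow> coin set" where "lowc \<eta> = {c. fst c \<le> \<eta>}"
text \<open>The coins up to a countable ordinal can be enumerated, so that their outcomes
  \<open>w \<circ> en \<eta>\<close> form a point of the countable product
  \<open>seqsM\<close>.\<close>

definition en :: "om1 \<Rightarrow> nat \<Rightarrow> coin" where "en \<eta> = from_nat_into (lowc \<eta>)"

lemma range_en: "range (en \<eta>) = lowc \<eta>"
proof -
  have "lowc \<eta> = {..\<eta>} \<times> UNIV" by (auto simp: lowc_def)
  then have "countable (lowc \<eta>)" using countable_atMost_om1[of \<eta>] by simp
  moreover have "lowc \<eta> \<noteq> {}" by (auto simp: lowc_def)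
  ultimately show ?thesis unfolding en_def by (rule range_from_nat_into[rotated])
qed

lemma en_le: "fst (en \<eta> n) \<le> \<eta>"
  using range_en[of \<eta>] by (auto simp: lowc_def)

definition cidx :: "om1 \<Rightarrow> coin \<Rightarrow> nat" where "cidx \<eta> c = (SOME n. en \<eta> n = c)"

lemma en_cidx: "fst c \<le> \<eta> \<Longrightarrow> en \<eta> (cidx \<eta> c) = c"
proof -
  assume "fst c \<le> \<eta>"
  then have "c \<in> range (en \<eta>)" unfolding range_en by (simp add: lowc_def)
  then show ?thesis unfolding cidx_def by (metis (mono_tags) imageE someI_ex)
qed

definition above :: "om1 \<Rightarrow> (nat \<Rightarrow> coin) \<Rightarrow> bool" where "above \<eta> d \<longleftrightarrow> (\<forall>n. \<eta> < fst (d n))"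

lemma above_comp: "above \<eta> d \<Longrightarrow> above \<eta> (d \<circ> \<iota>)" by (simp add: above_def)
lemma above_mono: "above \<eta>' d \<Longrightarrow> \<eta> \<le> \<eta>' \<Longrightarrow> above \<eta> d" unfolding above_def using le_less_trans by blast

abbreviation paramM where "paramM \<equiv> seqM \<Otimes>\<^sub>M seqsM \<Otimes>\<^sub>M seqsM"

text \<open>\<open>G\<close> sees the coins up to \<open>\<eta>\<close> and the arguments
  \<open>w \<circ> d\<close> only. The equality is demanded for arguments above
  \<open>\<eta>\<close>, which are independent of the coins that \<open>G\<close> uses, and it may
  fail on a null set depending on \<open>p\<close> and \<open>d\<close>.\<close>

definition rep :: "om1 \<Rightarrow> ((nat \<Rightarrow> bool) \<times> (nat \<Rightarrow> nat \<Rightarrow> bool) \<times> (nat \<Rightarrow> nat \<Rightarrow> bool) \<Rightarrow> nat) \<Rightarrow> fam \<Rightarrow> bool" where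
  "rep \<eta> G x \<longleftrightarrow> G \<in> paramM \<rightarrow>\<^sub>M count_space UNIV \<and>
     (\<forall>p d. above \<eta> d \<longrightarrow> (AE w in coinsM. x p w d = num (G (p, w \<circ> en \<eta>, w \<circ> d))))"

definition PN :: "fam \<Rightarrow> bool" where
  "PN x \<longleftrightarrow> (\<forall>p w d. \<exists>n. x p w d = num n) \<and> (\<exists>\<eta> G. rep \<eta> G x)"

lemma PN_num: assumes "PN x" obtains n where "x p w d = num n"
  using assms unfolding PN_def by blast

lemma measurable_reindex: "(\<lambda>s. s \<circ> r) \<in> seqsM \<rightarrow>\<^sub>M seqsM"
  by (rule measurable_into_seqsM) (simp add: comp_def)

lemma rep_raise:
  assumes "rep \<eta> G x" "\<eta> \<le> \<eta>'" shows "rep \<eta>' (\<lambda>(p, s, u). G (p, s \<circ> (\<lambda>n. cidx \<eta>' (en \<eta> n)), u)) x"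
proof -
  let ?r = "\<lambda>n. cidx \<eta>' (en \<eta> n)"
  note [measurable] = measurable_reindex[of ?r]
  have [measurable]: "G \<in> paramM \<rightarrow>\<^sub>M count_space UNIV" using assms by (simp add: rep_def)
  have "(\<lambda>(p, s, u). G (p, s \<circ> ?r, u)) \<in> paramM \<rightarrow>\<^sub>M count_space UNIV" by measurable
  moreover have "(w \<circ> en \<eta>') \<circ> ?r = w \<circ> en \<eta>" for w :: coins
    using en_cidx order_trans[OF en_le assms(2)] by (simp add: fun_eq_iff)
  ultimately show ?thesis using assms above_mono[OF _ assms(2)] by (simp add: rep_def)
qed

text \<open>Countably many bounds have a common bound in \<open>om1\<close>, and countably many null
  sets unite to a null set.\<close>

lemma PN_countable:
  assumes "\<And>k :: nat. PN (x k)"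
  shows "\<exists>\<eta> G. \<eta>0 \<le> \<eta> \<and> (\<forall>k. G k \<in> paramM \<rightarrow>\<^sub>M count_space UNIV) \<and>
    (\<forall>p d. above \<eta> d \<longrightarrow> (AE w in coinsM. \<forall>k. x k p w d = num (G k (p, w \<circ> en \<eta>, w \<circ> d))))"
proof -
  have "\<forall>k. \<exists>\<eta> G. rep \<eta> G (x k)" using assms by (simp add: PN_def)
  then obtain \<eta>f Gf where f: "\<And>k. rep (\<eta>f k) (Gf k) (x k)" by metis
  define \<eta> where "\<eta> = sup_om1 (case_nat \<eta>0 \<eta>f)"
  have le: "\<eta>0 \<le> \<eta>" "\<eta>f k \<le> \<eta>" for k
    using less_sup_om1[of "case_nat \<eta>0 \<eta>f" 0] less_sup_om1[of "case_nat \<eta>0 \<eta>f" "Suc k"]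
    by (simp_all add: \<eta>_def)
  then have "\<exists>G. rep \<eta> G (x k)" for k using rep_raise[OF f] by blast
  then obtain G where "\<And>k. rep \<eta> (G k) (x k)" by metis
  then have G: "\<And>k. G k \<in> paramM \<rightarrow>\<^sub>M count_space UNIV"
    "\<And>k p d. above \<eta> d \<Longrightarrow> AE w in coinsM. x k p w d = num (G k (p, w \<circ> en \<eta>, w \<circ> d))"
    unfolding rep_def by blast+
  have "AE w in coinsM. \<forall>k. x k p w d = num (G k (p, w \<circ> en \<eta>, w \<circ> d))" if "above \<eta> d" for p d
    unfolding AE_all_countable using G(2)[OF that] by blast
  with le(1) G(1) show ?thesis by blast
qed

text \<open>The operation \<open>F\<close> is allowed infinitely many arguments, since
  \<open>\<mu>\<close> depends on all values of a function.\<close>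

lemma PN_map:
  assumes x: "\<And>k :: nat. PN (x k)" and z: "\<And>p w d. z p w d = num (F (\<lambda>k. natof (x k p w d)))"
    and F: "\<And>(M :: ((nat \<Rightarrow> bool) \<times> (nat \<Rightarrow> nat \<Rightarrow> bool) \<times> (nat \<Rightarrow> nat \<Rightarrow> bool)) measure) H.
      (\<And>k. H k \<in> M \<rightarrow>\<^sub>M count_space UNIV) \<Longrightarrow> (\<lambda>\<omega>. F (\<lambda>k. H k \<omega>)) \<in> M \<rightarrow>\<^sub>M count_space UNIV"
  shows "PN z"
proof -
  obtain \<eta> G where G: "\<And>k. G k \<in> paramM \<rightarrow>\<^sub>M count_space UNIV"
    and ae: "\<And>p d. above \<eta> d \<Longrightarrow> AE w in coinsM. \<forall>k. x k p w d = num (G k (p, w \<circ> en \<eta>, w \<circ> d))"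
    using PN_countable[of x, OF x] by blast
  have "AE w in coinsM. z p w d = num (F (\<lambda>k. G k (p, w \<circ> en \<eta>, w \<circ> d)))" if "above \<eta> d" for p d
    using ae[OF that, of p] by eventually_elim (simp add: z)
  then have "rep \<eta> (\<lambda>q. F (\<lambda>k. G k q)) z" using F[OF G] by (simp add: rep_def)
  then show ?thesis using z by (auto simp: PN_def)
qed

lemma PN_const: "PN (\<lambda>p w d. num n)"
  by (auto simp: PN_def rep_def intro!: exI[of _ "\<lambda>_. n"])

lemma PN_param: "PN (\<lambda>p w d. num (of_bool (p n)))"
  by (auto simp: PN_def rep_def intro!: exI[of _ "\<lambda>(p, s, u). of_bool (p n)"])

lemma PN_coin: "PN (\<lambda>p w d. num (of_bool (w c n)))"
  unfolding PN_def rep_def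
  by (auto simp: en_cidx intro!: exI[of _ "fst c"] exI[of _ "\<lambda>(p, s, u). of_bool (s (cidx (fst c) c) n)"])

lemma PN_arg: "PN (\<lambda>p w d. num (of_bool (w (d k) n)))"
  by (auto simp: PN_def rep_def intro!: exI[of _ "\<lambda>(p, s, u). of_bool (u k n)"])

lemma PN_mono: assumes "PN x" shows "PN (\<lambda>p w d. x p w (d \<circ> \<iota>))"
proof -
  note [measurable] = measurable_reindex[of \<iota>]
  obtain \<eta> G where r: "rep \<eta> G x" using assms by (auto simp: PN_def)
  then have [measurable]: "G \<in> paramM \<rightarrow>\<^sub>M count_space UNIV" by (simp add: rep_def)
  have "(\<lambda>(p, s, u). G (p, s, u \<circ> \<iota>)) \<in> paramM \<rightarrow>\<^sub>M count_space UNIV" by measurable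
  then have "rep \<eta> (\<lambda>(p, s, u). G (p, s, u \<circ> \<iota>)) (\<lambda>p w d. x p w (d \<circ> \<iota>))"
    using r above_comp by (simp add: rep_def comp_assoc)
  then show ?thesis using assms by (auto simp: PN_def)
qed

lemma PN_glue:
  assumes i: "PN i" and y: "\<And>k. PN (y k)" and z: "\<And>p w d k. i p w d = num k \<Longrightarrow> z p w d = y k p w d"
  shows "PN z"
proof (rule PN_map[where x = "case_nat i y" and F = "\<lambda>h. h (Suc (h 0))"])
  show "PN (case_nat i y k)" for k using i y by (cases k) auto
  fix p w d
  obtain k where k: "i p w d = num k" by (rule PN_num[OF i])
  moreover obtain n where "y k p w d = num n" by (rule PN_num[OF y])
  ultimately show "z p w d = num ((\<lambda>h. h (Suc (h 0))) (\<lambda>k. natof (case_nat i y k p w d)))"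
    using z[OF k] by simp
next
  fix M :: "((nat \<Rightarrow> bool) \<times> (nat \<Rightarrow> nat \<Rightarrow> bool) \<times> (nat \<Rightarrow> nat \<Rightarrow> bool)) measure" and H :: "nat \<Rightarrow> _ \<Rightarrow> nat"
  assume [measurable]: "\<And>k. H k \<in> M \<rightarrow>\<^sub>M count_space UNIV"
  show "(\<lambda>\<omega>. H (Suc (H 0 \<omega>)) \<omega>) \<in> M \<rightarrow>\<^sub>M count_space UNIV"
    by (rule measurable_compose_countable[of "\<lambda>k. H (Suc k)"]) measurable
qed

text \<open>A Kripke logical predicate. A functional must preserve it even after its own random
  arguments have been reindexed by \<open>\<iota>\<close>, which makes room for further ones: with
  \<open>\<iota> = Suc\<close>, slot 0 becomes free for a random point to which the functional is
  applied, see \<open>Pr_good\<close>.\<close>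

primrec Pr :: "rty \<Rightarrow> fam \<Rightarrow> bool" where
  "Pr NN = PN"
| "Pr (\<sigma> \<rightarrow>\<^sub>r \<tau>) = (\<lambda>f. (\<forall>p w d. E (\<sigma> \<rightarrow>\<^sub>r \<tau>) (f p w d) (f p w d)) \<and>
     (\<forall>\<iota> x. Pr \<sigma> x \<longrightarrow> Pr \<tau> (\<lambda>p w d. f p w (d \<circ> \<iota>) \<cdot> x p w d)))"
| "Pr (LL \<sigma>) = (\<lambda>x. PN (\<lambda>p w d. fstD (x p w d)) \<and> (\<forall>k. Pr \<sigma> (\<lambda>p w d. sndD (x p w d) \<cdot> num k)))"
| "Pr (\<sigma> \<times>\<^sub>r \<tau>) = (\<lambda>x. Pr \<sigma> (\<lambda>p w d. fstD (x p w d)) \<and> Pr \<tau> (\<lambda>p w d. sndD (x p w d)))"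

lemma Pr_E: "Pr \<sigma> x \<Longrightarrow> E \<sigma> (x p w d) (x p w d)"
proof (induction \<sigma> arbitrary: x)
  case (LL \<sigma>)
  obtain n where n: "fstD (x p w d) = num n"
    by (rule PN_num[of "\<lambda>p w d. fstD (x p w d)"]) (use LL(2) in simp)
  have "E \<sigma> (sndD (x p w d) \<cdot> num k) (sndD (x p w d) \<cdot> num k)" for k
    using LL(1)[of "\<lambda>p w d. sndD (x p w d) \<cdot> num k"] LL(2) by simp
  then show ?case using n by (auto simp: isl_def dl_num list_all2_same)
next
  case (PP \<sigma> \<tau>)
  then show ?case
    using PP(1)[of "\<lambda>p w d. fstD (x p w d)"] PP(2)[of "\<lambda>p w d. sndD (x p w d)"] by simp
qed (auto simp: PN_def)

lemma Pr_mono: "Pr \<sigma> x \<Longrightarrow> Pr \<sigma> (\<lambda>p w d. x p w (d \<circ> \<iota>))"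
proof (induction \<sigma> arbitrary: x)
  case NN
  then show ?case unfolding Pr.simps by (rule PN_mono)
next
  case (FF \<sigma> \<tau>)
  show ?case using FF(3) unfolding Pr.simps comp_assoc by blast
next
  case (LL \<sigma>)
  then show ?case using PN_mono[of "\<lambda>p w d. fstD (x p w d)" \<iota>]
    LL(1)[of "\<lambda>p w d. sndD (x p w d) \<cdot> num k" for k] unfolding Pr.simps by blast
next
  case (PP \<sigma> \<tau>)
  then show ?case
    using PP(1)[of "\<lambda>p w d. fstD (x p w d)"] PP(2)[of "\<lambda>p w d. sndD (x p w d)"] unfolding Pr.simps by blast
qed

text \<open>An object selected by a random number is treated by cases on the countably many values
  of that number. This is what makes recursion and lists of random length preserve
  \<open>Pr\<close>.\<close>

lemma Pr_glue:
  assumes i: "PN i"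
  shows "(\<And>k. Pr \<sigma> (y k)) \<Longrightarrow> (\<And>p w d k. i p w d = num k \<Longrightarrow> z p w d = y k p w d) \<Longrightarrow> Pr \<sigma> z"
  using i
proof (induction \<sigma> arbitrary: i y z)
  case NN
  then show ?case using PN_glue[of i y z] by simp
next
  case (FF \<sigma> \<tau>)
  have "E (\<sigma> \<rightarrow>\<^sub>r \<tau>) (z p w d) (z p w d)" for p w d
    using FF(5) FF(4)[of p w d] Pr_E[OF FF(3)] by (metis PN_def)
  moreover have "Pr \<tau> (\<lambda>p w d. z p w (d \<circ> \<iota>) \<cdot> x p w d)" if "Pr \<sigma> x" for \<iota> x
  proof (rule FF(2)[of "\<lambda>k p w d. y k p w (d \<circ> \<iota>) \<cdot> x p w d"])
    show "Pr \<tau> (\<lambda>p w d. y k p w (d \<circ> \<iota>) \<cdot> x p w d)" for k using FF(3)[of k] that by simp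
    show "PN (\<lambda>p w d. i p w (d \<circ> \<iota>))" by (rule PN_mono[OF FF(5)])
    show "z p w (d \<circ> \<iota>) \<cdot> x p w d = y k p w (d \<circ> \<iota>) \<cdot> x p w d" if "i p w (d \<circ> \<iota>) = num k" for p w d k
      by (simp only: FF(4)[OF that])
  qed
  ultimately show ?case by (simp only: Pr.simps) blast
next
  case (LL \<sigma>)
  have "PN (\<lambda>p w d. fstD (z p w d))"
    by (rule PN_glue[OF LL(4), of "\<lambda>k p w d. fstD (y k p w d)"]) (use LL(2) LL(3) in simp_all)
  moreover have "Pr \<sigma> (\<lambda>p w d. sndD (z p w d) \<cdot> num n)" for n
    by (rule LL(1)[of "\<lambda>k p w d. sndD (y k p w d) \<cdot> num n", OF _ _ LL(4)]) (use LL(2) LL(3) in simp_all)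
  ultimately show ?case by simp
next
  case (PP \<sigma> \<tau>)
  have "Pr \<sigma> (\<lambda>p w d. fstD (z p w d))"
    by (rule PP(1)[of "\<lambda>k p w d. fstD (y k p w d)", OF _ _ PP(5)]) (use PP(3,4) in simp_all)
  moreover have "Pr \<tau> (\<lambda>p w d. sndD (z p w d))"
    by (rule PP(2)[of "\<lambda>k p w d. sndD (y k p w d)", OF _ _ PP(5)]) (use PP(3,4) in simp_all)
  ultimately show ?case by simp
qed

lemma Pr_ap: "Pr (\<sigma> \<rightarrow>\<^sub>r \<tau>) f \<Longrightarrow> Pr \<sigma> x \<Longrightarrow> Pr \<tau> (\<lambda>p w d. f p w d \<cdot> x p w d)"
proof -
  assume "Pr (\<sigma> \<rightarrow>\<^sub>r \<tau>) f" "Pr \<sigma> x"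
  then have "Pr \<tau> (\<lambda>p w d. f p w (d \<circ> id) \<cdot> x p w d)" unfolding Pr.simps by blast
  then show ?thesis by simp
qed

text \<open>For arguments of type \<open>NN\<close> the clause on reindexing reduces to numerals by
  gluing.\<close>

lemma Pr_funNI:
  assumes "\<And>p w d. E (NN \<rightarrow>\<^sub>r \<tau>) (f p w d) (f p w d)" "\<And>n. Pr \<tau> (\<lambda>p w d. f p w d \<cdot> num n)"
  shows "Pr (NN \<rightarrow>\<^sub>r \<tau>) f"
proof -
  have "Pr \<tau> (\<lambda>p w d. f p w (d \<circ> \<iota>) \<cdot> x p w d)" if "PN x" for \<iota> x
    by (rule Pr_glue[OF that, of _ "\<lambda>k p w d. f p w (d \<circ> \<iota>) \<cdot> num k"]) (use Pr_mono[OF assms(2)] in simp_all)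
  then show ?thesis using assms(1) by (simp only: Pr.simps) blast
qed

section \<open>Functionals at random points, and the covering functional\<close>

lemma E_coinD: "E (NN \<rightarrow>\<^sub>r NN) (coinD w c) (coinD w c)" by (simp only: coinD_def E_funD)

lemma Pr_coin: "Pr (NN \<rightarrow>\<^sub>r NN) (\<lambda>p w d. coinD w c)"
  by (rule Pr_funNI[OF E_coinD]) (simp add: PN_coin)

lemma Pr_arg: "Pr (NN \<rightarrow>\<^sub>r NN) (\<lambda>p w d. coinD w (d k))"
  by (rule Pr_funNI[OF E_coinD]) (simp add: PN_arg)

definition nbhd :: "fam \<Rightarrow> (nat \<Rightarrow> bool) \<Rightarrow> coins \<Rightarrow> (nat \<Rightarrow> coin) \<Rightarrow> coin \<Rightarrow> nat" where
  "nbhd g p w d c = natof (g p w d \<cdot> coinD w c)"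

lemma nbhd: "Pr ((NN \<rightarrow>\<^sub>r NN) \<rightarrow>\<^sub>r NN) g \<Longrightarrow> g p w d \<cdot> coinD w c = num (nbhd g p w d c)"
proof -
  assume "Pr ((NN \<rightarrow>\<^sub>r NN) \<rightarrow>\<^sub>r NN) g"
  from E_ap[OF Pr_E[OF this, of p w d] E_coinD[of w c]] obtain n where "g p w d \<cdot> coinD w c = num n" by auto
  then show ?thesis by (simp add: nbhd_def)
qed

text \<open>Applied to the random point in slot 0, with its own arguments shifted, \<open>g\<close>
  gives a measurable function of this point, of the coins up to \<open>\<eta>\<close> and of the
  remaining arguments. A block \<open>\<beta>\<close> above \<open>\<eta>\<close> and below all
  remaining arguments is independent of the latter two. Once they are fixed, the sizes of the
  neighbourhoods in the block are given by one Borel function, to which \<open>AE_covers\<close>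
  applies.\<close>

lemma Pr_good:
  assumes g: "Pr ((NN \<rightarrow>\<^sub>r NN) \<rightarrow>\<^sub>r NN) g"
  obtains \<beta> where "\<And>p d. above \<beta> d \<Longrightarrow> AE w in coinsM. good w (nbhd g p w d) \<beta>"
proof -
  have "PN (\<lambda>p w d. g p w (d \<circ> Suc) \<cdot> coinD w (d 0))"
    using g[unfolded Pr.simps(2)[of "NN \<rightarrow>\<^sub>r NN"], THEN conjunct2, rule_format, OF Pr_arg[of 0], of Suc]
    by (simp only: Pr.simps(1))
  then obtain \<eta> G where r: "rep \<eta> G (\<lambda>p w d. g p w (d \<circ> Suc) \<cdot> coinD w (d 0))" by (auto simp: PN_def)
  then have [measurable]: "G \<in> paramM \<rightarrow>\<^sub>M count_space UNIV" by (simp add: rep_def)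
  obtain \<beta> where \<beta>: "\<eta> < \<beta>" using ex_greater_om1[of "{\<eta>}"] by auto
  have "AE w in coinsM. good w (nbhd g p w d) \<beta>" if d: "above \<beta> d" for p d
  proof -
    let ?h = "\<lambda>w x. G (p, w \<circ> en \<eta>, case_nat x (w \<circ> d))"
    have "AE w in coinsM. nbhd g p w d (\<beta>, i) = ?h w (w (\<beta>, i))" for i
    proof -
      let ?d = "case_nat (\<beta>, i) d"
      have "\<eta> < fst (?d n)" for n using \<beta> d by (cases n) (auto simp: above_def intro: less_trans)
      then have "above \<eta> ?d" by (simp add: above_def)
      moreover have "?d \<circ> Suc = d" "w \<circ> ?d = case_nat (w (\<beta>, i)) (w \<circ> d)" for w :: coins
        by (simp_all add: fun_eq_iff split: nat.split)
      ultimately have "AE w in coinsM. g p w d \<cdot> coinD w (\<beta>, i) = num (?h w (w (\<beta>, i)))"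
        using r unfolding rep_def by fastforce
      then show ?thesis by eventually_elim (simp add: nbhd_def)
    qed
    then have 1: "AE w in coinsM. \<forall>i. nbhd g p w d (\<beta>, i) = ?h w (w (\<beta>, i))" by (simp add: AE_all_countable)
    let ?\<phi> = "\<lambda>w. \<forall>m>0. \<exists>j. covers (\<lambda>i. w (\<beta>, i)) (\<lambda>i. ?h w (w (\<beta>, i))) j m"
    have cn [measurable]: "(\<lambda>x. case_nat (f x) (r x)) \<in> M \<rightarrow>\<^sub>M seqsM"
      if [measurable]: "f \<in> M \<rightarrow>\<^sub>M seqM" "r \<in> M \<rightarrow>\<^sub>M seqsM" for f r and M :: "'x measure"
    proof (rule measurable_into_seqsM)
      show "(\<lambda>x. case n of 0 \<Rightarrow> f x | Suc k \<Rightarrow> r x k) \<in> M \<rightarrow>\<^sub>M seqM" for n by (cases n) simp_all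
    qed
    have cm [measurable]: "(\<lambda>w. w \<circ> r) \<in> coinsM \<rightarrow>\<^sub>M seqsM" for r :: "nat \<Rightarrow> coin"
      by (rule measurable_into_seqsM) (simp add: comp_def)
    have 2: "AE w in coinsM. ?\<phi> w"
    proof (rule AE_block)
      have "Measurable.pred coinsM (\<lambda>w. covers (\<lambda>i. w (\<beta>, i)) (\<lambda>i. ?h w (w (\<beta>, i))) j m)" for j m
      proof (rule measurable_covers)
        fix i
        show "(\<lambda>w. ?h w (w (\<beta>, i))) \<in> coinsM \<rightarrow>\<^sub>M count_space UNIV" by measurable
      qed measurable
      then have "{w \<in> space coinsM. ?\<phi> w} \<in> sets coinsM" by measurable
      then show "{w. ?\<phi> w} \<in> sets coinsM" by simp
      fix w :: coins
      have "override \<beta> w z (\<beta>, i) = z i" "override \<beta> w z \<circ> en \<eta> = w \<circ> en \<eta>" "override \<beta> w z \<circ> d = w \<circ> d" for z i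
        using en_le[of \<eta>] \<beta> d by (auto simp: override_def fun_eq_iff above_def) (metis leD)+
      moreover have "?h w \<in> seqM \<rightarrow>\<^sub>M count_space UNIV" by measurable
      from AE_covers[OF this] have "AE z in seqsM. \<forall>m>0. \<exists>j. covers z (\<lambda>i. ?h w (z i)) j m" .
      ultimately show "AE z in seqsM. ?\<phi> (override \<beta> w z)" by simp
    qed
    show ?thesis using 1 2 by eventually_elim (simp add: good_def)
  qed
  then show thesis by (rule that)
qed

text \<open>Almost surely the block \<open>\<beta>\<close> is good. The search for the least good
  block then stops at \<open>\<beta>\<close> or earlier and inspects countably many coins only, so
  that its result is a Borel function of them.\<close>

lemma Pr_cov:
  assumes g: "Pr ((NN \<rightarrow>\<^sub>r NN) \<rightarrow>\<^sub>r NN) g" and k: "PN k"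
  shows "Pr (LL (NN \<rightarrow>\<^sub>r NN)) (\<lambda>p w d. cden p w RCov \<cdot> g p w d \<cdot> k p w d)"
proof -
  let ?h = "nbhd g"
  obtain \<beta> where \<beta>: "\<And>p d. above \<beta> d \<Longrightarrow> AE w in coinsM. good w (?h p w d) \<beta>"
    using Pr_good[OF g] by blast
  have "PN (\<lambda>p w d. g p w d \<cdot> coinD w (en \<beta> n))" for n
    using Pr_ap[OF g Pr_coin[of "en \<beta> n"]] by simp
  from PN_countable[of "\<lambda>n p w d. g p w d \<cdot> coinD w (en \<beta> n)" \<beta>, OF this]
  obtain \<eta> G where le: "\<beta> \<le> \<eta>" and Gm: "\<And>n. G n \<in> paramM \<rightarrow>\<^sub>M count_space UNIV"
    and G: "\<And>p d. above \<eta> d \<Longrightarrow>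
      AE w in coinsM. \<forall>n. g p w d \<cdot> coinD w (en \<beta> n) = num (G n (p, w \<circ> en \<eta>, w \<circ> d))" by blast
  \<comment> \<open>Together with \<open>H\<close> this rebuilds outcomes and sizes of
    neighbourhoods from the Borel data. Beyond the block \<open>\<beta>\<close> the sizes are junk,
    but only blocks up to \<open>\<beta>\<close> will be consulted.\<close>
  define W :: "(nat \<Rightarrow> bool) \<times> (nat \<Rightarrow> nat \<Rightarrow> bool) \<times> (nat \<Rightarrow> nat \<Rightarrow> bool) \<Rightarrow> coins" where
    "W = (\<lambda>(p, s, u) c. s (cidx \<eta> c))"
  define H where "H = (\<lambda>q c. G (cidx \<beta> c) q)"
  define gd where "gd = (\<lambda>\<alpha> q. good (W q) (H q) \<alpha>)"
  \<comment> \<open>The alternative \<open>\<alpha> = \<beta>\<close> ends the search on the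
    exceptional null set as well, so that \<open>blk\<close> has a countable range
    everywhere.\<close>
  define blk where "blk = (\<lambda>q. LEAST \<alpha>. gd \<alpha> q \<or> \<alpha> = \<beta>)"
  have [measurable]: "(\<lambda>q. W q c n) \<in> paramM \<rightarrow>\<^sub>M count_space UNIV" for c n
    unfolding W_def split_beta by measurable
  have [measurable]: "(\<lambda>q. H q c) \<in> paramM \<rightarrow>\<^sub>M count_space UNIV" for c
    unfolding H_def by (rule Gm)
  have mc [measurable]: "Measurable.pred paramM (\<lambda>q. covers (\<lambda>i. W q (\<alpha>, i)) (\<lambda>i. H q (\<alpha>, i)) j m)" for \<alpha> j m
    by (rule measurable_covers) measurable
  have gdm [measurable]: "Measurable.pred paramM (gd \<alpha>)" for \<alpha>
    unfolding gd_def good_def by measurable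
  have blk_le: "blk q \<le> \<beta>" for q unfolding blk_def by (rule Least_le) simp
  have cb: "countable {..\<beta>}" by (rule countable_atMost_om1)
  have blkm: "blk \<in> paramM \<rightarrow>\<^sub>M count_space {..\<beta>}"
    unfolding measurable_count_space_eq_countable[OF cb]
  proof (intro conjI ballI)
    show "blk \<in> space paramM \<rightarrow> {..\<beta>}" using blk_le by auto
    fix \<alpha> assume "\<alpha> \<in> {..\<beta>}"
    have ca: "countable {..<\<alpha>}" by (rule countable_lessThan_om1)
    have "blk q = \<alpha> \<longleftrightarrow> (gd \<alpha> q \<or> \<alpha> = \<beta>) \<and> (\<forall>\<gamma>\<in>{..<\<alpha>}. \<not> (gd \<gamma> q \<or> \<gamma> = \<beta>))" for q
    proof
      assume "blk q = \<alpha>"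
      then show "(gd \<alpha> q \<or> \<alpha> = \<beta>) \<and> (\<forall>\<gamma>\<in>{..<\<alpha>}. \<not> (gd \<gamma> q \<or> \<gamma> = \<beta>))"
        using LeastI[of "\<lambda>\<alpha>. gd \<alpha> q \<or> \<alpha> = \<beta>" \<beta>] not_less_Least[of _ "\<lambda>\<alpha>. gd \<alpha> q \<or> \<alpha> = \<beta>"]
        unfolding blk_def by auto
    next
      assume "(gd \<alpha> q \<or> \<alpha> = \<beta>) \<and> (\<forall>\<gamma>\<in>{..<\<alpha>}. \<not> (gd \<gamma> q \<or> \<gamma> = \<beta>))"
      then show "blk q = \<alpha>" unfolding blk_def by (intro Least_equality) (auto simp: not_less[symmetric])
    qed
    then have "blk -` {\<alpha>} \<inter> space paramM
      = {q \<in> space paramM. (gd \<alpha> q \<or> \<alpha> = \<beta>) \<and> (\<forall>\<gamma>\<in>{..<\<alpha>}. \<not> (gd \<gamma> q \<or> \<gamma> = \<beta>))}" by auto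
    also have "\<dots> \<in> sets paramM"
      by (intro sets.sets_Collect_conj sets.sets_Collect_countable_All'[OF _ ca] predE) measurable
    finally show "blk -` {\<alpha>} \<inter> space paramM \<in> sets paramM" .
  qed
  have ae: "AE w in coinsM. covblk w (?h p w d) = blk (p, w \<circ> en \<eta>, w \<circ> d) \<and>
      good w (?h p w d) (covblk w (?h p w d)) \<and>
      (\<forall>c. fst c \<le> \<beta> \<longrightarrow> ?h p w d c = H (p, w \<circ> en \<eta>, w \<circ> d) c \<and> w c = W (p, w \<circ> en \<eta>, w \<circ> d) c)"
    if d: "above \<eta> d" for p d
    using G[OF d, of p] \<beta>[OF above_mono[OF d le], of p]
  proof eventually_elim
    fix w assume 1: "\<forall>n. g p w d \<cdot> coinD w (en \<beta> n) = num (G n (p, w \<circ> en \<eta>, w \<circ> d))"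
      and 2: "good w (?h p w d) \<beta>"
    let ?q = "(p, w \<circ> en \<eta>, w \<circ> d)"
    have c: "?h p w d c = H ?q c \<and> w c = W ?q c" if "fst c \<le> \<beta>" for c
      using 1[rule_format, of "cidx \<beta> c"] en_cidx[OF that] en_cidx[OF order_trans[OF that le]]
      by (simp add: nbhd_def H_def W_def)
    then have gd: "good w (?h p w d) \<alpha> \<longleftrightarrow> gd \<alpha> ?q" if "\<alpha> \<le> \<beta>" for \<alpha>
      using that unfolding gd_def good_def by simp
    have gl: "good w (?h p w d) (covblk w (?h p w d))" "covblk w (?h p w d) \<le> \<beta>"
      unfolding covblk_def by (rule LeastI[of _ \<beta>], rule 2, rule Least_le, rule 2)
    have "gd (blk ?q) ?q \<or> blk ?q = \<beta>"
      unfolding blk_def by (rule LeastI[of "\<lambda>\<alpha>. gd \<alpha> ?q \<or> \<alpha> = \<beta>" \<beta>]) simp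
    then have "good w (?h p w d) (blk ?q)" using gd[OF blk_le] 2 by auto
    then have "covblk w (?h p w d) \<le> blk ?q" unfolding covblk_def by (rule Least_le)
    moreover have "blk ?q \<le> covblk w (?h p w d)"
      unfolding blk_def by (rule Least_le) (use gl gd in blast)
    ultimately show "covblk w (?h p w d) = blk ?q \<and> good w (?h p w d) (covblk w (?h p w d)) \<and>
      (\<forall>c. fst c \<le> \<beta> \<longrightarrow> ?h p w d c = H ?q c \<and> w c = W ?q c)" using c gl by auto
  qed
  let ?c = "\<lambda>m p w d. cden p w RCov \<cdot> g p w d \<cdot> num m"
  have cD: "?c m p w d = pr (num (covlen w (?h p w d) m)) (blockD w (covblk w (?h p w d)))" for m p w d
    by (rule covD[OF nbhd[OF g]])
  have len: "PN (\<lambda>p w d. num (covlen w (?h p w d) m))" for m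
  proof -
    let ?L = "\<lambda>\<alpha> q. Suc (LEAST j. covers (\<lambda>i. W q (\<alpha>, i)) (\<lambda>i. H q (\<alpha>, i)) j m)"
    have "(\<lambda>q. ?L (blk q) q) \<in> paramM \<rightarrow>\<^sub>M count_space UNIV"
      by (rule measurable_compose_countable'[OF _ blkm cb]) measurable
    moreover have "AE w in coinsM. num (covlen w (?h p w d) m) = num (?L (blk (p, w \<circ> en \<eta>, w \<circ> d)) (p, w \<circ> en \<eta>, w \<circ> d))"
      if d: "above \<eta> d" for p d
      using ae[OF d, of p]
    proof eventually_elim
      fix w
      assume a: "covblk w (?h p w d) = blk (p, w \<circ> en \<eta>, w \<circ> d) \<and>
        good w (?h p w d) (covblk w (?h p w d)) \<and>
        (\<forall>c. fst c \<le> \<beta> \<longrightarrow> ?h p w d c = H (p, w \<circ> en \<eta>, w \<circ> d) c \<and> w c = W (p, w \<circ> en \<eta>, w \<circ> d) c)"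
      then have "covlen w (?h p w d) m = Suc (LEAST j. covers (\<lambda>i. w (covblk w (?h p w d), i))
          (\<lambda>i. ?h p w d (covblk w (?h p w d), i)) j m)"
        unfolding covlen_def by auto
      also have "\<dots> = ?L (blk (p, w \<circ> en \<eta>, w \<circ> d)) (p, w \<circ> en \<eta>, w \<circ> d)"
        using a blk_le by simp
      finally show "num (covlen w (?h p w d) m) = num (?L (blk (p, w \<circ> en \<eta>, w \<circ> d)) (p, w \<circ> en \<eta>, w \<circ> d))"
        by simp
    qed
    ultimately have "rep \<eta> (\<lambda>q. ?L (blk q) q) (\<lambda>p w d. num (covlen w (?h p w d) m))"
      unfolding rep_def by blast
    then show ?thesis unfolding PN_def by blast
  qed
  have ent: "PN (\<lambda>p w d. num (of_bool (w (covblk w (?h p w d), i) n)))" for i n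
  proof -
    have "(\<lambda>q. of_bool (W q (blk q, i) n)) \<in> paramM \<rightarrow>\<^sub>M count_space UNIV"
      by (rule measurable_compose_countable'[OF _ blkm cb, of "\<lambda>\<alpha> q. of_bool (W q (\<alpha>, i) n)"]) measurable
    moreover have "AE w in coinsM. num (of_bool (w (covblk w (?h p w d), i) n))
        = num (of_bool (W (p, w \<circ> en \<eta>, w \<circ> d) (blk (p, w \<circ> en \<eta>, w \<circ> d), i) n))"
      if d: "above \<eta> d" for p d
      using ae[OF d, of p] by eventually_elim (use blk_le in simp)
    ultimately have "rep \<eta> (\<lambda>q. of_bool (W q (blk q, i) n)) (\<lambda>p w d. num (of_bool (w (covblk w (?h p w d), i) n)))"
      unfolding rep_def by blast
    then show ?thesis unfolding PN_def by blast
  qed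
  have "Pr (LL (NN \<rightarrow>\<^sub>r NN)) (?c m)" for m
  proof -
    have "Pr (NN \<rightarrow>\<^sub>r NN) (\<lambda>p w d. coinD w (covblk w (?h p w d), i))" for i
      by (rule Pr_funNI[OF E_coinD]) (simp add: ent)
    then show ?thesis unfolding cD Pr.simps(3) by (simp only: fstD_pr sndD_pr blockD len simp_thms)
  qed
  then show ?thesis by (rule Pr_glue[OF k]) simp
qed

text \<open>The families given by the constants do not depend on \<open>d\<close>, which makes reindexing trivial.\<close>

lemma Pr_const1:
  assumes "\<And>p w. E (\<sigma> \<rightarrow>\<^sub>r \<tau>) (c p w) (c p w)" "\<And>x. Pr \<sigma> x \<Longrightarrow> Pr \<tau> (\<lambda>p w d. c p w \<cdot> x p w d)"
  shows "Pr (\<sigma> \<rightarrow>\<^sub>r \<tau>) (\<lambda>p w d. c p w)"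
  unfolding Pr.simps using assms by blast

lemma Pr_const2:
  assumes E: "\<And>p w. E (\<sigma> \<rightarrow>\<^sub>r \<rho> \<rightarrow>\<^sub>r \<tau>) (c p w) (c p w)"
    and *: "\<And>x y. Pr \<sigma> x \<Longrightarrow> Pr \<rho> y \<Longrightarrow> Pr \<tau> (\<lambda>p w d. c p w \<cdot> x p w d \<cdot> y p w d)"
  shows "Pr (\<sigma> \<rightarrow>\<^sub>r \<rho> \<rightarrow>\<^sub>r \<tau>) (\<lambda>p w d. c p w)"
proof (rule Pr_const1[OF E])
  fix x assume x: "Pr \<sigma> x"
  have "E (\<rho> \<rightarrow>\<^sub>r \<tau>) (c p w \<cdot> x p w d) (c p w \<cdot> x p w d)" for p w d by (rule E_ap[OF E Pr_E[OF x]])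
  moreover have "Pr \<tau> (\<lambda>p w d. c p w \<cdot> x p w (d \<circ> \<iota>) \<cdot> y p w d)" if "Pr \<rho> y" for \<iota> y
    by (rule *[OF Pr_mono[OF x] that])
  ultimately show "Pr (\<rho> \<rightarrow>\<^sub>r \<tau>) (\<lambda>p w d. c p w \<cdot> x p w d)" unfolding Pr.simps by blast
qed

lemma Pr_const3:
  assumes E: "\<And>p w. E (\<sigma> \<rightarrow>\<^sub>r \<rho> \<rightarrow>\<^sub>r \<pi> \<rightarrow>\<^sub>r \<tau>) (c p w) (c p w)"
    and *: "\<And>x y z. Pr \<sigma> x \<Longrightarrow> Pr \<rho> y \<Longrightarrow> Pr \<pi> z \<Longrightarrow> Pr \<tau> (\<lambda>p w d. c p w \<cdot> x p w d \<cdot> y p w d \<cdot> z p w d)"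
  shows "Pr (\<sigma> \<rightarrow>\<^sub>r \<rho> \<rightarrow>\<^sub>r \<pi> \<rightarrow>\<^sub>r \<tau>) (\<lambda>p w d. c p w)"
proof (rule Pr_const2[OF E])
  fix x y assume xy: "Pr \<sigma> x" "Pr \<rho> y"
  have "E (\<pi> \<rightarrow>\<^sub>r \<tau>) (c p w \<cdot> x p w d \<cdot> y p w d) (c p w \<cdot> x p w d \<cdot> y p w d)" for p w d
    by (rule E_ap[OF E_ap[OF E Pr_E[OF xy(1)]] Pr_E[OF xy(2)]])
  moreover have "Pr \<tau> (\<lambda>p w d. c p w \<cdot> x p w (d \<circ> \<iota>) \<cdot> y p w (d \<circ> \<iota>) \<cdot> z p w d)" if "Pr \<pi> z" for \<iota> z
    by (rule *[OF Pr_mono[OF xy(1)] Pr_mono[OF xy(2)] that])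
  ultimately show "Pr (\<pi> \<rightarrow>\<^sub>r \<tau>) (\<lambda>p w d. c p w \<cdot> x p w d \<cdot> y p w d)" unfolding Pr.simps by blast
qed

lemma Pr_zeroR: "Pr \<sigma> (\<lambda>p w d. zeroR \<sigma>)"
proof (induction \<sigma>)
  case (FF \<sigma> \<tau>)
  then show ?case by (intro Pr_const1) (simp_all only: E_zeroR[of "\<sigma> \<rightarrow>\<^sub>r \<tau>", unfolded zeroR.simps] zeroR.simps const_lm)
qed (simp_all add: PN_const zeroR.simps(3))

lemma Pr_recn:
  "Pr \<tau> s \<Longrightarrow> Pr (\<tau> \<rightarrow>\<^sub>r NN \<rightarrow>\<^sub>r \<tau>) f \<Longrightarrow> Pr \<tau> (\<lambda>p w d. recn (s p w d) (f p w d) n)"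
proof (induction n)
  case (Suc n)
  have "Pr NN (\<lambda>p w d. num n)" by (simp add: PN_const)
  from Pr_ap[OF Pr_ap[OF Suc(3) Suc(1)[OF Suc(2,3)]] this] show ?case by simp
qed simp

lemma Pr_lrecn:
  "Pr \<tau> s \<Longrightarrow> Pr (\<tau> \<rightarrow>\<^sub>r \<sigma> \<rightarrow>\<^sub>r \<tau>) f \<Longrightarrow> (\<And>i. Pr \<sigma> (\<lambda>p w d. h p w d i)) \<Longrightarrow>
    Pr \<tau> (\<lambda>p w d. lrecn (s p w d) (f p w d) n (h p w d))"
proof (induction n arbitrary: h)
  case (Suc n)
  have "Pr \<tau> (\<lambda>p w d. lrecn (s p w d) (f p w d) n (\<lambda>i. h p w d (Suc i)))"
    by (rule Suc(1)[OF Suc(2,3)]) (rule Suc(4))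
  from Pr_ap[OF Pr_ap[OF Suc(3) this] Suc(4)] show ?case by simp
qed simp

lemma PN_Suc:
  assumes "PN x" "\<And>p w d n. x p w d = num n \<Longrightarrow> z p w d = num (Suc n)" shows "PN z"
  by (rule PN_glue[OF assms(1), of "\<lambda>k p w d. num (Suc k)"]) (use assms(2) PN_const in auto)

lemma Pr_cden: "Pr (tyc c) (\<lambda>p w d. cden p w c)"
proof (cases c)
  case RZero
  then show ?thesis by (simp add: PN_const)
next
  case RSuc
  have "PN (\<lambda>p w d. cden p w RSuc \<cdot> x p w d)" if "PN x" for x
    by (rule PN_Suc[OF that]) simp
  then show ?thesis unfolding RSuc tyc.simps
    by (intro Pr_const1) (simp_all only: Pr.simps(1) E_cden[of RSuc, unfolded tyc.simps])
next
  case (RRec \<tau>)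
  show ?thesis unfolding RRec tyc.simps
  proof (rule Pr_const3)
    fix u s f assume u: "Pr NN u" and sf: "Pr \<tau> s" "Pr (\<tau> \<rightarrow>\<^sub>r NN \<rightarrow>\<^sub>r \<tau>) f"
    show "Pr \<tau> (\<lambda>p w d. cden p w (RRec \<tau>) \<cdot> u p w d \<cdot> s p w d \<cdot> f p w d)"
      by (rule Pr_glue[OF u[unfolded Pr.simps] Pr_recn[OF sf]]) (simp add: recD)
  qed (rule E_cden[of "RRec \<tau>", unfolded tyc.simps])
next
  case (RPair \<sigma> \<tau>)
  show ?thesis unfolding RPair tyc.simps
    by (rule Pr_const2) (simp_all add: E_cden[of "RPair \<sigma> \<tau>", unfolded tyc.simps] del: E.simps)
next
  case (RFst \<sigma> \<tau>)
  show ?thesis unfolding RFst tyc.simps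
    by (rule Pr_const1) (simp_all add: E_cden[of "RFst \<sigma> \<tau>", unfolded tyc.simps] del: E.simps)
next
  case (RSnd \<sigma> \<tau>)
  show ?thesis unfolding RSnd tyc.simps
    by (rule Pr_const1) (simp_all add: E_cden[of "RSnd \<sigma> \<tau>", unfolded tyc.simps] del: E.simps)
next
  case (RNil \<sigma>)
  show ?thesis unfolding RNil tyc.simps cden.simps(7) by (rule Pr_zeroR)
next
  case (RCons \<sigma>)
  show ?thesis unfolding RCons tyc.simps
  proof (rule Pr_const2)
    fix a l assume a: "Pr \<sigma> a" and l: "Pr (LL \<sigma>) l"
    have "PN (\<lambda>p w d. fstD (cden p w (RCons \<sigma>) \<cdot> a p w d \<cdot> l p w d))"
      by (rule PN_Suc[of "\<lambda>p w d. fstD (l p w d)"]) (use l fstD_consD in simp_all)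
    moreover have "Pr \<sigma> (\<lambda>p w d. sndD (cden p w (RCons \<sigma>) \<cdot> a p w d \<cdot> l p w d) \<cdot> num k)" for k
      unfolding sndD_consD using a l by (cases k) simp_all
    ultimately show "Pr (LL \<sigma>) (\<lambda>p w d. cden p w (RCons \<sigma>) \<cdot> a p w d \<cdot> l p w d)" by simp
  qed (rule E_cden[of "RCons \<sigma>", unfolded tyc.simps])
next
  case (RLRec \<sigma> \<tau>)
  show ?thesis unfolding RLRec tyc.simps
  proof (rule Pr_const3)
    fix l s f assume l: "Pr (LL \<sigma>) l" and sf: "Pr \<tau> s" "Pr (\<tau> \<rightarrow>\<^sub>r \<sigma> \<rightarrow>\<^sub>r \<tau>) f"
    show "Pr \<tau> (\<lambda>p w d. cden p w (RLRec \<sigma> \<tau>) \<cdot> l p w d \<cdot> s p w d \<cdot> f p w d)"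
    proof (rule Pr_glue)
      show "PN (\<lambda>p w d. fstD (l p w d))" using l by simp
      show "Pr \<tau> (\<lambda>p w d. lrecn (s p w d) (f p w d) k (\<lambda>i. sndD (l p w d) \<cdot> num i))" for k
        by (rule Pr_lrecn[OF sf]) (use l in simp)
    qed (simp add: lrecD_eq)
  qed (rule E_cden[of "RLRec \<sigma> \<tau>", unfolded tyc.simps])
next
  case RMu
  show ?thesis unfolding RMu tyc.simps
  proof (rule Pr_const1)
    fix f assume f: "Pr (NN \<rightarrow>\<^sub>r NN) f"
    have fn: "PN (\<lambda>p w d. f p w d \<cdot> num n)" for n
      using Pr_ap[OF f, of "\<lambda>p w d. num n"] by (simp add: PN_const)
    have "PN (\<lambda>p w d. cden p w RMu \<cdot> f p w d)"
    proof (rule PN_map[of "\<lambda>n p w d. f p w d \<cdot> num n" _ muv, OF fn])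
      fix p w d
      have "f p w d \<cdot> num n = num (natof (f p w d \<cdot> num n))" for n
        by (rule PN_num[OF fn[of n], of p w d]) simp
      then show "cden p w RMu \<cdot> f p w d = num (muv (\<lambda>k. natof (f p w d \<cdot> num k)))" by (rule muD)
    next
      fix M :: "((nat \<Rightarrow> bool) \<times> (nat \<Rightarrow> nat \<Rightarrow> bool) \<times> (nat \<Rightarrow> nat \<Rightarrow> bool)) measure" and H :: "nat \<Rightarrow> _ \<Rightarrow> nat"
      assume [measurable]: "\<And>k. H k \<in> M \<rightarrow>\<^sub>M count_space UNIV"
      show "(\<lambda>\<omega>. muv (\<lambda>k. H k \<omega>)) \<in> M \<rightarrow>\<^sub>M count_space UNIV" unfolding muv_def by measurable
    qed
    then show "Pr NN (\<lambda>p w d. cden p w RMu \<cdot> f p w d)" by simp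
  qed (rule E_cden[of RMu, unfolded tyc.simps])
next
  case RCov
  show ?thesis unfolding RCov tyc.simps
    by (rule Pr_const2) (rule E_cden[of RCov, unfolded tyc.simps], rule Pr_cov, simp_all only: Pr.simps(1))
next
  case (RPar i)
  show ?thesis unfolding RPar tyc.simps
    by (rule Pr_funNI) (simp_all add: E_funD cden.simps PN_param del: E.simps)
next
  case RAll
  show ?thesis unfolding RAll tyc.simps
    by (rule Pr_funNI) (simp_all add: E_funD cden.simps PN_param del: E.simps)
qed

text \<open>The fundamental lemma of the logical predicate. Under an abstraction the old assignment
  is reindexed while the new argument is not, which is possible by \<open>Pr_mono\<close>.\<close>

lemma Pr_den:
  "ht t \<sigma> \<Longrightarrow> (\<And>v. Pr (snd v) (\<lambda>p w d. e p w d v)) \<Longrightarrow> Pr \<sigma> (\<lambda>p w d. den p w (e p w d) t)"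
proof (induction t arbitrary: \<sigma> e)
  case (RA s t)
  then obtain \<rho> where "ht s (\<rho> \<rightarrow>\<^sub>r \<sigma>)" "ht t \<rho>" unfolding tyr_RA by blast
  from Pr_ap[OF RA(1)[OF this(1) RA(4)] RA(2)[OF this(2) RA(4)]] show ?case by simp
next
  case (RL v t)
  obtain \<tau> where \<tau>: "ht t \<tau>" "\<sigma> = snd v \<rightarrow>\<^sub>r \<tau>" using RL(2) by (auto simp: tyr.simps)
  have "E \<sigma> (den p w (e p w d) (RL v t)) (den p w (e p w d) (RL v t))" for p w d
    by (rule E_den[OF RL(2)]) (rule Pr_E[OF RL(3)])
  moreover have "Pr \<tau> (\<lambda>p w d. den p w (e p w (d \<circ> \<iota>)) (RL v t) \<cdot> x p w d)" if x: "Pr (snd v) x" for \<iota> x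
    unfolding den_RL
  proof (rule RL(1)[OF \<tau>(1)])
    show "Pr (snd u) (\<lambda>p w d. ((e p w (d \<circ> \<iota>))(v := x p w d)) u)" for u
      using x Pr_mono[OF RL(3)[of u], of \<iota>] by (cases "u = v") (simp_all only: fun_upd_same fun_upd_other not_False_eq_True)
  qed
  ultimately show ?case unfolding \<tau>(2) Pr.simps by blast
qed (auto simp: Pr_cden)

section \<open>Solutions of arithmetical transfinite recursion at random coins\<close>

instance rty :: countable by countable_datatype
instance rconst :: countable by countable_datatype
instance rtm :: countable by countable_datatype

lemma Pr_closed:
  assumes "fvr t = {}" "ht t \<sigma>" shows "Pr \<sigma> (\<lambda>p w d. den p w model.e0 t)"
proof -
  have "Pr \<sigma> (\<lambda>p w d. den p w (\<lambda>v. zeroR (snd v)) t)"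
    by (rule Pr_den[OF assms(2)]) (rule Pr_zeroR)
  moreover have "den p w (\<lambda>v. zeroR (snd v)) t = den p w model.e0 t" for p w by (rule den_closed[OF assms(1)])
  ultimately show ?thesis by simp
qed

lemma ex_above: "\<exists>d. above \<eta> d"
proof -
  obtain \<gamma> where "\<eta> < \<gamma>" using ex_greater_om1[of "{\<eta>}"] by auto
  then show ?thesis by (intro exI[of _ "\<lambda>n. (\<gamma>, n)"]) (simp add: above_def)
qed

text \<open>There are countably many closed terms, so their exceptional sets can be discarded
  together.\<close>

lemma AE_Good: "AE w in coinsM. model.Good p w"
proof -
  let ?C = "{t. fvr t = {} \<and> ht t ((NN \<rightarrow>\<^sub>r NN) \<rightarrow>\<^sub>r NN)}"
  have "AE w in coinsM. \<exists>\<alpha>. good w (\<lambda>c. natof (den p w model.e0 t \<cdot> coinD w c)) \<alpha>" if t: "t \<in> ?C" for t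
  proof -
    let ?g = "\<lambda>p w d. den p w model.e0 t"
    have "Pr ((NN \<rightarrow>\<^sub>r NN) \<rightarrow>\<^sub>r NN) ?g" by (rule Pr_closed) (use t in auto)
    then obtain \<beta> where \<beta>: "\<And>p d. above \<beta> d \<Longrightarrow> AE w in coinsM. good w (nbhd ?g p w d) \<beta>"
      using Pr_good by blast
    obtain d where "above \<beta> d" using ex_above by blast
    from \<beta>[OF this, of p] show ?thesis by eventually_elim (auto simp: nbhd_def[abs_def])
  qed
  then have "AE w in coinsM. \<forall>t\<in>?C. \<exists>\<alpha>. good w (\<lambda>c. natof (den p w model.e0 t \<cdot> coinD w c)) \<alpha>"
    by (intro AE_ball_countable[THEN iffD2]) auto
  then show ?thesis
    by eventually_elim (auto simp: model.Good_def model.R_def)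
qed

lemma closed_measurable:
  assumes "fvr t = {}" "ht t (NN \<rightarrow>\<^sub>r NN)"
  obtains v where "\<And>n. v n \<in> seqM \<Otimes>\<^sub>M coinsM \<rightarrow>\<^sub>M count_space (UNIV :: nat set)"
    "\<And>p. AE w in coinsM. \<forall>n. den p w model.e0 t \<cdot> num n = num (v n (p, w))"
proof -
  have "PN (\<lambda>p w d. den p w model.e0 t \<cdot> num n)" for n
    using Pr_ap[OF Pr_closed[OF assms], of "\<lambda>p w d. num n"] by (simp add: PN_const)
  from PN_countable[of "\<lambda>n p w d. den p w model.e0 t \<cdot> num n", OF this]
  obtain \<eta> G where Gm [measurable]: "\<And>n. G n \<in> paramM \<rightarrow>\<^sub>M count_space UNIV"
    and G: "\<And>p d. above \<eta> d \<Longrightarrow> AE w in coinsM. \<forall>n. den p w model.e0 t \<cdot> num n = num (G n (p, w \<circ> en \<eta>, w \<circ> d))"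
    by blast
  obtain d where d: "above \<eta> d" using ex_above by blast
  have [measurable]: "(\<lambda>w. w \<circ> r) \<in> coinsM \<rightarrow>\<^sub>M seqsM" for r :: "nat \<Rightarrow> coin"
    by (rule measurable_into_seqsM) (simp add: comp_def)
  have "(\<lambda>(p, w). G n (p, w \<circ> en \<eta>, w \<circ> d)) \<in> seqM \<Otimes>\<^sub>M coinsM \<rightarrow>\<^sub>M count_space UNIV" for n by measurable
  from that[of "\<lambda>n (p, w). G n (p, w \<circ> en \<eta>, w \<circ> d)", OF this] G[OF d] show thesis by simp
qed

abbreviation CT :: "rtm set" where "CT \<equiv> {t. fvr t = {} \<and> ht t (NN \<rightarrow>\<^sub>r NN)}"

text \<open>A choice of measurable versions. The denotations themselves are only almost surely equal
  to a measurable function, with a null set depending on \<open>p\<close>; the events of the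
  diagonal argument are formulated with \<open>val\<close> so that they are jointly measurable in
  \<open>p\<close> and \<open>w\<close>.\<close>

definition val :: "rtm \<Rightarrow> nat \<Rightarrow> (nat \<Rightarrow> bool) \<times> coins \<Rightarrow> nat" where
  "val t = (SOME v. (\<forall>n. v n \<in> seqM \<Otimes>\<^sub>M coinsM \<rightarrow>\<^sub>M count_space UNIV) \<and>
    (\<forall>p. AE w in coinsM. \<forall>n. den p w model.e0 t \<cdot> num n = num (v n (p, w))))"

lemma val:
  assumes "t \<in> CT"
  shows "\<And>n. val t n \<in> seqM \<Otimes>\<^sub>M coinsM \<rightarrow>\<^sub>M count_space UNIV"
    "\<And>p. AE w in coinsM. \<forall>n. den p w model.e0 t \<cdot> num n = num (val t n (p, w))"
proof -
  have "\<exists>v. (\<forall>n. v n \<in> seqM \<Otimes>\<^sub>M coinsM \<rightarrow>\<^sub>M count_space (UNIV :: nat set)) \<and>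
    (\<forall>p. AE w in coinsM. \<forall>n. den p w model.e0 t \<cdot> num n = num (v n (p, w)))"
    by (rule closed_measurable[of t]) (use assms in auto)
  from someI_ex[OF this]
  show "\<And>n. val t n \<in> seqM \<Otimes>\<^sub>M coinsM \<rightarrow>\<^sub>M count_space UNIV"
    "\<And>p. AE w in coinsM. \<forall>n. den p w model.e0 t \<cdot> num n = num (val t n (p, w))"
    unfolding val_def[symmetric] by blast+
qed

text \<open>The parameters: the set variable 4 denotes \<open>p\<close>, the others denote the columns of \<open>p\<close>.\<close>

definition params :: "(nat \<Rightarrow> bool) \<Rightarrow> nat \<Rightarrow> nat set" where
  "params p X = (if X = 4 then {n. p n} else {n. p (prod_encode (X, n))})"

lemma ATR_random:
  assumes pr: "sysP \<union> {Pi01_TRANS, LMP} \<^bold>\<turnstile> st_tr (foldr AllS Xs (AllS X (WO X \<longrightarrow>\<^sub>2 ExS Y B)))"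
    and B: "pure B" and WO: "sosat (\<lambda>_. 0) (params p) (WO X)"
  shows "AE w in coinsM. \<exists>t\<in>CT. sosat (\<lambda>_. 0) ((params p)(Y := {n. val t n (p, w) = 1})) B"
proof -
  have "AE w in coinsM. \<forall>t\<in>CT. \<forall>n. den p w model.e0 t \<cdot> num n = num (val t n (p, w))"
    using val(2) by (intro AE_ball_countable[THEN iffD2]) auto
  with AE_Good[of p] show ?thesis
  proof eventually_elim
    fix w assume Good: "model.Good p w" and v: "\<forall>t\<in>CT. \<forall>n. den p w model.e0 t \<cdot> num n = num (val t n (p, w))"
    interpret model p w .
    let ?A = "st_tr (foldr AllS Xs (AllS X (WO X \<longrightarrow>\<^sub>2 ExS Y B)))"
    have "Th \<^bold>\<turnstile> ?A" by (rule Th_proves[OF proves_LMP_Real[OF Good pr] wff_st_tr])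
    \<comment> \<open>The set variables denote the constants \<open>RAll\<close> and
      \<open>RPar\<close>, which are closed terms. This makes an arbitrary real and its columns
      standard.\<close>
    moreover define e where "e = (\<lambda>v. if snd v = NN \<rightarrow>\<^sub>r NN then cden p w (if fst v = 4 then RAll else RPar (fst v))
       else if v = ev Mv then dn e0 (RC RMu) else zeroR (snd v))"
    have "stdenv e (\<lambda>_. 0) (params p)"
      unfolding stdenv_def
    proof (intro conjI allI)
      show "vld e" unfolding vld_def e_def using E_cden[of RAll p w] E_cden[of "RPar i" p w for i] E_cden[of RMu p w]
        by (auto simp: E_zeroR simp del: E.simps)
      show "R (NN \<rightarrow>\<^sub>r NN) (e (Z, NN \<rightarrow>\<^sub>r NN))" for Z
        using R_closed[of "RC RAll" "NN \<rightarrow>\<^sub>r NN" e0] R_closed[of "RC (RPar Z)" "NN \<rightarrow>\<^sub>r NN" e0] by (simp add: e_def)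
      show "e (Z, NN \<rightarrow>\<^sub>r NN) \<cdot> num k = num (of_bool (k \<in> params p Z))" for Z k
        by (simp add: e_def params_def cden.simps)
    qed (simp_all add: e_def)
    ultimately obtain a T where a: "R (NN \<rightarrow>\<^sub>r NN) a" "\<And>k. a \<cdot> num k = num (of_bool (k \<in> T))"
      "sosat (\<lambda>_. 0) ((params p)(Y := T)) B"
      using ATR_solution[OF _ _ WO B] by blast
    obtain t where t: "t \<in> CT" "a = den p w model.e0 t" using a(1) by (auto simp: R_def)
    then have "val t n (p, w) = of_bool (n \<in> T)" for n
    proof -
      have "num (val t n (p, w)) = num (of_bool (n \<in> T))"
        unfolding a(2)[symmetric] t(2) using bspec[OF v t(1)] by simp
      then show ?thesis unfolding num_inject .
    qed
    then have "{n. val t n (p, w) = 1} = T" by auto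
    with t a(3) show "\<exists>t\<in>CT. sosat (\<lambda>_. 0) ((params p)(Y := {n. val t n (p, w) = 1})) B" by blast
  qed
qed

lemma measurable_sosat:
  "pure A \<Longrightarrow> (\<And>X n. Measurable.pred M (\<lambda>\<omega>. n \<in> S \<omega> X)) \<Longrightarrow> Measurable.pred M (\<lambda>\<omega>. sosat \<nu> (S \<omega>) A)"
proof (induction A arbitrary: \<nu>)
  case (SImp A B)
  then show ?case unfolding sosat.simps by (intro pred_intros_logic) auto
next
  case (AllN n A)
  then show ?case unfolding sosat.simps by (intro pred_intros_countable) auto
next
  case (SMem t X)
  then show ?case unfolding sosat.simps by blast
qed (simp_all only: sosat.simps pure.simps measurable_const space_count_space UNIV_I)

section \<open>Borel codes and diagonalisation\<close>

definition npair :: "nat \<Rightarrow> nat \<Rightarrow> nat" where "npair a b = (a + b) * (a + b) + a"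

text \<open>The square of \<open>a + b\<close> is the largest square not above
  \<open>npair a b\<close>. It determines \<open>a + b\<close> and thereby \<open>a\<close>.\<close>

lemma npair_inject [simp]: "npair a b = npair c d \<longleftrightarrow> a = c \<and> b = d"
proof
  have lt: "npair a b < npair c d" if "a + b < c + d" for a b c d
  proof -
    have "npair a b < (a + b + 1) * (a + b + 1)" by (simp add: npair_def)
    also have "\<dots> \<le> (c + d) * (c + d)" using that by (intro mult_le_mono) auto
    also have "\<dots> \<le> npair c d" by (simp add: npair_def)
    finally show ?thesis .
  qed
  assume *: "npair a b = npair c d"
  then have "a + b = c + d" using lt[of a b c d] lt[of c d a b] by (metis less_irrefl linorder_neqE_nat)
  then show "a = c \<and> b = d" using * by (simp add: npair_def)
qed auto

lemma tval_pair [simp]: "tval \<nu> (pair s t) = npair (tval \<nu> s) (tval \<nu> t)"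
  by (simp add: pair_def npair_def)

text \<open>\<open>Nor\<close> is true iff some child is false. This one gate is enough for all
  Borel sets: equal children give complements, and complemented children give countable
  unions.\<close>

datatype bor = Leaf nat | Nor "nat \<Rightarrow> bor"

primrec bval :: "(nat \<Rightarrow> bool) \<Rightarrow> bor \<Rightarrow> bool" where
  "bval a (Leaf l) = a l"
| "bval a (Nor f) = (\<exists>i. \<not> bval a (f i))"

lemma bor_code: "A \<in> sets seqM \<Longrightarrow> \<exists>c. A = {a. bval a c}"
proof -
  have compl: "\<exists>c. UNIV - A = {a. bval a c}" if A: "\<exists>c. A = {a. bval a c}" for A
  proof -
    obtain c where "A = {a. bval a c}" using A by blast
    then show ?thesis by (intro exI[of _ "Nor (\<lambda>_. c)"]) auto
  qed
  have full: "\<exists>c. UNIV = {a. bval a c}"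
  \<comment> \<open>The children are the proposition \<open>a 0\<close> and its negation, one of
    which is false at every \<open>a\<close>.\<close>
  proof (intro exI[of _ "Nor (case_nat (Leaf 0) (\<lambda>_. Nor (\<lambda>_. Leaf 0)))"] set_eqI)
    fix a :: "nat \<Rightarrow> bool"
    have "\<not> bval a (case_nat (Leaf 0) (\<lambda>_. Nor (\<lambda>_. Leaf 0)) (of_bool (a 0)))" by simp
    then show "a \<in> UNIV \<longleftrightarrow> a \<in> {a. bval a (Nor (case_nat (Leaf 0) (\<lambda>_. Nor (\<lambda>_. Leaf 0))))}"
      unfolding mem_Collect_eq bval.simps by blast
  qed
  assume "A \<in> sets seqM"
  then have "A \<in> sigma_sets UNIV {{f. f i \<in> B} | i B. B \<in> sets bitM}"
    unfolding seqM_def sets_PiM_single by simp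
  then show ?thesis
  proof (induction rule: sigma_sets.induct)
    case (Basic A)
    then obtain i B where A: "A = {f. f i \<in> B}" by auto
    have leaf: "\<exists>c. {f. f i} = {a. bval a c}" by (intro exI[of _ "Leaf i"]) simp
    have "A = UNIV \<or> A = {} \<or> A = {f. f i} \<or> A = UNIV - {f. f i}"
      unfolding A by (cases "True \<in> B"; cases "False \<in> B") (auto, metis+)
    then show ?case using leaf compl[OF leaf] full compl[OF full] by (metis Diff_cancel)
  next
    case Empty
    then show ?case using compl[OF full] by simp
  next
    case (Compl A)
    then show ?case using compl by blast
  next
    case (Union A)
    then have "\<forall>i. \<exists>c. UNIV - A i = {a. bval a c}" using compl by blast
    then obtain c where "\<And>i. UNIV - A i = {a. bval a (c i)}" by metis
    then have "bval a (c i) \<longleftrightarrow> a \<notin> A i" for a i by blast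
    then show ?case by (intro exI[of _ "Nor c"]) auto
  qed
qed

section \<open>Ranks and numerical tables of a Borel code\<close>

primrec rk :: "bor \<Rightarrow> om1" where
  "rk (Leaf l) = undefined"
| "rk (Nor f) = sup_om1 (\<lambda>i. rk (f i))"

text \<open>A path that reaches a leaf stays there, so that every list of numbers names a
  node.\<close>

fun sub :: "bor \<Rightarrow> nat list \<Rightarrow> bor" where
  "sub c [] = c"
| "sub (Nor f) (i # s) = sub (f i) s"
| "sub (Leaf l) (i # s) = Leaf l"

lemma sub_snoc: "sub c s = Nor f \<Longrightarrow> sub c (s @ [i]) = f i"
  by (induction c s rule: sub.induct) auto

definition node :: "bor \<Rightarrow> nat \<Rightarrow> bor" where "node c n = sub c (from_nat n)"

definition leafs :: "bor \<Rightarrow> nat \<Rightarrow> nat \<Rightarrow> bool" where "leafs c n l \<longleftrightarrow> node c n = Leaf l"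

definition child :: "bor \<Rightarrow> nat \<Rightarrow> nat \<Rightarrow> bool" where
  "child c n m \<longleftrightarrow> (\<exists>f i. node c n = Nor f \<and> (from_nat m :: nat list) = from_nat n @ [i])"

text \<open>The numbers of nodes ordered by rank, with ties broken by the numbers themselves. Every
  number belongs to the field, and children precede their parents strictly, as the recursion along
  this order requires.\<close>

definition nle :: "bor \<Rightarrow> nat \<Rightarrow> nat \<Rightarrow> bool" where
  "nle c n m \<longleftrightarrow> rk (node c n) < rk (node c m) \<or> rk (node c n) = rk (node c m) \<and> n \<le> m"

lemma child_iff:
  assumes "node c n = Nor f" shows "(\<exists>m. child c n m \<and> P (node c m)) \<longleftrightarrow> (\<exists>i. P (f i))"
proof -
  have "node c m = f i" if "(from_nat m :: nat list) = from_nat n @ [i]" for m i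
    unfolding node_def that by (rule sub_snoc) (use assms in \<open>simp add: node_def\<close>)
  moreover have "(from_nat (to_nat ((from_nat n :: nat list) @ [i])) :: nat list) = from_nat n @ [i]" for i by simp
  ultimately show ?thesis unfolding child_def using assms by metis
qed

lemma child_rk: "child c n m \<Longrightarrow> rk (node c m) < rk (node c n)"
proof -
  assume "child c n m"
  then obtain f i where f: "node c n = Nor f" "(from_nat m :: nat list) = from_nat n @ [i]"
    by (auto simp: child_def)
  then have "node c m = f i" using sub_snoc[of c "from_nat n" f i] by (simp add: node_def)
  then show ?thesis using f(1) less_sup_om1[of "\<lambda>i. rk (f i)" i] by simp
qed

lemma bval_node:
  "bval a (node c n) \<longleftrightarrow> (\<exists>l. leafs c n l \<and> a l) \<or> (\<exists>m. child c n m \<and> \<not> bval a (node c m))"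
proof (cases "node c n")
  case (Nor f)
  then show ?thesis using child_iff[OF Nor, of "\<lambda>c. \<not> bval a c"] by (simp add: leafs_def)
qed (simp add: leafs_def child_def)

lemma nle_wf: "\<not> (\<forall>k. nle c (f (Suc k)) (f k) \<and> \<not> nle c (f k) (f (Suc k)))"
proof
  assume *: "\<forall>k. nle c (f (Suc k)) (f k) \<and> \<not> nle c (f k) (f (Suc k))"
  let ?r = "inv_image ({(a :: om1, b). a < b} <*lex*> {(a :: nat, b). a < b}) (\<lambda>n. (rk (node c n), n))"
  have "wf ?r" by (intro wf_inv_image wf_lex_prod wf)
  moreover have "(f (Suc k), f k) \<in> ?r" for k using *[rule_format, of k] by (auto simp: nle_def)
  ultimately show False unfolding wf_iff_no_infinite_down_chain by blast
qed

text \<open>A real having the relevant tables of the code \<open>c\<close> as its columns 0, 2 and 3.\<close>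

definition coded :: "bor \<Rightarrow> nat \<Rightarrow> bool" where
  "coded c v = (case prod_decode v of (k, u) \<Rightarrow>
     \<exists>n m. u = npair n m \<and> (k = 0 \<and> nle c n m \<or> k = 2 \<and> leafs c n m \<or> k = 3 \<and> child c n m))"

lemma params_coded:
  "npair n m \<in> params (coded c) 0 \<longleftrightarrow> nle c n m"
  "npair n m \<in> params (coded c) 2 \<longleftrightarrow> leafs c n m"
  "npair n m \<in> params (coded c) 3 \<longleftrightarrow> child c n m"
  "params p 4 = {n. p n}"
  by (simp_all add: params_def coded_def)

lemma coded_WO: "sosat \<nu> (params (coded c)) (WO 0)"
proof -
  have WF: "sosat \<nu> (params (coded c)) (WF 0)"
  proof -
    have D: "(\<exists>k. \<forall>b. npair k b \<notin> T) \<or>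
        (\<exists>a b d. npair a b \<in> T \<and> npair (Suc a) d \<in> T \<and> (nle c d b \<longrightarrow> nle c b d))" for T
    proof (rule ccontr)
      assume *: "\<not> ?thesis"
      then obtain f where "\<And>k. npair k (f k) \<in> T" by metis
      then show False using * nle_wf[of c f] by blast
    qed
    have "sosat \<nu> (params (coded c)) (WF 0) \<longleftrightarrow> (\<forall>T. (\<exists>k. \<forall>b. npair k b \<notin> T) \<or>
        (\<exists>k a. npair k a \<in> T \<and> (\<exists>b. npair k b \<in> T \<and> a \<noteq> b)) \<or>
        (\<exists>a b. npair a b \<in> T \<and> (\<exists>d. npair (Suc a) d \<in> T \<and> (nle c d b \<longrightarrow> nle c b d))))"
      by (simp add: WF_def Let_def less_in_def le_in_def fun_upd_apply params_coded)
    moreover have "\<forall>T. (\<exists>k. \<forall>b. npair k b \<notin> T) \<or>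
        (\<exists>k a. npair k a \<in> T \<and> (\<exists>b. npair k b \<in> T \<and> a \<noteq> b)) \<or>
        (\<exists>a b. npair a b \<in> T \<and> (\<exists>d. npair (Suc a) d \<in> T \<and> (nle c d b \<longrightarrow> nle c b d)))" (is "\<forall>T. ?d T")
    proof
      fix T
      show "?d T" using D[of T] by blast
    qed
    ultimately show ?thesis by (rule iffD2)
  qed
  have LO: "sosat \<nu> (params (coded c)) (LO 0)"
  proof -
    have [simp]: "nle c a a" for a by (simp add: nle_def)
    have *: "sosat \<nu> S (A \<and>\<^sub>2 B) \<longleftrightarrow> sosat \<nu> S A \<and> sosat \<nu> S B" for \<nu> S A B by simp
    show ?thesis
      unfolding LO_def Let_def *
      by (intro conjI; simp add: le_in_def field_in_def fun_upd_apply params_coded; auto simp: nle_def)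
  qed
  show ?thesis using LO WF by (simp add: WO_def)
qed

text \<open>The clause that evaluates one node. Set 2 lists the labels of leaves, set 3 the
  children, set 4 is the real at which the code is evaluated, and set 5 holds the earlier stages of
  the recursion. The value of the node \<open>m\<close> is looked up at the pair of \<open>m\<close>
  with itself, that is, as written at stage \<open>m\<close>.\<close>

definition theta :: sofm where
  "theta = ExN 1 (pair (NV 0) (NV 1) \<in>\<^sub>2 2 \<and>\<^sub>2 NV 1 \<in>\<^sub>2 4) \<or>\<^sub>2
     ExN 1 (pair (NV 0) (NV 1) \<in>\<^sub>2 3 \<and>\<^sub>2 SNeg (pair (NV 1) (NV 1) \<in>\<^sub>2 5))"

definition Htheta :: sofm where "Htheta = H_iter 0 5 theta 2 3 4 5 0 1"

lemma pure_Htheta: "pure Htheta"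
  unfolding Htheta_def by (rule pure_H_iter) (simp add: theta_def)

text \<open>Each stage writes entries for all nodes, but only the diagonal is trusted: at stage
  \<open>n\<close> all children of \<open>n\<close> belong to strictly earlier stages, so that the
  restriction to those stages loses none of their values. Induction on the rank then identifies the
  diagonal with the evaluation.\<close>

lemma Htheta_bval:
  assumes H: "sosat \<nu> ((params (coded c))(1 := T)) Htheta"
  shows "npair n n \<in> T \<longleftrightarrow> bval (coded c) (node c n)"
proof -
  have T: "k \<in> T \<longleftrightarrow> (\<exists>n j. k = npair n j \<and> nle c j j \<and> ((\<exists>l. leafs c n l \<and> coded c l) \<or>
     (\<exists>m. child c n m \<and> \<not> (npair m m \<in> T \<and> (\<exists>m' i. npair m m = npair m' i \<and> nle c i j \<and> \<not> nle c j i)))))" for k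
    using H unfolding Htheta_def H_iter_def theta_def in_part_def less_in_def le_in_def field_in_def
    by (simp add: fun_upd_apply params_coded) blast
  have T: "npair n n \<in> T \<longleftrightarrow> (\<exists>l. leafs c n l \<and> coded c l) \<or> (\<exists>m. child c n m \<and> npair m m \<notin> T)" for n
  proof -
    have "nle c n n" by (simp add: nle_def)
    moreover have "nle c m n \<and> \<not> nle c n m" if "child c n m" for m
      using child_rk[OF that] by (auto simp: nle_def)
    ultimately show ?thesis by (subst T) auto
  qed
  show ?thesis
  proof (induction "rk (node c n)" arbitrary: n rule: less_induct)
    case less
    then have "npair m m \<in> T \<longleftrightarrow> bval (coded c) (node c m)" if "child c n m" for m
      using child_rk[OF that] by blast
    then show ?case unfolding T[of n] bval_node[of _ _ n] by blast
  qed
qed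

text \<open>The variables 2, 3 and 4 are the parameters of \<open>theta\<close>, 0 is the ordering
  and 1 the solution. Accordingly the tables of \<open>coded\<close> occupy the columns 0, 2 and
  3.\<close>

definition ATRtheta :: sofm where
  "ATRtheta = foldr AllS [2, 3, 4] (AllS 0 (WO 0 \<longrightarrow>\<^sub>2 ExS 1 Htheta))"

lemma ATRtheta: "ATRtheta \<in> ATR0"
proof -
  have "AllS 0 (WO 0 \<longrightarrow>\<^sub>2 ExS 1 Htheta) \<in> ATR0_open"
    unfolding Htheta_def by (rule ATR0_open.recursion) (auto simp: theta_def pair_def)
  moreover have "free_nvars ATRtheta = {}" "free_svars ATRtheta = {}"
    by (auto simp: ATRtheta_def Htheta_def WO_def LO_def WF_def H_iter_def theta_def in_part_def less_in_def
      le_in_def field_in_def pair_def Let_def)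
  ultimately show ?thesis
    unfolding ATR0_def mem_Collect_eq
    by (intro exI[of _ "[]"] exI[of _ "[2, 3, 4]"] exI[of _ "AllS 0 (WO 0 \<longrightarrow>\<^sub>2 ExS 1 Htheta)"])
      (simp add: ATRtheta_def)
qed

section \<open>Diagonalisation\<close>

definition root :: nat where "root = npair (to_nat ([] :: nat list)) (to_nat ([] :: nat list))"

definition solves :: "rtm \<Rightarrow> (nat \<Rightarrow> bool) \<Rightarrow> coins \<Rightarrow> bool" where
  "solves t p w \<longleftrightarrow> sosat (\<lambda>_. 0) ((params p)(1 := {n. val t n (p, w) = 1})) Htheta"

text \<open>Every solution has the same diagonal, so a term that computes a solution has no freedom
  in its answer at the root.\<close>

lemma solves_root:
  assumes "solves t (coded c) w" shows "val t root (coded c, w) = 1 \<longleftrightarrow> bval (coded c) c"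
  using Htheta_bval[OF assms[unfolded solves_def], of "to_nat ([] :: nat list)"]
  by (simp add: root_def node_def)

lemma measurable_solves:
  assumes t: "t \<in> CT"
  shows "Measurable.pred (seqM \<Otimes>\<^sub>M coinsM) (\<lambda>(p, w). solves t p w \<and> val t root (p, w) = 1)"
proof -
  note [measurable] = val(1)[OF t]
  have "Measurable.pred (seqM \<Otimes>\<^sub>M coinsM) (\<lambda>q. sosat (\<lambda>_. 0) ((params (fst q))(1 := {n. val t n q = 1})) Htheta)"
  proof (rule measurable_sosat[OF pure_Htheta])
    fix X n
    show "Measurable.pred (seqM \<Otimes>\<^sub>M coinsM) (\<lambda>q. n \<in> ((params (fst q))(1 := {n. val t n q = 1})) X)"
      by (cases "X = 1"; cases "X = 4") (simp_all add: params_def fun_upd_apply)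
  qed
  then have "Measurable.pred (seqM \<Otimes>\<^sub>M coinsM)
      (\<lambda>q. sosat (\<lambda>_. 0) ((params (fst q))(1 := {n. val t n q = 1})) Htheta \<and> val t root q = 1)" by measurable
  then show ?thesis by (simp add: solves_def split_beta')
qed

text \<open>The probability is taken term by term. Each is a Borel function of \<open>p\<close> by
  Fubini, and the disjunction over the countably many terms remains Borel.\<close>

definition affirmed :: "(nat \<Rightarrow> bool) \<Rightarrow> bool" where
  "affirmed p \<longleftrightarrow> (\<exists>t\<in>CT. emeasure coinsM {w. solves t p w \<and> val t root (p, w) = 1} > 0)"

lemma sets_affirmed: "{p. \<not> affirmed p} \<in> sets seqM"
proof -
  interpret C: prob_space coinsM by (rule prob_space_coinsM)
  have "{p \<in> space seqM. emeasure coinsM {w. solves t p w \<and> val t root (p, w) = 1} > 0} \<in> sets seqM" if t: "t \<in> CT" for t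
  proof -
    let ?Q = "{q \<in> space (seqM \<Otimes>\<^sub>M coinsM). case q of (p, w) \<Rightarrow> solves t p w \<and> val t root (p, w) = 1}"
    have "?Q \<in> sets (seqM \<Otimes>\<^sub>M coinsM)" using measurable_solves[OF t] by simp
    from C.measurable_emeasure_Pair[OF this]
    have "(\<lambda>p. emeasure coinsM {w. solves t p w \<and> val t root (p, w) = 1}) \<in> borel_measurable seqM"
      by (simp add: vimage_def space_pair_measure)
    then show ?thesis by measurable
  qed
  then have "{p \<in> space seqM. \<exists>t\<in>CT. emeasure coinsM {w. solves t p w \<and> val t root (p, w) = 1} > 0} \<in> sets seqM"
    by (intro sets.sets_Collect_countable_Ex') auto
  then have "space seqM - {p \<in> space seqM. affirmed p} \<in> sets seqM" unfolding affirmed_def by (rule sets.compl_sets)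
  moreover have "space seqM - {p \<in> space seqM. affirmed p} = {p. \<not> affirmed p}" by auto
  ultimately show ?thesis by simp
qed

theorem theorem6p3:
  assumes "consistent (sysP \<union> {Pi01_TRANS, LMP})"
  shows "\<not> proves_ATR0_st (sysP \<union> {Pi01_TRANS, LMP})"
proof
  assume "proves_ATR0_st (sysP \<union> {Pi01_TRANS, LMP})"
  then have pr: "sysP \<union> {Pi01_TRANS, LMP} \<^bold>\<turnstile> st_tr ATRtheta"
    using ATRtheta unfolding proves_ATR0_st_def by blast
  \<comment> \<open>The code \<open>c\<close> will be evaluated at the real \<open>coded c\<close>,
    whose columns describe \<open>c\<close> itself.\<close>
  obtain c where c: "{p. \<not> affirmed p} = {p. bval p c}" using bor_code[OF sets_affirmed] by blast
  interpret C: prob_space coinsM by (rule prob_space_coinsM)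
  let ?p = "coded c"
  have "bval ?p c \<longleftrightarrow> \<not> affirmed ?p" using c by blast
  moreover have "bval ?p c \<longleftrightarrow> affirmed ?p"
  proof
    assume b: "bval ?p c"
    \<comment> \<open>Almost surely some term computes a solution, which then affirms the root
      because the code is true. Countably many null events could not account for this.\<close>
    have ae: "AE w in coinsM. \<exists>t\<in>CT. solves t ?p w"
      unfolding solves_def using ATR_random[OF pr[unfolded ATRtheta_def] pure_Htheta coded_WO] .
    show "affirmed ?p"
    proof (rule ccontr)
      assume na: "\<not> affirmed ?p"
      have "AE w in coinsM. \<not> (solves t ?p w \<and> val t root (?p, w) = 1)" if t: "t \<in> CT" for t
      proof -
        have "{q \<in> space (seqM \<Otimes>\<^sub>M coinsM). case q of (p, w) \<Rightarrow> solves t p w \<and> val t root (p, w) = 1} \<in> sets (seqM \<Otimes>\<^sub>M coinsM)"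
          using measurable_solves[OF t] by simp
        from sets_Pair1[OF this, of ?p]
        have "{w. solves t ?p w \<and> val t root (?p, w) = 1} \<in> sets coinsM"
          by (simp add: vimage_def space_pair_measure)
        then have "{w. solves t ?p w \<and> val t root (?p, w) = 1} \<in> null_sets coinsM"
          using na t by (auto simp: affirmed_def null_sets_def)
        then show ?thesis using AE_not_in by fastforce
      qed
      then have "AE w in coinsM. \<forall>t\<in>CT. \<not> (solves t ?p w \<and> val t root (?p, w) = 1)"
        by (intro AE_ball_countable[THEN iffD2]) auto
      with ae have "AE w in coinsM. False"
        by eventually_elim (use solves_root b in blast)
      then show False by simp
    qed
  next
    assume "affirmed ?p"
    then obtain t where "emeasure coinsM {w. solves t ?p w \<and> val t root (?p, w) = 1} > 0"
      by (auto simp: affirmed_def)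
    \<comment> \<open>A single outcome at which a solution affirms the root is enough, since the
      answer of a solution is determined.\<close>
    then have "{w. solves t ?p w \<and> val t root (?p, w) = 1} \<noteq> {}" by (metis emeasure_empty less_irrefl)
    then show "bval ?p c" using solves_root by blast
  qed
  ultimately show False by blast
qed

end
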